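(* For every finite abelian $p$-group $F$, there exists an eigenfunction $E_F$ of $\Delta_0$ that is a finite linear combination of measures of the form $\mathbf{Moment}[\,\cdot\,]$ with leading term $\mathbf{Moment}[F]$. The eigenvalue associated to $E_F$ is $\frac{1}{|F|}$. The $E_F$ (as $F$ ranges over isomorphism classes of finite abelian $p$-groups) are linearly independent.
   Context: Fix a prime $p$. $X_0$ is the set of isomorphism classes of finite abelian $p$-groups; $X_1$ is the set of isomorphism classes of finitely generated $\mathbb{Z}_p$-modules of $\mathbb{Q}_p$-rank $1$. The random operator $d$ from $X_1$ to $X_0$: $d(H)$ is the quotient of $H$ by (the submodule generated by) a Haar-random element of $H$ (almost surely finite). The random operator $d^*$ from $X_0$ to $X_1$: $d^*(G)$ is the middle term of the extension $0\to\mathbb{Z}_p\to H\to G\to 0$ corresponding to a uniformly random element of the finite group $\mathrm{Ext}(G,\mathbb{Z}_p)$. $\Delta_0=d\,d^*$ (first $d^*$, then $d$, independent choices) acts linearly on signed measures on $X_0$ by $(\Delta_0\nu)(G')=\sum_{G}\nu(G)\,\mathbb{P}(\Delta_0(G)\cong G')$. An eigenfunction of $\Delta_0$ is a nonzero signed measure $\nu$ on $X_0$ with $\Delta_0\nu=\lambda\nu$. $\mu_0(G)=c_0/|\mathrm{Aut}(G)|$ with $c_0=\prod_{i\ge1}(1-p^{-i})$. $\mathbf{Moment}[F]$ is the measure on $X_0$ whose value at $G$ is $\#\mathrm{Sur}(G,F)\,\mu_0(G)$, where $\mathrm{Sur}(G,F)$ is the set of surjective homomorphisms $G\to F$. Partial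 order: $F'\le F$ iff $F$ admits a surjection onto $F'$. A finite linear combination $\sum_i a_i\,\mathbf{Moment}[F_i]$ (distinct $F_i$) has leading term $a_k\,\mathbf{Moment}[F_k]$ if $F_i\le F_k$ for all $i$. *)

theory Defs
  imports
    "HOL-Probability.Probability"
    "HOL-Algebra.Bij"
    "HOL-Algebra.Module"
    "HOL-Algebra.AbelCoset"
begin

section \<open>The ring of p-adic integers and its modules\<close>

text \<open>The inverse limit of the rings \<open>\<int>/p\<^sup>n\<close>, whose elements are the
  coherent sequences of least nonnegative residues.\<close>

type_synonym padic = "nat \<Rightarrow> int"

definition Zp :: "nat \<Rightarrow> padic ring" where
  "Zp p =
    \<lparr>carrier = {x. \<forall>n. 0 \<le> x n \<and> x n < int p ^ n \<and> x (Suc n) mod int p ^ n = x n},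
     mult = (\<lambda>x y n. (x n * y n) mod int p ^ n),
     one = (\<lambda>n. 1 mod int p ^ n),
     zero = (\<lambda>n. 0),
     add = (\<lambda>x y n. (x n + y n) mod int p ^ n)\<rparr>"

definition Zp_module :: "nat \<Rightarrow> (padic, padic) module" where
  "Zp_module p =
    \<lparr>carrier = carrier (Zp p), mult = mult (Zp p), one = one (Zp p), zero = zero (Zp p),
     add = add (Zp p), smult = mult (Zp p)\<rparr>"

definition module_hom ::
  "('r, 'm) ring_scheme \<Rightarrow> ('r, 'a, 'k) module_scheme \<Rightarrow> ('r, 'b, 'l) module_scheme \<Rightarrow> ('a \<Rightarrow> 'b) set"
where
  "module_hom R M N = {f \<in> hom (add_monoid M) (add_monoid N).
     \<forall>r\<in>carrier R. \<forall>x\<in>carrier M. f (r \<odot>\<^bsub>M\<^esub> x) = r \<odot>\<^bsub>N\<^esub> f x}"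

definition module_iso ::
  "('r, 'm) ring_scheme \<Rightarrow> ('r, 'a, 'k) module_scheme \<Rightarrow> ('r, 'b, 'l) module_scheme \<Rightarrow> ('a \<Rightarrow> 'b) set"
where
  "module_iso R M N = {f \<in> module_hom R M N. bij_betw f (carrier M) (carrier N)}"

definition fin_gen_module :: "('r, 'm) ring_scheme \<Rightarrow> ('r, 'a, 'k) module_scheme \<Rightarrow> bool" where
  "fin_gen_module R M \<longleftrightarrow>
     (\<exists>S. finite S \<and> S \<subseteq> carrier M \<and> (\<forall>N. submodule N R M \<and> S \<subseteq> N \<longrightarrow> N = carrier M))"

definition lin_indep_in :: "('r, 'm) ring_scheme \<Rightarrow> ('r, 'a, 'k) module_scheme \<Rightarrow> 'a set \<Rightarrow> bool" where
  "lin_indep_in R M S \<longleftrightarrow> finite S \<and> S \<subseteq> carrier M \<and>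
     (\<forall>a \<in> S \<rightarrow> carrier R. (\<Oplus>\<^bsub>M\<^esub>s\<in>S. a s \<odot>\<^bsub>M\<^esub> s) = \<zero>\<^bsub>M\<^esub> \<longrightarrow> (\<forall>s\<in>S. a s = \<zero>\<^bsub>R\<^esub>))"

text \<open>The rank of a module over a domain, i.e. the dimension after extending scalars to the
  field of fractions, as the maximal number of linearly independent elements.\<close>

definition has_rank :: "('r, 'm) ring_scheme \<Rightarrow> ('r, 'a, 'k) module_scheme \<Rightarrow> nat \<Rightarrow> bool" where
  "has_rank R M n \<longleftrightarrow>
     (\<exists>S. lin_indep_in R M S \<and> card S = n) \<and> (\<forall>S. lin_indep_in R M S \<longrightarrow> card S \<le> n)"


section \<open>The sets \<open>X\<^sub>0\<close> and \<open>X\<^sub>1\<close> of isomorphism classes\<close>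

definition class_rep :: "'a set \<Rightarrow> 'a" where
  "class_rep C = (SOME x. x \<in> C)"

text \<open>Every finite group is isomorphic to one whose carrier consists of natural numbers.\<close>

definition fin_ab_p_group :: "nat \<Rightarrow> nat monoid \<Rightarrow> bool" where
  "fin_ab_p_group p G \<longleftrightarrow>
     comm_group G \<and> finite (carrier G) \<and> (\<exists>k. card (carrier G) = p ^ k)"

definition X0 :: "nat \<Rightarrow> nat monoid set set" where
  "X0 p = Collect (fin_ab_p_group p) //
     {(G, H). fin_ab_p_group p G \<and> fin_ab_p_group p H \<and> G \<cong> H}"

text \<open>A finitely generated \<open>\<int>\<^sub>p\<close>-module has at most continuum many elements, and any extension of
  a finite group \<open>G\<close> by \<open>\<int>\<^sub>p\<close> is in bijection with \<open>\<int>\<^sub>p \<times> G\<close>. So, up to isomorphism of modules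
  and equivalence of extensions, nothing is lost by taking carriers in the following type.\<close>

type_synonym padic_mod = "(padic, padic \<times> nat) module"

definition fg_rank1 :: "nat \<Rightarrow> padic_mod \<Rightarrow> bool" where
  "fg_rank1 p H \<longleftrightarrow> Module.module (Zp p) H \<and> fin_gen_module (Zp p) H \<and> has_rank (Zp p) H 1"

definition X1 :: "nat \<Rightarrow> padic_mod set set" where
  "X1 p = Collect (fg_rank1 p) //
     {(H, K). fg_rank1 p H \<and> fg_rank1 p K \<and> module_iso (Zp p) H K \<noteq> {}}"

definition X1_class :: "nat \<Rightarrow> padic_mod \<Rightarrow> padic_mod set" where
  "X1_class p H = {K. fg_rank1 p K \<and> module_iso (Zp p) H K \<noteq> {}}"


section \<open>The random operator from \<open>X\<^sub>1\<close> to \<open>X\<^sub>0\<close>\<close>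

text \<open>Open sets of the p-adic topology, in which the submodules \<open>p\<^sup>nH\<close> form a
  neighbourhood basis of zero.\<close>

definition padic_open :: "nat \<Rightarrow> (padic, 'a) module \<Rightarrow> 'a set \<Rightarrow> bool" where
  "padic_open p H U \<longleftrightarrow> U \<subseteq> carrier H \<and>
     (\<forall>x\<in>U. \<exists>n. \<forall>h\<in>carrier H. x \<oplus>\<^bsub>H\<^esub> add_pow H (p ^ n) h \<in> U)"

definition is_haar_prob :: "nat \<Rightarrow> (padic, 'a) module \<Rightarrow> 'a measure \<Rightarrow> bool" where
  "is_haar_prob p H M \<longleftrightarrow> prob_space M \<and> space M = carrier H \<and>
     sets M = sigma_sets (carrier H) (Collect (padic_open p H)) \<and>
     (\<forall>A\<in>sets M. \<forall>x\<in>carrier H. emeasure M ((\<lambda>h. x \<oplus>\<^bsub>H\<^esub> h) ` A) = emeasure M A)"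

definition haar_prob :: "nat \<Rightarrow> (padic, 'a) module \<Rightarrow> 'a measure" where
  "haar_prob p H = (THE M. is_haar_prob p H M)"

definition cyclic_submodule :: "nat \<Rightarrow> (padic, 'a) module \<Rightarrow> 'a \<Rightarrow> 'a set" where
  "cyclic_submodule p H x = (\<lambda>z. z \<odot>\<^bsub>H\<^esub> x) ` carrier (Zp p)"

text \<open>The probability that \<open>d(K)\<close> is the class \<open>C\<close>.\<close>

definition d_prob :: "nat \<Rightarrow> padic_mod set \<Rightarrow> nat monoid set \<Rightarrow> real" where
  "d_prob p K C = (let H = class_rep K in
     measure (haar_prob p H)
       {x \<in> carrier H. H A_Mod (cyclic_submodule p H x) \<cong> class_rep C})"


section \<open>The random operator from \<open>X\<^sub>0\<close> to \<open>X\<^sub>1\<close>\<close>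

text \<open>A finite abelian p-group, written additively, as a \<open>\<int>\<^sub>p\<close>-module: \<open>z\<close> acts through its residue
  modulo \<open>p\<^sup>n\<close> for any \<open>n\<close> such that \<open>p\<^sup>n\<close> kills the group, and \<open>n = |G|\<close> is such an \<open>n\<close>.
  The fields \<open>mult\<close> and \<open>one\<close> are irrelevant for a module.\<close>

definition group_as_module :: "nat monoid \<Rightarrow> (padic, nat) module" where
  "group_as_module G =
    \<lparr>carrier = carrier G, mult = mult G, one = one G, zero = one G, add = mult G,
     smult = (\<lambda>z g. g [^]\<^bsub>G\<^esub> z (card (carrier G)))\<rparr>"

text \<open>A triple \<open>(H, i, q)\<close> stands for the short exact sequence
  \<open>0 \<rightarrow> \<int>\<^sub>p \<rightarrow> H \<rightarrow> G \<rightarrow> 0\<close> with maps \<open>i\<close> and \<open>q\<close>.\<close>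

type_synonym extension = "padic_mod \<times> (padic \<Rightarrow> padic \<times> nat) \<times> (padic \<times> nat \<Rightarrow> nat)"

definition is_extension :: "nat \<Rightarrow> nat monoid \<Rightarrow> extension \<Rightarrow> bool" where
  "is_extension p G = (\<lambda>(H, i, q).
     Module.module (Zp p) H \<and>
     i \<in> module_hom (Zp p) (Zp_module p) H \<and> inj_on i (carrier (Zp p)) \<and>
     q \<in> module_hom (Zp p) H (group_as_module G) \<and> q ` carrier H = carrier G \<and>
     i ` carrier (Zp p) = {h \<in> carrier H. q h = \<one>\<^bsub>G\<^esub>})"

definition equiv_extensions :: "nat \<Rightarrow> extension \<Rightarrow> extension \<Rightarrow> bool" where
  "equiv_extensions p = (\<lambda>(H, i, q) (H', i', q'). \<exists>f \<in> module_iso (Zp p) H H'.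
     (\<forall>z\<in>carrier (Zp p). f (i z) = i' z) \<and> (\<forall>h\<in>carrier H. q' (f h) = q h))"

definition Ext :: "nat \<Rightarrow> nat monoid \<Rightarrow> extension set set" where
  "Ext p G = Collect (is_extension p G) //
     {(e, e'). is_extension p G e \<and> is_extension p G e' \<and> equiv_extensions p e e'}"

definition middle_term :: "extension set \<Rightarrow> padic_mod" where
  "middle_term \<xi> = fst (class_rep \<xi>)"

definition d_star :: "nat \<Rightarrow> nat monoid set \<Rightarrow> padic_mod set pmf" where
  "d_star p C = map_pmf (\<lambda>\<xi>. X1_class p (middle_term \<xi>)) (pmf_of_set (Ext p (class_rep C)))"


section \<open>The operator \<open>\<Delta>\<^sub>0\<close> on signed measures\<close>

text \<open>The probability that \<open>\<Delta>\<^sub>0(C)\<close> is the class \<open>C'\<close>.\<close>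

definition Delta0_prob :: "nat \<Rightarrow> nat monoid set \<Rightarrow> nat monoid set \<Rightarrow> real" where
  "Delta0_prob p C C' = measure_pmf.expectation (d_star p C) (\<lambda>K. d_prob p K C')"

text \<open>A (finite) signed measure on the countable discrete set \<open>X\<^sub>0\<close> is identified with its
  absolutely summable family of point masses; values outside \<open>X\<^sub>0\<close> play no role.\<close>

definition signed_measure :: "nat \<Rightarrow> (nat monoid set \<Rightarrow> real) \<Rightarrow> bool" where
  "signed_measure p \<nu> \<longleftrightarrow> (\<lambda>C. \<bar>\<nu> C\<bar>) summable_on X0 p"

definition Delta0 :: "nat \<Rightarrow> (nat monoid set \<Rightarrow> real) \<Rightarrow> nat monoid set \<Rightarrow> real" where
  "Delta0 p \<nu> C' = (\<Sum>\<^sub>\<infinity>C\<in>X0 p. \<nu> C * Delta0_prob p C C')"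

definition eigenfunction :: "nat \<Rightarrow> real \<Rightarrow> (nat monoid set \<Rightarrow> real) \<Rightarrow> bool" where
  "eigenfunction p l \<nu> \<longleftrightarrow> signed_measure p \<nu> \<and> (\<exists>C\<in>X0 p. \<nu> C \<noteq> 0) \<and>
     (\<forall>C\<in>X0 p. Delta0 p \<nu> C = l * \<nu> C)"


section \<open>Moment measures\<close>

definition mu0 :: "nat \<Rightarrow> nat monoid set \<Rightarrow> real" where
  "mu0 p C = (\<Prod>i. 1 - 1 / real p ^ Suc i) / real (card (auto (class_rep C)))"

text \<open>Homomorphisms are taken extensional, so that they are determined by their values on the
  carrier and can be counted.\<close>

definition Sur :: "nat monoid \<Rightarrow> nat monoid \<Rightarrow> (nat \<Rightarrow> nat) set" where
  "Sur G F = epi G F \<inter> extensional (carrier G)"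

definition Moment :: "nat \<Rightarrow> nat monoid set \<Rightarrow> nat monoid set \<Rightarrow> real" where
  "Moment p F C = real (card (Sur (class_rep C) (class_rep F))) * mu0 p C"

definition class_le :: "nat monoid set \<Rightarrow> nat monoid set \<Rightarrow> bool" where
  "class_le F' F \<longleftrightarrow> Sur (class_rep F) (class_rep F') \<noteq> {}"

text \<open>\<open>\<nu>\<close> is a finite linear combination of moment measures with leading term
  \<open>c * Moment p F\<close>.\<close>

definition moment_comb_with_leading_term ::
  "nat \<Rightarrow> (nat monoid set \<Rightarrow> real) \<Rightarrow> real \<Rightarrow> nat monoid set \<Rightarrow> bool"
where
  "moment_comb_with_leading_term p \<nu> c F \<longleftrightarrow>
     (\<exists>S a. finite S \<and> S \<subseteq> X0 p \<and> F \<in> S \<and> a F = c \<and> (\<forall>F'\<in>S. class_le F' F) \<and>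
        (\<forall>C\<in>X0 p. \<nu> C = (\<Sum>F'\<in>S. a F' * Moment p F' C)))"

definition lin_indep_family ::
  "nat \<Rightarrow> 'i set \<Rightarrow> ('i \<Rightarrow> nat monoid set \<Rightarrow> real) \<Rightarrow> bool"
where
  "lin_indep_family p I E \<longleftrightarrow>
     (\<forall>S a. finite S \<and> S \<subseteq> I \<and> (\<forall>C\<in>X0 p. (\<Sum>F\<in>S. a F * E F C) = 0) \<longrightarrow> (\<forall>F\<in>S. a F = (0::real)))"

end

theory Submission
  imports Defs "HOL-Algebra.Multiplicative_Group" "HOL-Algebra.Elementary_Groups"
    "HOL-Algebra.Sylow" "HOL-Number_Theory.Cong"
begin

text \<open>A class in \<open>Ext(G, \<int>\<^sub>p)\<close> is a character of \<open>G\<close>. A pair consisting of such a class, with middle term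
  \<open>H\<close>, and of a surjection \<open>H \<rightarrow> F\<close> amounts to a certain subgroup of \<open>\<int> \<times> G \<times> F\<close>. The pairs whose
  surjection has a kernel generated by one element correspond to subgroups subject to a condition symmetric
  in \<open>G\<close> and \<open>F\<close>; hence \<open>\<Delta>\<^sub>0\<close> is reversible with respect to \<open>1 / |Aut|\<close>. Counting all pairs by the image of
  \<open>(|G|, 1)\<close> in \<open>F\<close> gives that the mean of \<open>#Sur(\<Delta>\<^sub>0(G), F)\<close> is the sum over \<open>y \<in> F\<close> of
  \<open>#Sur(G, F/\<langle>y\<rangle>)\<close>, divided by \<open>|F|\<close>. Together, \<open>\<Delta>\<^sub>0\<close> maps the measure \<open>Moment[F]\<close> to the average of the measures
  \<open>Moment[F/\<langle>y\<rangle>]\<close>. So \<open>\<Delta>\<^sub>0\<close> is triangular on the moment measures, with diagonal entries \<open>1 / |F|\<close> that differ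
  along the order, and can be diagonalised.

  That the moment measures are finite also follows from reversibility: one step of \<open>\<Delta>\<^sub>0\<close> changes the number
  of homomorphisms to \<open>\<int>/p\<close> by a factor \<open>1\<close>, \<open>p\<close> or \<open>1/p\<close>, with known probabilities. Balancing the flow
  between the set of groups with \<open>p\<^sup>r\<close> such homomorphisms and the set of those with \<open>p\<^sup>r\<^sup>+\<^sup>1\<close> shows that the
  mass of these sets decays superexponentially.\<close>

section \<open>Characters of finite abelian groups\<close>

text \<open>The linking subgroups have integers, not p-adic integers, as first entries. A surjection
  onto \<open>F\<close> kills \<open>|F|\<close> times the module, so it is determined by its values
  at the dense set of points with integral coordinate, and nothing is lost. What is gained is
  symmetry: the image of \<open>1\<close> in the extension has coordinate \<open>|G|\<close>, a
  generator of the kernel can be normalised to have coordinate \<open>|F|\<close>, and exchanging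
  the two roles is exchanging the last two factors. The factor \<open>(1 - 1/p) / |F|\<close>
  between counts and probabilities is the Haar mass of the generators of a cyclic submodule of index
  \<open>|F|\<close>. The definitions involve arbitrary representatives and a Haar measure given by
  a description. Everything is therefore proved for any module with coordinates in an explicit model
  inside \<open>Z_p\<close> times \<open>G\<close>, where the measure is built from independent
  digits. Groups of equal order share an eigenvalue, so independence of the eigenfunctions is drawn
  from their leading terms; the distinct eigenvalues along the order serve to construct
  them.\<close>

definition chr :: "('a, 'b) monoid_scheme \<Rightarrow> int \<Rightarrow> 'a set \<Rightarrow> ('a \<Rightarrow> int) set" where
  "chr G n A = {\<omega> \<in> A \<rightarrow>\<^sub>E {0..<n}. \<forall>a\<in>A. \<forall>b\<in>A. \<omega> (a \<otimes>\<^bsub>G\<^esub> b) = (\<omega> a + \<omega> b) mod n}"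

lemma chr_range: "\<omega> \<in> chr G n A \<Longrightarrow> a \<in> A \<Longrightarrow> 0 \<le> \<omega> a \<and> \<omega> a < n"
  unfolding chr_def using PiE_mem by fastforce

lemma chr_mod: "\<omega> \<in> chr G n A \<Longrightarrow> a \<in> A \<Longrightarrow> \<omega> a mod n = \<omega> a"
  by (simp add: chr_range mod_pos_pos_trivial)

lemma chr_mult: "\<omega> \<in> chr G n A \<Longrightarrow> a \<in> A \<Longrightarrow> b \<in> A \<Longrightarrow> \<omega> (a \<otimes>\<^bsub>G\<^esub> b) = (\<omega> a + \<omega> b) mod n"
  unfolding chr_def by blast

lemma chr_ext: "\<omega> \<in> chr G n A \<Longrightarrow> \<omega> \<in> extensional A"
  unfolding chr_def PiE_def by blast

lemma chr_eqI: "\<omega> \<in> chr G n A \<Longrightarrow> \<omega>' \<in> chr G n A \<Longrightarrow> (\<And>a. a \<in> A \<Longrightarrow> \<omega> a = \<omega>' a) \<Longrightarrow> \<omega> = \<omega>'"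
  by (rule extensionalityI[OF chr_ext chr_ext])

lemma finite_chr: "finite A \<Longrightarrow> finite (chr G n A)"
  unfolding chr_def by (rule finite_subset[OF Collect_subset]) (simp add: finite_PiE)

lemma mod_eq_dvd: "(a::int) mod n = b mod n \<longleftrightarrow> n dvd a - b"
  by (rule mod_eq_dvd_iff)

context group
begin

lemma chr_one:
  assumes "subgroup A G" "\<omega> \<in> chr G n A"
  shows "\<omega> \<one> = 0"
proof -
  have 1: "\<one> \<in> A" using assms(1) subgroup.one_closed by blast
  have "\<omega> \<one> = (\<omega> \<one> + \<omega> \<one>) mod n" using chr_mult[OF assms(2) 1 1] by simp
  then have "(\<omega> \<one> + \<omega> \<one>) mod n = \<omega> \<one> mod n"
    using chr_mod[OF assms(2) 1] by simp
  then have "n dvd \<omega> \<one>" unfolding mod_eq_dvd by simp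
  then have "\<omega> \<one> mod n = 0" by simp
  then show ?thesis using chr_mod[OF assms(2) 1] by simp
qed

lemma chr_int_pow:
  assumes A: "subgroup A G" and w: "\<omega> \<in> chr G n A" and a: "a \<in> A"
  shows "\<omega> (a [^] (k::int)) = (k * \<omega> a) mod n"
proof -
  have aG: "a \<in> carrier G" using A a subgroup.mem_carrier by metis
  have cl: "a [^] (k::int) \<in> A" for k
    using subgroup_int_pow_closed[OF A a] .
  have nat: "\<omega> (a [^] (int k)) = (int k * \<omega> a) mod n" for k
  proof (induction k)
    case 0
    then show ?case using chr_one[OF A w] by simp
  next
    case (Suc k)
    have "a [^] (int (Suc k)) = a [^] (int k) \<otimes> a"
      using aG int_pow_mult[OF aG, of "int k" 1] by (simp add: add.commute)
    then have "\<omega> (a [^] (int (Suc k))) = ((int k * \<omega> a) mod n + \<omega> a) mod n"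
      using chr_mult[OF w cl a, of "int k"] Suc by simp
    then show ?case by (simp add: algebra_simps mod_simps)
  qed
  show ?thesis
  proof (cases "k \<ge> 0")
    case True
    then show ?thesis using nat[of "nat k"] by simp
  next
    case False
    then have "k = - int (nat (- k))" by simp
    then obtain j where j: "k = - int j" by blast
    have "\<omega> (a [^] k \<otimes> a [^] (int j)) = (\<omega> (a [^] k) + (int j * \<omega> a) mod n) mod n"
      using chr_mult[OF w cl cl, of k "int j"] nat[of j] by simp
    moreover have "a [^] k \<otimes> a [^] (int j) = \<one>"
      using aG j by (simp add: int_pow_neg)
    ultimately have "(\<omega> (a [^] k) + (int j * \<omega> a)) mod n = 0"
      using chr_one[OF A w] by (simp add: mod_simps)
    then have "n dvd (\<omega> (a [^] k) + (int j * \<omega> a))" by auto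
    then have "n dvd \<omega> (a [^] k) - k * \<omega> a" using j by simp
    then have "\<omega> (a [^] k) mod n = (k * \<omega> a) mod n" using mod_eq_dvd by blast
    then show ?thesis using chr_mod[OF w cl] by simp
  qed
qed

end

text \<open>After division by \<open>d\<close> the condition fixes \<open>c\<close> modulo
  \<open>e = n / d\<close>, and an interval of length \<open>n\<close> contains \<open>d\<close>
  members of a residue class modulo \<open>e\<close>.\<close>

lemma card_linear_congruence:
  fixes d n w :: int
  assumes "d dvd n" "d dvd w" "n > 0" "d > 0"
  shows "card {c \<in> {0..<n}. n dvd d * c - w} = nat d"
proof -
  obtain e where e: "n = d * e" using assms(1) by blast
  obtain v where v: "w = d * v" using assms(2) by blast
  have e0: "e > 0" using e assms(3,4) by (simp add: zero_less_mult_iff)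
  have "bij_betw (\<lambda>i. v mod e + i * e) {0..<d} {c \<in> {0..<n}. n dvd d * c - w}"
  proof (rule bij_betw_byWitness[where f' = "\<lambda>c. c div e"])
    show "\<forall>a\<in>{0..<d}. (v mod e + a * e) div e = a" using e0 by simp
    show "\<forall>a'\<in>{c \<in> {0..<n}. n dvd d * c - w}. v mod e + a' div e * e = a'"
    proof
      fix c assume "c \<in> {c \<in> {0..<n}. n dvd d * c - w}"
      then have "d * e dvd d * (c - v)" using e v by (simp add: right_diff_distrib)
      then have "e dvd c - v" using assms(4) by simp
      then have "c mod e = v mod e" by (simp add: mod_eq_dvd)
      then show "v mod e + c div e * e = c" by (metis mod_div_mult_eq)
    qed
    show "(\<lambda>i. v mod e + i * e) ` {0..<d} \<subseteq> {c \<in> {0..<n}. n dvd d * c - w}"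
    proof
      fix c assume "c \<in> (\<lambda>i. v mod e + i * e) ` {0..<d}"
      then obtain i where i: "0 \<le> i" "i < d" "c = v mod e + i * e" by auto
      have r: "0 \<le> v mod e" "v mod e < e" using e0 by simp_all
      have "(i + 1) * e \<le> d * e" using i e0 by (intro mult_right_mono) auto
      then have "c < n" using i r e by (simp add: algebra_simps)
      moreover have "0 \<le> c" using i r e0 by simp
      moreover have "c mod e = v mod e" using i by simp
      then have "e dvd c - v" unfolding mod_eq_dvd .
      then have "d * e dvd d * (c - v)" by simp
      then have "n dvd d * c - w" unfolding e v by (simp add: right_diff_distrib)
      ultimately show "c \<in> {c \<in> {0..<n}. n dvd d * c - w}" by simp
    qed
    show "(\<lambda>c. c div e) ` {c \<in> {0..<n}. n dvd d * c - w} \<subseteq> {0..<d}"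
    proof
      fix i assume "i \<in> (\<lambda>c. c div e) ` {c \<in> {0..<n}. n dvd d * c - w}"
      then obtain c where c: "i = c div e" "0 \<le> c" "c < n" by auto
      have "(c div e) * e + c mod e = c" by simp
      moreover have "c mod e \<ge> 0" using e0 by simp
      ultimately have "(c div e) * e < d * e" using c e by linarith
      then have "c div e < d" using e0 by (simp add: mult_less_cancel_right)
      then show "i \<in> {0..<d}" using c e0 by (simp add: pos_imp_zdiv_nonneg_iff)
    qed
  qed
  from bij_betw_same_card[OF this] show ?thesis by simp
qed


definition chr_extns :: "('a, 'b) monoid_scheme \<Rightarrow> int \<Rightarrow> 'a set \<Rightarrow> 'a set \<Rightarrow> ('a \<Rightarrow> int) \<Rightarrow> ('a \<Rightarrow> int) set" where
  "chr_extns G n A E \<omega>0 = {\<omega> \<in> chr G n E. \<forall>a\<in>A. \<omega> a = \<omega>0 a}"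

context comm_group
begin

text \<open>Adjoins one element \<open>g\<close>. If \<open>d\<close> is the order of
  \<open>g\<close> modulo \<open>A\<close>, the group \<open>B\<close> generated by both has
  \<open>A\<close> as a subgroup of index \<open>d\<close>. An extension of \<open>\<omega>0\<close>
  to \<open>B\<close> amounts to a value \<open>c\<close> at \<open>g\<close> such that
  \<open>d * c\<close> is congruent to the prescribed value at the \<open>d\<close>-th power of
  \<open>g\<close>, and this congruence has exactly \<open>d\<close> solutions.\<close>

lemma chr_step:
  assumes A: "subgroup A G" and E: "subgroup E G" and AE: "A \<subseteq> E" and fin: "finite E"
    and n: "int (card E) dvd n" "n > 0" and w0: "\<omega>0 \<in> chr G n A" and g: "g \<in> E" "g \<notin> A"
  shows "\<exists>B. subgroup B G \<and> A \<subset> B \<and> B \<subseteq> E \<and> card B = card A * card (chr_extns G n A B \<omega>0)"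
proof -
  have gG: "g \<in> carrier G" and EG: "\<And>x. x \<in> E \<Longrightarrow> x \<in> carrier G"
    using E g subgroup.mem_carrier by metis+
  have AG: "\<And>x. x \<in> A \<Longrightarrow> x \<in> carrier G" using AE EG by blast
  have A1: "\<one> \<in> A" and Am: "\<And>x y. x \<in> A \<Longrightarrow> y \<in> A \<Longrightarrow> x \<otimes> y \<in> A"
    and Ai: "\<And>x. x \<in> A \<Longrightarrow> inv x \<in> A"
    using A by (auto simp: subgroup.one_closed subgroup.m_closed subgroup.m_inv_closed)
  have Ap: "\<And>x k. x \<in> A \<Longrightarrow> x [^] (k::int) \<in> A" using subgroup_int_pow_closed[OF A] .
  have Ep: "\<And>x k. x \<in> E \<Longrightarrow> x [^] (k::int) \<in> E" using subgroup_int_pow_closed[OF E] .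
  interpret EE: group "G\<lparr>carrier := E\<rparr>" by (rule subgroup.subgroup_is_group[OF E is_group])
  define N where "N = card E"
  have N0: "N > 0" unfolding N_def using fin g by (auto simp: card_gt_0_iff)
  have gN: "g [^] (int N) = \<one>"
  proof -
    have "g [^]\<^bsub>G\<lparr>carrier := E\<rparr>\<^esub> N = \<one>\<^bsub>G\<lparr>carrier := E\<rparr>\<^esub>"
      using EE.pow_order_eq_1[of g] g unfolding N_def order_def by simp
    then show ?thesis by (simp add: int_pow_int nat_pow_consistent[symmetric])
  qed
  define P where "P = (\<lambda>k::nat. k > 0 \<and> g [^] (int k) \<in> A)"
  have PN: "P N" unfolding P_def using N0 gN A1 by simp
  define d where "d = (LEAST k. P k)"
  have Pd: "P d" unfolding d_def using PN by (rule LeastI)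
  have d0: "d > 0" and gd: "g [^] (int d) \<in> A" using Pd unfolding P_def by auto
  have dmin: "d \<le> k" if "P k" for k unfolding d_def using that by (rule Least_le)
  have key: "g [^] (k::int) \<in> A \<longleftrightarrow> int d dvd k" for k
  proof
    assume "int d dvd k"
    then obtain q where "k = int d * q" by blast
    then have "g [^] k = (g [^] (int d)) [^] q" using gG by (simp add: int_pow_pow)
    then show "g [^] k \<in> A" using Ap[OF gd] by simp
  next
    assume k: "g [^] k \<in> A"
    define r where "r = k mod int d"
    have r: "0 \<le> r" "r < int d" unfolding r_def using d0 by auto
    have "r = k + int d * (- (k div int d))" unfolding r_def by (simp add: minus_mult_div_eq_mod[symmetric])
    then have "g [^] r = g [^] (k + int d * (- (k div int d)))" by simp
    also have "\<dots> = g [^] k \<otimes> g [^] (int d * (- (k div int d)))" by (rule int_pow_mult[OF gG])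
    also have "g [^] (int d * (- (k div int d))) = (g [^] (int d)) [^] (- (k div int d))"
      by (rule int_pow_pow[OF gG, symmetric])
    finally have "g [^] r = g [^] k \<otimes> (g [^] (int d)) [^] (- (k div int d))" .
    then have rA: "g [^] r \<in> A" using k Ap[OF gd] Am by simp
    have "r = 0"
    proof (rule ccontr)
      assume "r \<noteq> 0"
      then have "P (nat r)" unfolding P_def using rA r by simp
      from dmin[OF this] show False using r by simp
    qed
    then show "int d dvd k" unfolding r_def by auto
  qed
  have dn: "int d dvd int N" using key[of "int N"] gN A1 by simp
  then have dvdn: "int d dvd n" using n(1) N_def dvd_trans by blast
  define w where "w = \<omega>0 (g [^] (int d))"
  \<comment> \<open>Solvability of the congruence: with \<open>n = d * e\<close>, the
    \<open>n\<close>-th power of \<open>g\<close> is trivial, so \<open>e * w\<close> vanishes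
    modulo \<open>d * e\<close>.\<close>
  have dw: "int d dvd w"
  proof -
    obtain e where e: "n = int d * e" using dvdn by blast
    obtain f where f: "n = int N * f" using n(1) N_def by blast
    have "(g [^] (int d)) [^] e = g [^] n" using gG e by (simp add: int_pow_pow)
    also have "\<dots> = (g [^] (int N)) [^] f" using gG f by (simp add: int_pow_pow)
    also have "\<dots> = \<one>" using gN by (simp add: int_pow_one)
    finally have "(e * w) mod n = 0"
      using chr_int_pow[OF A w0 gd, of e] chr_one[OF A w0] w_def by simp
    then have "int d * e dvd e * w" unfolding e by auto
    moreover have "e \<noteq> 0" using e n by auto
    ultimately show ?thesis by (simp add: mult.commute)
  qed
  define B where "B = (\<lambda>(a, j). a \<otimes> g [^] (j::int)) ` (A \<times> UNIV)"
  have BI: "a \<otimes> g [^] (j::int) \<in> B" if "a \<in> A" for a j unfolding B_def using that by force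
  have BE: "\<exists>a j. a \<in> A \<and> x = a \<otimes> g [^] (j::int)" if "x \<in> B" for x using that unfolding B_def by auto
  have eq: "int d dvd j - i \<and> b = a \<otimes> g [^] (i - j)"
    if "a \<in> A" "b \<in> A" "a \<otimes> g [^] (i::int) = b \<otimes> g [^] (j::int)" for a b i j
  proof -
    have c: "a \<in> carrier G" "b \<in> carrier G" "g [^] i \<in> carrier G" "g [^] j \<in> carrier G"
      using that AG gG by auto
    have "a \<otimes> g [^] i \<otimes> inv (g [^] j) = b" using that c
      by (metis m_closed inv_solve_right')
    then have b: "b = a \<otimes> g [^] (i - j)" using c gG by (simp add: m_assoc int_pow_diff)
    then have "g [^] (i - j) = inv a \<otimes> b" using c gG
      by (metis int_pow_closed inv_solve_left)
    then have "g [^] (i - j) \<in> A" using that Ai Am by simp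
    then have "int d dvd i - j" using key by blast
    then have "int d dvd j - i" by (metis dvd_minus_iff minus_diff_eq)
    then show ?thesis using b by blast
  qed
  have mulB: "(a \<otimes> g [^] (i::int)) \<otimes> (b \<otimes> g [^] (j::int)) = (a \<otimes> b) \<otimes> g [^] (i + j)"
    if "a \<in> A" "b \<in> A" for a b i j
    using AG[OF that(1)] AG[OF that(2)] gG
    by (simp add: int_pow_mult) (metis int_pow_closed m_ac(1) m_ac(2) m_closed m_comm)
  have AB: "A \<subseteq> B"
  proof
    fix a assume "a \<in> A"
    then show "a \<in> B" using BI[of a 0] AG by simp
  qed
  have gB: "g \<in> B" using BI[OF A1, of 1] gG by simp
  have BEE: "B \<subseteq> E"
  proof
    fix x assume "x \<in> B"
    then obtain a j where "a \<in> A" "x = a \<otimes> g [^] (j::int)" using BE by blast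
    then show "x \<in> E" using AE Ep[OF g(1)] E subgroup.m_closed by (metis subsetD)
  qed
  have B: "subgroup B G"
  proof (rule subgroupI)
    show "B \<subseteq> carrier G" using BEE EG by blast
    show "B \<noteq> {}" using gB by blast
  next
    fix x assume "x \<in> B"
    then obtain a j where x: "a \<in> A" "x = a \<otimes> g [^] (j::int)" using BE by blast
    have "inv x = inv a \<otimes> g [^] (-j)"
      using x AG gG by (simp add: inv_mult int_pow_neg)
    then show "inv x \<in> B" using BI[OF Ai[OF x(1)]] by simp
  next
    fix x y assume "x \<in> B" "y \<in> B"
    then obtain a j b i where x: "a \<in> A" "x = a \<otimes> g [^] (j::int)" "b \<in> A" "y = b \<otimes> g [^] (i::int)"
      using BE by meson
    then have "x \<otimes> y = (a \<otimes> b) \<otimes> g [^] (j + i)" using mulB by simp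
    then show "x \<otimes> y \<in> B" using BI[OF Am[OF x(1,3)]] by simp
  qed
  have cB: "card B = card A * d"
  proof -
    have "bij_betw (\<lambda>(a, j). a \<otimes> g [^] (j::int)) (A \<times> {0..<int d}) B"
      unfolding bij_betw_def
    proof
      show "inj_on (\<lambda>(a, j). a \<otimes> g [^] (j::int)) (A \<times> {0..<int d})"
      proof (rule inj_onI, clarify)
        fix a i b j assume h: "a \<in> A" "b \<in> A" "i \<in> {0..<int d}" "j \<in> {0..<int d}"
          and e: "a \<otimes> g [^] i = b \<otimes> g [^] j"
        have "int d dvd j - i" "b = a \<otimes> g [^] (i - j)" using eq[OF h(1,2) e] by auto
        moreover from this(1) have "j = i" using h
          by (metis atLeastLessThan_iff mod_eq_dvd mod_pos_pos_trivial)
        ultimately show "a = b \<and> i = j" using AG[OF h(1)] by simp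
      qed
      show "(\<lambda>(a, j). a \<otimes> g [^] (j::int)) ` (A \<times> {0..<int d}) = B"
      proof
        show "(\<lambda>(a, j). a \<otimes> g [^] (j::int)) ` (A \<times> {0..<int d}) \<subseteq> B" unfolding B_def by auto
        show "B \<subseteq> (\<lambda>(a, j). a \<otimes> g [^] (j::int)) ` (A \<times> {0..<int d})"
        proof
          fix x assume "x \<in> B"
          then obtain a j where x: "a \<in> A" "x = a \<otimes> g [^] (j::int)" using BE by blast
          define c where "c = a \<otimes> g [^] (int d * (j div int d))"
          have cA: "c \<in> A" unfolding c_def using x Am key by simp
          have "g [^] j = g [^] (int d * (j div int d)) \<otimes> g [^] (j mod int d)"
            using int_pow_mult[OF gG, of "int d * (j div int d)" "j mod int d"] by simp
          then have "x = c \<otimes> g [^] (j mod int d)" unfolding c_def x(2)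
            using AG[OF x(1)] gG by (simp add: m_assoc)
          moreover have "(c, j mod int d) \<in> A \<times> {0..<int d}" using cA d0 by simp
          ultimately show "x \<in> (\<lambda>(a, j). a \<otimes> g [^] (j::int)) ` (A \<times> {0..<int d})" by force
        qed
      qed
    qed
    from bij_betw_same_card[OF this] show ?thesis by (simp add: card_cartesian_product)
  qed
  have cX: "card (chr_extns G n A B \<omega>0) = d"
  proof -
    let ?C = "{c \<in> {0..<n}. n dvd int d * c - w}"
    have "bij_betw (\<lambda>\<omega>. \<omega> g) (chr_extns G n A B \<omega>0) ?C"
      unfolding bij_betw_def
    proof
      have val: "\<omega> (a \<otimes> g [^] (j::int)) = (\<omega>0 a + j * \<omega> g) mod n"
        if "\<omega> \<in> chr_extns G n A B \<omega>0" "a \<in> A" for \<omega> a j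
      proof -
        have w: "\<omega> \<in> chr G n B" "\<omega> a = \<omega>0 a" using that unfolding chr_extns_def by auto
        have gj: "g [^] j \<in> B" using subgroup_int_pow_closed[OF B gB] .
        have "\<omega> (a \<otimes> g [^] (j::int)) = (\<omega> a + \<omega> (g [^] j)) mod n"
          using chr_mult[OF w(1) _ gj] AB that by blast
        also have "\<omega> (g [^] j) = (j * \<omega> g) mod n" by (rule chr_int_pow[OF B w(1) gB])
        finally show ?thesis using w by (simp add: mod_simps)
      qed
      show "inj_on (\<lambda>\<omega>. \<omega> g) (chr_extns G n A B \<omega>0)"
      proof (rule inj_onI)
        fix \<omega> \<omega>' assume h: "\<omega> \<in> chr_extns G n A B \<omega>0" "\<omega>' \<in> chr_extns G n A B \<omega>0" "\<omega> g = \<omega>' g"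
        show "\<omega> = \<omega>'"
        proof (rule chr_eqI)
          show "\<omega> \<in> chr G n B" "\<omega>' \<in> chr G n B" using h unfolding chr_extns_def by auto
          fix x assume "x \<in> B"
          then obtain a j where "a \<in> A" "x = a \<otimes> g [^] (j::int)" using BE by blast
          then show "\<omega> x = \<omega>' x" using val[OF h(1)] val[OF h(2)] h(3) by simp
        qed
      qed
      show "(\<lambda>\<omega>. \<omega> g) ` (chr_extns G n A B \<omega>0) = ?C"
      proof
        show "(\<lambda>\<omega>. \<omega> g) ` (chr_extns G n A B \<omega>0) \<subseteq> ?C"
        proof
          fix c assume "c \<in> (\<lambda>\<omega>. \<omega> g) ` (chr_extns G n A B \<omega>0)"
          then obtain \<omega> where w: "\<omega> \<in> chr_extns G n A B \<omega>0" "c = \<omega> g" by auto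
          have w': "\<omega> \<in> chr G n B" using w unfolding chr_extns_def by auto
          have "\<omega> (g [^] (int d)) = w" using w gd unfolding chr_extns_def w_def by auto
          then have "(int d * c) mod n = w" using chr_int_pow[OF B w' gB, of "int d"] w by simp
          then have "(int d * c) mod n = w mod n" using chr_mod[OF w0 gd] unfolding w_def by simp
          then show "c \<in> ?C" using chr_range[OF w' gB] w unfolding mod_eq_dvd by simp
        qed
        show "?C \<subseteq> (\<lambda>\<omega>. \<omega> g) ` (chr_extns G n A B \<omega>0)"
        proof
          fix c assume "c \<in> ?C"
          then have c: "0 \<le> c" "c < n" "n dvd int d * c - w" by auto
          \<comment> \<open>\<open>Q x v\<close> says that some way of writing \<open>x\<close> as a
            member of \<open>A\<close> times a power of \<open>g\<close> assigns the value
            \<open>v\<close> to \<open>x\<close>. The congruence for \<open>c\<close> makes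
            \<open>v\<close> independent of that choice, so the description below defines a
            character.\<close>
          define Q where "Q = (\<lambda>x v. \<exists>a j. a \<in> A \<and> x = a \<otimes> g [^] (j::int) \<and> v = (\<omega>0 a + j * c) mod n)"
          have Qu: "v = v'" if Qs: "Q x v" "Q x v'" for x v v'
          proof -
            obtain a j where a: "a \<in> A" "x = a \<otimes> g [^] (j::int)" "v = (\<omega>0 a + j * c) mod n"
              using Qs(1) unfolding Q_def by blast
            obtain b i where b: "b \<in> A" "x = b \<otimes> g [^] (i::int)" "v' = (\<omega>0 b + i * c) mod n"
              using Qs(2) unfolding Q_def by blast
            have e: "int d dvd i - j" "b = a \<otimes> g [^] (j - i)" using eq[OF a(1) b(1)] a(2) b(2) by auto
            obtain q where q: "j - i = int d * q" using e(1) by (metis dvd_def dvd_minus_iff minus_diff_eq)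
            have "b = a \<otimes> (g [^] (int d)) [^] q" using e(2) q gG by (simp add: int_pow_pow)
            then have "\<omega>0 b = (\<omega>0 a + (q * w) mod n) mod n"
              using chr_mult[OF w0 a(1) Ap[OF gd]] chr_int_pow[OF A w0 gd] w_def by simp
            then have "v' = (\<omega>0 a + q * w + i * c) mod n" using b(3) by (simp add: mod_simps)
            moreover have "(\<omega>0 a + q * w + i * c) mod n = (\<omega>0 a + j * c) mod n"
            proof -
              have "j * c = i * c + int d * q * c" using q by (metis add.commute diff_add_cancel distrib_right)
              then have "(\<omega>0 a + j * c) - (\<omega>0 a + q * w + i * c) = q * (int d * c - w)"
                by (simp add: algebra_simps)
              then have "n dvd (\<omega>0 a + j * c) - (\<omega>0 a + q * w + i * c)" using c(3) by simp
              then have "(\<omega>0 a + j * c) mod n = (\<omega>0 a + q * w + i * c) mod n" unfolding mod_eq_dvd .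
              then show ?thesis by simp
            qed
            ultimately show ?thesis using a(3) by simp
          qed
          define \<omega> where "\<omega> = restrict (\<lambda>x. THE v. Q x v) B"
          have wv: "\<omega> (a \<otimes> g [^] (j::int)) = (\<omega>0 a + j * c) mod n" if "a \<in> A" for a j
          proof -
            have "Q (a \<otimes> g [^] j) ((\<omega>0 a + j * c) mod n)" unfolding Q_def using that by blast
            then have "(THE v. Q (a \<otimes> g [^] j) v) = (\<omega>0 a + j * c) mod n" using Qu by (intro the_equality) auto
            then show ?thesis unfolding \<omega>_def using BI[OF that] by simp
          qed
          have "\<omega> \<in> chr G n B" unfolding chr_def
          proof (intro CollectI conjI ballI)
            show "\<omega> \<in> B \<rightarrow>\<^sub>E {0..<n}"
            proof (rule PiE_I)
              fix x assume "x \<in> B"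
              then obtain a j where "a \<in> A" "x = a \<otimes> g [^] (j::int)" using BE by blast
              then show "\<omega> x \<in> {0..<n}" using wv n(2) by simp
            qed (simp add: \<omega>_def)
            fix x y assume "x \<in> B" "y \<in> B"
            then obtain a j b i where x: "a \<in> A" "x = a \<otimes> g [^] (j::int)" "b \<in> A" "y = b \<otimes> g [^] (i::int)"
              using BE by meson
            have "\<omega> (x \<otimes> y) = (\<omega>0 (a \<otimes> b) + (j + i) * c) mod n"
              unfolding x(2,4) mulB[OF x(1,3)] by (rule wv[OF Am[OF x(1,3)]])
            also have "\<omega>0 (a \<otimes> b) = (\<omega>0 a + \<omega>0 b) mod n" by (rule chr_mult[OF w0 x(1,3)])
            finally show "\<omega> (x \<otimes> y) = (\<omega> x + \<omega> y) mod n"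
              unfolding x(2,4) wv[OF x(1)] wv[OF x(3)]
              by (simp only: mod_simps) (simp add: algebra_simps)
          qed
          moreover have "\<omega> a = \<omega>0 a" if "a \<in> A" for a
            using wv[OF that, of 0] AG[OF that] chr_mod[OF w0 that] by simp
          ultimately have "\<omega> \<in> chr_extns G n A B \<omega>0" unfolding chr_extns_def by blast
          moreover have "\<omega> g = c"
            using wv[OF A1, of 1] gG chr_one[OF A w0] c by simp
          ultimately show "c \<in> (\<lambda>\<omega>. \<omega> g) ` (chr_extns G n A B \<omega>0)" by blast
        qed
      qed
    qed
    from bij_betw_same_card[OF this] show ?thesis
      using card_linear_congruence[OF dvdn dw n(2)] d0 by simp
  qed
  have "A \<subset> B" using AB gB g by blast
  then show ?thesis using B BEE cB cX by blast
qed

text \<open>Induction on the number of elements of \<open>E\<close> outside \<open>A\<close>: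
  extensions to \<open>E\<close> are grouped by their restriction to the intermediate group
  \<open>B\<close> of the one-step lemma, and the indices multiply. Later this fixes the number of
  linking subgroups of a given shape.\<close>

theorem card_chr_extns:
  assumes E: "subgroup E G" and fin: "finite E" and n: "int (card E) dvd n" "n > 0"
    and A: "subgroup A G" "A \<subseteq> E" and w0: "\<omega>0 \<in> chr G n A"
  shows "card (chr_extns G n A E \<omega>0) * card A = card E"
  using A w0
proof (induction "card E - card A" arbitrary: A \<omega>0 rule: less_induct)
  case less
  show ?case
  proof (cases "A = E")
    case True
    have "chr_extns G n A E \<omega>0 = {\<omega>0}"
      using less(4) chr_eqI unfolding True chr_extns_def by blast
    then show ?thesis using True by simp
  next
    case False
    then obtain g where g: "g \<in> E" "g \<notin> A" using less by blast
    obtain B where B: "subgroup B G" "A \<subset> B" "B \<subseteq> E" "card B = card A * card (chr_extns G n A B \<omega>0)"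
      using chr_step[OF less(2) E less(3) fin n less(4) g] by blast
    have finB: "finite B" using B(3) fin finite_subset by blast
    have "card A < card B" by (rule psubset_card_mono[OF finB B(2)])
    moreover have "card B \<le> card E" by (rule card_mono[OF fin B(3)])
    ultimately have cards: "card A < card B" "card B \<le> card E" by auto
    from cards have lt: "card E - card B < card E - card A" by linarith
    have un: "chr_extns G n A E \<omega>0 = (\<Union>\<omega>1\<in>chr_extns G n A B \<omega>0. chr_extns G n B E \<omega>1)"
    proof
      show "chr_extns G n A E \<omega>0 \<subseteq> (\<Union>\<omega>1\<in>chr_extns G n A B \<omega>0. chr_extns G n B E \<omega>1)"
      proof
        fix \<omega> assume w: "\<omega> \<in> chr_extns G n A E \<omega>0"
        then have wE: "\<omega> \<in> chr G n E" unfolding chr_extns_def by blast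
        have cl: "a \<otimes> b \<in> B" if "a \<in> B" "b \<in> B" for a b using B(1) that subgroup.m_closed by metis
        have "restrict \<omega> B \<in> chr G n B" unfolding chr_def
        proof (intro CollectI conjI ballI)
          show "restrict \<omega> B \<in> B \<rightarrow>\<^sub>E {0..<n}" using chr_range[OF wE] B(3) by (auto intro!: PiE_I)
          show "restrict \<omega> B (a \<otimes> b) = (restrict \<omega> B a + restrict \<omega> B b) mod n" if "a \<in> B" "b \<in> B" for a b
            using chr_mult[OF wE, of a b] cl[OF that] that B(3) by auto
        qed
        then have "restrict \<omega> B \<in> chr_extns G n A B \<omega>0"
          using w B(2) unfolding chr_extns_def by auto
        moreover have "\<omega> \<in> chr_extns G n B E (restrict \<omega> B)" using wE unfolding chr_extns_def by simp
        ultimately show "\<omega> \<in> (\<Union>\<omega>1\<in>chr_extns G n A B \<omega>0. chr_extns G n B E \<omega>1)" by blast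
      qed
      show "(\<Union>\<omega>1\<in>chr_extns G n A B \<omega>0. chr_extns G n B E \<omega>1) \<subseteq> chr_extns G n A E \<omega>0"
        using B(2) unfolding chr_extns_def by auto
    qed
    have fX: "finite (chr_extns G n A B \<omega>0)"
      unfolding chr_extns_def by (rule finite_subset[OF Collect_restrict finite_chr[OF finB]])
    have fY: "finite (chr_extns G n B E \<omega>1)" for \<omega>1
      unfolding chr_extns_def by (rule finite_subset[OF Collect_restrict finite_chr[OF fin]])
    have dis: "chr_extns G n B E \<omega>1 \<inter> chr_extns G n B E \<omega>2 = {}"
      if "\<omega>1 \<in> chr_extns G n A B \<omega>0" "\<omega>2 \<in> chr_extns G n A B \<omega>0" "\<omega>1 \<noteq> \<omega>2" for \<omega>1 \<omega>2
    proof (rule ccontr)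
      assume "chr_extns G n B E \<omega>1 \<inter> chr_extns G n B E \<omega>2 \<noteq> {}"
      then obtain \<omega> where "\<omega> \<in> chr_extns G n B E \<omega>1" "\<omega> \<in> chr_extns G n B E \<omega>2" by blast
      then have "\<And>b. b \<in> B \<Longrightarrow> \<omega>1 b = \<omega>2 b" unfolding chr_extns_def by simp
      moreover have "\<omega>1 \<in> chr G n B" "\<omega>2 \<in> chr G n B" using that unfolding chr_extns_def by auto
      ultimately show False using chr_eqI that(3) by blast
    qed
    have "card (chr_extns G n A E \<omega>0) = (\<Sum>\<omega>1\<in>chr_extns G n A B \<omega>0. card (chr_extns G n B E \<omega>1))"
      unfolding un using fX fY dis by (intro card_UN_disjoint) auto
    then have "card (chr_extns G n A E \<omega>0) * card B
        = (\<Sum>\<omega>1\<in>chr_extns G n A B \<omega>0. card (chr_extns G n B E \<omega>1) * card B)"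
      by (simp add: sum_distrib_right)
    also have "\<dots> = (\<Sum>\<omega>1\<in>chr_extns G n A B \<omega>0. card E)"
    proof (rule sum.cong[OF refl])
      fix \<omega>1 assume "\<omega>1 \<in> chr_extns G n A B \<omega>0"
      then have "\<omega>1 \<in> chr G n B" unfolding chr_extns_def by blast
      then show "card (chr_extns G n B E \<omega>1) * card B = card E"
        using less(1)[OF lt B(1) B(3)] by blast
    qed
    finally have "card (chr_extns G n A E \<omega>0) * card B = card (chr_extns G n A B \<omega>0) * card E" by simp
    then have "card (chr_extns G n A B \<omega>0) * (card (chr_extns G n A E \<omega>0) * card A)
       = card (chr_extns G n A B \<omega>0) * card E" using B(4) by (simp add: mult_ac)
    moreover have "card (chr_extns G n A B \<omega>0) \<noteq> 0"
      using B(4) cards(1) by (metis mult_0_right not_less_zero)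
    ultimately show ?thesis by simp
  qed
qed

corollary card_chr:
  assumes E: "subgroup E G" and fin: "finite E" and n: "int (card E) dvd n" "n > 0"
  shows "card (chr G n E) = card E"
proof -
  have A: "subgroup {\<one>} G" "{\<one>} \<subseteq> E"
    using triv_subgroup subgroup.one_closed[OF E] by auto
  have w0: "(\<lambda>x\<in>{\<one>}. 0) \<in> chr G n {\<one>}" unfolding chr_def using n by (auto intro!: PiE_I)
  have "chr_extns G n {\<one>} E (\<lambda>x\<in>{\<one>}. 0) = chr G n E"
    unfolding chr_extns_def using chr_one[OF E] by auto
  then show ?thesis using card_chr_extns[OF E fin n A w0] by simp
qed

end

section \<open>Surjections and isomorphism classes of finite abelian groups\<close>

text \<open>Agrees with \<open>Sur\<close> on groups of naturals, but allows arbitrary carriers: the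
  sources will also be modules of rank one, the targets also quotient groups and residue class
  groups.\<close>

definition epis :: "('a, 'm) monoid_scheme \<Rightarrow> ('b, 'n) monoid_scheme \<Rightarrow> ('a \<Rightarrow> 'b) set" where
  "epis A F = epi A F \<inter> extensional (carrier A)"

lemma Sur_epis: "Sur G F = epis G F"
  by (simp add: Sur_def epis_def)

lemma episD:
  assumes "\<phi> \<in> epis A F"
  shows "\<phi> \<in> hom A F" "\<phi> ` carrier A = carrier F" "\<phi> \<in> extensional (carrier A)"
    "\<And>x. x \<in> carrier A \<Longrightarrow> \<phi> x \<in> carrier F"
    "\<And>x y. x \<in> carrier A \<Longrightarrow> y \<in> carrier A \<Longrightarrow> \<phi> (x \<otimes>\<^bsub>A\<^esub> y) = \<phi> x \<otimes>\<^bsub>F\<^esub> \<phi> y"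
  using assms by (auto simp: epis_def epi_def hom_def)

lemma episI:
  assumes "\<phi> \<in> extensional (carrier A)" "\<And>x. x \<in> carrier A \<Longrightarrow> \<phi> x \<in> carrier F"
    "\<And>x y. x \<in> carrier A \<Longrightarrow> y \<in> carrier A \<Longrightarrow> \<phi> (x \<otimes>\<^bsub>A\<^esub> y) = \<phi> x \<otimes>\<^bsub>F\<^esub> \<phi> y"
    "\<And>f. f \<in> carrier F \<Longrightarrow> \<exists>x\<in>carrier A. \<phi> x = f"
  shows "\<phi> \<in> epis A F"
  using assms unfolding epis_def epi_def hom_def by (force simp: image_iff)

lemma hom_eq_iff_diff:
  assumes "group A" "group F" "\<phi> \<in> hom A F" "x \<in> carrier A" "y \<in> carrier A"
  shows "\<phi> x = \<phi> y \<longleftrightarrow> \<phi> (x \<otimes>\<^bsub>A\<^esub> inv\<^bsub>A\<^esub> y) = \<one>\<^bsub>F\<^esub>"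
proof -
  interpret group_hom A F \<phi>
    using assms by (simp add: group_hom_def group_hom_axioms_def)
  have "\<phi> (x \<otimes>\<^bsub>A\<^esub> inv\<^bsub>A\<^esub> y) = \<phi> x \<otimes>\<^bsub>F\<^esub> inv\<^bsub>F\<^esub> \<phi> y" using assms by simp
  then show ?thesis using assms
    by (metis H.inv_closed H.inv_equality H.inv_inv H.r_inv hom_closed)
qed

text \<open>Composition with \<open>\<phi>\<close> is the bijection. Its inverse composes with a
  set-theoretic section \<open>s\<close>, which works because the maps on the left are constant on
  the fibres of \<open>\<phi>\<close>.\<close>

lemma card_epis_factor:
  assumes A: "group A" and G: "group G" and F: "group F" and ph: "\<phi> \<in> epi A G"
  shows "card {\<psi> \<in> epis A F. \<forall>x\<in>carrier A. \<phi> x = \<one>\<^bsub>G\<^esub> \<longrightarrow> \<psi> x = \<one>\<^bsub>F\<^esub>} = card (epis G F)"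
proof -
  let ?R = "{\<psi> \<in> epis A F. \<forall>x\<in>carrier A. \<phi> x = \<one>\<^bsub>G\<^esub> \<longrightarrow> \<psi> x = \<one>\<^bsub>F\<^esub>}"
  have ph: "\<phi> \<in> hom A G" "\<phi> ` carrier A = carrier G" using ph by (auto simp: epi_def)
  have phc: "\<And>x. x \<in> carrier A \<Longrightarrow> \<phi> x \<in> carrier G" using ph by (auto simp: hom_def)
  have phm: "\<And>x y. x \<in> carrier A \<Longrightarrow> y \<in> carrier A \<Longrightarrow> \<phi> (x \<otimes>\<^bsub>A\<^esub> y) = \<phi> x \<otimes>\<^bsub>G\<^esub> \<phi> y"
    using ph by (auto simp: hom_def)
  define s where "s = inv_into (carrier A) \<phi>"
  have s: "s g \<in> carrier A" "\<phi> (s g) = g" if "g \<in> carrier G" for g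
    unfolding s_def using that ph(2) by (metis inv_into_into, metis f_inv_into_f)
  have "bij_betw (\<lambda>\<sigma>. restrict (\<sigma> \<circ> \<phi>) (carrier A)) (epis G F) ?R"
  proof (rule bij_betw_byWitness[where f' = "\<lambda>\<psi>. restrict (\<psi> \<circ> s) (carrier G)"])
    show "\<forall>\<sigma>\<in>epis G F. restrict (restrict (\<sigma> \<circ> \<phi>) (carrier A) \<circ> s) (carrier G) = \<sigma>"
    proof
      fix \<sigma> assume "\<sigma> \<in> epis G F"
      note E = episD[OF this]
      show "restrict (restrict (\<sigma> \<circ> \<phi>) (carrier A) \<circ> s) (carrier G) = \<sigma>"
        by (rule extensionalityI[OF _ E(3)]) (auto simp: s)
    qed
    show "\<forall>\<psi>\<in>?R. restrict (restrict (\<psi> \<circ> s) (carrier G) \<circ> \<phi>) (carrier A) = \<psi>"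
    proof
      fix \<psi> assume R: "\<psi> \<in> ?R"
      then have "\<psi> \<in> epis A F" by simp
      note E = episD[OF this]
      have "\<psi> (s (\<phi> x)) = \<psi> x" if x: "x \<in> carrier A" for x
      proof -
        have c: "s (\<phi> x) \<in> carrier A" "\<phi> (s (\<phi> x)) = \<phi> x" using s phc x by auto
        then have "\<phi> (s (\<phi> x) \<otimes>\<^bsub>A\<^esub> inv\<^bsub>A\<^esub> x) = \<one>\<^bsub>G\<^esub>"
          using hom_eq_iff_diff[OF A G ph(1)] x by blast
        moreover have "s (\<phi> x) \<otimes>\<^bsub>A\<^esub> inv\<^bsub>A\<^esub> x \<in> carrier A"
          using A c x by (simp add: group.inv_closed group.is_monoid monoid.m_closed)
        ultimately have "\<psi> (s (\<phi> x) \<otimes>\<^bsub>A\<^esub> inv\<^bsub>A\<^esub> x) = \<one>\<^bsub>F\<^esub>" using R by blast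
        then show ?thesis using hom_eq_iff_diff[OF A F E(1)] c x by blast
      qed
      then show "restrict (restrict (\<psi> \<circ> s) (carrier G) \<circ> \<phi>) (carrier A) = \<psi>"
        by (intro extensionalityI[OF _ E(3)]) (auto simp: phc)
    qed
    show "(\<lambda>\<sigma>. restrict (\<sigma> \<circ> \<phi>) (carrier A)) ` epis G F \<subseteq> ?R"
    proof
      fix \<psi> assume "\<psi> \<in> (\<lambda>\<sigma>. restrict (\<sigma> \<circ> \<phi>) (carrier A)) ` epis G F"
      then obtain \<sigma> where sg: "\<sigma> \<in> epis G F" "\<psi> = restrict (\<sigma> \<circ> \<phi>) (carrier A)" by blast
      note E = episD[OF sg(1)]
      have one: "\<sigma> \<one>\<^bsub>G\<^esub> = \<one>\<^bsub>F\<^esub>" using hom_one[OF E(1) G F] .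
      have "\<psi> \<in> epis A F"
      proof (rule episI)
        fix x y assume xy: "x \<in> carrier A" "y \<in> carrier A"
        then have "x \<otimes>\<^bsub>A\<^esub> y \<in> carrier A" using A by (simp add: group.is_monoid monoid.m_closed)
        then show "\<psi> (x \<otimes>\<^bsub>A\<^esub> y) = \<psi> x \<otimes>\<^bsub>F\<^esub> \<psi> y" unfolding sg(2) using xy phm phc E(5) by simp
      next
        fix f assume "f \<in> carrier F"
        then obtain g where "g \<in> carrier G" "\<sigma> g = f" using E(2) by (metis imageE)
        then show "\<exists>x\<in>carrier A. \<psi> x = f" unfolding sg(2) using s by (intro bexI[of _ "s g"]) auto
      qed (auto simp: sg(2) phc E(4))
      then show "\<psi> \<in> ?R" unfolding sg(2) using one by simp
    qed
    show "(\<lambda>\<psi>. restrict (\<psi> \<circ> s) (carrier G)) ` ?R \<subseteq> epis G F"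
    proof
      fix \<sigma> assume "\<sigma> \<in> (\<lambda>\<psi>. restrict (\<psi> \<circ> s) (carrier G)) ` ?R"
      then obtain \<psi> where R: "\<psi> \<in> ?R" and sg: "\<sigma> = restrict (\<psi> \<circ> s) (carrier G)" by blast
      then have "\<psi> \<in> epis A F" by simp
      note E = episD[OF this]
      have fac: "\<psi> x = \<psi> y" if xy: "x \<in> carrier A" "y \<in> carrier A" "\<phi> x = \<phi> y" for x y
      proof -
        have "\<phi> (x \<otimes>\<^bsub>A\<^esub> inv\<^bsub>A\<^esub> y) = \<one>\<^bsub>G\<^esub>" using hom_eq_iff_diff[OF A G ph(1)] xy by blast
        moreover have "x \<otimes>\<^bsub>A\<^esub> inv\<^bsub>A\<^esub> y \<in> carrier A"
          using A xy by (simp add: group.inv_closed group.is_monoid monoid.m_closed)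
        ultimately have "\<psi> (x \<otimes>\<^bsub>A\<^esub> inv\<^bsub>A\<^esub> y) = \<one>\<^bsub>F\<^esub>" using R by blast
        then show ?thesis using hom_eq_iff_diff[OF A F E(1)] xy by blast
      qed
      show "\<sigma> \<in> epis G F"
      proof (rule episI)
        fix x y assume xy: "x \<in> carrier G" "y \<in> carrier G"
        have c: "x \<otimes>\<^bsub>G\<^esub> y \<in> carrier G" using G xy by (simp add: group.is_monoid monoid.m_closed)
        have m: "s x \<otimes>\<^bsub>A\<^esub> s y \<in> carrier A" using A s xy by (simp add: group.is_monoid monoid.m_closed)
        have "\<psi> (s (x \<otimes>\<^bsub>G\<^esub> y)) = \<psi> (s x \<otimes>\<^bsub>A\<^esub> s y)"
          by (rule fac) (use c m s xy phm in auto)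
        then show "\<sigma> (x \<otimes>\<^bsub>G\<^esub> y) = \<sigma> x \<otimes>\<^bsub>F\<^esub> \<sigma> y" unfolding sg using xy c s E(5) by simp
      next
        fix f assume "f \<in> carrier F"
        then obtain x where x: "x \<in> carrier A" "\<psi> x = f" using E(2) by (metis imageE)
        have "\<psi> (s (\<phi> x)) = \<psi> x" by (rule fac) (use s phc x in auto)
        then show "\<exists>x\<in>carrier G. \<sigma> x = f" unfolding sg using phc x by (intro bexI[of _ "\<phi> x"]) auto
      qed (auto simp: sg s E(4))
    qed
  qed
  from bij_betw_same_card[OF this] show ?thesis by simp
qed

text \<open>A surjective self-map of a finite set is injective, and both sides consist of
  extensional functions. This is how the number of automorphisms enters the counts of
  surjections.\<close>

lemma epis_self:
  assumes "finite (carrier G)"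
  shows "epis G G = auto G"
proof -
  have "inj_on f (carrier G)" if "f ` carrier G = carrier G" for f
    using that assms by (simp add: eq_card_imp_inj_on)
  then show ?thesis unfolding epis_def auto_def epi_def Bij_def bij_betw_def by auto
qed

lemma card_epis_iso_right:
  assumes "group A" "group F" "F \<cong> F'"
  shows "card (epis A F) = card (epis A F')"
proof -
  obtain f where f: "f \<in> iso F F'" using assms(3) by (auto simp: is_iso_def)
  define g where "g = inv_into (carrier F) f"
  have g: "g \<in> iso F' F" unfolding g_def by (rule group.iso_set_sym[OF assms(2) f])
  have fg: "f (g y) = y" if "y \<in> carrier F'" for y
    using f that unfolding g_def iso_iff by (metis f_inv_into_f)
  have gf: "g (f x) = x" if "x \<in> carrier F" for x
    using f that unfolding g_def iso_iff by (metis inv_into_f_f)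
  have cl: "restrict (k \<circ> \<sigma>) (carrier A) \<in> epis A K"
    if k: "k \<in> iso L K" and sg: "\<sigma> \<in> epis A L"
    for k :: "'x \<Rightarrow> 'y" and \<sigma> :: "'a \<Rightarrow> 'x" and K :: "('y, 'q) monoid_scheme" and L :: "('x, 'r) monoid_scheme"
  proof -
    note E = episD[OF sg]
    have kk: "\<And>x. x \<in> carrier L \<Longrightarrow> k x \<in> carrier K"
      "\<And>x y. x \<in> carrier L \<Longrightarrow> y \<in> carrier L \<Longrightarrow> k (x \<otimes>\<^bsub>L\<^esub> y) = k x \<otimes>\<^bsub>K\<^esub> k y"
      "k ` carrier L = carrier K"
      using k by (auto simp: iso_iff hom_def)
    show ?thesis
    proof (rule episI)
      fix x y assume xy: "x \<in> carrier A" "y \<in> carrier A"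
      then have "x \<otimes>\<^bsub>A\<^esub> y \<in> carrier A" using assms(1) by (simp add: group.is_monoid monoid.m_closed)
      then show "restrict (k \<circ> \<sigma>) (carrier A) (x \<otimes>\<^bsub>A\<^esub> y)
        = restrict (k \<circ> \<sigma>) (carrier A) x \<otimes>\<^bsub>K\<^esub> restrict (k \<circ> \<sigma>) (carrier A) y"
        using xy E kk by simp
    next
      fix z assume "z \<in> carrier K"
      then obtain l where "l \<in> carrier L" "k l = z" using kk(3) by (metis imageE)
      moreover then obtain x where "x \<in> carrier A" "\<sigma> x = l" using E(2) by (metis imageE)
      ultimately show "\<exists>x\<in>carrier A. restrict (k \<circ> \<sigma>) (carrier A) x = z" by (intro bexI[of _ x]) auto
    qed (auto simp: kk E)
  qed
  have "bij_betw (\<lambda>\<sigma>. restrict (f \<circ> \<sigma>) (carrier A)) (epis A F) (epis A F')"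
  proof (rule bij_betw_byWitness[where f' = "\<lambda>\<sigma>. restrict (g \<circ> \<sigma>) (carrier A)"])
    show "\<forall>\<sigma>\<in>epis A F. restrict (g \<circ> restrict (f \<circ> \<sigma>) (carrier A)) (carrier A) = \<sigma>"
    proof
      fix \<sigma> assume "\<sigma> \<in> epis A F"
      note E = episD[OF this]
      show "restrict (g \<circ> restrict (f \<circ> \<sigma>) (carrier A)) (carrier A) = \<sigma>"
        by (rule extensionalityI[OF _ E(3)]) (auto simp: gf E(4))
    qed
    show "\<forall>\<sigma>\<in>epis A F'. restrict (f \<circ> restrict (g \<circ> \<sigma>) (carrier A)) (carrier A) = \<sigma>"
    proof
      fix \<sigma> assume "\<sigma> \<in> epis A F'"
      note E = episD[OF this]
      show "restrict (f \<circ> restrict (g \<circ> \<sigma>) (carrier A)) (carrier A) = \<sigma>"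
        by (rule extensionalityI[OF _ E(3)]) (auto simp: fg E(4))
    qed
  qed (use cl[OF f] cl[OF g] in blast)+
  from bij_betw_same_card[OF this] show ?thesis .
qed

lemma finite_epis:
  assumes "finite (carrier A)" "finite (carrier F)"
  shows "finite (epis A F)"
  by (rule finite_subset[OF _ finite_PiE[OF assms(1), of "\<lambda>_. carrier F"]])
    (auto simp: assms(2) epis_def epi_def hom_def PiE_def)

text \<open>Replaces isomorphism with a quotient, as it occurs in \<open>d_prob\<close>, by the
  existence of a surjection with a prescribed kernel, which can be counted.\<close>

lemma quotient_iso_iff:
  assumes A: "group A" and N: "N \<lhd> A" and G: "group G"
  shows "A Mod N \<cong> G \<longleftrightarrow> (\<exists>\<phi>\<in>epis A G. kernel A G \<phi> = N)"
proof
  assume "A Mod N \<cong> G"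
  then obtain f where f: "f \<in> iso (A Mod N) G" by (auto simp: is_iso_def)
  interpret N: normal N A by (rule N)
  have NG: "group (A Mod N)" by (rule N.factorgroup_is_group)
  interpret f: group_hom "A Mod N" G f
    using f NG G by (simp add: group_hom_def group_hom_axioms_def iso_def)
  define \<phi> where "\<phi> = restrict (\<lambda>a. f (N #>\<^bsub>A\<^esub> a)) (carrier A)"
  have rc: "N #>\<^bsub>A\<^esub> a \<in> carrier (A Mod N)" if "a \<in> carrier A" for a
    using that by (simp add: carrier_FactGroup)
  have "\<phi> \<in> epis A G"
  proof (rule episI)
    fix x y assume xy: "x \<in> carrier A" "y \<in> carrier A"
    then have "N #>\<^bsub>A\<^esub> (x \<otimes>\<^bsub>A\<^esub> y) = (N #>\<^bsub>A\<^esub> x) \<otimes>\<^bsub>A Mod N\<^esub> (N #>\<^bsub>A\<^esub> y)"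
      by (simp add: N.rcos_sum)
    then show "\<phi> (x \<otimes>\<^bsub>A\<^esub> y) = \<phi> x \<otimes>\<^bsub>G\<^esub> \<phi> y"
      unfolding \<phi>_def using xy rc f.hom_mult by (simp add: N.m_closed del: mult_FactGroup)
  next
    fix g assume "g \<in> carrier G"
    then obtain c where c: "c \<in> carrier (A Mod N)" "f c = g" using f unfolding iso_iff by (metis imageE)
    then obtain a where "a \<in> carrier A" "c = N #>\<^bsub>A\<^esub> a" by (auto simp: carrier_FactGroup)
    then show "\<exists>x\<in>carrier A. \<phi> x = g" unfolding \<phi>_def using c by (intro bexI[of _ a]) auto
  qed (auto simp: \<phi>_def rc)
  moreover have "kernel A G \<phi> = N"
  proof -
    have "\<phi> a = \<one>\<^bsub>G\<^esub> \<longleftrightarrow> a \<in> N" if a: "a \<in> carrier A" for a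
    proof -
      have "\<phi> a = \<one>\<^bsub>G\<^esub> \<longleftrightarrow> N #>\<^bsub>A\<^esub> a = N"
      proof -
        have "f (N #>\<^bsub>A\<^esub> a) = f (\<one>\<^bsub>A Mod N\<^esub>) \<longleftrightarrow> N #>\<^bsub>A\<^esub> a = \<one>\<^bsub>A Mod N\<^esub>"
          by (rule inj_on_eq_iff[OF _ rc[OF a] f.G.one_closed]) (use f in \<open>simp add: iso_iff\<close>)
        then show ?thesis unfolding \<phi>_def using a f.hom_one by simp
      qed
      also have "\<dots> \<longleftrightarrow> a \<in> N"
        using a N.subgroup_axioms A
        by (metis group.coset_join2 group.coset_join1 N.subset N.is_group)
      finally show ?thesis .
    qed
    then show ?thesis unfolding kernel_def using N.subset by blast
  qed
  ultimately show "\<exists>\<phi>\<in>epis A G. kernel A G \<phi> = N" by blast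
next
  assume "\<exists>\<phi>\<in>epis A G. kernel A G \<phi> = N"
  then obtain \<phi> where ph: "\<phi> \<in> epis A G" "kernel A G \<phi> = N" by blast
  interpret group_hom A G \<phi>
    using episD[OF ph(1)] A G by (simp add: group_hom_def group_hom_axioms_def)
  show "A Mod N \<cong> G" using FactGroup_iso episD(2)[OF ph(1)] ph(2) by simp
qed

subsection \<open>The set \<open>X\<^sub>0\<close>\<close>

lemma fin_ab_p_groupD:
  assumes "fin_ab_p_group p G"
  shows "comm_group G" "group G" "finite (carrier G)" "\<exists>k. card (carrier G) = p ^ k"
  using assms by (auto simp: fin_ab_p_group_def comm_group.axioms(2))

abbreviation X0_rel :: "nat \<Rightarrow> (nat monoid \<times> nat monoid) set" where
  "X0_rel p \<equiv> {(G, H). fin_ab_p_group p G \<and> fin_ab_p_group p H \<and> G \<cong> H}"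

lemma equiv_X0_rel: "equiv (Collect (fin_ab_p_group p)) (X0_rel p)"
proof (rule equivI)
  show "X0_rel p \<subseteq> Collect (fin_ab_p_group p) \<times> Collect (fin_ab_p_group p)" by auto
  show "refl_on (Collect (fin_ab_p_group p)) (X0_rel p)" by (auto intro!: refl_onI)
  show "sym (X0_rel p)"
    by (rule symI) (auto dest: fin_ab_p_groupD(2) intro: group.iso_sym)
  show "trans (X0_rel p)" by (rule transI) (auto intro: iso_trans)
qed

lemma class_rep_in:
  assumes "equiv A r" "C \<in> A // r"
  shows "class_rep C \<in> C"
  unfolding class_rep_def using in_quotient_imp_non_empty[OF assms] by (simp add: some_in_eq)

lemma X0_rep:
  assumes "C \<in> X0 p"
  shows "fin_ab_p_group p (class_rep C)"
  using class_rep_in[OF equiv_X0_rel] in_quotient_imp_subset[OF equiv_X0_rel] assms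
  unfolding X0_def by blast

lemma X0_eq:
  assumes "C \<in> X0 p" "C' \<in> X0 p" "class_rep C \<cong> class_rep C'"
  shows "C = C'"
proof -
  have "(class_rep C, class_rep C') \<in> X0_rel p" using assms X0_rep by simp
  then show ?thesis
    using quotient_eqI[OF equiv_X0_rel] class_rep_in[OF equiv_X0_rel] assms
    unfolding X0_def by blast
qed

lemma X0_ex:
  assumes "fin_ab_p_group p G"
  shows "\<exists>C\<in>X0 p. G \<cong> class_rep C"
proof -
  let ?C = "X0_rel p `` {G}"
  have C: "?C \<in> X0 p" unfolding X0_def by (rule quotientI) (simp add: assms)
  then have "class_rep ?C \<in> ?C" using class_rep_in[OF equiv_X0_rel] unfolding X0_def by blast
  then show ?thesis using C by blast
qed

text \<open>Transport of structure along an enumeration. Quotient groups live on sets of cosets,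
  whereas the members of \<open>X0\<close> are classes of groups on naturals.\<close>

lemma iso_nat_monoid:
  fixes Q :: "('a, 'b) monoid_scheme"
  assumes "comm_group Q" "finite (carrier Q)"
  obtains G :: "nat monoid" where "comm_group G" "Q \<cong> G"
proof -
  interpret comm_group Q by (rule assms(1))
  obtain b where b: "bij_betw b (carrier Q) {0..<card (carrier Q)}"
    using ex_bij_betw_finite_nat[OF assms(2)] by blast
  define c where "c = inv_into (carrier Q) b"
  have cb: "c (b x) = x" if "x \<in> carrier Q" for x
    unfolding c_def using b that by (simp add: bij_betw_inv_into_left)
  define G :: "nat monoid" where
    "G = \<lparr>carrier = b ` carrier Q, mult = (\<lambda>i j. b (c i \<otimes>\<^bsub>Q\<^esub> c j)), one = b \<one>\<^bsub>Q\<^esub>\<rparr>"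
  have bi: "b \<in> iso Q G"
    unfolding iso_iff hom_def G_def using b cb by (auto simp: bij_betw_def)
  have "comm_group (G\<lparr>one := b \<one>\<^bsub>Q\<^esub>\<rparr>)" by (rule iso_imp_img_comm_group[OF bi])
  then have "comm_group G" by (simp add: G_def)
  then show thesis using that bi by (auto simp: is_iso_def)
qed

lemma X0_ex':
  fixes Q :: "('a, 'b) monoid_scheme"
  assumes "comm_group Q" "finite (carrier Q)" "card (carrier Q) = p ^ k"
  shows "\<exists>C\<in>X0 p. Q \<cong> class_rep C"
proof -
  obtain G :: "nat monoid" where G: "comm_group G" "Q \<cong> G" using iso_nat_monoid[OF assms(1,2)] .
  have "fin_ab_p_group p G"
    unfolding fin_ab_p_group_def using G assms iso_same_card[OF G(2)] iso_finite[OF G(2)] by auto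
  then obtain C where "C \<in> X0 p" "G \<cong> class_rep C" using X0_ex by blast
  then show ?thesis using G(2) iso_trans by blast
qed

text \<open>Relabelled by \<open>{0..<n}\<close>, a group of order \<open>n\<close> is recorded by
  its multiplication table \<open>t C\<close>. Equal tables belong to isomorphic groups, and there
  are finitely many tables.\<close>

lemma finite_X0_order: "finite {C \<in> X0 p. card (carrier (class_rep C)) = n}"
proof -
  let ?S = "{C \<in> X0 p. card (carrier (class_rep C)) = n}"
  have "\<forall>C\<in>?S. \<exists>b. bij_betw b (carrier (class_rep C)) {0..<n}"
    using ex_bij_betw_finite_nat X0_rep fin_ab_p_groupD(3) by blast
  from bchoice[OF this] obtain b where b: "\<And>C. C \<in> ?S \<Longrightarrow> bij_betw (b C) (carrier (class_rep C)) {0..<n}"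
    by blast
  define c where "c C = inv_into (carrier (class_rep C)) (b C)" for C
  define t where "t C = (\<lambda>(i, j)\<in>{0..<n} \<times> {0..<n}. b C (c C i \<otimes>\<^bsub>class_rep C\<^esub> c C j))" for C
  have cb: "c C (b C x) = x" if "C \<in> ?S" "x \<in> carrier (class_rep C)" for C x
    unfolding c_def using b[OF that(1)] that(2) by (simp add: bij_betw_inv_into_left)
  have bc: "b C (c C i) = i" "c C i \<in> carrier (class_rep C)" if "C \<in> ?S" "i \<in> {0..<n}" for C i
    unfolding c_def using bij_betw_inv_into_right[OF b[OF that(1)] that(2)]
      bij_betw_apply[OF bij_betw_inv_into[OF b[OF that(1)]] that(2)] by auto
  have bin: "b C x \<in> {0..<n}" if "C \<in> ?S" "x \<in> carrier (class_rep C)" for C x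
    using b[OF that(1)] that(2) bij_betwE by blast
  have tb: "t C (b C x, b C y) = b C (x \<otimes>\<^bsub>class_rep C\<^esub> y)"
    if "C \<in> ?S" "x \<in> carrier (class_rep C)" "y \<in> carrier (class_rep C)" for C x y
    unfolding t_def using bin that cb by simp
  have mc: "x \<otimes>\<^bsub>class_rep C\<^esub> y \<in> carrier (class_rep C)"
    if "C \<in> ?S" "x \<in> carrier (class_rep C)" "y \<in> carrier (class_rep C)" for C x y
  proof -
    have "C \<in> X0 p" using that(1) by simp
    from fin_ab_p_groupD(2)[OF X0_rep[OF this]] have "group (class_rep C)" .
    then show ?thesis using that(2,3) by (rule monoid.m_closed[OF group.is_monoid])
  qed
  have "t C \<in> ({0..<n} \<times> {0..<n}) \<rightarrow>\<^sub>E {0..<n}" if C: "C \<in> ?S" for C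
  proof (rule PiE_I)
    fix x assume "x \<in> {0..<n} \<times> {0..<n}"
    then obtain i j where x: "x = (i, j)" "i \<in> {0..<n}" "j \<in> {0..<n}" by blast
    have "b C (c C i \<otimes>\<^bsub>class_rep C\<^esub> c C j) \<in> {0..<n}"
      by (rule bin[OF C mc[OF C bc(2)[OF C x(2)] bc(2)[OF C x(3)]]])
    then show "t C x \<in> {0..<n}" unfolding t_def using x by simp
  qed (simp add: t_def)
  then have "t ` ?S \<subseteq> ({0..<n} \<times> {0..<n}) \<rightarrow>\<^sub>E {0..<n}" by blast
  then have "finite (t ` ?S)" by (rule finite_subset) (auto intro: finite_PiE)
  moreover have "inj_on t ?S"
  proof (rule inj_onI)
    fix C D assume CD: "C \<in> ?S" "D \<in> ?S" "t C = t D"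
    define f where "f = c D \<circ> b C"
    have fb: "b D (f x) = b C x" "f x \<in> carrier (class_rep D)" if "x \<in> carrier (class_rep C)" for x
      unfolding f_def using bc[OF CD(2) bin[OF CD(1) that]] by auto
    have "f \<in> iso (class_rep C) (class_rep D)"
    proof (rule isoI)
      show "f \<in> hom (class_rep C) (class_rep D)"
      proof (rule homI)
        fix x y assume xy: "x \<in> carrier (class_rep C)" "y \<in> carrier (class_rep C)"
        have "b C (x \<otimes>\<^bsub>class_rep C\<^esub> y) = t D (b D (f x), b D (f y))"
          using tb[OF CD(1) xy] CD(3) fb xy by simp
        also have "\<dots> = b D (f x \<otimes>\<^bsub>class_rep D\<^esub> f y)" by (rule tb[OF CD(2) fb(2)[OF xy(1)] fb(2)[OF xy(2)]])
        finally have "f (x \<otimes>\<^bsub>class_rep C\<^esub> y) = c D (b D (f x \<otimes>\<^bsub>class_rep D\<^esub> f y))" unfolding f_def by simp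
        then show "f (x \<otimes>\<^bsub>class_rep C\<^esub> y) = f x \<otimes>\<^bsub>class_rep D\<^esub> f y"
          using cb[OF CD(2) mc[OF CD(2)]] fb xy by simp
      qed (use fb in blast)
      show "bij_betw f (carrier (class_rep C)) (carrier (class_rep D))"
        unfolding f_def c_def using b[OF CD(1)] bij_betw_inv_into[OF b[OF CD(2)]] by (rule bij_betw_trans)
    qed
    then show "C = D" using X0_eq CD(1,2) is_isoI by blast
  qed
  ultimately show ?thesis by (rule finite_imageD)
qed

lemma countable_X0: "countable (X0 p)"
proof -
  have "X0 p = (\<Union>n. {C \<in> X0 p. card (carrier (class_rep C)) = n})" by blast
  moreover have "countable (\<Union>n. {C \<in> X0 p. card (carrier (class_rep C)) = n})"
    by (rule countable_UN[OF countableI_type countable_finite[OF finite_X0_order]])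
  ultimately show ?thesis by simp
qed

section \<open>Arithmetic of p-adic integers\<close>

locale padics =
  fixes p :: nat
  assumes prime_p: "prime p"
begin

abbreviation Z :: "padic ring" where "Z \<equiv> Zp p"
abbreviation P :: int where "P \<equiv> int p"

lemma p_gt_1: "p > 1" using prime_p by (rule prime_gt_1_nat)
lemma P_gt_1: "P > 1" using p_gt_1 by simp
lemma P_pos: "P ^ n > 0" using P_gt_1 by simp
lemma P_dvd: "m \<le> n \<Longrightarrow> P ^ m dvd P ^ n" by (rule le_imp_power_dvd)

lemma P_mult_mod: "(P ^ m * a) mod P ^ (n + m) = P ^ m * (a mod P ^ n)"
  by (metis add.commute mod_mult_mult1 power_add)

lemma Zp_mem: "x \<in> carrier Z \<longleftrightarrow> (\<forall>n. 0 \<le> x n \<and> x n < P ^ n \<and> x (Suc n) mod P ^ n = x n)"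
  by (simp add: Zp_def)

lemma Zp_add: "x \<oplus>\<^bsub>Z\<^esub> y = (\<lambda>n. (x n + y n) mod P ^ n)" by (simp add: Zp_def)
lemma Zp_mult: "x \<otimes>\<^bsub>Z\<^esub> y = (\<lambda>n. (x n * y n) mod P ^ n)" by (simp add: Zp_def)
lemma Zp_zero: "\<zero>\<^bsub>Z\<^esub> = (\<lambda>n. 0)" by (simp add: Zp_def)
lemma Zp_one: "\<one>\<^bsub>Z\<^esub> = (\<lambda>n. 1 mod P ^ n)" by (simp add: Zp_def)

lemma Zp_range: "x \<in> carrier Z \<Longrightarrow> 0 \<le> x n" "x \<in> carrier Z \<Longrightarrow> x n < P ^ n"
  by (auto simp: Zp_mem)

lemma Zp_at_0: "x \<in> carrier Z \<Longrightarrow> x 0 = 0"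
  using Zp_range[of x 0] by simp

lemma Zp_mod: "x \<in> carrier Z \<Longrightarrow> m \<le> n \<Longrightarrow> x n mod P ^ m = x m"
proof (induction n)
  case 0
  then show ?case using Zp_range[of x 0] by simp
next
  case (Suc n)
  show ?case
  proof (cases "m = Suc n")
    case True
    then show ?thesis using Zp_range[OF Suc.prems(1), of m] by simp
  next
    case False
    then have m: "m \<le> n" using Suc.prems by simp
    have "x (Suc n) mod P ^ m = x (Suc n) mod P ^ n mod P ^ m"
      using P_dvd[OF m] by (simp add: mod_mod_cancel)
    also have "x (Suc n) mod P ^ n = x n" using Suc.prems by (simp add: Zp_mem)
    also have "x n mod P ^ m = x m" by (rule Suc.IH[OF Suc.prems(1) m])
    finally show ?thesis .
  qed
qed

lemma Zp_mod_self: "x \<in> carrier Z \<Longrightarrow> x n mod P ^ n = x n"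
  using Zp_mod by blast

lemma Zp_mk:
  assumes "\<And>n. a (Suc n) mod P ^ n = a n mod P ^ n"
  shows "(\<lambda>n. a n mod P ^ n) \<in> carrier Z"
  unfolding Zp_mem
proof (intro allI conjI)
  fix n
  show "0 \<le> a n mod P ^ n" "a n mod P ^ n < P ^ n" using P_pos[of n] by simp_all
  have "a (Suc n) mod P ^ Suc n mod P ^ n = a (Suc n) mod P ^ n"
    using P_dvd[of n "Suc n"] by (simp add: mod_mod_cancel)
  then show "a (Suc n) mod P ^ Suc n mod P ^ n = a n mod P ^ n" using assms by simp
qed

lemma Zp_ext:
  assumes "\<And>n. n \<ge> N \<Longrightarrow> x n = y n" "x \<in> carrier Z" "y \<in> carrier Z"
  shows "x = y"
proof
  fix n
  have "x n = x (max n N) mod P ^ n" using Zp_mod[OF assms(2), of n "max n N"] by simp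
  also have "\<dots> = y (max n N) mod P ^ n" using assms(1)[of "max n N"] by simp
  also have "\<dots> = y n" using Zp_mod[OF assms(3), of n "max n N"] by simp
  finally show "x n = y n" .
qed

lemma Zp_cring: "cring Z"
proof (rule cringI)
  show "abelian_group Z"
  proof (rule abelian_groupI)
    fix x y assume xy: "x \<in> carrier Z" "y \<in> carrier Z"
    have "(x (Suc n) + y (Suc n)) mod P ^ n = (x n + y n) mod P ^ n" for n
      using Zp_mod[OF xy(1), of n "Suc n"] Zp_mod[OF xy(2), of n "Suc n"]
      by (metis le_SucI mod_add_eq order_refl)
    then show "x \<oplus>\<^bsub>Z\<^esub> y \<in> carrier Z" unfolding Zp_add by (rule Zp_mk)
    show "x \<oplus>\<^bsub>Z\<^esub> y = y \<oplus>\<^bsub>Z\<^esub> x" by (simp add: Zp_add add.commute)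
  next
    show "\<zero>\<^bsub>Z\<^esub> \<in> carrier Z" by (simp add: Zp_zero Zp_mem p_gt_1 prime_gt_0_nat prime_p)
    fix x assume x: "x \<in> carrier Z"
    show "\<zero>\<^bsub>Z\<^esub> \<oplus>\<^bsub>Z\<^esub> x = x" using Zp_mod_self[OF x] by (simp add: Zp_zero Zp_add)
    have "(- x (Suc n)) mod P ^ n = (- x n) mod P ^ n" for n
      using Zp_mod[OF x, of n "Suc n"] by (metis le_SucI mod_minus_eq order_refl)
    then have "(\<lambda>n. (- x n) mod P ^ n) \<in> carrier Z" by (rule Zp_mk)
    moreover have "(\<lambda>n. (- x n) mod P ^ n) \<oplus>\<^bsub>Z\<^esub> x = \<zero>\<^bsub>Z\<^esub>"
      by (simp add: Zp_add Zp_zero mod_simps)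
    ultimately show "\<exists>y\<in>carrier Z. y \<oplus>\<^bsub>Z\<^esub> x = \<zero>\<^bsub>Z\<^esub>" by blast
  qed (simp add: Zp_add mod_simps add.assoc)
  show "Group.comm_monoid Z"
  proof (rule comm_monoidI)
    fix x y assume xy: "x \<in> carrier Z" "y \<in> carrier Z"
    have "(x (Suc n) * y (Suc n)) mod P ^ n = (x n * y n) mod P ^ n" for n
      using Zp_mod[OF xy(1), of n "Suc n"] Zp_mod[OF xy(2), of n "Suc n"]
      by (metis le_SucI mod_mult_eq order_refl)
    then show "x \<otimes>\<^bsub>Z\<^esub> y \<in> carrier Z" unfolding Zp_mult by (rule Zp_mk)
    show "x \<otimes>\<^bsub>Z\<^esub> y = y \<otimes>\<^bsub>Z\<^esub> x" by (simp add: Zp_mult mult.commute)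
  next
    show "\<one>\<^bsub>Z\<^esub> \<in> carrier Z" unfolding Zp_one by (rule Zp_mk) simp
    fix x assume x: "x \<in> carrier Z"
    show "\<one>\<^bsub>Z\<^esub> \<otimes>\<^bsub>Z\<^esub> x = x" using Zp_mod_self[OF x] by (simp add: Zp_one Zp_mult mod_simps)
  qed (simp add: Zp_mult mod_simps mult.assoc)
  fix x y z
  show "(x \<oplus>\<^bsub>Z\<^esub> y) \<otimes>\<^bsub>Z\<^esub> z = x \<otimes>\<^bsub>Z\<^esub> z \<oplus>\<^bsub>Z\<^esub> y \<otimes>\<^bsub>Z\<^esub> z"
    by (simp add: Zp_add Zp_mult mod_simps distrib_right)
qed

sublocale ZR: cring Z by (rule Zp_cring)

lemma Zp_minus: "x \<in> carrier Z \<Longrightarrow> \<ominus>\<^bsub>Z\<^esub> x = (\<lambda>n. (- x n) mod P ^ n)"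
proof -
  assume x: "x \<in> carrier Z"
  have "(- x (Suc n)) mod P ^ n = (- x n) mod P ^ n" for n
    using Zp_mod[OF x, of n "Suc n"] by (metis le_SucI mod_minus_eq order_refl)
  then have "(\<lambda>n. (- x n) mod P ^ n) \<in> carrier Z" by (rule Zp_mk)
  moreover have "(\<lambda>n. (- x n) mod P ^ n) \<oplus>\<^bsub>Z\<^esub> x = \<zero>\<^bsub>Z\<^esub>"
    by (simp add: Zp_add Zp_zero mod_simps)
  ultimately show ?thesis using x ZR.minus_equality by blast
qed

definition iota :: "int \<Rightarrow> padic" where "iota k = (\<lambda>n. k mod P ^ n)"

lemma iota_closed [simp]: "iota k \<in> carrier Z"
  unfolding iota_def by (rule Zp_mk) simp

lemma iota_add: "iota (k + l) = iota k \<oplus>\<^bsub>Z\<^esub> iota l"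
  by (simp add: iota_def Zp_add mod_simps)
lemma iota_mult: "iota (k * l) = iota k \<otimes>\<^bsub>Z\<^esub> iota l"
  by (simp add: iota_def Zp_mult mod_simps)
lemma iota_0: "iota 0 = \<zero>\<^bsub>Z\<^esub>" by (simp add: iota_def Zp_zero)
lemma iota_1: "iota 1 = \<one>\<^bsub>Z\<^esub>" by (simp add: iota_def Zp_one)
lemma iota_minus: "iota (- k) = \<ominus>\<^bsub>Z\<^esub> iota k"
  by (simp add: Zp_minus) (simp add: iota_def mod_simps)

lemma iota_inj: "iota k = iota l \<longleftrightarrow> k = l"
proof
  assume e: "iota k = iota l"
  define n where "n = nat \<bar>k - l\<bar>"
  have "k mod P ^ n = l mod P ^ n" using e by (metis iota_def)
  then have "P ^ n dvd k - l" by (simp add: mod_eq_dvd)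
  moreover have "\<bar>k - l\<bar> < P ^ n"
  proof -
    have "n < p ^ n" by (rule power_gt_expt) (use p_gt_1 in simp)
    then have "int n < P ^ n" by (metis of_nat_less_iff of_nat_power)
    then show ?thesis unfolding n_def by simp
  qed
  ultimately have "k - l = 0" using zdvd_imp_le[of "P ^ n" "\<bar>k - l\<bar>"] by (cases "k - l = 0") auto
  then show "k = l" by simp
qed simp

lemma iota_mult_at: "(iota k \<otimes>\<^bsub>Z\<^esub> x) n = (k * x n) mod P ^ n"
  by (simp add: iota_def Zp_mult mod_simps)

text \<open>The quotient is the shifted sequence \<open>x (n + m) div P ^ m\<close>: division costs
  \<open>m\<close> digits of precision.\<close>

lemma Zp_divide:
  assumes x: "x \<in> carrier Z" and m: "x m = 0"
  obtains w where "w \<in> carrier Z" "x = iota (P ^ m) \<otimes>\<^bsub>Z\<^esub> w" "\<And>n. x (n + m) = P ^ m * w n"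
proof -
  define w where "w = (\<lambda>n. x (n + m) div P ^ m)"
  have d: "x (n + m) = P ^ m * w n" for n
  proof -
    have "x (n + m) mod P ^ m = 0" using Zp_mod[OF x, of m "n + m"] m by simp
    then show ?thesis unfolding w_def by (metis add.right_neutral mult_div_mod_eq)
  qed
  have wc: "w \<in> carrier Z" unfolding Zp_mem
  proof (intro allI conjI)
    fix n
    show "0 \<le> w n" unfolding w_def using Zp_range(1)[OF x] P_pos by (simp add: pos_imp_zdiv_nonneg_iff)
    have "P ^ m * w n < P ^ m * P ^ n" using d Zp_range(2)[OF x, of "n + m"] by (simp add: power_add mult.commute)
    then show "w n < P ^ n" using P_pos[of m] by simp
    have "P ^ m * w n = (P ^ m * w (Suc n)) mod P ^ (n + m)"
      using Zp_mod[OF x, of "n + m" "Suc n + m"] d[of n] d[of "Suc n"] by simp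
    also have "\<dots> = P ^ m * (w (Suc n) mod P ^ n)" by (rule P_mult_mod)
    finally show "w (Suc n) mod P ^ n = w n" using p_gt_1 by simp
  qed
  have "x = iota (P ^ m) \<otimes>\<^bsub>Z\<^esub> w"
  proof
    fix n
    have "w (n + m) mod P ^ n = w n" using Zp_mod[OF wc, of n "n + m"] by simp
    have "x n = x (n + m) mod P ^ n" using Zp_mod[OF x, of n "n + m"] by simp
    also have "\<dots> = (P ^ m * w n) mod P ^ n" using d by simp
    finally show "x n = (iota (P ^ m) \<otimes>\<^bsub>Z\<^esub> w) n" by (simp add: iota_mult_at)
  qed
  then show thesis using that wc d by blast
qed

text \<open>A residue that is nonzero modulo \<open>P\<close> is invertible modulo every power of
  \<open>P\<close>; the inverses fit together because inverses modulo \<open>P ^ n\<close> are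
  unique.\<close>

lemma Zp_inverse:
  assumes x: "x \<in> carrier Z" and x1: "x 1 \<noteq> 0"
  obtains u where "u \<in> carrier Z" "x \<otimes>\<^bsub>Z\<^esub> u = \<one>\<^bsub>Z\<^esub>"
proof -
  have cop: "coprime (x n) (P ^ n)" for n
  proof (cases n)
    case (Suc k)
    have "\<not> P dvd x n"
    proof
      assume "P dvd x n"
      then have "x n mod P ^ 1 = 0" by simp
      then show False using Zp_mod[OF x, of 1 n] x1 Suc by simp
    qed
    then have "coprime (x n) P"
      using prime_imp_coprime[of P "x n"] prime_p by (simp add: coprime_commute)
    then show ?thesis by simp
  qed simp
  have "\<exists>v. [x n * v = 1] (mod P ^ n)" for n
    using cop[of n] by (rule cong_solve_coprime_int)
  then obtain v where v: "\<And>n. [x n * v n = 1] (mod P ^ n)" by metis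
  have coh: "v (Suc n) mod P ^ n = v n mod P ^ n" for n
  proof -
    have "[x (Suc n) * v (Suc n) = 1] (mod P ^ n)"
      by (rule cong_dvd_modulus[OF v P_dvd]) simp
    moreover have "[x (Suc n) = x n] (mod P ^ n)"
      using Zp_mod[OF x, of n "Suc n"] Zp_mod_self[OF x, of n] by (simp add: cong_def)
    ultimately have "[x n * v (Suc n) = 1] (mod P ^ n)"
      by (metis cong_scalar_right cong_sym cong_trans)
    then have "[x n * v (Suc n) = x n * v n] (mod P ^ n)" using v[of n] cong_sym cong_trans by blast
    then have "[v (Suc n) = v n] (mod P ^ n)" using cop[of n] cong_mult_lcancel by blast
    then show ?thesis by (simp add: cong_def)
  qed
  define u where "u = (\<lambda>n. v n mod P ^ n)"
  have "u \<in> carrier Z" unfolding u_def using coh by (rule Zp_mk)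
  moreover have "x \<otimes>\<^bsub>Z\<^esub> u = \<one>\<^bsub>Z\<^esub>"
    using v by (simp add: Zp_mult Zp_one u_def mod_simps cong_def)
  ultimately show thesis using that by blast
qed

lemma Zp_torsion_free:
  assumes w: "w \<in> carrier Z" and "iota (P ^ m) \<otimes>\<^bsub>Z\<^esub> w = \<zero>\<^bsub>Z\<^esub>"
  shows "w = \<zero>\<^bsub>Z\<^esub>"
proof
  fix n
  have "(P ^ m * w (n + m)) mod P ^ (n + m) = 0"
    using assms(2) iota_mult_at[of "P ^ m" w "n + m"] by (simp add: Zp_zero)
  then have "P ^ m * (w (n + m) mod P ^ n) = 0"
    by (simp only: P_mult_mod)
  then have "w (n + m) mod P ^ n = 0" using p_gt_1 by simp
  then show "w n = \<zero>\<^bsub>Z\<^esub> n" using Zp_mod[OF w, of n "n + m"] by (simp add: Zp_zero)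
qed

text \<open>Every nonzero p-adic integer is a power of \<open>p\<close> times a unit.\<close>

lemma Zp_valuation:
  assumes x: "x \<in> carrier Z" and nz: "x \<noteq> \<zero>\<^bsub>Z\<^esub>"
  obtains v u u' where "u \<in> carrier Z" "u' \<in> carrier Z" "u \<otimes>\<^bsub>Z\<^esub> u' = \<one>\<^bsub>Z\<^esub>"
    "x = iota (P ^ v) \<otimes>\<^bsub>Z\<^esub> u"
proof -
  obtain n where n: "x n \<noteq> 0" using nz by (auto simp: Zp_zero)
  define N where "N = (LEAST n. x n \<noteq> 0)"
  have N: "x N \<noteq> 0" unfolding N_def using n by (rule LeastI)
  have "N \<noteq> 0" using N Zp_at_0[OF x] by metis
  then obtain v where v: "N = Suc v" using not0_implies_Suc by blast
  have xv: "x v = 0" using not_less_Least[of v "\<lambda>n. x n \<noteq> 0"] v unfolding N_def by simp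
  obtain u where u: "u \<in> carrier Z" "x = iota (P ^ v) \<otimes>\<^bsub>Z\<^esub> u" "\<And>n. x (n + v) = P ^ v * u n"
    using Zp_divide[OF x xv] by metis
  have "u 1 \<noteq> 0" using u(3)[of 1] N v by auto
  then obtain u' where "u' \<in> carrier Z" "u \<otimes>\<^bsub>Z\<^esub> u' = \<one>\<^bsub>Z\<^esub>" using Zp_inverse[OF u(1)] by blast
  then show thesis using that u by blast
qed

text \<open>\<open>padic_open\<close> is phrased with repeated addition; this turns it into
  multiplication by an integral scalar.\<close>

lemma add_pow_smult:
  assumes "Module.module Z M" "x \<in> carrier M"
  shows "add_pow M (k::nat) x = iota (int k) \<odot>\<^bsub>M\<^esub> x"
proof -
  interpret M: Module.module Z M by (rule assms(1))
  show ?thesis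
  proof (induction k)
    case 0
    have "\<zero>\<^bsub>Z\<^esub> \<odot>\<^bsub>M\<^esub> x = \<zero>\<^bsub>M\<^esub>" using assms(2) by (rule M.smult_l_null)
    then show ?case by (simp add: iota_0)
  next
    case (Suc k)
    have "iota (int (Suc k)) = iota (int k + 1)" by (simp add: add.commute)
    then have "iota (int (Suc k)) = iota (int k) \<oplus>\<^bsub>Z\<^esub> \<one>\<^bsub>Z\<^esub>" unfolding iota_add iota_1 .
    then show ?case using Suc assms(2) by (simp add: M.smult_l_distr)
  qed
qed

end

section \<open>Extensions by \<open>\<int>\<^sub>p\<close> and characters\<close>

lemma module_homD:
  assumes "f \<in> module_hom R M N"
  shows "\<And>x. x \<in> carrier M \<Longrightarrow> f x \<in> carrier N"
    "\<And>x y. x \<in> carrier M \<Longrightarrow> y \<in> carrier M \<Longrightarrow> f (x \<oplus>\<^bsub>M\<^esub> y) = f x \<oplus>\<^bsub>N\<^esub> f y"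
    "\<And>r x. r \<in> carrier R \<Longrightarrow> x \<in> carrier M \<Longrightarrow> f (r \<odot>\<^bsub>M\<^esub> x) = r \<odot>\<^bsub>N\<^esub> f x"
  using assms by (auto simp: module_hom_def hom_def)

lemma module_homI:
  assumes "\<And>x. x \<in> carrier M \<Longrightarrow> f x \<in> carrier N"
    "\<And>x y. x \<in> carrier M \<Longrightarrow> y \<in> carrier M \<Longrightarrow> f (x \<oplus>\<^bsub>M\<^esub> y) = f x \<oplus>\<^bsub>N\<^esub> f y"
    "\<And>r x. r \<in> carrier R \<Longrightarrow> x \<in> carrier M \<Longrightarrow> f (r \<odot>\<^bsub>M\<^esub> x) = r \<odot>\<^bsub>N\<^esub> f x"
  shows "f \<in> module_hom R M N"
  using assms by (auto simp: module_hom_def hom_def)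

lemma module_isoD:
  assumes "f \<in> module_iso R M N"
  shows "f \<in> module_hom R M N" "bij_betw f (carrier M) (carrier N)"
  using assms by (auto simp: module_iso_def)

lemma module_iso_id: "(\<lambda>x. x) \<in> module_iso R M M"
  by (auto simp: module_iso_def module_hom_def hom_def bij_betw_def)

lemma module_iso_comp:
  assumes "f \<in> module_iso R M N" "g \<in> module_iso R N K"
  shows "g \<circ> f \<in> module_iso R M K"
  using module_homD[OF module_isoD(1)[OF assms(1)]] module_homD[OF module_isoD(1)[OF assms(2)]]
    bij_betw_trans[OF module_isoD(2)[OF assms(1)] module_isoD(2)[OF assms(2)]]
  unfolding module_iso_def by (auto intro!: module_homI)

lemma module_iso_inv:
  assumes M: "Module.module R M" and f: "f \<in> module_iso R M N"
  shows "inv_into (carrier M) f \<in> module_iso R N M"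
proof -
  interpret M: Module.module R M by (rule M)
  note h = module_homD[OF module_isoD(1)[OF f]] and b = module_isoD(2)[OF f]
  define g where "g = inv_into (carrier M) f"
  have g: "g y \<in> carrier M" "f (g y) = y" if "y \<in> carrier N" for y
    unfolding g_def using bij_betw_apply[OF bij_betw_inv_into[OF b] that]
      bij_betw_inv_into_right[OF b that] by auto
  have gf: "g (f x) = x" if "x \<in> carrier M" for x
    unfolding g_def using bij_betw_inv_into_left[OF b that] .
  have "g \<in> module_hom R N M"
  proof (rule module_homI)
    fix x y assume xy: "x \<in> carrier N" "y \<in> carrier N"
    have "g (f (g x \<oplus>\<^bsub>M\<^esub> g y)) = g x \<oplus>\<^bsub>M\<^esub> g y" using g xy by (intro gf) simp
    then show "g (x \<oplus>\<^bsub>N\<^esub> y) = g x \<oplus>\<^bsub>M\<^esub> g y" using h(2) g xy by simp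
  next
    fix r x assume xy: "r \<in> carrier R" "x \<in> carrier N"
    have "g (f (r \<odot>\<^bsub>M\<^esub> g x)) = r \<odot>\<^bsub>M\<^esub> g x" using g xy by (intro gf) simp
    then show "g (r \<odot>\<^bsub>N\<^esub> x) = r \<odot>\<^bsub>M\<^esub> g x" using h(3) g xy by simp
  qed (use g in blast)
  then show ?thesis unfolding module_iso_def using bij_betw_inv_into[OF b] by (simp add: g_def)
qed

lemma equiv_extensionsI:
  assumes "f \<in> module_iso (Zp p) H H'" "\<And>z. z \<in> carrier (Zp p) \<Longrightarrow> f (i z) = i' z"
    "\<And>h. h \<in> carrier H \<Longrightarrow> q' (f h) = q h"
  shows "equiv_extensions p (H, i, q) (H', i', q')"
  unfolding equiv_extensions_def prod.case using assms by blast

lemma is_extensionD: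
  assumes "is_extension p G (H, i, q)"
  shows "Module.module (Zp p) H" "i \<in> module_hom (Zp p) (Zp_module p) H" "inj_on i (carrier (Zp p))"
     "q \<in> module_hom (Zp p) H (group_as_module G)" "q ` carrier H = carrier G"
     "i ` carrier (Zp p) = {h \<in> carrier H. q h = \<one>\<^bsub>G\<^esub>}"
  using assms unfolding is_extension_def prod.case by - ((elim conjE, assumption)+)

lemma equiv_ext_rel:
  "equiv (Collect (is_extension p G))
     {(e, e'). is_extension p G e \<and> is_extension p G e' \<and> equiv_extensions p e e'}"
proof (rule equivI)
  show "{(e, e'). is_extension p G e \<and> is_extension p G e' \<and> equiv_extensions p e e'}
    \<subseteq> Collect (is_extension p G) \<times> Collect (is_extension p G)" by auto
  have "equiv_extensions p e e" for e
    by (cases e) (auto intro: equiv_extensionsI module_iso_id)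
  then show "refl_on (Collect (is_extension p G))
     {(e, e'). is_extension p G e \<and> is_extension p G e' \<and> equiv_extensions p e e'}"
    unfolding refl_on_def by simp
  have "equiv_extensions p e' e" if ext: "is_extension p G e" and eq: "equiv_extensions p e e'" for e e'
  proof -
    obtain H i q H' i' q' where e: "e = (H, i, q)" "e' = (H', i', q')" by (metis prod_cases3)
    obtain f where f: "f \<in> module_iso (Zp p) H H'" "\<And>z. z \<in> carrier (Zp p) \<Longrightarrow> f (i z) = i' z"
      "\<And>h. h \<in> carrier H \<Longrightarrow> q' (f h) = q h"
      using eq unfolding e equiv_extensions_def by auto
    note E = is_extensionD[OF ext[unfolded e]]
    have b: "bij_betw f (carrier H) (carrier H')" using f(1) by (rule module_isoD(2))
    have iH: "i z \<in> carrier H" if "z \<in> carrier (Zp p)" for z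
      using module_homD(1)[OF E(2), of z] that by (simp add: Zp_module_def)
    show ?thesis unfolding e
    proof (rule equiv_extensionsI[OF module_iso_inv[OF E(1) f(1)]])
      fix z assume "z \<in> carrier (Zp p)"
      then show "inv_into (carrier H) f (i' z) = i z"
        using f(2) bij_betw_inv_into_left[OF b iH] by metis
    next
      fix h assume h: "h \<in> carrier H'"
      have "q' (f (inv_into (carrier H) f h)) = q (inv_into (carrier H) f h)"
        by (rule f(3)[OF bij_betw_apply[OF bij_betw_inv_into[OF b] h]])
      then show "q (inv_into (carrier H) f h) = q' h" using bij_betw_inv_into_right[OF b h] by simp
    qed
  qed
  note sym' = this
  show "sym {(e, e'). is_extension p G e \<and> is_extension p G e' \<and> equiv_extensions p e e'}"
  proof (rule symI)
    fix x y assume "(x, y) \<in> {(e, e'). is_extension p G e \<and> is_extension p G e' \<and> equiv_extensions p e e'}"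
    then show "(y, x) \<in> {(e, e'). is_extension p G e \<and> is_extension p G e' \<and> equiv_extensions p e e'}"
      using sym'[of x y] by simp
  qed
  have "equiv_extensions p e e''"
    if ext: "is_extension p G e" and eq: "equiv_extensions p e e'" "equiv_extensions p e' e''" for e e' e''
  proof -
    obtain H i q H' i' q' H'' i'' q'' where e: "e = (H, i, q)" "e' = (H', i', q')" "e'' = (H'', i'', q'')"
      by (metis prod_cases3)
    obtain f where f: "f \<in> module_iso (Zp p) H H'" "\<And>z. z \<in> carrier (Zp p) \<Longrightarrow> f (i z) = i' z"
      "\<And>h. h \<in> carrier H \<Longrightarrow> q' (f h) = q h"
      using eq(1) unfolding e equiv_extensions_def by auto
    obtain g where g: "g \<in> module_iso (Zp p) H' H''" "\<And>z. z \<in> carrier (Zp p) \<Longrightarrow> g (i' z) = i'' z"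
      "\<And>h. h \<in> carrier H' \<Longrightarrow> q'' (g h) = q' h"
      using eq(2) unfolding e equiv_extensions_def by auto
    show ?thesis unfolding e
      by (rule equiv_extensionsI[OF module_iso_comp[OF f(1) g(1)]])
        (use f g module_homD(1)[OF module_isoD(1)[OF f(1)]] in auto)
  qed
  note trans' = this
  show "trans {(e, e'). is_extension p G e \<and> is_extension p G e' \<and> equiv_extensions p e e'}"
  proof (rule transI)
    fix x y z assume "(x, y) \<in> {(e, e'). is_extension p G e \<and> is_extension p G e' \<and> equiv_extensions p e e'}"
      "(y, z) \<in> {(e, e'). is_extension p G e \<and> is_extension p G e' \<and> equiv_extensions p e e'}"
    then show "(x, z) \<in> {(e, e'). is_extension p G e \<and> is_extension p G e' \<and> equiv_extensions p e e'}"
      using trans'[of x y z] by simp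
  qed
qed

text \<open>The operator sees an arbitrary choice from the isomorphism class of \<open>H\<close>.
  Whatever is chosen is isomorphic to any member \<open>H'\<close> that is already
  understood.\<close>

lemma X1_class_rep:
  assumes "fg_rank1 p H'" "f \<in> module_iso (Zp p) H H'" "Module.module (Zp p) H"
  obtains K g where "K = class_rep (X1_class p H)" "fg_rank1 p K" "g \<in> module_iso (Zp p) K H'"
proof -
  have "class_rep (X1_class p H) \<in> X1_class p H"
    unfolding class_rep_def by (rule someI[of _ H']) (use assms(1,2) in \<open>auto simp: X1_class_def\<close>)
  then obtain g where g: "fg_rank1 p (class_rep (X1_class p H))"
     "g \<in> module_iso (Zp p) H (class_rep (X1_class p H))" by (auto simp: X1_class_def)
  have "f \<circ> inv_into (carrier H) g \<in> module_iso (Zp p) (class_rep (X1_class p H)) H'"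
    by (rule module_iso_comp[OF module_iso_inv[OF assms(3) g(2)] assms(2)])
  then show thesis using that g(1) by blast
qed

section \<open>Extensions of a fixed group of order \<open>p ^ m\<close>\<close>

locale pgroup = padics p + G: comm_group G for p and G :: "nat monoid" (structure) +
  fixes m :: nat
  assumes fin_G: "finite (carrier G)" and card_G: "card (carrier G) = p ^ m"
begin

lemma Zp_add_at: "(x \<oplus>\<^bsub>Z\<^esub> y) n = (x n + y n) mod P ^ n" by (simp add: Zp_add)
lemma Zp_mult_at: "(x \<otimes>\<^bsub>Z\<^esub> y) n = (x n * y n) mod P ^ n" by (simp add: Zp_mult)
lemma Zp_zero_at: "\<zero>\<^bsub>Z\<^esub> n = 0" by (simp add: Zp_zero)
lemma Zp_one_at: "\<one>\<^bsub>Z\<^esub> n = 1 mod P ^ n" by (simp add: Zp_one)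
lemma Zp_minus_at: "x \<in> carrier Z \<Longrightarrow> (\<ominus>\<^bsub>Z\<^esub> x) n = (- x n) mod P ^ n" by (simp add: Zp_minus)
lemma iota_at: "iota k n = k mod P ^ n" by (simp add: iota_def)

lemma Zp_add_diff:
  assumes "x \<in> carrier Z" "y \<in> carrier Z"
  shows "y \<oplus>\<^bsub>Z\<^esub> (x \<ominus>\<^bsub>Z\<^esub> y) = x"
proof -
  have "y \<oplus>\<^bsub>Z\<^esub> (x \<ominus>\<^bsub>Z\<^esub> y) = (x \<ominus>\<^bsub>Z\<^esub> y) \<oplus>\<^bsub>Z\<^esub> y" using assms by (simp add: ZR.a_comm)
  then show ?thesis using assms by (simp add: ZR.minus_eq ZR.a_assoc ZR.l_neg)
qed

lemma int_card_G: "int (card (carrier G)) = P ^ m" by (simp add: card_G)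

lemma pow_cong:
  assumes "g \<in> carrier G" "P ^ m dvd i - j"
  shows "g [^] (i::int) = g [^] (j::int)"
proof -
  obtain k where k: "i - j = P ^ m * k" using assms(2) by blast
  have "g [^] (P ^ m) = \<one>"
    using G.pow_order_eq_1[OF assms(1)] int_card_G by (metis int_pow_int order_def)
  then have "g [^] (i - j) = \<one>" unfolding k
    using assms(1) by (simp add: G.int_pow_pow[symmetric] G.int_pow_one)
  then show ?thesis using G.int_pow_diff[OF assms(1), of i j] assms(1)
    by (metis G.int_pow_closed G.inv_equality G.inv_inv G.inv_closed)
qed

lemma m_le_card: "m \<le> card (carrier G)"
  unfolding card_G using power_gt_expt[of p m] p_gt_1 by (simp add: less_imp_le)

text \<open>The index \<open>card (carrier G)\<close> is the one in \<open>group_as_module\<close>;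
  by \<open>act_eq\<close> every index from \<open>m\<close> on gives the same action.\<close>

definition act :: "padic \<Rightarrow> nat \<Rightarrow> nat" where "act z g = g [^] (z (card (carrier G)))"

lemma act_eq: "z \<in> carrier Z \<Longrightarrow> g \<in> carrier G \<Longrightarrow> m \<le> k \<Longrightarrow> act z g = g [^] (z k)"
proof -
  assume h: "z \<in> carrier Z" "g \<in> carrier G" "m \<le> k"
  have "z (card (carrier G)) mod P ^ m = z k mod P ^ m"
    using Zp_mod[OF h(1) m_le_card] Zp_mod[OF h(1) h(3)] by simp
  then show ?thesis unfolding act_def using h(2) by (intro pow_cong) (simp_all add: mod_eq_dvd)
qed

lemma act_closed [simp]: "g \<in> carrier G \<Longrightarrow> act z g \<in> carrier G"
  by (simp add: act_def)

lemma act_add: "z \<in> carrier Z \<Longrightarrow> w \<in> carrier Z \<Longrightarrow> g \<in> carrier G \<Longrightarrow> act (z \<oplus>\<^bsub>Z\<^esub> w) g = act z g \<otimes> act w g"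
proof -
  assume h: "z \<in> carrier Z" "w \<in> carrier Z" "g \<in> carrier G"
  have "g [^] ((z m + w m) mod P ^ m) = g [^] (z m + w m)"
    using h(3) by (intro pow_cong) (simp_all add: mod_eq_dvd[symmetric])
  then show ?thesis using h act_eq[of _ g m] by (simp add: Zp_add_at G.int_pow_mult)
qed

lemma act_mult: "z \<in> carrier Z \<Longrightarrow> w \<in> carrier Z \<Longrightarrow> g \<in> carrier G \<Longrightarrow> act (z \<otimes>\<^bsub>Z\<^esub> w) g = act z (act w g)"
proof -
  assume h: "z \<in> carrier Z" "w \<in> carrier Z" "g \<in> carrier G"
  have "g [^] ((z m * w m) mod P ^ m) = g [^] (w m * z m)"
    using h(3) by (intro pow_cong) (simp_all add: mod_eq_dvd[symmetric] mult.commute)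
  moreover have "act (z \<otimes>\<^bsub>Z\<^esub> w) g = g [^] ((z m * w m) mod P ^ m)"
    using act_eq[of "z \<otimes>\<^bsub>Z\<^esub> w" g m] h by (simp add: Zp_mult_at)
  moreover have "act z (act w g) = (g [^] (w m)) [^] (z m)"
    using act_eq[of z "act w g" m] act_eq[of w g m] h by simp
  ultimately show ?thesis using h by (simp add: G.int_pow_pow)
qed

lemma act_distr: "g \<in> carrier G \<Longrightarrow> h \<in> carrier G \<Longrightarrow> act z (g \<otimes> h) = act z g \<otimes> act z h"
  by (simp add: act_def G.int_pow_mult_distrib G.m_comm)

lemma act_one_left: "g \<in> carrier G \<Longrightarrow> act \<one>\<^bsub>Z\<^esub> g = g"
proof -
  assume g: "g \<in> carrier G"
  have "g [^] (1 mod P ^ m) = g [^] (1::int)" using g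
    by (intro pow_cong) (simp_all add: mod_eq_dvd[symmetric])
  then show ?thesis using act_eq[of "\<one>\<^bsub>Z\<^esub>" g m] g by (simp add: Zp_one_at)
qed

lemma act_one_right [simp]: "act z \<one> = \<one>"
  by (simp add: act_def G.int_pow_one)

lemma act_iota: "g \<in> carrier G \<Longrightarrow> act (iota k) g = g [^] k"
proof -
  assume g: "g \<in> carrier G"
  have "g [^] (k mod P ^ m) = g [^] k" using g
    by (intro pow_cong) (simp_all add: mod_eq_dvd[symmetric])
  then show ?thesis using act_eq[of "iota k" g m] g by (simp add: iota_at)
qed

lemma act_kill: "w \<in> carrier Z \<Longrightarrow> g \<in> carrier G \<Longrightarrow> act (iota (P ^ m) \<otimes>\<^bsub>Z\<^esub> w) g = \<one>"
proof -
  assume h: "w \<in> carrier Z" "g \<in> carrier G"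
  have "act w g [^] (P ^ m) = act w g [^] (0::int)" using h by (intro pow_cong) simp_all
  then show ?thesis using h by (simp add: act_mult act_iota)
qed

abbreviation chars :: "(nat \<Rightarrow> int) set" where "chars \<equiv> chr G (P ^ m) (carrier G)"

lemma chars_one: "\<kappa> \<in> chars \<Longrightarrow> \<kappa> \<one> = 0"
  using G.chr_one[OF G.subgroup_self] .

lemma chars_pow: "\<kappa> \<in> chars \<Longrightarrow> g \<in> carrier G \<Longrightarrow> \<kappa> (g [^] (k::int)) = (k * \<kappa> g) mod P ^ m"
  using G.chr_int_pow[OF G.subgroup_self] .

lemma card_chars: "card chars = card (carrier G)"
  by (rule G.card_chr[OF G.subgroup_self fin_G]) (simp_all only: int_card_G P_pos dvd_refl)

lemma finite_chars: "finite chars" by (rule finite_chr[OF fin_G])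

text \<open>The extension with class \<open>\<kappa>\<close>, realised inside \<open>Z_p\<close>
  times \<open>G\<close>. The first coordinate of an element measures \<open>|G|\<close> times that
  element in units of the image of \<open>1\<close>, and its residue modulo \<open>|G|\<close> is
  prescribed by the second coordinate.\<close>

definition HM :: "(nat \<Rightarrow> int) \<Rightarrow> padic_mod" where
  "HM \<kappa> = \<lparr>carrier = {(z, g). z \<in> carrier Z \<and> g \<in> carrier G \<and> z m = \<kappa> g},
     mult = (\<lambda>x y. x), one = (\<zero>\<^bsub>Z\<^esub>, \<one>), zero = (\<zero>\<^bsub>Z\<^esub>, \<one>),
     add = (\<lambda>(z, g) (w, h). (z \<oplus>\<^bsub>Z\<^esub> w, g \<otimes> h)),
     smult = (\<lambda>r (z, g). (r \<otimes>\<^bsub>Z\<^esub> z, act r g))\<rparr>"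

lemma HM_mem: "(z, g) \<in> carrier (HM \<kappa>) \<longleftrightarrow> z \<in> carrier Z \<and> g \<in> carrier G \<and> z m = \<kappa> g"
  by (simp add: HM_def)
lemma HM_add: "(z, g) \<oplus>\<^bsub>HM \<kappa>\<^esub> (w, h) = (z \<oplus>\<^bsub>Z\<^esub> w, g \<otimes> h)" by (simp add: HM_def)
lemma HM_smult: "r \<odot>\<^bsub>HM \<kappa>\<^esub> (z, g) = (r \<otimes>\<^bsub>Z\<^esub> z, act r g)" by (simp add: HM_def)
lemma HM_zero: "\<zero>\<^bsub>HM \<kappa>\<^esub> = (\<zero>\<^bsub>Z\<^esub>, \<one>)" by (simp add: HM_def)

lemma HM_module:
  assumes ch: "\<kappa> \<in> chars"
  shows "Module.module Z (HM \<kappa>)"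
proof (rule moduleI[OF Zp_cring])
  have add_cl: "x \<oplus>\<^bsub>HM \<kappa>\<^esub> y \<in> carrier (HM \<kappa>)" if "x \<in> carrier (HM \<kappa>)" "y \<in> carrier (HM \<kappa>)" for x y
  proof -
    obtain z g w h where xy: "x = (z, g)" "y = (w, h)" by (metis surj_pair)
    have "(z \<oplus>\<^bsub>Z\<^esub> w) m = (\<kappa> g + \<kappa> h) mod P ^ m" using that by (simp add: xy HM_mem Zp_add_at)
    then show ?thesis using that chr_mult[OF ch] by (simp add: xy HM_mem HM_add)
  qed
  have smult_cl: "r \<odot>\<^bsub>HM \<kappa>\<^esub> x \<in> carrier (HM \<kappa>)" if "r \<in> carrier Z" "x \<in> carrier (HM \<kappa>)" for r x
  proof -
    obtain z g where x: "x = (z, g)" by (metis surj_pair)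
    have "\<kappa> (act r g) = (r m * \<kappa> g) mod P ^ m"
      using that act_eq[of r g m] chars_pow[OF ch, of g "r m"] by (simp add: x HM_mem)
    then show ?thesis using that by (simp add: x HM_mem HM_smult Zp_mult_at)
  qed
  show "abelian_group (HM \<kappa>)"
  proof (rule abelian_groupI)
    show "\<zero>\<^bsub>HM \<kappa>\<^esub> \<in> carrier (HM \<kappa>)"
      using chars_one[OF ch] by (simp add: HM_zero HM_mem) (simp add: Zp_zero_at)
    fix x assume x: "x \<in> carrier (HM \<kappa>)"
    obtain z g where xy: "x = (z, g)" by (metis surj_pair)
    show "\<zero>\<^bsub>HM \<kappa>\<^esub> \<oplus>\<^bsub>HM \<kappa>\<^esub> x = x" using x by (simp add: xy HM_mem HM_add HM_zero)
    have "(iota (-1) \<odot>\<^bsub>HM \<kappa>\<^esub> x) \<oplus>\<^bsub>HM \<kappa>\<^esub> x = \<zero>\<^bsub>HM \<kappa>\<^esub>"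
    proof -
      have "iota (-1) \<otimes>\<^bsub>Z\<^esub> z \<oplus>\<^bsub>Z\<^esub> z = \<zero>\<^bsub>Z\<^esub>"
        using x iota_minus[of 1] by (simp add: xy HM_mem iota_1 ZR.l_minus ZR.l_neg)
      moreover have "act (iota (-1)) g \<otimes> g = \<one>"
        using x act_iota[of g "-1"] by (simp add: xy HM_mem G.int_pow_neg G.l_inv)
      ultimately show ?thesis by (simp add: xy HM_smult HM_add HM_zero)
    qed
    then show "\<exists>y\<in>carrier (HM \<kappa>). y \<oplus>\<^bsub>HM \<kappa>\<^esub> x = \<zero>\<^bsub>HM \<kappa>\<^esub>" using smult_cl[OF iota_closed x] by blast
  next
    fix x y z assume "x \<in> carrier (HM \<kappa>)" "y \<in> carrier (HM \<kappa>)" "z \<in> carrier (HM \<kappa>)"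
    then show "(x \<oplus>\<^bsub>HM \<kappa>\<^esub> y) \<oplus>\<^bsub>HM \<kappa>\<^esub> z = x \<oplus>\<^bsub>HM \<kappa>\<^esub> (y \<oplus>\<^bsub>HM \<kappa>\<^esub> z)"
      by (cases x; cases y; cases z) (simp add: HM_mem HM_add ZR.a_assoc G.m_assoc)
  next
    fix x y assume "x \<in> carrier (HM \<kappa>)" "y \<in> carrier (HM \<kappa>)"
    then show "x \<oplus>\<^bsub>HM \<kappa>\<^esub> y = y \<oplus>\<^bsub>HM \<kappa>\<^esub> x"
      by (cases x; cases y) (simp add: HM_mem HM_add ZR.a_comm G.m_comm)
  qed (rule add_cl)
  fix a x assume ab: "a \<in> carrier Z" "x \<in> carrier (HM \<kappa>)"
  show "a \<odot>\<^bsub>HM \<kappa>\<^esub> x \<in> carrier (HM \<kappa>)" by (rule smult_cl[OF ab])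
next
  fix x assume ab: "x \<in> carrier (HM \<kappa>)"
  show "\<one>\<^bsub>Z\<^esub> \<odot>\<^bsub>HM \<kappa>\<^esub> x = x"
    using ab by (cases x) (simp add: HM_mem HM_smult act_one_left)
next
  fix a b x assume ab: "a \<in> carrier Z" "x \<in> carrier (HM \<kappa>)" and b: "b \<in> carrier Z"
  show "(a \<oplus>\<^bsub>Z\<^esub> b) \<odot>\<^bsub>HM \<kappa>\<^esub> x = a \<odot>\<^bsub>HM \<kappa>\<^esub> x \<oplus>\<^bsub>HM \<kappa>\<^esub> b \<odot>\<^bsub>HM \<kappa>\<^esub> x"
    using ab b by (cases x) (simp add: HM_mem HM_smult HM_add act_add ZR.l_distr)
  show "(a \<otimes>\<^bsub>Z\<^esub> b) \<odot>\<^bsub>HM \<kappa>\<^esub> x = a \<odot>\<^bsub>HM \<kappa>\<^esub> (b \<odot>\<^bsub>HM \<kappa>\<^esub> x)"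
    using ab b by (cases x) (simp add: HM_mem HM_smult act_mult ZR.m_assoc)
next
  fix a x y assume "a \<in> carrier Z" "x \<in> carrier (HM \<kappa>)" "y \<in> carrier (HM \<kappa>)"
  then show "a \<odot>\<^bsub>HM \<kappa>\<^esub> (x \<oplus>\<^bsub>HM \<kappa>\<^esub> y) = a \<odot>\<^bsub>HM \<kappa>\<^esub> x \<oplus>\<^bsub>HM \<kappa>\<^esub> a \<odot>\<^bsub>HM \<kappa>\<^esub> y"
    by (cases x; cases y) (simp add: HM_mem HM_smult HM_add act_distr ZR.r_distr)
qed

text \<open>The factor \<open>P ^ m\<close> in the inclusion is forced: as \<open>\<kappa>\<close>
  vanishes at the neutral element, the members of \<open>HM \<kappa>\<close> over it are those whose
  first coordinate is divisible by \<open>|G|\<close>.\<close>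

definition ext_of :: "(nat \<Rightarrow> int) \<Rightarrow> extension" where
  "ext_of \<kappa> = (HM \<kappa>, (\<lambda>z. (iota (P ^ m) \<otimes>\<^bsub>Z\<^esub> z, \<one>)), snd)"

lemma P_mult_at_m: "w \<in> carrier Z \<Longrightarrow> (iota (P ^ m) \<otimes>\<^bsub>Z\<^esub> w) m = 0"
  by (simp add: iota_mult_at)

lemma P_mult_inj:
  assumes "z \<in> carrier Z" "w \<in> carrier Z" "iota (P ^ k) \<otimes>\<^bsub>Z\<^esub> z = iota (P ^ k) \<otimes>\<^bsub>Z\<^esub> w"
  shows "z = w"
proof -
  have "iota (P ^ k) \<otimes>\<^bsub>Z\<^esub> (z \<ominus>\<^bsub>Z\<^esub> w) = \<zero>\<^bsub>Z\<^esub>"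
    using assms by (simp add: ZR.minus_eq ZR.r_distr ZR.r_minus ZR.r_neg)
  then have "z \<ominus>\<^bsub>Z\<^esub> w = \<zero>\<^bsub>Z\<^esub>" using Zp_torsion_free[of "z \<ominus>\<^bsub>Z\<^esub> w" k] assms by simp
  then show ?thesis using assms by simp
qed

lemma HM_lift: "\<kappa> \<in> chars \<Longrightarrow> g \<in> carrier G \<Longrightarrow> (iota (\<kappa> g), g) \<in> carrier (HM \<kappa>)"
  using chr_mod[of \<kappa> G] by (simp add: HM_mem) (simp add: iota_at)

lemma ext_of_is_extension:
  assumes ch: "\<kappa> \<in> chars"
  shows "is_extension p G (ext_of \<kappa>)"
  unfolding ext_of_def is_extension_def prod.case
proof (intro conjI)
  show "Module.module Z (HM \<kappa>)" by (rule HM_module[OF ch])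
  have i_cl: "(iota (P ^ m) \<otimes>\<^bsub>Z\<^esub> z, \<one>) \<in> carrier (HM \<kappa>)" if "z \<in> carrier Z" for z
    using that by (simp add: HM_mem P_mult_at_m chars_one[OF ch])
  show "(\<lambda>z. (iota (P ^ m) \<otimes>\<^bsub>Z\<^esub> z, \<one>)) \<in> module_hom Z (Zp_module p) (HM \<kappa>)"
    by (rule module_homI)
      (simp_all add: Zp_module_def i_cl HM_add HM_smult ZR.r_distr ZR.m_lcomm)
  show "inj_on (\<lambda>z. (iota (P ^ m) \<otimes>\<^bsub>Z\<^esub> z, \<one>)) (carrier Z)"
    by (rule inj_onI) (auto intro: P_mult_inj)
  show "snd \<in> module_hom Z (HM \<kappa>) (group_as_module G)"
    by (rule module_homI) (auto simp: group_as_module_def HM_mem HM_add HM_smult act_def)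
  show "snd ` carrier (HM \<kappa>) = carrier G"
  proof
    show "snd ` carrier (HM \<kappa>) \<subseteq> carrier G" by (auto simp: HM_mem)
    show "carrier G \<subseteq> snd ` carrier (HM \<kappa>)" using HM_lift[OF ch] by force
  qed
  show "(\<lambda>z. (iota (P ^ m) \<otimes>\<^bsub>Z\<^esub> z, \<one>)) ` carrier Z = {h \<in> carrier (HM \<kappa>). snd h = \<one>}"
  proof
    show "(\<lambda>z. (iota (P ^ m) \<otimes>\<^bsub>Z\<^esub> z, \<one>)) ` carrier Z \<subseteq> {h \<in> carrier (HM \<kappa>). snd h = \<one>}"
      using i_cl by auto
    show "{h \<in> carrier (HM \<kappa>). snd h = \<one>} \<subseteq> (\<lambda>z. (iota (P ^ m) \<otimes>\<^bsub>Z\<^esub> z, \<one>)) ` carrier Z"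
    proof
      fix h assume "h \<in> {h \<in> carrier (HM \<kappa>). snd h = \<one>}"
      then obtain z where h: "h = (z, \<one>)" "(z, \<one>) \<in> carrier (HM \<kappa>)" by (cases h) auto
      then have z: "z \<in> carrier Z" "z m = 0" using chars_one[OF ch] by (auto simp: HM_mem)
      from Zp_divide[OF this] obtain w where "w \<in> carrier Z" "z = iota (P ^ m) \<otimes>\<^bsub>Z\<^esub> w" by metis
      then show "h \<in> (\<lambda>z. (iota (P ^ m) \<otimes>\<^bsub>Z\<^esub> z, \<one>)) ` carrier Z" using h by blast
    qed
  qed
qed

text \<open>Multiplication by \<open>p\<^sup>m\<close> maps an extension \<open>H\<close> of \<open>G\<close> into \<open>\<int>\<^sub>p\<close>; together with the projection to
  \<open>G\<close> it embeds \<open>H\<close> into \<open>\<int>\<^sub>p \<times> G\<close>.\<close>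

lemma extension_equiv_ext_of:
  assumes "is_extension p G (H, i, q)"
  shows "\<exists>\<kappa>\<in>chars. equiv_extensions p (H, i, q) (ext_of \<kappa>)"
proof -
  note E = is_extensionD[OF assms]
  interpret H: Module.module Z H by (rule E(1))
  have i: "\<And>z. z \<in> carrier Z \<Longrightarrow> i z \<in> carrier H"
    "\<And>z w. z \<in> carrier Z \<Longrightarrow> w \<in> carrier Z \<Longrightarrow> i (z \<oplus>\<^bsub>Z\<^esub> w) = i z \<oplus>\<^bsub>H\<^esub> i w"
    "\<And>r z. r \<in> carrier Z \<Longrightarrow> z \<in> carrier Z \<Longrightarrow> i (r \<otimes>\<^bsub>Z\<^esub> z) = r \<odot>\<^bsub>H\<^esub> i z"
    using module_homD[OF E(2)] by (simp_all add: Zp_module_def)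
  have q: "\<And>h. h \<in> carrier H \<Longrightarrow> q h \<in> carrier G"
    "\<And>h k. h \<in> carrier H \<Longrightarrow> k \<in> carrier H \<Longrightarrow> q (h \<oplus>\<^bsub>H\<^esub> k) = q h \<otimes> q k"
    "\<And>r h. r \<in> carrier Z \<Longrightarrow> h \<in> carrier H \<Longrightarrow> q (r \<odot>\<^bsub>H\<^esub> h) = act r (q h)"
    using module_homD[OF E(4)] by (simp_all add: group_as_module_def act_def)
  have qi: "q (i z) = \<one>" if "z \<in> carrier Z" for z using E(6) that by blast
  have ker: "\<exists>z\<in>carrier Z. h = i z" if "h \<in> carrier H" "q h = \<one>" for h using E(6) that by blast
  have "\<exists>z\<in>carrier Z. iota (P ^ m) \<odot>\<^bsub>H\<^esub> h = i z" if "h \<in> carrier H" for h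
    by (rule ker) (use that q act_kill[of "\<one>\<^bsub>Z\<^esub>" "q h"] in auto)
  then obtain \<rho> where \<rho>: "\<And>h. h \<in> carrier H \<Longrightarrow> \<rho> h \<in> carrier Z"
    "\<And>h. h \<in> carrier H \<Longrightarrow> iota (P ^ m) \<odot>\<^bsub>H\<^esub> h = i (\<rho> h)" by metis
  have iinj: "z = w" if "i z = i w" "z \<in> carrier Z" "w \<in> carrier Z" for z w
    using E(3) that by (rule inj_onD)
  have \<rho>_add: "\<rho> (h \<oplus>\<^bsub>H\<^esub> k) = \<rho> h \<oplus>\<^bsub>Z\<^esub> \<rho> k" if "h \<in> carrier H" "k \<in> carrier H" for h k
  proof (rule iinj)
    show "i (\<rho> (h \<oplus>\<^bsub>H\<^esub> k)) = i (\<rho> h \<oplus>\<^bsub>Z\<^esub> \<rho> k)"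
      using that by (simp add: \<rho>(1) i(2) \<rho>(2)[symmetric] H.smult_r_distr)
  qed (use that \<rho>(1) in auto)
  have \<rho>_smult: "\<rho> (r \<odot>\<^bsub>H\<^esub> h) = r \<otimes>\<^bsub>Z\<^esub> \<rho> h" if "h \<in> carrier H" "r \<in> carrier Z" for h r
  proof (rule iinj)
    have "i (\<rho> (r \<odot>\<^bsub>H\<^esub> h)) = (iota (P ^ m) \<otimes>\<^bsub>Z\<^esub> r) \<odot>\<^bsub>H\<^esub> h"
      using that by (simp add: \<rho>(2)[symmetric] H.smult_assoc1)
    also have "\<dots> = (r \<otimes>\<^bsub>Z\<^esub> iota (P ^ m)) \<odot>\<^bsub>H\<^esub> h" using that by (simp add: ZR.m_comm)
    also have "\<dots> = i (r \<otimes>\<^bsub>Z\<^esub> \<rho> h)"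
      using that by (simp add: i(3) \<rho>(1) \<rho>(2)[symmetric] H.smult_assoc1)
    finally show "i (\<rho> (r \<odot>\<^bsub>H\<^esub> h)) = i (r \<otimes>\<^bsub>Z\<^esub> \<rho> h)" .
  qed (use that \<rho>(1) in auto)
  have \<rho>_i: "\<rho> (i z) = iota (P ^ m) \<otimes>\<^bsub>Z\<^esub> z" if "z \<in> carrier Z" for z
    by (rule iinj) (use that \<rho>(1) i in \<open>simp_all add: \<rho>(2)[symmetric]\<close>)
  have dec: "\<exists>z\<in>carrier Z. h = k \<oplus>\<^bsub>H\<^esub> i z" if "h \<in> carrier H" "k \<in> carrier H" "q h = q k" for h k
  proof -
    have "k \<oplus>\<^bsub>H\<^esub> (\<ominus>\<^bsub>H\<^esub> k \<oplus>\<^bsub>H\<^esub> h) = h" using that by (simp add: H.r_neg1 H.r_neg2)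
    moreover from this have "q k \<otimes> q (\<ominus>\<^bsub>H\<^esub> k \<oplus>\<^bsub>H\<^esub> h) = q k"
      using that q(2)[of k "\<ominus>\<^bsub>H\<^esub> k \<oplus>\<^bsub>H\<^esub> h"] by simp
    then have "q (\<ominus>\<^bsub>H\<^esub> k \<oplus>\<^bsub>H\<^esub> h) = \<one>" using that q(1) by simp
    ultimately show ?thesis using ker[of "\<ominus>\<^bsub>H\<^esub> k \<oplus>\<^bsub>H\<^esub> h"] that by auto
  qed
  \<comment> \<open>Two lifts of the same element of \<open>G\<close> differ by some
    \<open>i z\<close>, which changes \<open>\<rho>\<close> by a multiple of \<open>|G|\<close>.
    Hence \<open>\<rho>\<close> modulo \<open>|G|\<close> descends to a function on
    \<open>G\<close>, the character sought.\<close>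
  have \<rho>m: "\<rho> h m = \<rho> k m" if hk: "h \<in> carrier H" "k \<in> carrier H" "q h = q k" for h k
  proof -
    obtain z where z: "z \<in> carrier Z" "h = k \<oplus>\<^bsub>H\<^esub> i z" using dec[OF hk] by blast
    then have "\<rho> h = \<rho> k \<oplus>\<^bsub>Z\<^esub> (iota (P ^ m) \<otimes>\<^bsub>Z\<^esub> z)" using hk i \<rho>_add \<rho>_i by simp
    then have "\<rho> h m = (\<rho> k m + (iota (P ^ m) \<otimes>\<^bsub>Z\<^esub> z) m) mod P ^ m" by (simp add: Zp_add_at)
    then show ?thesis using P_mult_at_m[OF z(1)] Zp_mod_self[OF \<rho>(1)[OF hk(2)]] by simp
  qed
  define s where "s g = (SOME h. h \<in> carrier H \<and> q h = g)" for g
  have s: "s g \<in> carrier H" "q (s g) = g" if "g \<in> carrier G" for g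
  proof -
    have "\<exists>h. h \<in> carrier H \<and> q h = g" using E(5) that by (metis imageE)
    from someI_ex[OF this] show "s g \<in> carrier H" "q (s g) = g" unfolding s_def by auto
  qed
  define \<kappa> where "\<kappa> = (\<lambda>g\<in>carrier G. \<rho> (s g) m)"
  have \<kappa>: "\<kappa> (q h) = \<rho> h m" if "h \<in> carrier H" for h
  proof -
    have "\<rho> (s (q h)) m = \<rho> h m" by (rule \<rho>m) (use that s q(1) in auto)
    then show ?thesis unfolding \<kappa>_def using q(1)[OF that] by simp
  qed
  have "\<kappa> \<in> chars" unfolding chr_def
  proof (intro CollectI conjI ballI)
    show "\<kappa> \<in> carrier G \<rightarrow>\<^sub>E {0..<P ^ m}"
      unfolding \<kappa>_def using Zp_range[OF \<rho>(1)] s by (auto intro!: PiE_I)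
    fix a b assume ab: "a \<in> carrier G" "b \<in> carrier G"
    have "\<kappa> (q (s a \<oplus>\<^bsub>H\<^esub> s b)) = \<rho> (s a \<oplus>\<^bsub>H\<^esub> s b) m" using ab s by (intro \<kappa>) simp
    also have "\<dots> = (\<kappa> a + \<kappa> b) mod P ^ m"
      using ab s by (simp add: \<rho>_add Zp_add_at \<kappa>_def)
    finally show "\<kappa> (a \<otimes> b) = (\<kappa> a + \<kappa> b) mod P ^ m" using ab s q(2) by simp
  qed
  moreover have "equiv_extensions p (H, i, q) (ext_of \<kappa>)" unfolding ext_of_def
  proof (rule equiv_extensionsI)
    let ?f = "\<lambda>h. (\<rho> h, q h)"
    have fc: "?f h \<in> carrier (HM \<kappa>)" if "h \<in> carrier H" for h
      using that \<rho> q \<kappa> by (simp add: HM_mem)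
    have "?f \<in> module_hom Z H (HM \<kappa>)"
      by (rule module_homI) (use fc \<rho>_add \<rho>_smult q in \<open>simp_all add: HM_add HM_smult\<close>)
    moreover have "bij_betw ?f (carrier H) (carrier (HM \<kappa>))" unfolding bij_betw_def
    proof
      show "inj_on ?f (carrier H)"
      proof (rule inj_onI)
        fix h k assume hk: "h \<in> carrier H" "k \<in> carrier H" "?f h = ?f k"
        obtain z where z: "z \<in> carrier Z" "h = k \<oplus>\<^bsub>H\<^esub> i z" using dec[of h k] hk by auto
        have "\<rho> k \<oplus>\<^bsub>Z\<^esub> (iota (P ^ m) \<otimes>\<^bsub>Z\<^esub> z) = \<rho> k" using hk z i \<rho>_add \<rho>_i by simp
        then have "iota (P ^ m) \<otimes>\<^bsub>Z\<^esub> z = \<zero>\<^bsub>Z\<^esub>" using \<rho>(1)[OF hk(2)] z(1)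
          by (metis ZR.add.l_cancel_one ZR.m_closed iota_closed)
        then have "z = \<zero>\<^bsub>Z\<^esub>" by (rule Zp_torsion_free[OF z(1)])
        moreover have "i \<zero>\<^bsub>Z\<^esub> = \<zero>\<^bsub>H\<^esub>"
          using i(3)[of "\<zero>\<^bsub>Z\<^esub>" "\<zero>\<^bsub>Z\<^esub>"] i(1)[of "\<zero>\<^bsub>Z\<^esub>"] by simp
        ultimately show "h = k" using z hk by simp
      qed
      show "?f ` carrier H = carrier (HM \<kappa>)"
      proof
        show "?f ` carrier H \<subseteq> carrier (HM \<kappa>)" using fc by blast
        show "carrier (HM \<kappa>) \<subseteq> ?f ` carrier H"
        proof
          fix x assume "x \<in> carrier (HM \<kappa>)"
          then obtain z g where x: "x = (z, g)" "z \<in> carrier Z" "g \<in> carrier G" "z m = \<kappa> g"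
            by (cases x) (auto simp: HM_mem)
          \<comment> \<open>Surjectivity: a lift of \<open>g\<close> is corrected by an element of
            the embedded \<open>Z_p\<close>, since its first coordinate already has the right
            residue modulo \<open>|G|\<close>.\<close>
          have "(z \<ominus>\<^bsub>Z\<^esub> \<rho> (s g)) m = 0"
            using x s \<rho>(1) by (simp add: ZR.minus_eq Zp_minus_at Zp_add_at \<kappa>_def mod_simps)
          then obtain w where w: "w \<in> carrier Z" "z \<ominus>\<^bsub>Z\<^esub> \<rho> (s g) = iota (P ^ m) \<otimes>\<^bsub>Z\<^esub> w"
            using Zp_divide[of "z \<ominus>\<^bsub>Z\<^esub> \<rho> (s g)" m] x s \<rho>(1) by (metis ZR.minus_closed)
          have "\<rho> (s g \<oplus>\<^bsub>H\<^esub> i w) = \<rho> (s g) \<oplus>\<^bsub>Z\<^esub> (z \<ominus>\<^bsub>Z\<^esub> \<rho> (s g))"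
            using \<rho>_add[OF s(1)[OF x(3)] i(1)[OF w(1)]] \<rho>_i[OF w(1)] w(2) by simp
          also have "\<dots> = z" by (rule Zp_add_diff[OF x(2) \<rho>(1)[OF s(1)[OF x(3)]]])
          finally have z: "\<rho> (s g \<oplus>\<^bsub>H\<^esub> i w) = z" .
          have g: "q (s g \<oplus>\<^bsub>H\<^esub> i w) = g"
            using q(2)[OF s(1)[OF x(3)] i(1)[OF w(1)]] s(2)[OF x(3)] qi[OF w(1)] x(3) by simp
          show "x \<in> ?f ` carrier H" unfolding x(1)
            by (rule image_eqI[of _ _ "s g \<oplus>\<^bsub>H\<^esub> i w"]) (simp_all add: z g s(1)[OF x(3)] i(1)[OF w(1)])
        qed
      qed
    qed
    ultimately show "?f \<in> module_iso Z H (HM \<kappa>)" by (simp add: module_iso_def)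
  qed (simp_all add: \<rho>_i qi)
  ultimately show ?thesis by blast
qed

text \<open>An equivalence fixes the image of \<open>Z_p\<close>, which contains \<open>|G|\<close>
  times every element. As \<open>Z_p\<close> is torsion free, it preserves the first coordinate, and
  the residue of that coordinate is the character.\<close>

lemma ext_of_inj:
  assumes ch: "\<kappa> \<in> chars" "\<kappa>' \<in> chars" and eq: "equiv_extensions p (ext_of \<kappa>) (ext_of \<kappa>')"
  shows "\<kappa> = \<kappa>'"
proof (rule chr_eqI[OF ch])
  fix g assume g: "g \<in> carrier G"
  obtain f where f: "f \<in> module_iso Z (HM \<kappa>) (HM \<kappa>')"
    "\<And>z. z \<in> carrier Z \<Longrightarrow> f (iota (P ^ m) \<otimes>\<^bsub>Z\<^esub> z, \<one>) = (iota (P ^ m) \<otimes>\<^bsub>Z\<^esub> z, \<one>)"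
    "\<And>h. h \<in> carrier (HM \<kappa>) \<Longrightarrow> snd (f h) = snd h"
    using eq unfolding ext_of_def equiv_extensions_def by auto
  note h = module_homD[OF module_isoD(1)[OF f(1)]]
  let ?x = "(iota (\<kappa> g), g)"
  have x: "?x \<in> carrier (HM \<kappa>)" by (rule HM_lift[OF ch(1) g])
  obtain w where w: "f ?x = (w, g)" using f(3)[OF x] by (metis prod.collapse snd_conv)
  have wc: "w \<in> carrier Z" "w m = \<kappa>' g" using h(1)[OF x] w by (auto simp: HM_mem)
  have k1: "act (iota (P ^ m)) g = \<one>" using act_kill[of "\<one>\<^bsub>Z\<^esub>" g] g by simp
  have "f (iota (P ^ m) \<odot>\<^bsub>HM \<kappa>\<^esub> ?x) = (iota (P ^ m) \<otimes>\<^bsub>Z\<^esub> w, \<one>)"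
    using h(3)[of "iota (P ^ m)", OF iota_closed x] w k1 by (simp add: HM_smult)
  moreover have "f (iota (P ^ m) \<odot>\<^bsub>HM \<kappa>\<^esub> ?x) = (iota (P ^ m) \<otimes>\<^bsub>Z\<^esub> iota (\<kappa> g), \<one>)"
    using f(2)[of "iota (\<kappa> g)"] k1 by (simp add: HM_smult)
  ultimately have "w = iota (\<kappa> g)" using P_mult_inj[of w "iota (\<kappa> g)" m] wc by simp
  then show "\<kappa> g = \<kappa>' g" using wc(2) chr_mod[OF ch(1) g] by (simp add: iota_at)
qed

abbreviation ext_class :: "(nat \<Rightarrow> int) \<Rightarrow> extension set" where
  "ext_class \<kappa> \<equiv> {(e, e'). is_extension p G e \<and> is_extension p G e' \<and> equiv_extensions p e e'} `` {ext_of \<kappa>}"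

text \<open>Identifies the extension classes with the dual of \<open>G\<close>, from which their
  number and finiteness follow.\<close>

lemma bij_ext_class: "bij_betw ext_class chars (Ext p G)"
  unfolding bij_betw_def
proof
  show "inj_on ext_class chars"
  proof (rule inj_onI)
    fix \<kappa> \<kappa>' assume ch: "\<kappa> \<in> chars" "\<kappa>' \<in> chars" and "ext_class \<kappa> = ext_class \<kappa>'"
    then have "(ext_of \<kappa>, ext_of \<kappa>') \<in> {(e, e'). is_extension p G e \<and> is_extension p G e' \<and> equiv_extensions p e e'}"
      by (intro eq_equiv_class[OF _ equiv_ext_rel]) (auto simp: ext_of_is_extension)
    then show "\<kappa> = \<kappa>'" using ext_of_inj ch by blast
  qed
  show "ext_class ` chars = Ext p G"
  proof
    show "ext_class ` chars \<subseteq> Ext p G"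
    proof
      fix \<xi> assume "\<xi> \<in> ext_class ` chars"
      then obtain \<kappa> where ch: "\<kappa> \<in> chars" "\<xi> = ext_class \<kappa>" by blast
      show "\<xi> \<in> Ext p G" unfolding Ext_def ch(2)
        by (rule quotientI) (simp add: ext_of_is_extension ch(1))
    qed
    show "Ext p G \<subseteq> ext_class ` chars"
    proof
      fix \<xi> assume "\<xi> \<in> Ext p G"
      then obtain e where e: "is_extension p G e"
        "\<xi> = {(e, e'). is_extension p G e \<and> is_extension p G e' \<and> equiv_extensions p e e'} `` {e}"
        unfolding Ext_def by (auto elim!: quotientE)
      obtain H i q where hiq: "e = (H, i, q)" by (metis prod_cases3)
      obtain \<kappa> where ch: "\<kappa> \<in> chars" "equiv_extensions p e (ext_of \<kappa>)"
        using extension_equiv_ext_of e(1) unfolding hiq by blast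
      have "\<xi> = ext_class \<kappa>" unfolding e(2)
        by (rule equiv_class_eq[OF equiv_ext_rel]) (use e(1) ch ext_of_is_extension in auto)
      then show "\<xi> \<in> ext_class ` chars" using ch(1) by blast
    qed
  qed
qed

text \<open>Ensures that \<open>X1_class\<close> of a middle term is nonempty, so that choosing from
  it is meaningful. The image of \<open>1\<close> and one lift for each element of \<open>G\<close>
  generate. The rank is one because elements with first coordinate zero are torsion and any two
  elements are linearly dependent.\<close>

lemma HM_fg_rank1:
  assumes ch: "\<kappa> \<in> chars"
  shows "fg_rank1 p (HM \<kappa>)"
  unfolding fg_rank1_def
proof (intro conjI)
  show M: "Module.module Z (HM \<kappa>)" by (rule HM_module[OF ch])
  interpret M: Module.module Z "HM \<kappa>" by (rule M)
  define y where "y = (iota (P ^ m), \<one>)"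
  have y: "y \<in> carrier (HM \<kappa>)" unfolding y_def using P_mult_at_m[of "\<one>\<^bsub>Z\<^esub>"] chars_one[OF ch] by (simp add: HM_mem)
  show "fin_gen_module Z (HM \<kappa>)" unfolding fin_gen_module_def
  proof (intro exI conjI allI impI)
    let ?S = "insert y ((\<lambda>g. (iota (\<kappa> g), g)) ` carrier G)"
    show "finite ?S" using fin_G by simp
    show "?S \<subseteq> carrier (HM \<kappa>)" using y HM_lift[OF ch] by blast
    fix N assume N: "submodule N Z (HM \<kappa>) \<and> ?S \<subseteq> N"
    then interpret N: submodule N Z "HM \<kappa>" by blast
    have Nadd: "\<And>a b. a \<in> N \<Longrightarrow> b \<in> N \<Longrightarrow> a \<oplus>\<^bsub>HM \<kappa>\<^esub> b \<in> N" using N.m_closed by simp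
    show "N = carrier (HM \<kappa>)"
    proof
      show "N \<subseteq> carrier (HM \<kappa>)" using N.subset by simp
      show "carrier (HM \<kappa>) \<subseteq> N"
      proof
        fix x assume "x \<in> carrier (HM \<kappa>)"
        then obtain z g where x: "x = (z, g)" "z \<in> carrier Z" "g \<in> carrier G" "z m = \<kappa> g"
          by (cases x) (auto simp: HM_mem)
        have "(z \<ominus>\<^bsub>Z\<^esub> iota (\<kappa> g)) m = 0"
          using x by (simp add: ZR.minus_eq Zp_minus_at Zp_add_at) (simp add: iota_at mod_simps)
        then obtain w where w: "w \<in> carrier Z" "z \<ominus>\<^bsub>Z\<^esub> iota (\<kappa> g) = iota (P ^ m) \<otimes>\<^bsub>Z\<^esub> w"
          using Zp_divide[of "z \<ominus>\<^bsub>Z\<^esub> iota (\<kappa> g)" m] x by (metis ZR.minus_closed iota_closed)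
        have "w \<odot>\<^bsub>HM \<kappa>\<^esub> y \<oplus>\<^bsub>HM \<kappa>\<^esub> (iota (\<kappa> g), g) = ((z \<ominus>\<^bsub>Z\<^esub> iota (\<kappa> g)) \<oplus>\<^bsub>Z\<^esub> iota (\<kappa> g), g)"
          using x w by (simp add: y_def HM_smult HM_add ZR.m_comm)
        also have "\<dots> = x" using x by (simp add: ZR.minus_eq ZR.a_assoc ZR.l_neg)
        finally have e: "w \<odot>\<^bsub>HM \<kappa>\<^esub> y \<oplus>\<^bsub>HM \<kappa>\<^esub> (iota (\<kappa> g), g) = x" .
        have "w \<odot>\<^bsub>HM \<kappa>\<^esub> y \<in> N" "(iota (\<kappa> g), g) \<in> N" using N w x(3) N.smult_closed by auto
        then show "x \<in> N" using Nadd e by metis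
      qed
    qed
  qed
  show "has_rank Z (HM \<kappa>) 1" unfolding has_rank_def
  proof (intro conjI exI allI impI)
    show "lin_indep_in Z (HM \<kappa>) {y}" unfolding lin_indep_in_def
    proof (intro conjI ballI impI)
      fix a s assume a: "a \<in> {y} \<rightarrow> carrier Z" "(\<Oplus>\<^bsub>HM \<kappa>\<^esub>s\<in>{y}. a s \<odot>\<^bsub>HM \<kappa>\<^esub> s) = \<zero>\<^bsub>HM \<kappa>\<^esub>" and s: "s \<in> {y}"
      have ay: "a y \<in> carrier Z" using a by auto
      then have "a y \<odot>\<^bsub>HM \<kappa>\<^esub> y = \<zero>\<^bsub>HM \<kappa>\<^esub>" using a(2) y by simp
      then have "iota (P ^ m) \<otimes>\<^bsub>Z\<^esub> a y = \<zero>\<^bsub>Z\<^esub>" using ay by (simp add: y_def HM_smult HM_zero ZR.m_comm)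
      then show "a s = \<zero>\<^bsub>Z\<^esub>" using Zp_torsion_free[OF ay] s by simp
    qed (use y in auto)
    show "card {y} = 1" by simp
    fix S assume S: "lin_indep_in Z (HM \<kappa>) S"
    then have fS: "finite S" and SM: "S \<subseteq> carrier (HM \<kappa>)"
      and ind: "\<And>a. a \<in> S \<rightarrow> carrier Z \<Longrightarrow> (\<Oplus>\<^bsub>HM \<kappa>\<^esub>s\<in>S. a s \<odot>\<^bsub>HM \<kappa>\<^esub> s) = \<zero>\<^bsub>HM \<kappa>\<^esub> \<Longrightarrow> \<forall>s\<in>S. a s = \<zero>\<^bsub>Z\<^esub>"
      unfolding lin_indep_in_def by auto
    have sum0: "(\<Oplus>\<^bsub>HM \<kappa>\<^esub>s\<in>S'. a s \<odot>\<^bsub>HM \<kappa>\<^esub> s) = \<zero>\<^bsub>HM \<kappa>\<^esub>"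
      if "S' \<subseteq> S" "\<And>s. s \<in> S' \<Longrightarrow> a s = \<zero>\<^bsub>Z\<^esub>" for a S'
      using that SM by (intro M.add.finprod_one_eqI) (auto simp: M.smult_l_null)
    have nz: "z \<noteq> \<zero>\<^bsub>Z\<^esub>" if zg: "(z, g) \<in> S" for z g
    proof
      assume z0: "z = \<zero>\<^bsub>Z\<^esub>"
      define a where "a s = (if s = (z, g) then iota (P ^ m) else \<zero>\<^bsub>Z\<^esub>)" for s :: "padic \<times> nat"
      have g: "g \<in> carrier G" "(z, g) \<in> carrier (HM \<kappa>)" using zg SM by (auto simp: HM_mem)
      have "(\<Oplus>\<^bsub>HM \<kappa>\<^esub>s\<in>insert (z, g) (S - {(z, g)}). a s \<odot>\<^bsub>HM \<kappa>\<^esub> s)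
        = a (z, g) \<odot>\<^bsub>HM \<kappa>\<^esub> (z, g) \<oplus>\<^bsub>HM \<kappa>\<^esub> (\<Oplus>\<^bsub>HM \<kappa>\<^esub>s\<in>S - {(z, g)}. a s \<odot>\<^bsub>HM \<kappa>\<^esub> s)"
        using fS SM g by (intro M.finsum_insert) (auto simp: a_def)
      also have "\<dots> = a (z, g) \<odot>\<^bsub>HM \<kappa>\<^esub> (z, g)"
        using g by (subst sum0) (auto simp: a_def)
      also have "\<dots> = \<zero>\<^bsub>HM \<kappa>\<^esub>"
        using act_kill[of "\<one>\<^bsub>Z\<^esub>" g] g by (simp add: a_def HM_smult HM_zero z0)
      finally have "\<forall>s\<in>S. a s = \<zero>\<^bsub>Z\<^esub>" using zg by (intro ind) (auto simp: a_def insert_absorb)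
      then have "iota (P ^ m) = iota 0" using zg by (auto simp: a_def iota_0)
      then show False using p_gt_1 by (simp add: iota_inj)
    qed
    show "card S \<le> 1"
    proof (rule ccontr)
      assume "\<not> card S \<le> 1"
      then obtain s t where st: "s \<in> S" "t \<in> S" "s \<noteq> t" using fS by (metis card_le_Suc0_iff_eq One_nat_def)
      obtain z g w h where zw: "s = (z, g)" "t = (w, h)" by (metis surj_pair)
      have c: "z \<in> carrier Z" "w \<in> carrier Z" "g \<in> carrier G" "h \<in> carrier G" "s \<in> carrier (HM \<kappa>)" "t \<in> carrier (HM \<kappa>)"
        using st SM by (auto simp: zw HM_mem)
      \<comment> \<open>With first coordinates \<open>z\<close> of \<open>s\<close> and
        \<open>w\<close> of \<open>t\<close>, the relation is \<open>|G| w s - |G| z t = 0\<close>;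
        the factor \<open>|G|\<close> kills the components in \<open>G\<close>.\<close>
      define a where "a u = (if u = s then iota (P ^ m) \<otimes>\<^bsub>Z\<^esub> w else if u = t then iota (P ^ m) \<otimes>\<^bsub>Z\<^esub> (\<ominus>\<^bsub>Z\<^esub> z) else \<zero>\<^bsub>Z\<^esub>)"
        for u :: "padic \<times> nat"
      have ac: "a u \<in> carrier Z" for u unfolding a_def using c by simp
      have "(\<Oplus>\<^bsub>HM \<kappa>\<^esub>u\<in>insert s (insert t (S - {s, t})). a u \<odot>\<^bsub>HM \<kappa>\<^esub> u)
        = a s \<odot>\<^bsub>HM \<kappa>\<^esub> s \<oplus>\<^bsub>HM \<kappa>\<^esub> (\<Oplus>\<^bsub>HM \<kappa>\<^esub>u\<in>insert t (S - {s, t}). a u \<odot>\<^bsub>HM \<kappa>\<^esub> u)"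
        using fS SM c st ac by (intro M.finsum_insert) auto
      also have "(\<Oplus>\<^bsub>HM \<kappa>\<^esub>u\<in>insert t (S - {s, t}). a u \<odot>\<^bsub>HM \<kappa>\<^esub> u)
        = a t \<odot>\<^bsub>HM \<kappa>\<^esub> t \<oplus>\<^bsub>HM \<kappa>\<^esub> (\<Oplus>\<^bsub>HM \<kappa>\<^esub>u\<in>S - {s, t}. a u \<odot>\<^bsub>HM \<kappa>\<^esub> u)"
        using fS SM c st ac by (intro M.finsum_insert) auto
      also have "(\<Oplus>\<^bsub>HM \<kappa>\<^esub>u\<in>S - {s, t}. a u \<odot>\<^bsub>HM \<kappa>\<^esub> u) = \<zero>\<^bsub>HM \<kappa>\<^esub>"
        by (rule sum0) (auto simp: a_def)
      also have "a t \<odot>\<^bsub>HM \<kappa>\<^esub> t \<oplus>\<^bsub>HM \<kappa>\<^esub> \<zero>\<^bsub>HM \<kappa>\<^esub> = a t \<odot>\<^bsub>HM \<kappa>\<^esub> t" using c ac by simp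
      also have "a s \<odot>\<^bsub>HM \<kappa>\<^esub> s \<oplus>\<^bsub>HM \<kappa>\<^esub> a t \<odot>\<^bsub>HM \<kappa>\<^esub> t = \<zero>\<^bsub>HM \<kappa>\<^esub>"
      proof -
        have "a s \<odot>\<^bsub>HM \<kappa>\<^esub> s = (iota (P ^ m) \<otimes>\<^bsub>Z\<^esub> w \<otimes>\<^bsub>Z\<^esub> z, \<one>)"
          using c act_kill by (simp add: a_def zw HM_smult)
        moreover have "a t \<odot>\<^bsub>HM \<kappa>\<^esub> t = (iota (P ^ m) \<otimes>\<^bsub>Z\<^esub> (\<ominus>\<^bsub>Z\<^esub> z) \<otimes>\<^bsub>Z\<^esub> w, \<one>)"
          using c st act_kill by (auto simp: a_def zw HM_smult)
        moreover have "iota (P ^ m) \<otimes>\<^bsub>Z\<^esub> w \<otimes>\<^bsub>Z\<^esub> z \<oplus>\<^bsub>Z\<^esub> iota (P ^ m) \<otimes>\<^bsub>Z\<^esub> (\<ominus>\<^bsub>Z\<^esub> z) \<otimes>\<^bsub>Z\<^esub> w = \<zero>\<^bsub>Z\<^esub>"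
          using c by (simp add: ZR.m_assoc ZR.m_comm[of w z] ZR.l_minus ZR.r_minus ZR.r_neg)
        ultimately show ?thesis by (simp add: HM_add HM_zero)
      qed
      finally have "(\<Oplus>\<^bsub>HM \<kappa>\<^esub>u\<in>insert s (insert t (S - {s, t})). a u \<odot>\<^bsub>HM \<kappa>\<^esub> u) = \<zero>\<^bsub>HM \<kappa>\<^esub>" .
      moreover have "insert s (insert t (S - {s, t})) = S" using st by auto
      ultimately have "\<forall>s\<in>S. a s = \<zero>\<^bsub>Z\<^esub>" using ac by (intro ind) auto
      then have "iota (P ^ m) \<otimes>\<^bsub>Z\<^esub> w = \<zero>\<^bsub>Z\<^esub>" using st unfolding a_def by metis
      then have "w = \<zero>\<^bsub>Z\<^esub>" by (rule Zp_torsion_free[OF c(2)])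
      then show False using nz st zw by blast
    qed
  qed
qed

lemma Delta0_prob_eq:
  assumes G: "G = class_rep C"
  shows "Delta0_prob p C C' = (\<Sum>\<kappa>\<in>chars. d_prob p (X1_class p (middle_term (ext_class \<kappa>))) C') / real (card (carrier G))"
proof -
  have fin: "finite (Ext p G)" using bij_ext_class finite_chars bij_betw_finite by blast
  have card: "card (Ext p G) = card (carrier G)" using bij_betw_same_card[OF bij_ext_class] card_chars by simp
  moreover have "card (carrier G) > 0" using fin_G G.one_closed by (auto simp: card_gt_0_iff)
  ultimately have ne: "Ext p G \<noteq> {}" by (metis card.empty less_irrefl)
  have "Delta0_prob p C C' = (\<Sum>\<xi>\<in>Ext p G. d_prob p (X1_class p (middle_term \<xi>)) C') / real (card (Ext p G))"
    unfolding Delta0_prob_def d_star_def G[symmetric] by (simp add: integral_pmf_of_set[OF ne fin])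
  also have "(\<Sum>\<xi>\<in>Ext p G. d_prob p (X1_class p (middle_term \<xi>)) C')
     = (\<Sum>\<kappa>\<in>chars. d_prob p (X1_class p (middle_term (ext_class \<kappa>))) C')"
    using sum.reindex_bij_betw[OF bij_ext_class, of "\<lambda>\<xi>. d_prob p (X1_class p (middle_term \<xi>)) C'"] by simp
  finally show ?thesis using card by simp
qed

text \<open>Two arbitrary choices intervene, an extension in its equivalence class and a module in
  the isomorphism class of the middle term. Both stay isomorphic to the model.\<close>

lemma middle_class_rep:
  assumes ch: "\<kappa> \<in> chars"
  obtains K g where "K = class_rep (X1_class p (middle_term (ext_class \<kappa>)))" "Module.module Z K"
    "g \<in> module_iso Z K (HM \<kappa>)"
proof -
  have Q: "ext_class \<kappa> \<in> Ext p G" by (rule bij_betw_apply[OF bij_ext_class ch])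
  have "class_rep (ext_class \<kappa>) \<in> ext_class \<kappa>"
    by (rule class_rep_in[OF equiv_ext_rel]) (use Q Ext_def in simp)
  then have r: "is_extension p G (class_rep (ext_class \<kappa>))"
    "equiv_extensions p (ext_of \<kappa>) (class_rep (ext_class \<kappa>))"
    unfolding Image_singleton_iff mem_Collect_eq case_prod_conv by blast+
  obtain H i q where e: "class_rep (ext_class \<kappa>) = (H, i, q)" by (rule prod_cases3)
  have H: "middle_term (ext_class \<kappa>) = H" unfolding middle_term_def e by (rule fst_conv)
  obtain f where "f \<in> module_iso Z (HM \<kappa>) H"
    using r(2)[unfolded e] unfolding ext_of_def equiv_extensions_def prod.case by (elim bexE)
  from module_iso_inv[OF HM_module[OF ch] this]
  have f: "inv_into (carrier (HM \<kappa>)) f \<in> module_iso Z H (HM \<kappa>)" .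
  have "Module.module Z H" using r(1) unfolding e by (rule is_extensionD(1))
  then obtain K g where
    K: "K = class_rep (X1_class p H)" "fg_rank1 p K" "g \<in> module_iso Z K (HM \<kappa>)"
    by (rule X1_class_rep[OF HM_fg_rank1[OF ch] f])
  show thesis
  proof (rule that)
    show "K = class_rep (X1_class p (middle_term (ext_class \<kappa>)))" unfolding H by (rule K(1))
    show "Module.module Z K" using K(2) unfolding fg_rank1_def by (rule conjunct1)
  qed (rule K(3))
qed

end

section \<open>Haar measure on modules of rank one\<close>

lemma digits_unique:
  fixes P c :: int and d :: "nat \<Rightarrow> int"
  assumes P: "P > 1" and d: "\<And>i. 0 \<le> d i \<and> d i < P"
  shows "(\<Sum>i<k. d i * P ^ i) = c mod P ^ k \<longleftrightarrow> (\<forall>i<k. d i = c div P ^ i mod P)"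
proof (induction k)
  case 0
  then show ?case by simp
next
  case (Suc k)
  let ?S = "\<Sum>i<k. d i * P ^ i"
  have S: "0 \<le> ?S \<and> ?S < P ^ k"
  proof (induction k)
    case (Suc k)
    have "d k * P ^ k \<le> (P - 1) * P ^ k" using d[of k] P by (intro mult_right_mono) auto
    then show ?case using Suc d[of k] P by (simp add: algebra_simps)
  qed simp
  have c: "c mod P ^ Suc k = c mod P ^ k + (c div P ^ k mod P) * P ^ k"
    using zmod_zmult2_eq[of P c "P ^ k"] P by (simp add: mult.commute)
  have r: "0 \<le> c mod P ^ k" "c mod P ^ k < P ^ k" using P by simp_all
  have "?S + d k * P ^ k = c mod P ^ k + (c div P ^ k mod P) * P ^ k
      \<longleftrightarrow> ?S = c mod P ^ k \<and> d k = c div P ^ k mod P" (is "?L \<longleftrightarrow> ?R")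
  proof
    assume L: ?L
    have "(?S + d k * P ^ k) div P ^ k = d k" using S P by simp
    moreover have "(c mod P ^ k + (c div P ^ k mod P) * P ^ k) div P ^ k = c div P ^ k mod P"
      using r P by simp
    ultimately have "d k = c div P ^ k mod P" using L by simp
    then show ?R using L by simp
  qed simp
  then show ?case using Suc c by (auto simp: less_Suc_eq)
qed

text \<open>A module known only through coordinates in the model \<open>HM \<kappa>\<close>, so that
  the same results apply to the model itself and to whichever representative has been
  chosen.\<close>

locale rank1 = pgroup p G m for p and G :: "nat monoid" (structure) and m +
  fixes \<kappa> :: "nat \<Rightarrow> int" and K :: "(padic, 'k) module"
    and \<zeta> :: "'k \<Rightarrow> padic" and \<gamma> :: "'k \<Rightarrow> nat"
  assumes ch: "\<kappa> \<in> chars" and K_module: "Module.module Z K"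
    and coords: "bij_betw (\<lambda>x. (\<zeta> x, \<gamma> x)) (carrier K) (carrier (HM \<kappa>))"
    and zeta_add: "\<And>x y. x \<in> carrier K \<Longrightarrow> y \<in> carrier K \<Longrightarrow> \<zeta> (x \<oplus>\<^bsub>K\<^esub> y) = \<zeta> x \<oplus>\<^bsub>Z\<^esub> \<zeta> y"
    and gamma_add: "\<And>x y. x \<in> carrier K \<Longrightarrow> y \<in> carrier K \<Longrightarrow> \<gamma> (x \<oplus>\<^bsub>K\<^esub> y) = \<gamma> x \<otimes> \<gamma> y"
    and zeta_smult: "\<And>r x. r \<in> carrier Z \<Longrightarrow> x \<in> carrier K \<Longrightarrow> \<zeta> (r \<odot>\<^bsub>K\<^esub> x) = r \<otimes>\<^bsub>Z\<^esub> \<zeta> x"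
    and gamma_smult: "\<And>r x. r \<in> carrier Z \<Longrightarrow> x \<in> carrier K \<Longrightarrow> \<gamma> (r \<odot>\<^bsub>K\<^esub> x) = act r (\<gamma> x)"
begin

sublocale K: Module.module Z K by (rule K_module)

lemma coord_mem: "x \<in> carrier K \<Longrightarrow> (\<zeta> x, \<gamma> x) \<in> carrier (HM \<kappa>)"
  using bij_betw_apply[OF coords] by simp

lemma zeta_closed [simp]: "x \<in> carrier K \<Longrightarrow> \<zeta> x \<in> carrier Z"
  and gamma_closed [simp]: "x \<in> carrier K \<Longrightarrow> \<gamma> x \<in> carrier G"
  and zeta_gamma: "x \<in> carrier K \<Longrightarrow> \<zeta> x m = \<kappa> (\<gamma> x)"
  using coord_mem by (simp_all add: HM_mem)

lemma coord_eqI: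
  assumes "x \<in> carrier K" "y \<in> carrier K" "\<zeta> x = \<zeta> y" "\<gamma> x = \<gamma> y"
  shows "x = y"
  using coords assms unfolding bij_betw_def by (auto dest: inj_onD)

lemma coord_ex:
  assumes "z \<in> carrier Z" "g \<in> carrier G" "z m = \<kappa> g"
  obtains x where "x \<in> carrier K" "\<zeta> x = z" "\<gamma> x = g"
proof -
  have "(z, g) \<in> (\<lambda>x. (\<zeta> x, \<gamma> x)) ` carrier K"
    using coords assms unfolding bij_betw_def by (simp add: HM_mem)
  then show thesis using that by blast
qed

lemma zeta_zero [simp]: "\<zeta> \<zero>\<^bsub>K\<^esub> = \<zero>\<^bsub>Z\<^esub>"
  using zeta_smult[of "\<zero>\<^bsub>Z\<^esub>" "\<zero>\<^bsub>K\<^esub>"] by simp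
lemma gamma_zero [simp]: "\<gamma> \<zero>\<^bsub>K\<^esub> = \<one>"
  using gamma_add[of "\<zero>\<^bsub>K\<^esub>" "\<zero>\<^bsub>K\<^esub>"] G.l_cancel_one[of "\<gamma> \<zero>\<^bsub>K\<^esub>" "\<gamma> \<zero>\<^bsub>K\<^esub>"] by simp

lemma zeta_minus: "x \<in> carrier K \<Longrightarrow> \<zeta> (\<ominus>\<^bsub>K\<^esub> x) = \<ominus>\<^bsub>Z\<^esub> \<zeta> x"
  using zeta_add[of "\<ominus>\<^bsub>K\<^esub> x" x] ZR.minus_equality[of "\<zeta> (\<ominus>\<^bsub>K\<^esub> x)" "\<zeta> x"] by (simp add: K.l_neg)
lemma gamma_minus: "x \<in> carrier K \<Longrightarrow> \<gamma> (\<ominus>\<^bsub>K\<^esub> x) = inv (\<gamma> x)"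
  using gamma_add[of "\<ominus>\<^bsub>K\<^esub> x" x] G.inv_equality[of "\<gamma> (\<ominus>\<^bsub>K\<^esub> x)" "\<gamma> x"] by (simp add: K.l_neg)

section \<open>Cylinder sets and the topology of a module of rank one\<close>

definition Cyl :: "nat \<Rightarrow> int \<Rightarrow> nat \<Rightarrow> 'k set" where
  "Cyl N a b = {x \<in> carrier K. \<zeta> x N = a \<and> \<gamma> x = b}"

text \<open>The residue of the first coordinate modulo \<open>|G|\<close> is determined by the
  component in \<open>G\<close>; from level \<open>m\<close> on, all nonempty cylinders of one level
  have the same mass. The whole space is added as the covering set for the uniqueness theorem on
  measures.\<close>

definition Cyls :: "'k set set" where
  "Cyls = insert (carrier K) {Cyl N a b | N a b. m \<le> N}"

lemma CylsI: "m \<le> N \<Longrightarrow> Cyl N a b \<in> Cyls" unfolding Cyls_def by blast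

lemma Cyl_sub: "Cyl N a b \<subseteq> carrier K" by (auto simp: Cyl_def)

lemma Cyls_Pow: "Cyls \<subseteq> Pow (carrier K)" using Cyl_sub by (auto simp: Cyls_def)

lemma Cyl_mono: "x \<in> carrier K \<Longrightarrow> N \<le> N' \<Longrightarrow> Cyl N' (\<zeta> x N') (\<gamma> x) \<subseteq> Cyl N (\<zeta> x N) (\<gamma> x)"
  unfolding Cyl_def using Zp_mod by (auto, metis zeta_closed)

text \<open>Two cylinders are nested or disjoint, like balls in an ultrametric space.\<close>

lemma Int_stable_Cyls: "Int_stable Cyls"
proof (rule Int_stableI)
  fix A B assume AB: "A \<in> Cyls" "B \<in> Cyls"
  have cc: "Cyl N a b \<inter> Cyl N' a' b' \<in> Cyls" if "m \<le> N" "N \<le> N'" for N N' a b a' b'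
  proof (cases "Cyl N a b \<inter> Cyl N' a' b' = {}")
    case True
    \<comment> \<open>A residue is never negative, so \<open>-1\<close> exhibits the empty set as a
      member of \<open>Cyls\<close>.\<close>
    have "Cyl m (-1) b = {}" unfolding Cyl_def using Zp_range(1) zeta_closed
      by (auto, metis neg_0_le_iff_le not_one_le_zero)
    then show ?thesis using True unfolding Cyls_def by force
  next
    case False
    then obtain x where x: "x \<in> Cyl N a b" "x \<in> Cyl N' a' b'" by blast
    then have "x \<in> carrier K" "a = \<zeta> x N" "b = \<gamma> x" "a' = \<zeta> x N'" "b' = \<gamma> x" by (auto simp: Cyl_def)
    then have "Cyl N' a' b' \<subseteq> Cyl N a b" using Cyl_mono that(2) by blast
    then have "Cyl N a b \<inter> Cyl N' a' b' = Cyl N' a' b'" by blast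
    then show ?thesis using CylsI that by (metis le_trans)
  qed
  have cc': "Cyl N a b \<inter> Cyl N' a' b' \<in> Cyls" if "m \<le> N" "m \<le> N'" for N N' a b a' b'
    using cc[of N N' a b a' b'] cc[of N' N a' b' a b] that by (metis Int_commute nle_le)
  show "A \<inter> B \<in> Cyls"
  proof (cases "A = carrier K \<or> B = carrier K")
    case True
    then have "A \<inter> B = B \<or> A \<inter> B = A" using AB Cyls_Pow by blast
    then show ?thesis using AB by metis
  next
    case False
    then obtain N a b N' a' b' where "A = Cyl N a b" "m \<le> N" "B = Cyl N' a' b'" "m \<le> N'"
      using AB unfolding Cyls_def by blast
    then show ?thesis using cc' by simp
  qed
qed

abbreviation opn :: "'k set \<Rightarrow> bool" where "opn \<equiv> padic_open p K"
abbreviation mpow :: "nat \<Rightarrow> 'k \<Rightarrow> 'k" where "mpow n h \<equiv> iota (P ^ n) \<odot>\<^bsub>K\<^esub> h"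

lemma opn_iff: "opn U \<longleftrightarrow> U \<subseteq> carrier K \<and> (\<forall>x\<in>U. \<exists>n. \<forall>h\<in>carrier K. x \<oplus>\<^bsub>K\<^esub> mpow n h \<in> U)"
  unfolding padic_open_def using add_pow_smult[OF K_module, of _ "p ^ _"] by simp

lemma mpow_zeta: "h \<in> carrier K \<Longrightarrow> \<zeta> (mpow n h) = iota (P ^ n) \<otimes>\<^bsub>Z\<^esub> \<zeta> h"
  by (simp add: zeta_smult)

lemma mpow_gamma: "h \<in> carrier K \<Longrightarrow> m \<le> n \<Longrightarrow> \<gamma> (mpow n h) = \<one>"
proof -
  assume h: "h \<in> carrier K" "m \<le> n"
  have "iota (P ^ n) = iota (P ^ m) \<otimes>\<^bsub>Z\<^esub> iota (P ^ (n - m))"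
    using h(2) by (simp add: iota_mult[symmetric] power_add[symmetric])
  then show ?thesis using h by (simp add: gamma_smult act_kill)
qed

text \<open>The level is \<open>n + m\<close> because the difference of the two points is
  \<open>P ^ n\<close> times a point with first coordinate \<open>P ^ m * w\<close> and trivial
  second coordinate, and the factor \<open>P ^ m\<close> is what puts that point into the
  module.\<close>

lemma Cyl_near:
  assumes x: "x \<in> carrier K" and y: "y \<in> Cyl (n + m) (\<zeta> x (n + m)) (\<gamma> x)"
  obtains h where "h \<in> carrier K" "y = x \<oplus>\<^bsub>K\<^esub> mpow n h"
proof -
  have yK: "y \<in> carrier K" "\<zeta> y (n + m) = \<zeta> x (n + m)" "\<gamma> y = \<gamma> x" using y by (auto simp: Cyl_def)
  define d where "d = y \<ominus>\<^bsub>K\<^esub> x"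
  have d: "d \<in> carrier K" unfolding d_def using x yK by simp
  have zd: "\<zeta> d = \<zeta> y \<ominus>\<^bsub>Z\<^esub> \<zeta> x" unfolding d_def using x yK
    by (simp add: K.minus_eq zeta_add zeta_minus ZR.minus_eq)
  have "\<zeta> d (n + m) = 0" unfolding zd using x yK
    by (simp add: ZR.minus_eq Zp_add_at Zp_minus_at mod_simps)
  then obtain w where w: "w \<in> carrier Z" "\<zeta> d = iota (P ^ (n + m)) \<otimes>\<^bsub>Z\<^esub> w"
    using Zp_divide[of "\<zeta> d" "n + m"] d by (metis zeta_closed)
  have "(iota (P ^ m) \<otimes>\<^bsub>Z\<^esub> w) m = \<kappa> \<one>" using P_mult_at_m[OF w(1)] chars_one[OF ch] by simp
  then obtain h where h: "h \<in> carrier K" "\<zeta> h = iota (P ^ m) \<otimes>\<^bsub>Z\<^esub> w" "\<gamma> h = \<one>"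
    using coord_ex[of "iota (P ^ m) \<otimes>\<^bsub>Z\<^esub> w" \<one>] w(1) by auto
  have "mpow n h = d"
  proof (rule coord_eqI)
    show "\<zeta> (mpow n h) = \<zeta> d" using h w
      by (simp add: zeta_smult power_add iota_mult ZR.m_assoc)
    show "\<gamma> (mpow n h) = \<gamma> d" using h x yK
      by (simp add: gamma_smult d_def K.minus_eq gamma_add gamma_minus)
  qed (use h d in auto)
  moreover have "x \<oplus>\<^bsub>K\<^esub> d = y"
  proof -
    have "x \<oplus>\<^bsub>K\<^esub> d = d \<oplus>\<^bsub>K\<^esub> x" using x d by (rule K.a_comm)
    then show ?thesis unfolding d_def using x yK by (simp add: K.minus_eq K.a_assoc K.l_neg)
  qed
  ultimately show thesis using that h by metis
qed

lemma opn_Cyl: "m \<le> N \<Longrightarrow> opn (Cyl N a b)"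
  unfolding opn_iff
proof (intro conjI ballI)
  show "Cyl N a b \<subseteq> carrier K" by (rule Cyl_sub)
  fix x assume N: "m \<le> N" and "x \<in> Cyl N a b"
  then have x: "x \<in> carrier K" "a = \<zeta> x N" "b = \<gamma> x" by (auto simp: Cyl_def)
  have "x \<oplus>\<^bsub>K\<^esub> mpow N h \<in> Cyl N a b" if h: "h \<in> carrier K" for h
    unfolding Cyl_def using x h N
    by (simp add: zeta_add mpow_zeta gamma_add mpow_gamma Zp_add_at iota_mult_at Zp_mod_self)
  then show "\<exists>n. \<forall>h\<in>carrier K. x \<oplus>\<^bsub>K\<^esub> mpow n h \<in> Cyl N a b" by blast
qed

lemma opn_carrier: "opn (carrier K)"
  unfolding opn_iff by auto

text \<open>There are only countably many cylinders, so this puts the open sets into the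
  sigma-algebra that the cylinders generate.\<close>

lemma opn_Union_Cyl:
  assumes "opn U"
  shows "U = (\<Union>(N, a, b) \<in> {(N, a, b). m \<le> N \<and> Cyl N a b \<subseteq> U}. Cyl N a b)"
proof
  show "U \<subseteq> (\<Union>(N, a, b) \<in> {(N, a, b). m \<le> N \<and> Cyl N a b \<subseteq> U}. Cyl N a b)"
  proof
    fix x assume x: "x \<in> U"
    obtain n where n: "\<And>h. h \<in> carrier K \<Longrightarrow> x \<oplus>\<^bsub>K\<^esub> mpow n h \<in> U"
      using assms x unfolding opn_iff by blast
    have xK: "x \<in> carrier K" using assms x unfolding opn_iff by blast
    have "Cyl (n + m) (\<zeta> x (n + m)) (\<gamma> x) \<subseteq> U"
    proof
      fix y assume "y \<in> Cyl (n + m) (\<zeta> x (n + m)) (\<gamma> x)"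
      then obtain h where "h \<in> carrier K" "y = x \<oplus>\<^bsub>K\<^esub> mpow n h" by (rule Cyl_near[OF xK])
      then show "y \<in> U" using n by simp
    qed
    moreover have "x \<in> Cyl (n + m) (\<zeta> x (n + m)) (\<gamma> x)" using xK by (simp add: Cyl_def)
    ultimately show "x \<in> (\<Union>(N, a, b) \<in> {(N, a, b). m \<le> N \<and> Cyl N a b \<subseteq> U}. Cyl N a b)"
      by (intro UN_I[of "(n + m, \<zeta> x (n + m), \<gamma> x)"]) simp_all
  qed
qed auto

lemma sigma_Cyls: "sigma_sets (carrier K) (Collect opn) = sigma_sets (carrier K) Cyls"
proof (rule sigma_sets_eqI)
  fix U assume "U \<in> Collect opn"
  then have "opn U" by simp
  note e = opn_Union_Cyl[OF this]
  have "countable {(N, a, b). m \<le> N \<and> Cyl N a b \<subseteq> U}" by (rule countableI_type)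
  then have "(\<Union>(N, a, b) \<in> {(N, a, b). m \<le> N \<and> Cyl N a b \<subseteq> U}. Cyl N a b) \<in> sigma_sets (carrier K) Cyls"
    by (rule sigma_sets_UNION[OF countable_image]) (auto simp: Cyls_def intro!: sigma_sets.Basic)
  then show "U \<in> sigma_sets (carrier K) Cyls" using e by simp
next
  fix U assume "U \<in> Cyls"
  then have "opn U" using opn_Cyl opn_carrier unfolding Cyls_def by auto
  then show "U \<in> sigma_sets (carrier K) (Collect opn)" by (intro sigma_sets.Basic) simp
qed

text \<open>The criterion for a cylinder of level at least \<open>m\<close> to be nonempty, as
  \<open>Cyl_empty\<close> and \<open>Cyl_point\<close> confirm.\<close>

definition valid :: "nat \<Rightarrow> int \<Rightarrow> nat \<Rightarrow> bool" where
  "valid N a b \<longleftrightarrow> 0 \<le> a \<and> a < P ^ N \<and> b \<in> carrier G \<and> a mod P ^ m = \<kappa> b"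

lemma Cyl_empty: "m \<le> N \<Longrightarrow> \<not> valid N a b \<Longrightarrow> Cyl N a b = {}"
proof (rule ccontr)
  assume N: "m \<le> N" and v: "\<not> valid N a b" and "Cyl N a b \<noteq> {}"
  then obtain x where x: "x \<in> carrier K" "\<zeta> x N = a" "\<gamma> x = b" by (auto simp: Cyl_def)
  have "valid N a b" unfolding valid_def
    using x Zp_range[OF zeta_closed[OF x(1)], of N] Zp_mod[OF zeta_closed[OF x(1)] N] zeta_gamma[OF x(1)] by auto
  then show False using v by simp
qed

lemma Cyl_point:
  assumes "m \<le> N" "valid N a b"
  obtains x where "x \<in> carrier K" "a = \<zeta> x N" "b = \<gamma> x"
proof -
  have "iota a m = \<kappa> b" "iota a N = a" using assms by (auto simp: valid_def iota_at)
  then show thesis using that coord_ex[of "iota a" b] assms by (metis iota_closed valid_def)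
qed

subsection \<open>Existence of Haar measure\<close>

text \<open>Coordinate \<open>0\<close> is a uniform element of the group \<open>G\<close>, the other coordinates are the digits of a
  random p-adic integer.\<close>

definition coin :: "nat \<Rightarrow> nat measure" where
  "coin i = (if i = 0 then measure_pmf (pmf_of_set (carrier G)) else measure_pmf (pmf_of_set {0..<p}))"

definition \<Omega> :: "(nat \<Rightarrow> nat) measure" where "\<Omega> = PiM UNIV coin"

lemma coin_simps [simp]: "sets (coin i) = UNIV" "space (coin i) = UNIV"
  by (auto simp: coin_def)

lemma space_Omega [simp]: "space \<Omega> = UNIV"
  by (simp add: \<Omega>_def space_PiM PiE_UNIV_domain Pi_def)

lemma coin_product: "product_prob_space coin"
proof (rule product_prob_spaceI)
  fix i show "prob_space (coin i)" by (cases "i = 0") (simp_all add: coin_def measure_pmf.prob_space_axioms)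
qed

text \<open>Sample points are arbitrary sequences of naturals. The reduction \<open>mod p\<close>
  here and the default \<open>\<one>\<close> in \<open>bval\<close> give meaning to points outside
  the support of \<open>coin\<close>.\<close>

definition zval :: "(nat \<Rightarrow> nat) \<Rightarrow> padic" where
  "zval \<omega> = (\<lambda>n. (\<Sum>i<n. int (\<omega> (Suc i) mod p) * P ^ i) mod P ^ n)"

lemma zval_closed: "zval \<omega> \<in> carrier Z"
  unfolding zval_def by (rule Zp_mk) simp

definition bval :: "(nat \<Rightarrow> nat) \<Rightarrow> nat" where
  "bval \<omega> = (if \<omega> 0 \<in> carrier G then \<omega> 0 else \<one>)"

text \<open>Over a given element of \<open>G\<close> the admissible first coordinates are the value
  of \<open>\<kappa>\<close> there plus \<open>|G|\<close> times a free p-adic integer, and that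
  integer is drawn digit by digit.\<close>

definition xval :: "(nat \<Rightarrow> nat) \<Rightarrow> 'k" where
  "xval \<omega> = (SOME x. x \<in> carrier K \<and> \<gamma> x = bval \<omega> \<and> \<zeta> x = iota (\<kappa> (bval \<omega>)) \<oplus>\<^bsub>Z\<^esub> iota (P ^ m) \<otimes>\<^bsub>Z\<^esub> zval \<omega>)"

lemma bval_closed [simp]: "bval \<omega> \<in> carrier G" by (simp add: bval_def)

lemma xval: "xval \<omega> \<in> carrier K" "\<gamma> (xval \<omega>) = bval \<omega>"
  "\<zeta> (xval \<omega>) = iota (\<kappa> (bval \<omega>)) \<oplus>\<^bsub>Z\<^esub> iota (P ^ m) \<otimes>\<^bsub>Z\<^esub> zval \<omega>"
proof -
  let ?z = "iota (\<kappa> (bval \<omega>)) \<oplus>\<^bsub>Z\<^esub> iota (P ^ m) \<otimes>\<^bsub>Z\<^esub> zval \<omega>"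
  have "?z m = \<kappa> (bval \<omega>)"
    using chr_mod[OF ch bval_closed] by (simp add: Zp_add_at iota_mult_at iota_at)
  then obtain x where "x \<in> carrier K" "\<zeta> x = ?z" "\<gamma> x = bval \<omega>"
    using coord_ex[of ?z "bval \<omega>"] zval_closed by auto
  then have "\<exists>x. x \<in> carrier K \<and> \<gamma> x = bval \<omega> \<and> \<zeta> x = ?z" by blast
  from someI_ex[OF this] show "xval \<omega> \<in> carrier K" "\<gamma> (xval \<omega>) = bval \<omega>" "\<zeta> (xval \<omega>) = ?z"
    unfolding xval_def by auto
qed

text \<open>A cylinder of level \<open>k + m\<close> constrains \<open>k + 1\<close> independent
  coordinates: the component in \<open>G\<close>, which carries the residue modulo
  \<open>|G|\<close>, and the next \<open>k\<close> digits.\<close>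

lemma xval_Cyl:
  assumes v: "valid (k + m) a b"
  shows "xval \<omega> \<in> Cyl (k + m) a b \<longleftrightarrow>
    bval \<omega> = b \<and> (\<forall>i<k. \<omega> (Suc i) mod p = nat ((a div P ^ m) div P ^ i mod P))"
proof -
  define c where "c = a div P ^ m"
  have a: "a = a mod P ^ m + P ^ m * c" unfolding c_def by simp
  have ab: "a mod P ^ m = \<kappa> b" using v by (simp add: valid_def)
  have kb: "0 \<le> \<kappa> (bval \<omega>)" "\<kappa> (bval \<omega>) < P ^ m" using chr_range[OF ch bval_closed] by auto
  have zk: "0 \<le> zval \<omega> k" "zval \<omega> k < P ^ k" using Zp_range[OF zval_closed] by auto
  have c_range: "0 \<le> c" "c < P ^ k"
  proof -
    show "0 \<le> c" unfolding c_def using v P_pos by (simp add: valid_def pos_imp_zdiv_nonneg_iff)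
    have "0 \<le> a mod P ^ m" using P_pos by simp
    then have "P ^ m * c \<le> a" using a by linarith
    also have "a < P ^ m * P ^ k" using v by (simp add: valid_def power_add mult.commute)
    finally show "c < P ^ k" using P_pos[of m] by (simp add: mult_less_cancel_left_pos)
  qed
  have "\<zeta> (xval \<omega>) (k + m) = (\<kappa> (bval \<omega>) + (P ^ m * zval \<omega> (k + m)) mod P ^ (k + m)) mod P ^ (k + m)"
    unfolding xval(3) by (simp only: Zp_add_at iota_mult_at iota_at mod_simps)
  also have "(P ^ m * zval \<omega> (k + m)) mod P ^ (k + m) = P ^ m * zval \<omega> k"
    using P_mult_mod[of m "zval \<omega> (k + m)" k] Zp_mod[OF zval_closed, of k "k + m"] by simp
  also have "(\<kappa> (bval \<omega>) + P ^ m * zval \<omega> k) mod P ^ (k + m) = \<kappa> (bval \<omega>) + P ^ m * zval \<omega> k"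
  proof (rule mod_pos_pos_trivial)
    show "0 \<le> \<kappa> (bval \<omega>) + P ^ m * zval \<omega> k" using kb zk by simp
    have "P ^ m * zval \<omega> k \<le> P ^ m * (P ^ k - 1)" using zk P_pos[of m] by (intro mult_left_mono) auto
    then show "\<kappa> (bval \<omega>) + P ^ m * zval \<omega> k < P ^ (k + m)"
      using kb by (simp add: power_add algebra_simps)
  qed
  finally have z: "\<zeta> (xval \<omega>) (k + m) = \<kappa> (bval \<omega>) + P ^ m * zval \<omega> k" .
  have "xval \<omega> \<in> Cyl (k + m) a b \<longleftrightarrow> bval \<omega> = b \<and> \<kappa> b + P ^ m * zval \<omega> k = \<kappa> b + P ^ m * c"
    using a ab xval(1) by (auto simp: Cyl_def xval(2) z)
  also have "\<dots> \<longleftrightarrow> bval \<omega> = b \<and> zval \<omega> k = c" using P_gt_1 by simp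
  also have "zval \<omega> k = c \<longleftrightarrow> (\<Sum>i<k. int (\<omega> (Suc i) mod p) * P ^ i) = c mod P ^ k"
  proof -
    let ?S = "\<Sum>i<k. int (\<omega> (Suc i) mod p) * P ^ i"
    have "0 \<le> ?S \<and> ?S < P ^ k"
    proof (induction k)
      case (Suc k)
      have r: "0 \<le> int (\<omega> (Suc k) mod p)" "int (\<omega> (Suc k) mod p) < P" using p_gt_1 by auto
      have "int (\<omega> (Suc k) mod p) * P ^ k \<le> (P - 1) * P ^ k" using r by (intro mult_right_mono) auto
      then show ?case using Suc by (simp add: algebra_simps)
    qed simp
    then have "?S mod P ^ k = ?S" by simp
    moreover have "c mod P ^ k = c" using c_range by simp
    ultimately show ?thesis unfolding zval_def by simp
  qed
  also have "\<dots> \<longleftrightarrow> (\<forall>i<k. int (\<omega> (Suc i) mod p) = c div P ^ i mod P)"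
    by (rule digits_unique) (use p_gt_1 in auto)
  also have "\<dots> \<longleftrightarrow> (\<forall>i<k. \<omega> (Suc i) mod p = nat (c div P ^ i mod P))"
  proof -
    have "int x = y \<longleftrightarrow> x = nat y" if "0 \<le> y" for x y using that by auto
    then show ?thesis using P_gt_1 by simp
  qed
  finally show ?thesis unfolding c_def .
qed

lemma emeasure_xval:
  assumes v: "valid (k + m) a b"
  shows "emeasure \<Omega> {\<omega>. xval \<omega> \<in> Cyl (k + m) a b} = ennreal (1 / real p ^ (k + m))"
    and "{\<omega>. xval \<omega> \<in> Cyl (k + m) a b} \<in> sets \<Omega>"
proof -
  define c where "c i = nat ((a div P ^ m) div P ^ i mod P)" for i
  have c: "c i < p" for i unfolding c_def using P_gt_1 by (simp add: nat_less_iff)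
  define X where "X i = (case i of 0 \<Rightarrow> {g. (if g \<in> carrier G then g else \<one>) = b} | Suc j \<Rightarrow> {d. d mod p = c j})" for i
  have eq: "{\<omega>. xval \<omega> \<in> Cyl (k + m) a b} = {\<omega> \<in> space (PiM UNIV coin). \<forall>i\<in>{..k}. \<omega> i \<in> X i}"
  proof -
    have "(\<forall>i\<in>{..k}. \<omega> i \<in> X i) \<longleftrightarrow> bval \<omega> = b \<and> (\<forall>i<k. \<omega> (Suc i) mod p = c i)" for \<omega>
    proof -
      have "{..k} = insert 0 (Suc ` {..<k})" by (auto simp: image_iff) (metis Suc_le_eq lessThan_iff not0_implies_Suc)
      then show ?thesis by (auto simp: X_def bval_def)
    qed
    then show ?thesis using space_Omega by (auto simp: xval_Cyl[OF v] c_def \<Omega>_def)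
  qed
  have ne: "carrier G \<noteq> {}" "{0..<p} \<noteq> {}" using G.one_closed p_gt_1 by auto
  have b: "b \<in> carrier G" using v by (simp add: valid_def)
  have "emeasure (PiM UNIV coin) {\<omega> \<in> space (PiM UNIV coin). \<forall>i\<in>{..k}. \<omega> i \<in> X i} = (\<Prod>i\<in>{..k}. emeasure (coin i) (X i))"
    by (rule product_prob_space.emeasure_PiM_Collect[OF coin_product]) auto
  also have "\<dots> = (\<Prod>i\<in>{..k}. ennreal (if i = 0 then 1 / real p ^ m else 1 / real p))"
  proof (rule prod.cong[OF refl])
    fix i assume "i \<in> {..k}"
    show "emeasure (coin i) (X i) = ennreal (if i = 0 then 1 / real p ^ m else 1 / real p)"
    proof (cases i)
      case 0
      have "carrier G \<inter> X 0 = {b}" using b by (auto simp: X_def)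
      then show ?thesis using 0 ne fin_G by (simp add: coin_def emeasure_pmf_of_set card_G)
    next
      case (Suc j)
      have "{0..<p} \<inter> X (Suc j) = {c j}" using c[of j] by (auto simp: X_def)
      then show ?thesis using Suc ne by (simp add: coin_def emeasure_pmf_of_set)
    qed
  qed
  also have "\<dots> = ennreal (\<Prod>i\<in>{..k}. (if i = 0 then 1 / real p ^ m else 1 / real p))"
    by (rule prod_ennreal) auto
  also have "(\<Prod>i\<in>{..k}. (if i = 0 then 1 / real p ^ m else 1 / real p)) = 1 / real p ^ (k + m)"
    by (induction k) (auto simp: power_add)
  finally show "emeasure \<Omega> {\<omega>. xval \<omega> \<in> Cyl (k + m) a b} = ennreal (1 / real p ^ (k + m))"
    unfolding eq \<Omega>_def .
  have "{\<omega> \<in> space (PiM UNIV coin). \<forall>i\<in>{..k}. \<omega> i \<in> X i} \<in> sets (PiM UNIV coin)"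
  proof -
    have [measurable]: "(\<lambda>x. x i) \<in> measurable (PiM UNIV coin) (count_space UNIV)" for i
      using measurable_component_singleton[of i UNIV coin]
      by (simp add: measurable_cong_sets[OF refl, of "coin i" "count_space UNIV"])
    show ?thesis by measurable
  qed
  then show "{\<omega>. xval \<omega> \<in> Cyl (k + m) a b} \<in> sets \<Omega>" unfolding eq \<Omega>_def .
qed

definition MK :: "'k measure" where "MK = distr \<Omega> (sigma (carrier K) Cyls) xval"

lemma sets_MK: "sets MK = sigma_sets (carrier K) Cyls" and space_MK: "space MK = carrier K"
  using Cyls_Pow by (simp_all add: MK_def sets_measure_of space_measure_of)

lemma measurable_xval: "xval \<in> measurable \<Omega> (sigma (carrier K) Cyls)"
proof (rule measurable_measure_of[OF Cyls_Pow])
  show "xval \<in> space \<Omega> \<rightarrow> carrier K" using xval(1) by simp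
  fix A assume "A \<in> Cyls"
  then consider "A = carrier K" | N a b where "m \<le> N" "A = Cyl N a b" unfolding Cyls_def by blast
  then show "xval -` A \<inter> space \<Omega> \<in> sets \<Omega>"
  proof cases
    case 1
    then have "xval -` A \<inter> space \<Omega> = space \<Omega>" using xval(1) by auto
    then show ?thesis by (simp only: sets.top)
  next
    case 2
    have N: "N = (N - m) + m" using 2 by simp
    show ?thesis
    proof (cases "valid N a b")
      case True
      have "{\<omega>. xval \<omega> \<in> Cyl ((N - m) + m) a b} \<in> sets \<Omega>"
        by (rule emeasure_xval(2)) (use True N in simp)
      then show ?thesis using 2 N by (simp add: vimage_def)
    next
      case False
      then show ?thesis using Cyl_empty[OF 2(1) False] 2 by simp
    qed
  qed
qed

lemma MK_Cyl:
  assumes "m \<le> N" "valid N a b"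
  shows "emeasure MK (Cyl N a b) = ennreal (1 / real p ^ N)"
proof -
  have N: "N = (N - m) + m" using assms by simp
  have "Cyl N a b \<in> sets (sigma (carrier K) Cyls)"
    using Cyls_Pow CylsI[OF assms(1)] by (simp add: sets_measure_of sigma_sets.Basic)
  then have "emeasure MK (Cyl N a b) = emeasure \<Omega> (xval -` Cyl N a b \<inter> space \<Omega>)"
    unfolding MK_def by (rule emeasure_distr[OF measurable_xval])
  also have "\<dots> = emeasure \<Omega> {\<omega>. xval \<omega> \<in> Cyl ((N - m) + m) a b}" using N by (simp add: vimage_def)
  also have "\<dots> = ennreal (1 / real p ^ ((N - m) + m))"
    by (rule emeasure_xval(1)) (use assms N in simp)
  finally show ?thesis using N by simp
qed

lemma prob_space_MK: "prob_space MK"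
  unfolding MK_def
proof (rule prob_space.prob_space_distr[OF _ measurable_xval])
  show "prob_space \<Omega>" unfolding \<Omega>_def
    by (rule prob_space_PiM) (auto simp: coin_def measure_pmf.prob_space_axioms)
qed

lemma measure_eq_Cyls:
  assumes "sets M = sigma_sets (carrier K) Cyls" "sets N = sigma_sets (carrier K) Cyls"
    "emeasure M (carrier K) = 1" "emeasure N (carrier K) = 1"
    "\<And>n a b. m \<le> n \<Longrightarrow> valid n a b \<Longrightarrow> emeasure M (Cyl n a b) = emeasure N (Cyl n a b)"
  shows "M = N"
proof (rule measure_eqI_generator_eq[OF Int_stable_Cyls Cyls_Pow _ assms(1,2), of "\<lambda>_. carrier K"])
  fix X assume "X \<in> Cyls"
  then consider "X = carrier K" | n a b where "m \<le> n" "X = Cyl n a b" unfolding Cyls_def by blast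
  then show "emeasure M X = emeasure N X"
  proof cases
    case 2
    then show ?thesis using assms(5)[OF 2(1)] Cyl_empty[OF 2(1)] by (cases "valid n a b") auto
  qed (use assms in simp)
qed (use assms in \<open>auto simp: Cyls_def\<close>)

lemma translate_Cyl:
  assumes x: "x \<in> carrier K" and y: "y \<in> carrier K" and N: "m \<le> N"
  shows "(\<lambda>h. x \<oplus>\<^bsub>K\<^esub> h) ` Cyl N (\<zeta> y N) (\<gamma> y) = Cyl N (\<zeta> (x \<oplus>\<^bsub>K\<^esub> y) N) (\<gamma> (x \<oplus>\<^bsub>K\<^esub> y))"
proof -
  have sub: "(\<lambda>h. x \<oplus>\<^bsub>K\<^esub> h) ` Cyl N (\<zeta> y N) (\<gamma> y) \<subseteq> Cyl N (\<zeta> (x \<oplus>\<^bsub>K\<^esub> y) N) (\<gamma> (x \<oplus>\<^bsub>K\<^esub> y))"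
    if "x \<in> carrier K" "y \<in> carrier K" for x y
    using that by (auto simp: Cyl_def zeta_add gamma_add Zp_add_at)
  have "Cyl N (\<zeta> (x \<oplus>\<^bsub>K\<^esub> y) N) (\<gamma> (x \<oplus>\<^bsub>K\<^esub> y)) \<subseteq> (\<lambda>h. x \<oplus>\<^bsub>K\<^esub> h) ` Cyl N (\<zeta> y N) (\<gamma> y)"
  proof
    fix w assume w: "w \<in> Cyl N (\<zeta> (x \<oplus>\<^bsub>K\<^esub> y) N) (\<gamma> (x \<oplus>\<^bsub>K\<^esub> y))"
    have wK: "w \<in> carrier K" using w by (simp add: Cyl_def)
    have e: "\<ominus>\<^bsub>K\<^esub> x \<oplus>\<^bsub>K\<^esub> (x \<oplus>\<^bsub>K\<^esub> y) = y" using x y by (simp add: K.r_neg1)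
    have "(\<lambda>h. \<ominus>\<^bsub>K\<^esub> x \<oplus>\<^bsub>K\<^esub> h) w \<in> Cyl N (\<zeta> (\<ominus>\<^bsub>K\<^esub> x \<oplus>\<^bsub>K\<^esub> (x \<oplus>\<^bsub>K\<^esub> y)) N) (\<gamma> (\<ominus>\<^bsub>K\<^esub> x \<oplus>\<^bsub>K\<^esub> (x \<oplus>\<^bsub>K\<^esub> y)))"
      using sub[of "\<ominus>\<^bsub>K\<^esub> x" "x \<oplus>\<^bsub>K\<^esub> y"] x y w by blast
    then have "\<ominus>\<^bsub>K\<^esub> x \<oplus>\<^bsub>K\<^esub> w \<in> Cyl N (\<zeta> y N) (\<gamma> y)" unfolding e .
    moreover have "w = x \<oplus>\<^bsub>K\<^esub> (\<ominus>\<^bsub>K\<^esub> x \<oplus>\<^bsub>K\<^esub> w)" using x wK by (simp add: K.r_neg2)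
    ultimately show "w \<in> (\<lambda>h. x \<oplus>\<^bsub>K\<^esub> h) ` Cyl N (\<zeta> y N) (\<gamma> y)" by blast
  qed
  then show ?thesis using sub[OF x y] by blast
qed

lemma valid_coord: "x \<in> carrier K \<Longrightarrow> m \<le> N \<Longrightarrow> valid N (\<zeta> x N) (\<gamma> x)"
  using Cyl_empty[of N "\<zeta> x N" "\<gamma> x"] by (auto simp: Cyl_def)

lemma translate_vimage:
  assumes x: "x \<in> carrier K" and A: "A \<subseteq> carrier K"
  shows "(\<lambda>h. x \<oplus>\<^bsub>K\<^esub> h) -` A \<inter> carrier K = (\<lambda>h. \<ominus>\<^bsub>K\<^esub> x \<oplus>\<^bsub>K\<^esub> h) ` A"
proof
  show "(\<lambda>h. x \<oplus>\<^bsub>K\<^esub> h) -` A \<inter> carrier K \<subseteq> (\<lambda>h. \<ominus>\<^bsub>K\<^esub> x \<oplus>\<^bsub>K\<^esub> h) ` A"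
  proof
    fix h assume h: "h \<in> (\<lambda>h. x \<oplus>\<^bsub>K\<^esub> h) -` A \<inter> carrier K"
    then have "h = \<ominus>\<^bsub>K\<^esub> x \<oplus>\<^bsub>K\<^esub> (x \<oplus>\<^bsub>K\<^esub> h)" using x by (simp add: K.r_neg1)
    then show "h \<in> (\<lambda>h. \<ominus>\<^bsub>K\<^esub> x \<oplus>\<^bsub>K\<^esub> h) ` A" using h by blast
  qed
  show "(\<lambda>h. \<ominus>\<^bsub>K\<^esub> x \<oplus>\<^bsub>K\<^esub> h) ` A \<subseteq> (\<lambda>h. x \<oplus>\<^bsub>K\<^esub> h) -` A \<inter> carrier K"
    using x A by (auto simp: K.r_neg2 subset_iff)
qed

text \<open>Translations permute the nonempty cylinders of a level, which all have equal mass. So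
  the image of \<open>MK\<close> under a translation agrees with \<open>MK\<close> on a generating
  family stable under intersections.\<close>

lemma is_haar_MK: "is_haar_prob p K MK"
  unfolding is_haar_prob_def
proof (intro conjI ballI)
  show "prob_space MK" by (rule prob_space_MK)
  show "space MK = carrier K" by (rule space_MK)
  show "sets MK = sigma_sets (carrier K) (Collect opn)" using sets_MK sigma_Cyls by simp
  fix A x assume A: "A \<in> sets MK" and x: "x \<in> carrier K"
  \<comment> \<open>Translation by the negative of \<open>x\<close>: preimages under it are the
    translates by \<open>x\<close> that occur in the definition of invariance.\<close>
  let ?t = "\<lambda>h. \<ominus>\<^bsub>K\<^esub> x \<oplus>\<^bsub>K\<^esub> h"
  have mx: "\<ominus>\<^bsub>K\<^esub> x \<in> carrier K" using x by simp
  have vt: "?t -` B \<inter> space MK = (\<lambda>h. x \<oplus>\<^bsub>K\<^esub> h) ` B" if "B \<subseteq> carrier K" for B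
    using translate_vimage[OF mx that] x by (simp add: space_MK)
  have sk: "?t -` carrier K \<inter> space MK = space MK" using mx by (auto simp: space_MK)
  have meas: "?t \<in> measurable MK MK"
  proof (rule measurable_sigma_sets[OF sets_MK Cyls_Pow])
    show "?t \<in> space MK \<rightarrow> carrier K" using mx by (auto simp: space_MK)
    fix B assume "B \<in> Cyls"
    then consider "B = carrier K" | N a b where "m \<le> N" "B = Cyl N a b" unfolding Cyls_def by blast
    then show "?t -` B \<inter> space MK \<in> sets MK"
    proof cases
      case 1
      then show ?thesis using sk by simp
    next
      case 2
      show ?thesis
      proof (cases "valid N a b")
        case True
        from Cyl_point[OF 2(1) this] obtain y where y: "y \<in> carrier K" "a = \<zeta> y N" "b = \<gamma> y" .
        have "?t -` B \<inter> space MK = Cyl N (\<zeta> (x \<oplus>\<^bsub>K\<^esub> y) N) (\<gamma> (x \<oplus>\<^bsub>K\<^esub> y))"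
          unfolding 2(2) y(2,3) using vt[OF Cyl_sub] translate_Cyl[OF x y(1) 2(1)] by simp
        then show ?thesis unfolding sets_MK using CylsI[OF 2(1)] by (simp add: sigma_sets.Basic)
      next
        case False
        then show ?thesis using Cyl_empty[OF 2(1) False] 2 by simp
      qed
    qed
  qed
  have "distr MK MK ?t = MK"
  proof (rule measure_eq_Cyls)
    show "sets (distr MK MK ?t) = sigma_sets (carrier K) Cyls" "sets MK = sigma_sets (carrier K) Cyls"
      using sets_MK by auto
    show "emeasure MK (carrier K) = 1" using prob_space.emeasure_space_1[OF prob_space_MK] space_MK by simp
    then show "emeasure (distr MK MK ?t) (carrier K) = 1"
      using emeasure_distr[OF meas, of "carrier K"] sk space_MK sets.top[of MK] by simp
    fix N a b assume N: "m \<le> N" and v: "valid N a b"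
    obtain y where y: "y \<in> carrier K" "a = \<zeta> y N" "b = \<gamma> y" using Cyl_point[OF N v] .
    have "Cyl N a b \<in> sets MK" unfolding sets_MK using CylsI[OF N] by (simp add: sigma_sets.Basic)
    from emeasure_distr[OF meas this]
    have "emeasure (distr MK MK ?t) (Cyl N a b) = emeasure MK (Cyl N (\<zeta> (x \<oplus>\<^bsub>K\<^esub> y) N) (\<gamma> (x \<oplus>\<^bsub>K\<^esub> y)))"
      using vt[OF Cyl_sub] translate_Cyl[OF x y(1) N] y by simp
    also have "\<dots> = emeasure MK (Cyl N a b)"
      using MK_Cyl[OF N v] MK_Cyl[OF N valid_coord[OF _ N]] x y by simp
    finally show "emeasure (distr MK MK ?t) (Cyl N a b) = emeasure MK (Cyl N a b)" .
  qed
  then have "emeasure MK A = emeasure (distr MK MK ?t) A" by simp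
  also have "\<dots> = emeasure MK ((\<lambda>h. x \<oplus>\<^bsub>K\<^esub> h) ` A)"
    using emeasure_distr[OF meas A] vt[of A] sets.sets_into_space[OF A] space_MK by simp
  finally show "emeasure MK ((\<lambda>h. x \<oplus>\<^bsub>K\<^esub> h) ` A) = emeasure MK A" by simp
qed

definition idx :: "nat \<Rightarrow> (int \<times> nat) set" where "idx N = {(a, b). valid N a b}"

lemma finite_idx: "finite (idx N)"
  by (rule finite_subset[of _ "{0..<P ^ N} \<times> carrier G"]) (auto simp: idx_def valid_def fin_G)

text \<open>Translations act transitively on the nonempty cylinders of a level, which partition the
  space; invariance therefore gives them equal mass. The product form avoids dividing extended
  reals.\<close>

lemma haar_Cyl:
  assumes M: "is_haar_prob p K M" and N: "m \<le> N" and v: "valid N a b"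
  shows "emeasure M (Cyl N a b) * of_nat (card (idx N)) = 1"
proof -
  have sets: "sets M = sigma_sets (carrier K) Cyls" and sp: "space M = carrier K" and pr: "prob_space M"
    and inv: "\<And>A x. A \<in> sets M \<Longrightarrow> x \<in> carrier K \<Longrightarrow> emeasure M ((\<lambda>h. x \<oplus>\<^bsub>K\<^esub> h) ` A) = emeasure M A"
    using M sigma_Cyls unfolding is_haar_prob_def by auto
  have CM: "Cyl N a b \<in> sets M" for a b
    unfolding sets using CylsI[OF N] by (simp add: sigma_sets.Basic)
  have eq: "emeasure M (Cyl N a' b') = emeasure M (Cyl N a b)" if v': "valid N a' b'" for a' b'
  proof -
    obtain y where y: "y \<in> carrier K" "a = \<zeta> y N" "b = \<gamma> y" using Cyl_point[OF N v] .
    obtain w where w: "w \<in> carrier K" "a' = \<zeta> w N" "b' = \<gamma> w" using Cyl_point[OF N v'] .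
    define x where "x = w \<ominus>\<^bsub>K\<^esub> y"
    have x: "x \<in> carrier K" "x \<oplus>\<^bsub>K\<^esub> y = w" unfolding x_def using y w by (auto simp: K.minus_eq K.a_assoc K.l_neg)
    show ?thesis using inv[OF CM x(1), of a b] translate_Cyl[OF x(1) y(1) N] x(2) y w by simp
  qed
  have "1 = emeasure M (carrier K)" using prob_space.emeasure_space_1[OF pr] sp by simp
  also have "carrier K = (\<Union>i\<in>idx N. Cyl N (fst i) (snd i))"
  proof
    show "carrier K \<subseteq> (\<Union>i\<in>idx N. Cyl N (fst i) (snd i))"
    proof
      fix x assume x: "x \<in> carrier K"
      have "(\<zeta> x N, \<gamma> x) \<in> idx N" using valid_coord[OF x N] by (simp add: idx_def)
      moreover have "x \<in> Cyl N (fst (\<zeta> x N, \<gamma> x)) (snd (\<zeta> x N, \<gamma> x))" using x by (simp add: Cyl_def)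
      ultimately show "x \<in> (\<Union>i\<in>idx N. Cyl N (fst i) (snd i))" by blast
    qed
  qed (use Cyl_sub in blast)
  also have "emeasure M (\<Union>i\<in>idx N. Cyl N (fst i) (snd i)) = (\<Sum>i\<in>idx N. emeasure M (Cyl N (fst i) (snd i)))"
  proof (rule sum_emeasure[symmetric])
    show "disjoint_family_on (\<lambda>i. Cyl N (fst i) (snd i)) (idx N)"
      unfolding disjoint_family_on_def Cyl_def by (auto simp: prod_eq_iff)
  qed (use CM finite_idx in auto)
  also have "\<dots> = (\<Sum>i\<in>idx N. emeasure M (Cyl N a b))"
    by (rule sum.cong) (auto simp: idx_def eq)
  finally show ?thesis by (simp add: mult.commute)
qed

text \<open>Existence and uniqueness together resolve the definite description in
  \<open>haar_prob\<close>.\<close>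

lemma haar_MK: "haar_prob p K = MK"
  unfolding haar_prob_def
proof (rule the_equality)
  show "is_haar_prob p K MK" by (rule is_haar_MK)
  fix M assume M: "is_haar_prob p K M"
  have sets: "sets M = sigma_sets (carrier K) Cyls" and sp: "space M = carrier K" and pr: "prob_space M"
    using M sigma_Cyls unfolding is_haar_prob_def by auto
  show "M = MK"
  proof (rule measure_eq_Cyls)
    show "emeasure M (carrier K) = 1" using prob_space.emeasure_space_1[OF pr] sp by simp
    show "emeasure MK (carrier K) = 1" using prob_space.emeasure_space_1[OF prob_space_MK] space_MK by simp
    fix n a b assume n: "m \<le> n" and v: "valid n a b"
    let ?c = "of_nat (card (idx n)) :: ennreal"
    \<comment> \<open>Both masses are inverse to the number \<open>?c\<close> of nonempty cylinders,
      so they coincide.\<close>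
    have "emeasure M (Cyl n a b) = emeasure M (Cyl n a b) * (emeasure MK (Cyl n a b) * ?c)"
      using haar_Cyl[OF is_haar_MK n v] by simp
    also have "\<dots> = (emeasure M (Cyl n a b) * ?c) * emeasure MK (Cyl n a b)" by (simp only: mult_ac)
    also have "\<dots> = emeasure MK (Cyl n a b)" using haar_Cyl[OF M n v] by simp
    finally show "emeasure M (Cyl n a b) = emeasure MK (Cyl n a b)" .
  qed (use sets sets_MK in auto)
qed

end

section \<open>Random quotients\<close>

lemma has_sum_measure_disjoint:
  assumes M: "finite_measure M" and I: "countable I" and X: "\<And>i. i \<in> I \<Longrightarrow> X i \<in> sets M"
    and dis: "disjoint_family_on X I"
  shows "((\<lambda>i. measure M (X i)) has_sum measure M (\<Union>i\<in>I. X i)) I"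
proof (cases "finite I")
  case True
  have "measure M (\<Union>i\<in>I. X i) = (\<Sum>i\<in>I. measure M (X i))"
    using finite_measure.finite_measure_finite_Union[OF M True] X dis by blast
  then show ?thesis using True by (simp add: has_sum_finiteI)
next
  case False
  let ?g = "from_nat_into I"
  have b: "bij_betw ?g UNIV I" using I False by (rule bij_betw_from_nat_into)
  have gI: "?g n \<in> I" for n using b bij_betwE by blast
  have "(\<lambda>n. measure M (X (?g n))) sums measure M (\<Union>n. X (?g n))"
  proof (rule finite_measure.finite_measure_UNION[OF M])
    show "range (\<lambda>n. X (?g n)) \<subseteq> sets M" using X gI by blast
    show "disjoint_family (\<lambda>n. X (?g n))"
      unfolding disjoint_family_on_def
    proof (intro ballI impI)
      fix i j :: nat assume "i \<noteq> j"
      then have "?g i \<noteq> ?g j" using b unfolding bij_betw_def by (meson UNIV_I inj_onD)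
      then show "X (?g i) \<inter> X (?g j) = {}" using dis gI unfolding disjoint_family_on_def by meson
    qed
  qed
  moreover have "(\<Union>n. X (?g n)) = (\<Union>i\<in>I. X i)"
  proof -
    have "range (\<lambda>n. X (?g n)) = X ` range ?g" by (simp only: image_image)
    also have "range ?g = I" by (rule bij_betw_imp_surj_on[OF b])
    finally show ?thesis by (simp only:)
  qed
  ultimately have "((\<lambda>n. measure M (X (?g n))) has_sum measure M (\<Union>i\<in>I. X i)) UNIV"
    using sums_nonneg_imp_has_sum[of "\<lambda>n. measure M (X (?g n))"] by simp
  then show ?thesis using has_sum_reindex_bij_betw[OF b, of "\<lambda>i. measure M (X i)"] by simp
qed

text \<open>Double counting of the pairs \<open>(x, i)\<close> with \<open>x \<in> A i\<close>.\<close>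

lemma sum_measure_const:
  assumes M: "finite_measure M" and I: "finite I" and A: "\<And>i. i \<in> I \<Longrightarrow> A i \<in> sets M" and E: "E \<in> sets M"
    and sub: "\<And>i. i \<in> I \<Longrightarrow> A i \<subseteq> E" and cnt: "\<And>x. x \<in> E \<Longrightarrow> card {i \<in> I. x \<in> A i} = c"
  shows "(\<Sum>i\<in>I. measure M (A i)) = measure M E * real c"
proof -
  interpret finite_measure M by (rule M)
  have "(\<Sum>i\<in>I. measure M (A i)) = (\<Sum>i\<in>I. \<integral>x. indicator (A i) x \<partial>M)"
    using A by (intro sum.cong) (auto simp: sets.Int_space_eq2)
  also have "\<dots> = (\<integral>x. (\<Sum>i\<in>I. indicator (A i) x) \<partial>M)"
    using A by (intro Bochner_Integration.integral_sum[symmetric]) (auto intro!: integrable_real_indicator simp: emeasure_eq_measure)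
  also have "\<dots> = (\<integral>x. indicator E x * real c \<partial>M)"
  proof (rule Bochner_Integration.integral_cong[OF refl])
    fix x
    have "(\<Sum>i\<in>I. indicator (A i) x) = (\<Sum>i\<in>{i \<in> I. x \<in> A i}. (1::real))"
      using I by (intro sum.mono_neutral_cong_right) (auto simp: indicator_def)
    also have "\<dots> = real (card {i \<in> I. x \<in> A i})" by simp
    also have "\<dots> = indicator E x * real c"
    proof (cases "x \<in> E")
      case False
      then have "{i \<in> I. x \<in> A i} = {}" using sub by blast
      then show ?thesis using False by (simp only: card.empty) simp
    qed (simp add: cnt)
    finally show "(\<Sum>i\<in>I. indicator (A i) x) = indicator E x * real c" .
  qed
  also have "\<dots> = measure M E * real c" using E by (simp add: sets.Int_space_eq2)
  finally show ?thesis .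
qed

context rank1
begin

sublocale MKp: prob_space MK by (rule prob_space_MK)

abbreviation \<mu> :: "'k set \<Rightarrow> real" where "\<mu> \<equiv> measure MK"

lemma AK_group: "group (add_monoid K)" and AK_comm: "comm_group (add_monoid K)"
  using K.a_comm_group by (simp_all add: comm_group.axioms(2))

lemma opn_sets: "opn U \<Longrightarrow> U \<in> sets MK"
  unfolding sets_MK sigma_Cyls[symmetric] by (rule sigma_sets.Basic) simp

lemma mu_translate: "A \<in> sets MK \<Longrightarrow> x \<in> carrier K \<Longrightarrow> \<mu> ((\<lambda>h. x \<oplus>\<^bsub>K\<^esub> h) ` A) = \<mu> A"
  using is_haar_MK unfolding is_haar_prob_def measure_def by simp

lemma mu_Cyl: "m \<le> N \<Longrightarrow> valid N a b \<Longrightarrow> \<mu> (Cyl N a b) = 1 / real p ^ N"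
  using MK_Cyl unfolding measure_def by simp

lemma translate_opn:
  assumes U: "opn U" and x: "x \<in> carrier K"
  shows "opn ((\<lambda>h. x \<oplus>\<^bsub>K\<^esub> h) ` U)"
  unfolding opn_iff
proof (intro conjI ballI)
  have UK: "U \<subseteq> carrier K" using U unfolding opn_iff by blast
  then show "(\<lambda>h. x \<oplus>\<^bsub>K\<^esub> h) ` U \<subseteq> carrier K" using x by auto
  fix y assume "y \<in> (\<lambda>h. x \<oplus>\<^bsub>K\<^esub> h) ` U"
  then obtain u where u: "u \<in> U" "y = x \<oplus>\<^bsub>K\<^esub> u" by blast
  obtain n where n: "\<And>h. h \<in> carrier K \<Longrightarrow> u \<oplus>\<^bsub>K\<^esub> mpow n h \<in> U" using U u(1) unfolding opn_iff by blast
  have "y \<oplus>\<^bsub>K\<^esub> mpow n h \<in> (\<lambda>h. x \<oplus>\<^bsub>K\<^esub> h) ` U" if h: "h \<in> carrier K" for h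
  proof -
    have "y \<oplus>\<^bsub>K\<^esub> mpow n h = x \<oplus>\<^bsub>K\<^esub> (u \<oplus>\<^bsub>K\<^esub> mpow n h)"
      unfolding u(2) using x u(1) UK h by (simp add: K.a_assoc subsetD)
    then show ?thesis using n[OF h] by blast
  qed
  then show "\<exists>n. \<forall>h\<in>carrier K. y \<oplus>\<^bsub>K\<^esub> mpow n h \<in> (\<lambda>h. x \<oplus>\<^bsub>K\<^esub> h) ` U" by blast
qed

end

section \<open>Surjections from a module of rank one onto a group of order
  \<open>p ^ k\<close>\<close>

locale rank1_target = rank1 p G m \<kappa> K \<zeta> \<gamma> + F: comm_group F
  for p and G :: "nat monoid" (structure) and m \<kappa> and K :: "(padic, 'k) module" and \<zeta> \<gamma>
    and F :: "'f monoid" +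
  fixes k :: nat
  assumes fin_F: "finite (carrier F)" and card_F: "card (carrier F) = p ^ k"
begin

abbreviation epi_KF :: "('k \<Rightarrow> 'f) set" where "epi_KF \<equiv> epis (add_monoid K) F"

lemma epiD:
  assumes "\<psi> \<in> epi_KF"
  shows "x \<in> carrier K \<Longrightarrow> \<psi> x \<in> carrier F"
    "x \<in> carrier K \<Longrightarrow> y \<in> carrier K \<Longrightarrow> \<psi> (x \<oplus>\<^bsub>K\<^esub> y) = \<psi> x \<otimes>\<^bsub>F\<^esub> \<psi> y"
    "\<And>f. f \<in> carrier F \<Longrightarrow> \<exists>x\<in>carrier K. \<psi> x = f"
    "\<psi> \<zero>\<^bsub>K\<^esub> = \<one>\<^bsub>F\<^esub>"
    "x \<in> carrier K \<Longrightarrow> \<psi> (\<ominus>\<^bsub>K\<^esub> x) = inv\<^bsub>F\<^esub> (\<psi> x)"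
    "x \<in> carrier K \<Longrightarrow> \<psi> (add_pow K (j::nat) x) = \<psi> x [^]\<^bsub>F\<^esub> j"
proof -
  note E = episD[OF assms, simplified]
  interpret h: group_hom "add_monoid K" F \<psi>
    using E(1) AK_group F.is_group by (simp add: group_hom_def group_hom_axioms_def)
  show "x \<in> carrier K \<Longrightarrow> \<psi> x \<in> carrier F" by (rule E(4))
  show "x \<in> carrier K \<Longrightarrow> y \<in> carrier K \<Longrightarrow> \<psi> (x \<oplus>\<^bsub>K\<^esub> y) = \<psi> x \<otimes>\<^bsub>F\<^esub> \<psi> y" by (rule E(5))
  show "\<exists>x\<in>carrier K. \<psi> x = f" if "f \<in> carrier F" for f using E(2) that by (metis imageE)
  show "\<psi> \<zero>\<^bsub>K\<^esub> = \<one>\<^bsub>F\<^esub>" using h.hom_one by simp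
  show "x \<in> carrier K \<Longrightarrow> \<psi> (\<ominus>\<^bsub>K\<^esub> x) = inv\<^bsub>F\<^esub> (\<psi> x)"
    using h.hom_inv[of x] by (simp add: a_inv_def)
  show "x \<in> carrier K \<Longrightarrow> \<psi> (add_pow K (j::nat) x) = \<psi> x [^]\<^bsub>F\<^esub> j"
    using h.hom_nat_pow[of x j] by (simp add: add_pow_def)
qed

lemma epi_mpow:
  assumes "\<psi> \<in> epi_KF" "h \<in> carrier K"
  shows "\<psi> (mpow k h) = \<one>\<^bsub>F\<^esub>"
proof -
  have "mpow k h = add_pow K (p ^ k) h" using add_pow_smult[OF K_module assms(2), of "p ^ k"] by simp
  then show ?thesis using epiD(6)[OF assms] F.pow_order_eq_1[OF epiD(1)[OF assms]] card_F by (simp add: order_def)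
qed

text \<open>Members of \<open>epi_KF\<close> are merely additive. Since they kill
  \<open>P ^ k\<close> times the module, a p-adic scalar acts on their values like an integer, so
  their kernels are submodules.\<close>

lemma epi_smult:
  assumes "\<psi> \<in> epi_KF" "x \<in> carrier K" "r \<in> carrier Z" "\<psi> x = \<one>\<^bsub>F\<^esub>"
  shows "\<psi> (r \<odot>\<^bsub>K\<^esub> x) = \<one>\<^bsub>F\<^esub>"
proof -
  have "(r \<ominus>\<^bsub>Z\<^esub> iota (r k)) k = 0"
    using assms(3) by (simp add: ZR.minus_eq Zp_minus_at Zp_add_at iota_at mod_simps)
  then obtain w where w: "w \<in> carrier Z" "r \<ominus>\<^bsub>Z\<^esub> iota (r k) = iota (P ^ k) \<otimes>\<^bsub>Z\<^esub> w"
    using Zp_divide[of "r \<ominus>\<^bsub>Z\<^esub> iota (r k)" k] assms(3) by (metis ZR.minus_closed iota_closed)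
  have r: "r = iota (r k) \<oplus>\<^bsub>Z\<^esub> iota (P ^ k) \<otimes>\<^bsub>Z\<^esub> w"
    using Zp_add_diff[OF assms(3) iota_closed[of "r k"]] w(2) by simp
  have "iota (r k) \<odot>\<^bsub>K\<^esub> x = add_pow K (nat (r k)) x"
    using add_pow_smult[OF K_module assms(2), of "nat (r k)"] Zp_range(1)[OF assms(3), of k] by simp
  then have "\<psi> (iota (r k) \<odot>\<^bsub>K\<^esub> x) = \<one>\<^bsub>F\<^esub>" using epiD(6)[OF assms(1,2)] assms(4) by simp
  moreover have "\<psi> (mpow k (w \<odot>\<^bsub>K\<^esub> x)) = \<one>\<^bsub>F\<^esub>" by (rule epi_mpow) (use assms w in auto)
  moreover have "r \<odot>\<^bsub>K\<^esub> x = iota (r k) \<odot>\<^bsub>K\<^esub> x \<oplus>\<^bsub>K\<^esub> mpow k (w \<odot>\<^bsub>K\<^esub> x)"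
    by (subst r) (use assms w in \<open>simp add: K.smult_l_distr K.smult_assoc1\<close>)
  ultimately show ?thesis using epiD(2)[OF assms(1)] assms w by simp
qed

definition fib :: "('k \<Rightarrow> 'f) \<Rightarrow> 'f \<Rightarrow> 'k set" where "fib \<psi> f = {x \<in> carrier K. \<psi> x = f}"

lemma opn_fib: "\<psi> \<in> epi_KF \<Longrightarrow> opn (fib \<psi> f)"
  unfolding opn_iff
proof (intro conjI ballI)
  assume ps: "\<psi> \<in> epi_KF"
  show "fib \<psi> f \<subseteq> carrier K" by (auto simp: fib_def)
  fix x assume "x \<in> fib \<psi> f"
  then have x: "x \<in> carrier K" "\<psi> x = f" by (auto simp: fib_def)
  have "x \<oplus>\<^bsub>K\<^esub> mpow k h \<in> fib \<psi> f" if "h \<in> carrier K" for h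
    using x(1) that epiD(1,2)[OF ps] epi_mpow[OF ps that] x(2)[symmetric] by (simp add: fib_def)
  then show "\<exists>n. \<forall>h\<in>carrier K. x \<oplus>\<^bsub>K\<^esub> mpow n h \<in> fib \<psi> f" by blast
qed

lemma fib_translate:
  assumes ps: "\<psi> \<in> epi_KF" and x: "x \<in> carrier K"
  shows "fib \<psi> (\<psi> x) = (\<lambda>h. x \<oplus>\<^bsub>K\<^esub> h) ` fib \<psi> \<one>\<^bsub>F\<^esub>"
proof
  show "(\<lambda>h. x \<oplus>\<^bsub>K\<^esub> h) ` fib \<psi> \<one>\<^bsub>F\<^esub> \<subseteq> fib \<psi> (\<psi> x)"
    using x epiD(1,2)[OF ps] by (auto simp: fib_def)
  show "fib \<psi> (\<psi> x) \<subseteq> (\<lambda>h. x \<oplus>\<^bsub>K\<^esub> h) ` fib \<psi> \<one>\<^bsub>F\<^esub>"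
  proof
    fix y assume "y \<in> fib \<psi> (\<psi> x)"
    then have y: "y \<in> carrier K" "\<psi> y = \<psi> x" by (auto simp: fib_def)
    have "\<ominus>\<^bsub>K\<^esub> x \<oplus>\<^bsub>K\<^esub> y \<in> fib \<psi> \<one>\<^bsub>F\<^esub>"
      using x y epiD(1,2,5)[OF ps] by (simp add: fib_def)
    moreover have "y = x \<oplus>\<^bsub>K\<^esub> (\<ominus>\<^bsub>K\<^esub> x \<oplus>\<^bsub>K\<^esub> y)" using x y by (simp add: K.r_neg2)
    ultimately show "y \<in> (\<lambda>h. x \<oplus>\<^bsub>K\<^esub> h) ` fib \<psi> \<one>\<^bsub>F\<^esub>" by blast
  qed
qed

text \<open>The \<open>p ^ k\<close> fibres are translates of each other and partition the
  module.\<close>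

lemma mu_fib:
  assumes ps: "\<psi> \<in> epi_KF"
  shows "\<mu> (fib \<psi> \<one>\<^bsub>F\<^esub>) = 1 / real p ^ k"
proof -
  have eq: "\<mu> (fib \<psi> f) = \<mu> (fib \<psi> \<one>\<^bsub>F\<^esub>)" if f: "f \<in> carrier F" for f
  proof -
    obtain x where x: "x \<in> carrier K" "\<psi> x = f" using epiD(3)[OF ps f] by blast
    show ?thesis using fib_translate[OF ps x(1)] mu_translate[OF opn_sets[OF opn_fib[OF ps]] x(1)] x(2) by simp
  qed
  have "1 = \<mu> (carrier K)" using MKp.prob_space space_MK by simp
  also have "carrier K = (\<Union>f\<in>carrier F. fib \<psi> f)" using epiD(1)[OF ps] by (auto simp: fib_def)
  also have "\<mu> (\<Union>f\<in>carrier F. fib \<psi> f) = (\<Sum>f\<in>carrier F. \<mu> (fib \<psi> f))"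
    by (rule MKp.finite_measure_finite_Union[OF fin_F])
      (use opn_sets[OF opn_fib[OF ps]] in \<open>auto simp: disjoint_family_on_def fib_def\<close>)
  also have "\<dots> = (\<Sum>f\<in>carrier F. \<mu> (fib \<psi> \<one>\<^bsub>F\<^esub>))" by (rule sum.cong[OF refl eq])
  also have "\<dots> = real p ^ k * \<mu> (fib \<psi> \<one>\<^bsub>F\<^esub>)" by (simp add: card_F)
  finally show ?thesis using p_gt_1 by (simp add: field_simps)
qed

lemma epi_near:
  assumes ps: "\<psi> \<in> epi_KF" and x: "x \<in> carrier K" and y: "y \<in> Cyl (k + m) (\<zeta> x (k + m)) (\<gamma> x)"
  shows "\<psi> y = \<psi> x"
proof -
  obtain h where h: "h \<in> carrier K" "y = x \<oplus>\<^bsub>K\<^esub> mpow k h" using Cyl_near[OF x y] .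
  then show ?thesis using epiD(1,2)[OF ps] x epi_mpow[OF ps h(1)] by simp
qed

text \<open>A member of \<open>epi_KF\<close> is constant on cylinders of level
  \<open>k + m\<close>. There are finitely many nonempty ones, and \<open>pt\<close> selects a point
  in each.\<close>

lemma finite_epi_KF: "finite epi_KF"
proof -
  define pt where "pt i = (SOME x. x \<in> Cyl (k + m) (fst i) (snd i))" for i
  have pt: "pt (\<zeta> x (k + m), \<gamma> x) \<in> Cyl (k + m) (\<zeta> x (k + m)) (\<gamma> x)" if "x \<in> carrier K" for x
  proof -
    have "x \<in> Cyl (k + m) (\<zeta> x (k + m)) (\<gamma> x)" using that by (simp add: Cyl_def)
    from someI[of "\<lambda>y. y \<in> Cyl (k + m) (\<zeta> x (k + m)) (\<gamma> x)", OF this] show ?thesis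
      unfolding pt_def fst_conv snd_conv .
  qed
  let ?r = "\<lambda>\<psi>. restrict (\<psi> \<circ> pt) (idx (k + m))"
  have idx: "(\<zeta> x (k + m), \<gamma> x) \<in> idx (k + m)" if "x \<in> carrier K" for x
    using valid_coord[OF that, of "k + m"] by (simp add: idx_def)
  have "pt i \<in> carrier K" if i: "i \<in> idx (k + m)" for i
  proof -
    obtain a b where ab: "i = (a, b)" by (metis surj_pair)
    then have "valid (k + m) a b" using i by (simp add: idx_def)
    from Cyl_point[OF _ this] obtain x where "x \<in> carrier K" "a = \<zeta> x (k + m)" "b = \<gamma> x" by (metis le_add2)
    then show ?thesis using pt ab by (auto simp: Cyl_def)
  qed
  then have "?r ` epi_KF \<subseteq> idx (k + m) \<rightarrow>\<^sub>E carrier F"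
    using epiD(1) by (auto intro!: PiE_I)
  then have "finite (?r ` epi_KF)" using finite_idx fin_F by (meson finite_PiE finite_subset)
  moreover have "inj_on ?r epi_KF"
  proof (rule inj_onI)
    fix \<psi> \<psi>' assume h: "\<psi> \<in> epi_KF" "\<psi>' \<in> epi_KF" "?r \<psi> = ?r \<psi>'"
    have "\<psi> x = \<psi>' x" if x: "x \<in> carrier K" for x
    proof -
      have "?r \<psi> (\<zeta> x (k + m), \<gamma> x) = ?r \<psi>' (\<zeta> x (k + m), \<gamma> x)" using h(3) by simp
      then show ?thesis using idx[OF x] epi_near[OF h(1) x pt[OF x]] epi_near[OF h(2) x pt[OF x]] by simp
    qed
    then show "\<psi> = \<psi>'"
      using extensionalityI[OF episD(3)[OF h(1)] episD(3)[OF h(2)]] by simp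
  qed
  ultimately show ?thesis by (rule finite_imageD)
qed

end

section \<open>Cyclic submodules and their measure\<close>

context rank1
begin

abbreviation cyc :: "'k \<Rightarrow> 'k set" where "cyc x \<equiv> cyclic_submodule p K x"

lemma cyc_mem: "y \<in> cyc x \<longleftrightarrow> (\<exists>r\<in>carrier Z. y = r \<odot>\<^bsub>K\<^esub> x)"
  unfolding cyclic_submodule_def by blast

lemma cycI: "r \<in> carrier Z \<Longrightarrow> r \<odot>\<^bsub>K\<^esub> x \<in> cyc x" unfolding cyc_mem by blast

lemma cyc_self: "x \<in> carrier K \<Longrightarrow> x \<in> cyc x" using cycI[of "\<one>\<^bsub>Z\<^esub>" x] by simp

lemma cyc_sub: "x \<in> carrier K \<Longrightarrow> cyc x \<subseteq> carrier K" by (auto simp: cyc_mem)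

lemma cyc_trans: "x \<in> carrier K \<Longrightarrow> y \<in> cyc x \<Longrightarrow> cyc y \<subseteq> cyc x"
proof
  fix z assume x: "x \<in> carrier K" and "y \<in> cyc x" "z \<in> cyc y"
  then obtain r s where r: "r \<in> carrier Z" "s \<in> carrier Z" "y = r \<odot>\<^bsub>K\<^esub> x" "z = s \<odot>\<^bsub>K\<^esub> y"
    unfolding cyc_mem by blast
  have "z = (s \<otimes>\<^bsub>Z\<^esub> r) \<odot>\<^bsub>K\<^esub> x" unfolding r(3,4) using r(1,2) x by (simp add: K.smult_assoc1)
  then show "z \<in> cyc x" using cycI[of "s \<otimes>\<^bsub>Z\<^esub> r"] r(1,2) by simp
qed

lemma cyc_add: "x \<in> carrier K \<Longrightarrow> a \<in> cyc x \<Longrightarrow> b \<in> cyc x \<Longrightarrow> a \<oplus>\<^bsub>K\<^esub> b \<in> cyc x"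
  by (auto simp: cyc_mem K.smult_l_distr[symmetric])

lemma cyc_minus: "x \<in> carrier K \<Longrightarrow> a \<in> cyc x \<Longrightarrow> \<ominus>\<^bsub>K\<^esub> a \<in> cyc x"
  by (auto simp: cyc_mem K.smult_l_minus[symmetric])

lemma cyc_subgroup: "x \<in> carrier K \<Longrightarrow> subgroup (cyc x) (add_monoid K)"
proof (rule group.subgroupI[OF AK_group])
  assume x: "x \<in> carrier K"
  show "cyc x \<subseteq> carrier (add_monoid K)" using cyc_sub[OF x] by simp
  show "cyc x \<noteq> {}" using cyc_self[OF x] by blast
  show "inv\<^bsub>add_monoid K\<^esub> a \<in> cyc x" if "a \<in> cyc x" for a
    using cyc_minus[OF x that] by (simp add: a_inv_def)
  show "a \<otimes>\<^bsub>add_monoid K\<^esub> b \<in> cyc x" if "a \<in> cyc x" "b \<in> cyc x" for a b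
    using cyc_add[OF x that] by simp
qed

text \<open>Multiplication by \<open>|G|\<close> removes the component in \<open>G\<close>, after
  which the cyclic submodule is visible as a cylinder.\<close>

lemma cyc_mpow:
  assumes x: "x \<in> carrier K" and z: "\<zeta> x = iota (P ^ v)"
  shows "cyc (mpow m x) = Cyl (m + v) 0 \<one>"
proof
  show "cyc (mpow m x) \<subseteq> Cyl (m + v) 0 \<one>"
  proof
    fix y assume "y \<in> cyc (mpow m x)"
    then obtain r where r: "r \<in> carrier Z" "y = r \<odot>\<^bsub>K\<^esub> mpow m x" unfolding cyc_mem by blast
    have "\<zeta> y = r \<otimes>\<^bsub>Z\<^esub> iota (P ^ m * P ^ v)" using x r z by (simp add: zeta_smult iota_mult)
    then have "\<zeta> y (m + v) = 0" by (simp add: Zp_mult_at iota_at power_add)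
    moreover have "\<gamma> y = \<one>" using x r mpow_gamma[of x m] by (simp add: gamma_smult)
    ultimately show "y \<in> Cyl (m + v) 0 \<one>" using x r by (simp add: Cyl_def)
  qed
  show "Cyl (m + v) 0 \<one> \<subseteq> cyc (mpow m x)"
  proof
    fix y assume "y \<in> Cyl (m + v) 0 \<one>"
    then have y: "y \<in> carrier K" "\<zeta> y (m + v) = 0" "\<gamma> y = \<one>" by (auto simp: Cyl_def)
    obtain w where w: "w \<in> carrier Z" "\<zeta> y = iota (P ^ (m + v)) \<otimes>\<^bsub>Z\<^esub> w"
      using Zp_divide[OF zeta_closed[OF y(1)] y(2)] by metis
    have "y = w \<odot>\<^bsub>K\<^esub> mpow m x"
    proof (rule coord_eqI)
      show "\<zeta> y = \<zeta> (w \<odot>\<^bsub>K\<^esub> mpow m x)" using w x z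
        by (simp add: zeta_smult power_add iota_mult ZR.m_comm)
      show "\<gamma> y = \<gamma> (w \<odot>\<^bsub>K\<^esub> mpow m x)" using w x y mpow_gamma[of x m] by (simp add: gamma_smult)
    qed (use x y w in auto)
    then show "y \<in> cyc (mpow m x)" using cycI[OF w(1)] by simp
  qed
qed

lemma valid_zero: "valid (m + v) 0 \<one>"
  using chars_one[OF ch] p_gt_1 by (simp add: valid_def)

text \<open>\<open>cyc x\<close> is the union of the translates of the cylinder
  \<open>cyc (mpow m x)\<close> by \<open>j\<close> times \<open>x\<close>, for
  \<open>0 <= j < |G|\<close>. These are disjoint because their first coordinates are
  \<open>j * P ^ v\<close> at level \<open>m + v\<close>, and each has mass
  \<open>1 / p ^ (m + v)\<close>. Thus the valuation of the first coordinate of \<open>x\<close>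
  gives the index of \<open>cyc x\<close>.\<close>

lemma mu_cyc:
  assumes x: "x \<in> carrier K" and z: "\<zeta> x = iota (P ^ v)"
  shows "opn (cyc x)" "\<mu> (cyc x) = 1 / real p ^ v"
proof -
  let ?B = "cyc (mpow m x)"
  let ?t = "\<lambda>j. (\<lambda>h. iota j \<odot>\<^bsub>K\<^esub> x \<oplus>\<^bsub>K\<^esub> h) ` ?B"
  have B: "?B = Cyl (m + v) 0 \<one>" by (rule cyc_mpow[OF assms])
  have oB: "opn ?B" unfolding B by (rule opn_Cyl) simp
  have un: "cyc x = (\<Union>j\<in>{0..<P ^ m}. ?t j)"
  proof
    show "cyc x \<subseteq> (\<Union>j\<in>{0..<P ^ m}. ?t j)"
    proof
      fix y assume "y \<in> cyc x"
      then obtain r where r: "r \<in> carrier Z" "y = r \<odot>\<^bsub>K\<^esub> x" unfolding cyc_mem by blast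
      have "(r \<ominus>\<^bsub>Z\<^esub> iota (r m)) m = 0"
        using r by (simp add: ZR.minus_eq Zp_minus_at Zp_add_at iota_at mod_simps)
      then obtain w where w: "w \<in> carrier Z" "r \<ominus>\<^bsub>Z\<^esub> iota (r m) = iota (P ^ m) \<otimes>\<^bsub>Z\<^esub> w"
        using Zp_divide[of "r \<ominus>\<^bsub>Z\<^esub> iota (r m)" m] r by (metis ZR.minus_closed iota_closed)
      have "r = iota (r m) \<oplus>\<^bsub>Z\<^esub> w \<otimes>\<^bsub>Z\<^esub> iota (P ^ m)"
        using Zp_add_diff[OF r(1) iota_closed[of "r m"]] w by (simp add: ZR.m_comm)
      then have "y = (iota (r m) \<oplus>\<^bsub>Z\<^esub> w \<otimes>\<^bsub>Z\<^esub> iota (P ^ m)) \<odot>\<^bsub>K\<^esub> x" using r(2) by simp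
      also have "\<dots> = iota (r m) \<odot>\<^bsub>K\<^esub> x \<oplus>\<^bsub>K\<^esub> w \<odot>\<^bsub>K\<^esub> mpow m x"
        using x w by (simp add: K.smult_l_distr K.smult_assoc1)
      finally have "y \<in> ?t (r m)" using cycI[OF w(1)] by blast
      moreover have "r m \<in> {0..<P ^ m}" using Zp_range[OF r(1)] by simp
      ultimately show "y \<in> (\<Union>j\<in>{0..<P ^ m}. ?t j)" by blast
    qed
    have "mpow m x \<in> cyc x" by (rule cycI) simp
    then show "(\<Union>j\<in>{0..<P ^ m}. ?t j) \<subseteq> cyc x"
      using cyc_add[OF x] cycI[OF iota_closed] cyc_trans[OF x] by blast
  qed
  have ot: "opn (?t j)" for j by (rule translate_opn[OF oB]) (use x in simp)
  show "opn (cyc x)" unfolding opn_iff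
  proof (intro conjI ballI)
    show "cyc x \<subseteq> carrier K" by (rule cyc_sub[OF x])
    fix y assume "y \<in> cyc x"
    then obtain j where j: "j \<in> {0..<P ^ m}" "y \<in> ?t j" unfolding un by (rule UN_E)
    have sub: "?t j \<subseteq> cyc x" unfolding un using j(1) by (rule UN_upper)
    obtain n where n: "\<And>h. h \<in> carrier K \<Longrightarrow> y \<oplus>\<^bsub>K\<^esub> mpow n h \<in> ?t j"
      using ot[of j] j(2) unfolding opn_iff by metis
    show "\<exists>n. \<forall>h\<in>carrier K. y \<oplus>\<^bsub>K\<^esub> mpow n h \<in> cyc x"
      using n subsetD[OF sub] by metis
  qed
  have zt: "\<zeta> y (m + v) = j * P ^ v" if yj: "y \<in> ?t j" "j \<in> {0..<P ^ m}" for y j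
  proof -
    from yj(1) obtain b where b: "y = iota j \<odot>\<^bsub>K\<^esub> x \<oplus>\<^bsub>K\<^esub> b" "b \<in> ?B" by (rule imageE)
    then have bz: "b \<in> carrier K" "\<zeta> b (m + v) = 0" unfolding B Cyl_def by auto
    have "\<zeta> y (m + v) = (j * P ^ v) mod P ^ (m + v)"
      unfolding b(1) using x z bz by (simp add: zeta_add zeta_smult Zp_add_at Zp_mult_at iota_at mod_simps)
    moreover have "j * P ^ v < P ^ m * P ^ v" by (rule mult_strict_right_mono) (use yj(2) P_pos[of v] in auto)
    moreover have "0 \<le> j * P ^ v" using yj(2) by simp
    ultimately show ?thesis by (simp add: power_add)
  qed
  have "\<mu> (cyc x) = (\<Sum>j\<in>{0..<P ^ m}. \<mu> (?t j))" unfolding un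
  proof (rule MKp.finite_measure_finite_Union)
    show "?t ` {0..<P ^ m} \<subseteq> sets MK" using opn_sets[OF ot] by blast
    show "disjoint_family_on ?t {0..<P ^ m}" unfolding disjoint_family_on_def
    proof (intro ballI impI, rule ccontr)
      fix i j assume ij: "i \<in> {0..<P ^ m}" "j \<in> {0..<P ^ m}" "i \<noteq> j" "?t i \<inter> ?t j \<noteq> {}"
      then obtain y where "y \<in> ?t i" "y \<in> ?t j" by blast
      then have "i * P ^ v = j * P ^ v" using zt ij(1,2) by metis
      then show False using ij(3) p_gt_1 by simp
    qed
  qed simp
  also have "\<dots> = (\<Sum>j\<in>{0..<P ^ m}. 1 / real p ^ (m + v))"
  proof (rule sum.cong[OF refl])
    fix j
    have "\<mu> (?t j) = \<mu> ?B" by (rule mu_translate[OF opn_sets[OF oB]]) (use x in simp)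
    then show "\<mu> (?t j) = 1 / real p ^ (m + v)" unfolding B using mu_Cyl[of "m + v", OF _ valid_zero] by simp
  qed
  also have "\<dots> = 1 / real p ^ v" using p_gt_1 by (simp add: power_add nat_power_eq)
  finally show "\<mu> (cyc x) = 1 / real p ^ v" .
qed

text \<open>A unit multiple of \<open>x\<close> generates the same submodule, so the unit part of
  the first coordinate can be removed.\<close>

lemma cyc_normal_form:
  assumes x: "x \<in> carrier K" and nz: "\<zeta> x \<noteq> \<zero>\<^bsub>Z\<^esub>"
  obtains v x0 where "x0 \<in> carrier K" "\<zeta> x0 = iota (P ^ v)" "cyc x0 = cyc x"
proof -
  obtain v u u' where u: "u \<in> carrier Z" "u' \<in> carrier Z" "u \<otimes>\<^bsub>Z\<^esub> u' = \<one>\<^bsub>Z\<^esub>" "\<zeta> x = iota (P ^ v) \<otimes>\<^bsub>Z\<^esub> u"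
    using Zp_valuation[OF zeta_closed[OF x] nz] .
  let ?x0 = "u' \<odot>\<^bsub>K\<^esub> x"
  have "\<zeta> ?x0 = iota (P ^ v) \<otimes>\<^bsub>Z\<^esub> (u \<otimes>\<^bsub>Z\<^esub> u')" using u(1,2) x unfolding zeta_smult[OF u(2) x] u(4)
    by (simp add: ZR.m_lcomm[of u'] ZR.m_comm[of u' u])
  then have z: "\<zeta> ?x0 = iota (P ^ v)" using u by simp
  have "x = u \<odot>\<^bsub>K\<^esub> ?x0" using u x by (simp add: K.smult_assoc1[symmetric])
  then have "x \<in> cyc ?x0" using cycI[OF u(1), of ?x0] by simp
  then have "cyc x \<subseteq> cyc ?x0" using cyc_trans[of ?x0 x] u x by simp
  moreover have "cyc ?x0 \<subseteq> cyc x" using cyc_trans[OF x cycI[OF u(2)]] .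
  ultimately show thesis using that[of ?x0 v] u x z by auto
qed

text \<open>A strictly larger subgroup would contain a second coset of \<open>cyc x\<close> and so
  have at least twice its mass.\<close>

lemma cyc_sub_eq:
  assumes x: "x \<in> carrier K" and z: "\<zeta> x = iota (P ^ v)" and W: "subgroup W (add_monoid K)" "W \<in> sets MK"
    and sub: "cyc x \<subseteq> W" and le: "\<mu> W \<le> \<mu> (cyc x)"
  shows "W = cyc x"
proof (rule ccontr)
  assume "W \<noteq> cyc x"
  then obtain w where w: "w \<in> W" "w \<notin> cyc x" using sub by blast
  have wK: "w \<in> carrier K" using subgroup.mem_carrier[OF W(1) w(1)] by simp
  let ?t = "(\<lambda>h. w \<oplus>\<^bsub>K\<^esub> h) ` cyc x"
  have s: "cyc x \<in> sets MK" "?t \<in> sets MK"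
    using opn_sets[OF mu_cyc(1)[OF x z]] opn_sets[OF translate_opn[OF mu_cyc(1)[OF x z] wK]] by auto
  have "cyc x \<inter> ?t = {}"
  proof (rule ccontr)
    assume "cyc x \<inter> ?t \<noteq> {}"
    then obtain h where h: "h \<in> cyc x" "w \<oplus>\<^bsub>K\<^esub> h \<in> cyc x" by blast
    have hK: "h \<in> carrier K" using cyc_sub[OF x] h(1) by blast
    have "(w \<oplus>\<^bsub>K\<^esub> h) \<oplus>\<^bsub>K\<^esub> \<ominus>\<^bsub>K\<^esub> h = w" using wK hK by (simp add: K.a_assoc K.r_neg)
    then show False using cyc_add[OF x h(2) cyc_minus[OF x h(1)]] w(2) by simp
  qed
  then have "\<mu> (cyc x \<union> ?t) = \<mu> (cyc x) + \<mu> ?t" using s by (intro MKp.finite_measure_Union) auto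
  moreover have "\<mu> ?t = \<mu> (cyc x)" by (rule mu_translate[OF s(1) wK])
  moreover have "cyc x \<union> ?t \<subseteq> W" using sub w(1) subgroup.m_closed[OF W(1)] by auto
  then have "\<mu> (cyc x \<union> ?t) \<le> \<mu> W" using W(2) by (rule MKp.finite_measure_mono)
  moreover have "\<mu> (cyc x) > 0" using mu_cyc(2)[OF x z] p_gt_1 by simp
  ultimately show False using le by simp
qed

text \<open>The generators of \<open>cyc x0\<close> are its elements outside \<open>p\<close> times
  it, a submodule with \<open>1 / p\<close> of the mass. This is the origin of the factor
  \<open>1 - 1/p\<close> in the transition probabilities.\<close>

lemma mu_generators:
  assumes x0: "x0 \<in> carrier K" and z: "\<zeta> x0 = iota (P ^ v)"
  shows "{x \<in> carrier K. cyc x = cyc x0} \<in> sets MK"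
    "\<mu> {x \<in> carrier K. cyc x = cyc x0} = (1 - 1 / real p) / real p ^ v"
proof -
  let ?x1 = "iota P \<odot>\<^bsub>K\<^esub> x0"
  have x1: "?x1 \<in> carrier K" "\<zeta> ?x1 = iota (P ^ Suc v)"
    using x0 z by (simp_all add: zeta_smult iota_mult)
  have eq: "{x \<in> carrier K. cyc x = cyc x0} = cyc x0 - cyc ?x1"
  proof
    show "{x \<in> carrier K. cyc x = cyc x0} \<subseteq> cyc x0 - cyc ?x1"
    proof
      fix x assume "x \<in> {x \<in> carrier K. cyc x = cyc x0}"
      then have x: "x \<in> carrier K" "cyc x = cyc x0" by auto
      have "x \<notin> cyc ?x1"
      proof
        assume "x \<in> cyc ?x1"
        then obtain e where e: "e \<in> carrier Z" "x = e \<odot>\<^bsub>K\<^esub> ?x1" unfolding cyc_mem by blast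
        have "x0 \<in> cyc x" using x cyc_self[OF x0] by simp
        then obtain d where d: "d \<in> carrier Z" "x0 = d \<odot>\<^bsub>K\<^esub> x" unfolding cyc_mem by blast
        have "\<zeta> x = e \<otimes>\<^bsub>Z\<^esub> iota (P ^ Suc v)"
          unfolding e(2) x1(2)[symmetric] by (rule zeta_smult[OF e(1) x1(1)])
        moreover have "\<zeta> x0 = d \<otimes>\<^bsub>Z\<^esub> \<zeta> x" using arg_cong[OF d(2), of \<zeta>] zeta_smult[OF d(1) x(1)] by simp
        ultimately have "\<zeta> x0 = d \<otimes>\<^bsub>Z\<^esub> (e \<otimes>\<^bsub>Z\<^esub> iota (P ^ Suc v))" by simp
        then have "iota (P ^ v) (Suc v) = (d \<otimes>\<^bsub>Z\<^esub> (e \<otimes>\<^bsub>Z\<^esub> iota (P ^ Suc v))) (Suc v)" using z by simp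
        then have "P ^ v mod P ^ Suc v = 0" by (simp add: Zp_mult_at iota_at)
        moreover have "P ^ v mod P ^ Suc v = P ^ v" using P_gt_1 by simp
        ultimately show False using p_gt_1 by simp
      qed
      then show "x \<in> cyc x0 - cyc ?x1" using x cyc_self[OF x(1)] by simp
    qed
    show "cyc x0 - cyc ?x1 \<subseteq> {x \<in> carrier K. cyc x = cyc x0}"
    proof
      fix x assume x: "x \<in> cyc x0 - cyc ?x1"
      then have "x \<in> cyc x0" by simp
      then obtain c where c: "c \<in> carrier Z" "x = c \<odot>\<^bsub>K\<^esub> x0" unfolding cyc_mem by metis
      have "c 1 \<noteq> 0"
      proof
        assume "c 1 = 0"
        then obtain w where w: "w \<in> carrier Z" "c = iota (P ^ 1) \<otimes>\<^bsub>Z\<^esub> w"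
          using Zp_divide[OF c(1)] by metis
        then have "x = w \<odot>\<^bsub>K\<^esub> ?x1" using c x0 by (simp add: ZR.m_comm K.smult_assoc1)
        then show False using x cycI[OF w(1)] by simp
      qed
      then obtain u where u: "u \<in> carrier Z" "c \<otimes>\<^bsub>Z\<^esub> u = \<one>\<^bsub>Z\<^esub>" using Zp_inverse[OF c(1)] by blast
      have "x0 = u \<odot>\<^bsub>K\<^esub> x" using c u x0 by (simp add: K.smult_assoc1[symmetric] ZR.m_comm[of u c])
      then have "x0 \<in> cyc x" using cycI[OF u(1), of x] by simp
      moreover have xK: "x \<in> carrier K" using c x0 by simp
      ultimately have "cyc x0 \<subseteq> cyc x" using cyc_trans by blast
      moreover have "cyc x \<subseteq> cyc x0" using cyc_trans[OF x0] x by blast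
      ultimately show "x \<in> {x \<in> carrier K. cyc x = cyc x0}" using xK by blast
    qed
  qed
  have s: "cyc x0 \<in> sets MK" "cyc ?x1 \<in> sets MK"
    using opn_sets mu_cyc(1)[OF x0 z] mu_cyc(1)[OF x1] by auto
  then show "{x \<in> carrier K. cyc x = cyc x0} \<in> sets MK" unfolding eq by simp
  have "cyc ?x1 \<subseteq> cyc x0" by (rule cyc_trans[OF x0 cycI]) simp
  then have "\<mu> (cyc x0 - cyc ?x1) = \<mu> (cyc x0) - \<mu> (cyc ?x1)" using s by (intro MKp.finite_measure_Diff)
  then show "\<mu> {x \<in> carrier K. cyc x = cyc x0} = (1 - 1 / real p) / real p ^ v"
    unfolding eq mu_cyc(2)[OF x0 z] mu_cyc(2)[OF x1] using p_gt_1 by (simp add: field_simps)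
qed

text \<open>The elements of finite order, for which the quotient is infinite.\<close>

definition Z0 :: "'k set" where "Z0 = {x \<in> carrier K. \<zeta> x = \<zero>\<^bsub>Z\<^esub>}"

text \<open>\<open>Z0\<close> is covered by \<open>|G|\<close> cylinders of level
  \<open>N + m\<close>, of total mass at most \<open>1 / p ^ N\<close>, for every
  \<open>N\<close>.\<close>

lemma Z0_null: "Z0 \<in> sets MK" "\<mu> Z0 = 0"
proof -
  let ?W = "\<lambda>N. \<Union>b\<in>carrier G. Cyl (N + m) 0 b"
  have C: "Cyl (N + m) 0 b \<in> sets MK" for N b by (intro opn_sets opn_Cyl) simp
  then have W: "?W N \<in> sets MK" for N using fin_G by (intro sets.finite_UN) auto
  have Z0: "Z0 = (\<Inter>N. ?W N)"
  proof
    show "Z0 \<subseteq> (\<Inter>N. ?W N)" by (auto simp: Z0_def Cyl_def Zp_zero_at)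
    show "(\<Inter>N. ?W N) \<subseteq> Z0"
    proof
      fix x assume x: "x \<in> (\<Inter>N. ?W N)"
      then have xK: "x \<in> carrier K" and z: "\<And>N. \<zeta> x (N + m) = 0" by (auto simp: Cyl_def)
      have "\<zeta> x = \<zero>\<^bsub>Z\<^esub>"
      proof (rule Zp_ext[of m])
        fix n assume "m \<le> n"
        then show "\<zeta> x n = \<zero>\<^bsub>Z\<^esub> n" using z[of "n - m"] by (simp add: Zp_zero_at)
      qed (use xK in auto)
      then show "x \<in> Z0" using xK by (simp add: Z0_def)
    qed
  qed
  show s: "Z0 \<in> sets MK" unfolding Z0 using W by (intro sets.countable_INT) auto
  have le: "\<mu> Z0 \<le> (1 / real p) ^ N" for N
  proof -
    have "\<mu> Z0 \<le> \<mu> (?W N)" using Z0 W by (intro MKp.finite_measure_mono) auto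
    also have "\<dots> \<le> (\<Sum>b\<in>carrier G. \<mu> (Cyl (N + m) 0 b))"
      using C fin_G by (intro MKp.finite_measure_subadditive_finite) auto
    also have "\<dots> \<le> (\<Sum>b\<in>carrier G. 1 / real p ^ (N + m))"
    proof (rule sum_mono)
      fix b show "\<mu> (Cyl (N + m) 0 b) \<le> 1 / real p ^ (N + m)"
        using mu_Cyl[of "N + m" 0 b] Cyl_empty[of "N + m" 0 b] by (cases "valid (N + m) 0 b") auto
    qed
    also have "\<dots> = (1 / real p) ^ N" using p_gt_1 by (simp add: card_G power_add power_divide)
    finally show ?thesis .
  qed
  have "(\<lambda>N. (1 / real p) ^ N) \<longlonglongrightarrow> 0" using p_gt_1 by (intro LIMSEQ_realpow_zero) auto
  then have "\<mu> Z0 \<le> 0" by (rule LIMSEQ_le_const) (use le in blast)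
  then show "\<mu> Z0 = 0" using measure_nonneg[of MK Z0] by linarith
qed

lemma cyc_Z0: "x \<in> Z0 \<Longrightarrow> cyc x \<subseteq> Z0"
  by (auto simp: Z0_def cyc_mem zeta_smult)

definition Ev :: "('f, 'n) monoid_scheme \<Rightarrow> 'k set" where "Ev F = {x \<in> carrier K. K A_Mod cyc x \<cong> F}"

lemma A_Mod_eq: "K A_Mod N = add_monoid K Mod N" by (simp add: A_FactGroup_def)

lemma cyc_normal: "x \<in> carrier K \<Longrightarrow> cyc x \<lhd> add_monoid K"
  by (rule comm_group.subgroup_imp_normal[OF AK_comm cyc_subgroup])

lemma Ev_iff:
  assumes "group F"
  shows "x \<in> Ev F \<longleftrightarrow> x \<in> carrier K \<and> (\<exists>\<phi>\<in>epis (add_monoid K) F. kernel (add_monoid K) F \<phi> = cyc x)"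
  unfolding Ev_def A_Mod_eq using quotient_iso_iff[OF AK_group cyc_normal assms] by auto

text \<open>The cosets of \<open>cyc x\<close> partition \<open>K\<close> into sets of measure \<open>p\<^sup>-\<^sup>v\<close>, so there are \<open>p\<^sup>v\<close> of them.\<close>

lemma quotient_finite:
  assumes x: "x \<in> carrier K" and nz: "\<zeta> x \<noteq> \<zero>\<^bsub>Z\<^esub>"
  shows "\<exists>C\<in>X0 p. x \<in> Ev (class_rep C)"
proof -
  obtain v x0 where x0: "x0 \<in> carrier K" "\<zeta> x0 = iota (P ^ v)" "cyc x0 = cyc x"
    using cyc_normal_form[OF x nz] .
  let ?A = "add_monoid K" and ?N = "cyc x0"
  have sg: "subgroup ?N ?A" by (rule cyc_subgroup[OF x0(1)])
  let ?R = "rcosets\<^bsub>?A\<^esub> ?N"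
  have R: "T \<in> sets MK \<and> \<mu> T = 1 / real p ^ v" if "T \<in> ?R" for T
  proof -
    have "\<exists>a\<in>carrier K. T = ?N #>\<^bsub>?A\<^esub> a" using that unfolding RCOSETS_def by simp
    then obtain a where a: "a \<in> carrier K" "T = ?N #>\<^bsub>?A\<^esub> a" by blast
    have T: "T = (\<lambda>h. a \<oplus>\<^bsub>K\<^esub> h) ` ?N" unfolding a(2) r_coset_def
      using a(1) cyc_sub[OF x0(1)] by (auto simp: K.a_comm subset_iff image_iff)
    show ?thesis unfolding T
      using opn_sets[OF translate_opn[OF mu_cyc(1)[OF x0(1,2)] a(1)]]
        mu_translate[OF opn_sets[OF mu_cyc(1)[OF x0(1,2)]] a(1)] mu_cyc(2)[OF x0(1,2)] by simp
  qed
  have dis: "S \<inter> T = {}" if "S \<in> ?R" "T \<in> ?R" "S \<noteq> T" for S T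
    using group.rcos_disjoint[OF AK_group sg] that unfolding pairwise_def disjnt_def by blast
  have fin_mu: "\<mu> (\<Union>\<T>) = real (card \<T>) / real p ^ v" if "finite \<T>" "\<T> \<subseteq> ?R" for \<T>
  proof -
    have "\<mu> (\<Union>T\<in>\<T>. T) = (\<Sum>T\<in>\<T>. \<mu> T)"
      by (rule MKp.finite_measure_finite_Union) (use that R dis in \<open>auto simp: disjoint_family_on_def subset_iff\<close>)
    also have "\<dots> = (\<Sum>T\<in>\<T>. 1 / real p ^ v)" using that R by (intro sum.cong) auto
    finally show ?thesis by simp
  qed
  have le: "card \<T> \<le> p ^ v" if "finite \<T>" "\<T> \<subseteq> ?R" for \<T>
  proof -
    have "real (card \<T>) / real p ^ v \<le> 1" using fin_mu[OF that] MKp.prob_le_1[of "\<Union>\<T>"] by simp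
    then have "real (card \<T>) \<le> real (p ^ v)" using p_gt_1 by (simp add: divide_le_eq)
    then show ?thesis by (simp only: of_nat_le_iff)
  qed
  have finR: "finite ?R"
  proof (rule ccontr)
    assume "infinite ?R"
    then obtain \<T> where "finite \<T>" "card \<T> = Suc (p ^ v)" "\<T> \<subseteq> ?R" using infinite_arbitrarily_large by blast
    then show False using le by fastforce
  qed
  have "\<Union>?R = carrier K" using group.rcosets_part_G[OF AK_group sg] by simp
  then have "real (card ?R) / real p ^ v = 1" using fin_mu[OF finR] MKp.prob_space space_MK by simp
  then have "real (card ?R) = real (p ^ v)" using p_gt_1 by (simp add: field_simps)
  then have cR: "card ?R = p ^ v" by (simp only: of_nat_eq_iff)
  have car: "carrier (?A Mod ?N) = ?R" by (simp add: FactGroup_def)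
  have "comm_group (?A Mod ?N)" by (rule comm_group.abelian_FactGroup[OF AK_comm sg])
  from X0_ex'[OF this] obtain C where "C \<in> X0 p" "?A Mod ?N \<cong> class_rep C"
    unfolding car using finR cR by blast
  then show ?thesis unfolding Ev_def A_Mod_eq using x x0(3) by auto
qed

end

section \<open>Kernels with one generator and the law of the random quotient\<close>

context rank1_target
begin

lemma fib_kernel: "fib \<psi> \<one>\<^bsub>F\<^esub> = kernel (add_monoid K) F \<psi>"
  by (simp add: fib_def kernel_def)

lemma kernel_subgroup: "\<psi> \<in> epi_KF \<Longrightarrow> subgroup (kernel (add_monoid K) F \<psi>) (add_monoid K)"
  using episD(1) AK_group F.is_group
  by (intro group_hom.subgroup_kernel) (simp add: group_hom_def group_hom_axioms_def)

lemma cyc_in_kernel: "\<psi> \<in> epi_KF \<Longrightarrow> x \<in> carrier K \<Longrightarrow> \<psi> x = \<one>\<^bsub>F\<^esub> \<Longrightarrow> cyc x \<subseteq> kernel (add_monoid K) F \<psi>"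
  using epi_smult by (auto simp: cyc_mem kernel_def)

definition gens :: "('k \<Rightarrow> 'f) \<Rightarrow> 'k set" where
  "gens \<phi> = {x \<in> carrier K. cyc x = kernel (add_monoid K) F \<phi>}"

text \<open>The kernel of a surjection onto \<open>F\<close> has index \<open>p ^ k\<close>. If a
  single element generates it, a unit multiple of that element has first coordinate
  \<open>P ^ k\<close>; conversely such an element of the kernel generates it.\<close>

definition special :: "('k \<Rightarrow> 'f) \<Rightarrow> bool" where
  "special \<phi> \<longleftrightarrow> (\<exists>x0\<in>carrier K. \<zeta> x0 = iota (P ^ k) \<and> \<phi> x0 = \<one>\<^bsub>F\<^esub>)"

text \<open>The kernel contains \<open>cyc x0\<close>, and both have mass
  \<open>1 / p ^ k\<close>.\<close>

lemma special_kernel: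
  assumes ps: "\<phi> \<in> epi_KF" and x0: "x0 \<in> carrier K" "\<zeta> x0 = iota (P ^ k)" "\<phi> x0 = \<one>\<^bsub>F\<^esub>"
  shows "kernel (add_monoid K) F \<phi> = cyc x0"
  using cyc_sub_eq[OF x0(1,2) kernel_subgroup[OF ps] _ cyc_in_kernel[OF ps x0(1,3)]]
    opn_sets[OF opn_fib[OF ps]] mu_fib[OF ps] mu_cyc(2)[OF x0(1,2)] unfolding fib_kernel[symmetric] by simp

lemma gens_special:
  assumes ps: "\<phi> \<in> epi_KF" and x: "x \<in> gens \<phi>"
  shows "special \<phi>"
proof -
  have x: "x \<in> carrier K" "cyc x = fib \<phi> \<one>\<^bsub>F\<^esub>" using x by (auto simp: gens_def fib_kernel)
  \<comment> \<open>Otherwise the kernel, of positive mass, would lie in the null set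
    \<open>Z0\<close>.\<close>
  have "\<zeta> x \<noteq> \<zero>\<^bsub>Z\<^esub>"
  proof
    assume "\<zeta> x = \<zero>\<^bsub>Z\<^esub>"
    then have "fib \<phi> \<one>\<^bsub>F\<^esub> \<subseteq> Z0" using cyc_Z0[of x] x by (simp add: Z0_def)
    then have "\<mu> (fib \<phi> \<one>\<^bsub>F\<^esub>) \<le> \<mu> Z0" using Z0_null(1) by (rule MKp.finite_measure_mono)
    moreover have "0 < 1 / real p ^ k" using p_gt_1 by simp
    ultimately show False using Z0_null(2) mu_fib[OF ps] by linarith
  qed
  from cyc_normal_form[OF x(1) this] obtain v x0 where
    x0: "x0 \<in> carrier K" "\<zeta> x0 = iota (P ^ v)" "cyc x0 = cyc x" .
  have "1 / real p ^ v = 1 / real p ^ k" using mu_cyc(2)[OF x0(1,2)] mu_fib[OF ps] x0(3) x(2) by simp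
  then have "real p ^ v = real p ^ k" using p_gt_1 by (simp add: field_simps)
  then have "v = k" using p_gt_1 by simp
  moreover have "\<phi> x0 = \<one>\<^bsub>F\<^esub>" using cyc_self[OF x0(1)] x0(3) x(2) by (auto simp: fib_def)
  ultimately show ?thesis unfolding special_def using x0 by blast
qed

lemma mu_gens:
  assumes ps: "\<phi> \<in> epi_KF"
  shows "gens \<phi> \<in> sets MK" "\<mu> (gens \<phi>) = (if special \<phi> then (1 - 1 / real p) / real p ^ k else 0)"
proof -
  have "gens \<phi> \<in> sets MK \<and> \<mu> (gens \<phi>) = (if special \<phi> then (1 - 1 / real p) / real p ^ k else 0)"
  proof (cases "special \<phi>")
    case True
    then obtain x0 where x0: "x0 \<in> carrier K" "\<zeta> x0 = iota (P ^ k)" "\<phi> x0 = \<one>\<^bsub>F\<^esub>"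
      unfolding special_def by blast
    have "gens \<phi> = {x \<in> carrier K. cyc x = cyc x0}"
      unfolding gens_def special_kernel[OF ps x0] ..
    then show ?thesis using mu_generators[OF x0(1,2)] True by simp
  next
    case False
    then have "gens \<phi> = {}" using gens_special[OF ps] by blast
    then show ?thesis using False by simp
  qed
  then show "gens \<phi> \<in> sets MK" "\<mu> (gens \<phi>) = (if special \<phi> then (1 - 1 / real p) / real p ^ k else 0)" by auto
qed

lemma Ev_gens: "Ev F = (\<Union>\<phi>\<in>epi_KF. gens \<phi>)"
  using Ev_iff[OF F.is_group] unfolding gens_def set_eq_iff UN_iff mem_Collect_eq by metis

lemma Ev_sets: "Ev F \<in> sets MK"
  unfolding Ev_gens using mu_gens(1) finite_epi_KF by (intro sets.finite_UN) auto

text \<open>Surjections from \<open>K/\<langle>x\<rangle>\<close> are the surjections from \<open>K\<close> that kill \<open>x\<close>.\<close>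

lemma card_epi_kill:
  assumes C: "group C" and x: "x \<in> Ev C"
  shows "card {\<psi> \<in> epi_KF. \<psi> x = \<one>\<^bsub>F\<^esub>} = card (epis C F)"
proof -
  obtain \<phi> where ph: "\<phi> \<in> epis (add_monoid K) C" "kernel (add_monoid K) C \<phi> = cyc x" and xK: "x \<in> carrier K"
    using x Ev_iff[OF C] by blast
  have "{\<psi> \<in> epi_KF. \<psi> x = \<one>\<^bsub>F\<^esub>} = {\<psi> \<in> epi_KF. \<forall>y\<in>carrier (add_monoid K). \<phi> y = \<one>\<^bsub>C\<^esub> \<longrightarrow> \<psi> y = \<one>\<^bsub>F\<^esub>}"
  proof (intro Collect_cong conj_cong refl iffI ballI impI)
    fix \<psi> y assume h: "\<psi> \<in> epi_KF" "\<psi> x = \<one>\<^bsub>F\<^esub>" "y \<in> carrier (add_monoid K)" "\<phi> y = \<one>\<^bsub>C\<^esub>"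
    then have "y \<in> cyc x" using ph(2) by (auto simp: kernel_def)
    then show "\<psi> y = \<one>\<^bsub>F\<^esub>" using cyc_in_kernel[OF h(1) xK h(2)] by (auto simp: kernel_def)
  next
    fix \<psi> assume h: "\<psi> \<in> epi_KF" "\<forall>y\<in>carrier (add_monoid K). \<phi> y = \<one>\<^bsub>C\<^esub> \<longrightarrow> \<psi> y = \<one>\<^bsub>F\<^esub>"
    have "x \<in> kernel (add_monoid K) C \<phi>" using ph(2) cyc_self[OF xK] by simp
    then show "\<psi> x = \<one>\<^bsub>F\<^esub>" using h(2) by (simp add: kernel_def)
  qed
  moreover have "\<phi> \<in> epi (add_monoid K) C" using ph(1) by (simp add: epis_def)
  ultimately show ?thesis using card_epis_factor[OF AK_group C F.is_group] by simp
qed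

text \<open>Each \<open>x\<close> in \<open>Ev F\<close> generates the kernel of exactly
  \<open>|Aut F|\<close> surjections. Summing the mass of the generators over all surjections
  therefore counts \<open>Ev F\<close> that many times, and only special surjections
  contribute.\<close>

theorem mu_Ev: "\<mu> (Ev F) * real (card (auto F)) = (1 - 1 / real p) / real p ^ k * real (card {\<phi> \<in> epi_KF. special \<phi>})"
proof -
  have "(\<Sum>\<phi>\<in>epi_KF. \<mu> (gens \<phi>)) = \<mu> (Ev F) * real (card (epis F F))"
  proof (rule sum_measure_const[OF MKp.finite_measure_axioms finite_epi_KF _ Ev_sets])
    fix x assume x: "x \<in> Ev F"
    then have xK: "x \<in> carrier K" by (simp add: Ev_def)
    obtain \<phi>0 where p0: "\<phi>0 \<in> epi_KF" "kernel (add_monoid K) F \<phi>0 = cyc x"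
      using x Ev_iff[OF F.is_group] by blast
    then have "x \<in> gens \<phi>0" using xK by (simp add: gens_def)
    then obtain x0 where x0: "x0 \<in> carrier K" "\<zeta> x0 = iota (P ^ k)" "\<phi>0 x0 = \<one>\<^bsub>F\<^esub>"
      using gens_special[OF p0(1)] unfolding special_def by blast
    have c0: "cyc x0 = cyc x" using special_kernel[OF p0(1) x0] p0(2) by simp
    \<comment> \<open>A surjection that kills \<open>x\<close> kills the submodule
      \<open>cyc x = cyc x0\<close>, which already has the index of its kernel; so containment is
      equality.\<close>
    have "{\<phi> \<in> epi_KF. x \<in> gens \<phi>} = {\<phi> \<in> epi_KF. \<phi> x = \<one>\<^bsub>F\<^esub>}"
    proof (intro Collect_cong conj_cong refl iffI)
      fix \<phi> assume "\<phi> \<in> epi_KF" "x \<in> gens \<phi>"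
      then show "\<phi> x = \<one>\<^bsub>F\<^esub>" using cyc_self[OF xK] by (auto simp: gens_def kernel_def)
    next
      fix \<phi> assume ph: "\<phi> \<in> epi_KF" "\<phi> x = \<one>\<^bsub>F\<^esub>"
      have "x0 \<in> kernel (add_monoid K) F \<phi>"
        using cyc_in_kernel[OF ph(1) xK ph(2)] c0 cyc_self[OF x0(1)] by blast
      then have "kernel (add_monoid K) F \<phi> = cyc x0"
        by (intro special_kernel[OF ph(1) x0(1,2)]) (simp add: kernel_def)
      then show "x \<in> gens \<phi>" using xK c0 by (simp add: gens_def)
    qed
    then show "card {\<phi> \<in> epi_KF. x \<in> gens \<phi>} = card (epis F F)"
      using card_epi_kill[OF F.is_group x] by simp
  qed (use mu_gens(1) Ev_gens in auto)
  moreover have "(\<Sum>\<phi>\<in>epi_KF. \<mu> (gens \<phi>)) = (\<Sum>\<phi>\<in>{\<phi> \<in> epi_KF. special \<phi>}. (1 - 1 / real p) / real p ^ k)"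
    using finite_epi_KF mu_gens(2) by (intro sum.mono_neutral_cong_right) auto
  ultimately show ?thesis using epis_self[OF fin_F] by (simp add: mult_ac)
qed

end

lemma (in rank1) Ev_sets_X0: "C \<in> X0 p \<Longrightarrow> Ev (class_rep C) \<in> sets MK"
proof -
  assume C: "C \<in> X0 p"
  note D = fin_ab_p_groupD[OF X0_rep[OF C]]
  obtain k where k: "card (carrier (class_rep C)) = p ^ k" using D(4) by blast
  interpret comm_group "class_rep C" by (rule D(1))
  interpret T: rank1_target p G m \<kappa> K \<zeta> \<gamma> "class_rep C" k by unfold_locales (use D k in auto)
  show ?thesis by (rule T.Ev_sets)
qed

text \<open>A fixed surjection \<open>\<psi>\<close> kills a random \<open>x\<close> with
  probability \<open>1 / |F|\<close>, and outside \<open>Z0\<close> this event splits according to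
  the class of the quotient by \<open>x\<close>. Summed over \<open>\<psi>\<close>, each
  \<open>x\<close> is counted once for every surjection from its quotient onto
  \<open>F\<close>.\<close>

theorem (in rank1_target) has_sum_Ev:
  "((\<lambda>C. \<mu> (Ev (class_rep C)) * real (card (epis (class_rep C) F))) has_sum (real (card epi_KF) / real p ^ k)) (X0 p)"
proof -
  have G: "group (class_rep C)" if "C \<in> X0 p" for C using fin_ab_p_groupD(2)[OF X0_rep[OF that]] .
  have s: "fib \<psi> \<one>\<^bsub>F\<^esub> \<in> sets MK" if "\<psi> \<in> epi_KF" for \<psi> using opn_sets[OF opn_fib[OF that]] .
  have "((\<lambda>C. \<mu> (Ev (class_rep C) \<inter> fib \<psi> \<one>\<^bsub>F\<^esub>)) has_sum (1 / real p ^ k)) (X0 p)" if ps: "\<psi> \<in> epi_KF" for \<psi>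
  proof -
    have "((\<lambda>C. \<mu> (Ev (class_rep C) \<inter> fib \<psi> \<one>\<^bsub>F\<^esub>)) has_sum
      \<mu> (\<Union>C\<in>X0 p. Ev (class_rep C) \<inter> fib \<psi> \<one>\<^bsub>F\<^esub>)) (X0 p)"
    proof (rule has_sum_measure_disjoint[OF MKp.finite_measure_axioms countable_X0])
      show "disjoint_family_on (\<lambda>C. Ev (class_rep C) \<inter> fib \<psi> \<one>\<^bsub>F\<^esub>) (X0 p)"
        unfolding disjoint_family_on_def
      proof (intro ballI impI, rule ccontr)
        fix C D assume CD: "C \<in> X0 p" "D \<in> X0 p" "C \<noteq> D"
          "(Ev (class_rep C) \<inter> fib \<psi> \<one>\<^bsub>F\<^esub>) \<inter> (Ev (class_rep D) \<inter> fib \<psi> \<one>\<^bsub>F\<^esub>) \<noteq> {}"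
        then obtain x where x: "x \<in> Ev (class_rep C)" "x \<in> Ev (class_rep D)" by blast
        then have "x \<in> carrier K" "add_monoid K Mod cyc x \<cong> class_rep C" "add_monoid K Mod cyc x \<cong> class_rep D"
          by (auto simp: Ev_def A_Mod_eq)
        moreover have "group (add_monoid K Mod cyc x)"
          using normal.factorgroup_is_group[OF cyc_normal] calculation(1) by blast
        ultimately have "class_rep C \<cong> class_rep D" using group.iso_sym iso_trans by blast
        then show False using X0_eq CD by blast
      qed
      fix C assume "C \<in> X0 p"
      then show "Ev (class_rep C) \<inter> fib \<psi> \<one>\<^bsub>F\<^esub> \<in> sets MK" using Ev_sets_X0 s[OF ps] by simp
    qed
    moreover have "\<mu> (\<Union>C\<in>X0 p. Ev (class_rep C) \<inter> fib \<psi> \<one>\<^bsub>F\<^esub>) = \<mu> (fib \<psi> \<one>\<^bsub>F\<^esub>)"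
    proof (rule MKp.finite_measure_eq_AE)
      have "AE x in MK. x \<notin> Z0" using Z0_null by (intro AE_not_in) (simp add: null_sets_def MKp.emeasure_eq_measure)
      then show "AE x in MK. (x \<in> (\<Union>C\<in>X0 p. Ev (class_rep C) \<inter> fib \<psi> \<one>\<^bsub>F\<^esub>)) = (x \<in> fib \<psi> \<one>\<^bsub>F\<^esub>)"
      proof eventually_elim
        case (elim x)
        show ?case
        proof
          assume x: "x \<in> fib \<psi> \<one>\<^bsub>F\<^esub>"
          then have "x \<in> carrier K" "\<zeta> x \<noteq> \<zero>\<^bsub>Z\<^esub>" using elim by (auto simp: fib_def Z0_def)
          from quotient_finite[OF this] show "x \<in> (\<Union>C\<in>X0 p. Ev (class_rep C) \<inter> fib \<psi> \<one>\<^bsub>F\<^esub>)" using x by blast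
        qed blast
      qed
      show "(\<Union>C\<in>X0 p. Ev (class_rep C) \<inter> fib \<psi> \<one>\<^bsub>F\<^esub>) \<in> sets MK"
        using Ev_sets_X0 s[OF ps] countable_X0 by (intro sets.countable_UN'') auto
    qed (rule s[OF ps])
    ultimately show ?thesis using mu_fib[OF ps] by simp
  qed
  note hs = this
  have "((\<lambda>C. \<Sum>\<psi>\<in>epi_KF. \<mu> (Ev (class_rep C) \<inter> fib \<psi> \<one>\<^bsub>F\<^esub>)) has_sum (\<Sum>\<psi>\<in>epi_KF. 1 / real p ^ k)) (X0 p)"
  proof -
    have "((\<lambda>C. \<Sum>i\<in>I. f i C) has_sum (\<Sum>i\<in>I. (b i::real))) A"
      if "finite I" "\<And>i. i \<in> I \<Longrightarrow> (f i has_sum b i) A" for I :: "('k \<Rightarrow> 'f) set" and f b and A :: "nat monoid set set"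
      using that by (induction rule: finite_induct) (auto intro: has_sum_add)
    from this[OF finite_epi_KF hs] show ?thesis .
  qed
  moreover have "(\<Sum>\<psi>\<in>epi_KF. \<mu> (Ev (class_rep C) \<inter> fib \<psi> \<one>\<^bsub>F\<^esub>)) = \<mu> (Ev (class_rep C)) * real (card (epis (class_rep C) F))"
    if C: "C \<in> X0 p" for C
  proof (rule sum_measure_const[OF MKp.finite_measure_axioms finite_epi_KF _ Ev_sets_X0[OF C]])
    fix x assume x: "x \<in> Ev (class_rep C)"
    then have "{\<psi> \<in> epi_KF. x \<in> Ev (class_rep C) \<inter> fib \<psi> \<one>\<^bsub>F\<^esub>} = {\<psi> \<in> epi_KF. \<psi> x = \<one>\<^bsub>F\<^esub>}"
      by (auto simp: fib_def Ev_def)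
    then show "card {\<psi> \<in> epi_KF. x \<in> Ev (class_rep C) \<inter> fib \<psi> \<one>\<^bsub>F\<^esub>} = card (epis (class_rep C) F)"
      using card_epi_kill[OF G[OF C] x] by simp
  qed (use Ev_sets_X0[OF C] s in auto)
  moreover have "(\<Sum>\<psi>\<in>epi_KF. 1 / real p ^ k) = real (card epi_KF) / real p ^ k" by simp
  ultimately show ?thesis using has_sum_cong[of "X0 p" "\<lambda>C. \<Sum>\<psi>\<in>epi_KF. \<mu> (Ev (class_rep C) \<inter> fib \<psi> \<one>\<^bsub>F\<^esub>)"
      "\<lambda>C. \<mu> (Ev (class_rep C)) * real (card (epis (class_rep C) F))"] by simp
qed

section \<open>Linking subgroups\<close>

text \<open>A surjection \<open>\<phi>\<close> from an extension \<open>H\<close> of \<open>G\<close> onto \<open>F\<close> is encoded by the subgroup of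
  \<open>\<int> \<times> G \<times> F\<close> that consists of the triples \<open>(k, q h, \<phi> h)\<close> with \<open>|G| h = k \<cdot> i(1)\<close>.\<close>

definition link :: "('g, 'c) monoid_scheme \<Rightarrow> ('f, 'd) monoid_scheme \<Rightarrow> (int \<times> 'g \<times> 'f) set \<Rightarrow> bool" where
  "link G F S \<longleftrightarrow>
     (\<forall>k g f. (k, g, f) \<in> S \<longrightarrow> g \<in> carrier G \<and> f \<in> carrier F \<and> (- k, inv\<^bsub>G\<^esub> g, inv\<^bsub>F\<^esub> f) \<in> S) \<and>
     (\<forall>k g f k' g' f'. (k, g, f) \<in> S \<longrightarrow> (k', g', f') \<in> S \<longrightarrow> (k + k', g \<otimes>\<^bsub>G\<^esub> g', f \<otimes>\<^bsub>F\<^esub> f') \<in> S) \<and>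
     (\<forall>g\<in>carrier G. \<exists>k f. (k, g, f) \<in> S) \<and> (\<forall>f\<in>carrier F. \<exists>k g. (k, g, f) \<in> S) \<and>
     (\<exists>f. (int (card (carrier G)), \<one>\<^bsub>G\<^esub>, f) \<in> S) \<and>
     (\<forall>k f. (k, \<one>\<^bsub>G\<^esub>, f) \<in> S \<longrightarrow> int (card (carrier G)) dvd k \<and> (k = 0 \<longrightarrow> f = \<one>\<^bsub>F\<^esub>))"

text \<open>Says that \<open>\<kappa>\<close> is the class of the extension from which
  \<open>S\<close> arises.\<close>

definition compat :: "('g, 'c) monoid_scheme \<Rightarrow> (int \<times> 'g \<times> 'f) set \<Rightarrow> ('g \<Rightarrow> int) \<Rightarrow> bool" where
  "compat G S \<kappa> \<longleftrightarrow> (\<forall>k g f. (k, g, f) \<in> S \<longrightarrow> k mod int (card (carrier G)) = \<kappa> g)"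

definition flip :: "(int \<times> 'g \<times> 'f) set \<Rightarrow> (int \<times> 'f \<times> 'g) set" where
  "flip S = {(k, f, g). (k, g, f) \<in> S}"

lemma flip_mem [simp]: "(k, f, g) \<in> flip S \<longleftrightarrow> (k, g, f) \<in> S" by (simp add: flip_def)
lemma flip_flip [simp]: "flip (flip S) = S" by (auto simp: flip_def)

lemma linkD:
  assumes "link G F S"
  shows "\<And>k g f. (k, g, f) \<in> S \<Longrightarrow> g \<in> carrier G"
    "\<And>k g f. (k, g, f) \<in> S \<Longrightarrow> f \<in> carrier F"
    "\<And>k g f. (k, g, f) \<in> S \<Longrightarrow> (- k, inv\<^bsub>G\<^esub> g, inv\<^bsub>F\<^esub> f) \<in> S"
    "\<And>k g f k' g' f'. (k, g, f) \<in> S \<Longrightarrow> (k', g', f') \<in> S \<Longrightarrow> (k + k', g \<otimes>\<^bsub>G\<^esub> g', f \<otimes>\<^bsub>F\<^esub> f') \<in> S"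
    "\<And>g. g \<in> carrier G \<Longrightarrow> \<exists>k f. (k, g, f) \<in> S"
    "\<And>f. f \<in> carrier F \<Longrightarrow> \<exists>k g. (k, g, f) \<in> S"
    "\<exists>f. (int (card (carrier G)), \<one>\<^bsub>G\<^esub>, f) \<in> S"
    "\<And>k f. (k, \<one>\<^bsub>G\<^esub>, f) \<in> S \<Longrightarrow> int (card (carrier G)) dvd k"
    "\<And>f. (0, \<one>\<^bsub>G\<^esub>, f) \<in> S \<Longrightarrow> f = \<one>\<^bsub>F\<^esub>"
proof -
  note a = assms[unfolded link_def]
  note b = conjunct2[OF a] note c = conjunct2[OF b] note d = conjunct2[OF c] note e = conjunct2[OF d]
  note a1 = conjunct1[OF a] and b1 = conjunct1[OF b] and c1 = conjunct1[OF c] and d1 = conjunct1[OF d]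
    and e1 = conjunct1[OF e] and e2 = conjunct2[OF e]
  show "\<And>k g f. (k, g, f) \<in> S \<Longrightarrow> g \<in> carrier G" "\<And>k g f. (k, g, f) \<in> S \<Longrightarrow> f \<in> carrier F"
    "\<And>k g f. (k, g, f) \<in> S \<Longrightarrow> (- k, inv\<^bsub>G\<^esub> g, inv\<^bsub>F\<^esub> f) \<in> S" using a1 by simp_all
  show "\<And>k g f k' g' f'. (k, g, f) \<in> S \<Longrightarrow> (k', g', f') \<in> S \<Longrightarrow> (k + k', g \<otimes>\<^bsub>G\<^esub> g', f \<otimes>\<^bsub>F\<^esub> f') \<in> S"
    using b1 by simp
  show "\<And>g. g \<in> carrier G \<Longrightarrow> \<exists>k f. (k, g, f) \<in> S" using c1 by simp
  show "\<And>f. f \<in> carrier F \<Longrightarrow> \<exists>k g. (k, g, f) \<in> S" using d1 by simp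
  show "\<exists>f. (int (card (carrier G)), \<one>\<^bsub>G\<^esub>, f) \<in> S" by (rule e1)
  show "\<And>k f. (k, \<one>\<^bsub>G\<^esub>, f) \<in> S \<Longrightarrow> int (card (carrier G)) dvd k"
    "\<And>f. (0, \<one>\<^bsub>G\<^esub>, f) \<in> S \<Longrightarrow> f = \<one>\<^bsub>F\<^esub>" using e2 by simp_all
qed

locale two_groups = G: comm_group G + F: comm_group F for G :: "'g monoid" (structure) and F :: "'f monoid"
begin

lemma link_pow:
  assumes S: "link G F S" and s: "(k, g, f) \<in> S"
  shows "(j * k, g [^] j, f [^]\<^bsub>F\<^esub> (j::int)) \<in> S"
proof -
  note L = linkD[OF S]
  have c: "g \<in> carrier G" "f \<in> carrier F" using L(1,2) s by auto
  have nat: "(int j * k, g [^] int j, f [^]\<^bsub>F\<^esub> int j) \<in> S" for j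
  proof (induction j)
    case 0
    show ?case using L(4)[OF s L(3)[OF s]] c by simp
  next
    case (Suc j)
    have "(int j * k + k, g [^] int j \<otimes> g, f [^]\<^bsub>F\<^esub> int j \<otimes>\<^bsub>F\<^esub> f) \<in> S" by (rule L(4)[OF Suc s])
    moreover have "g [^] int (Suc j) = g [^] int j \<otimes> g" "f [^]\<^bsub>F\<^esub> int (Suc j) = f [^]\<^bsub>F\<^esub> int j \<otimes>\<^bsub>F\<^esub> f"
      using c G.int_pow_mult[of g "int j" 1] F.int_pow_mult[of f "int j" 1] by (simp_all add: add.commute)
    moreover have "int (Suc j) * k = int j * k + k" by (simp add: algebra_simps)
    ultimately show ?case by simp
  qed
  show ?thesis
  proof (cases "j \<ge> 0")
    case True
    then show ?thesis using nat[of "nat j"] by simp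
  next
    case False
    then have j: "j = - int (nat (- j))" by simp
    define i where "i = nat (- j)"
    have "(- (int i * k), inv (g [^] int i), inv\<^bsub>F\<^esub> (f [^]\<^bsub>F\<^esub> int i)) \<in> S" by (rule L(3)[OF nat])
    then show ?thesis using c j unfolding i_def[symmetric]
      by (simp add: G.int_pow_neg F.int_pow_neg)
  qed
qed

lemma link_diff:
  assumes S: "link G F S" and s: "(k, g, f) \<in> S" "(k', g', f') \<in> S"
  shows "(k - k', g \<otimes> inv g', f \<otimes>\<^bsub>F\<^esub> inv\<^bsub>F\<^esub> f') \<in> S"
  using linkD(4)[OF S s(1) linkD(3)[OF S s(2)]] by simp

lemma link_unique:
  assumes S: "link G F S" and s: "(k, g, f) \<in> S" "(k, g, f') \<in> S"
  shows "f = f'"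
proof -
  have c: "g \<in> carrier G" "f \<in> carrier F" "f' \<in> carrier F" using linkD(1,2)[OF S] s by auto
  have "(0, \<one>, f \<otimes>\<^bsub>F\<^esub> inv\<^bsub>F\<^esub> f') \<in> S" using link_diff[OF S s] c by simp
  then have "f \<otimes>\<^bsub>F\<^esub> inv\<^bsub>F\<^esub> f' = \<one>\<^bsub>F\<^esub>" by (rule linkD(9)[OF S])
  then show ?thesis using c by (metis F.inv_closed F.inv_equality F.inv_inv)
qed

lemma link_cong:
  assumes S: "link G F S" and s: "(k, g, f) \<in> S" "(k', g, f') \<in> S"
  shows "int (card (carrier G)) dvd k - k'"
proof -
  have c: "g \<in> carrier G" using linkD(1)[OF S] s by auto
  have "(k - k', \<one>, f \<otimes>\<^bsub>F\<^esub> inv\<^bsub>F\<^esub> f') \<in> S" using link_diff[OF S s] c by simp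
  then show ?thesis by (rule linkD(8)[OF S])
qed

text \<open>Members of \<open>S\<close> over the same \<open>g\<close> have first entries congruent
  modulo \<open>|G|\<close>, so the residue is a function of \<open>g\<close>; it is additive
  because \<open>S\<close> is closed under addition.\<close>

lemma link_compat:
  assumes S: "link G F S" and n: "card (carrier G) > 0"
  shows "\<exists>\<kappa>\<in>chr G (int (card (carrier G))) (carrier G). compat G S \<kappa>"
proof -
  let ?n = "int (card (carrier G))"
  have "\<exists>k. \<exists>f. (k, g, f) \<in> S" if "g \<in> carrier G" for g using linkD(5)[OF S that] by blast
  then obtain s where s: "\<And>g. g \<in> carrier G \<Longrightarrow> \<exists>f. (s g, g, f) \<in> S" by metis
  define \<kappa> where "\<kappa> = (\<lambda>g\<in>carrier G. s g mod ?n)"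
  have k: "k mod ?n = \<kappa> g" if h: "(k, g, f) \<in> S" for k g f
  proof -
    have g: "g \<in> carrier G" using linkD(1)[OF S h] .
    then obtain f' where "(s g, g, f') \<in> S" using s by blast
    then have "k mod ?n = s g mod ?n" unfolding mod_eq_dvd using link_cong[OF S h] by blast
    then show ?thesis unfolding \<kappa>_def using g by simp
  qed
  have "\<kappa> \<in> chr G ?n (carrier G)" unfolding chr_def
  proof (intro CollectI conjI ballI)
    show "\<kappa> \<in> carrier G \<rightarrow>\<^sub>E {0..<?n}" unfolding \<kappa>_def using n by (auto intro!: PiE_I)
    fix a b assume ab: "a \<in> carrier G" "b \<in> carrier G"
    obtain f f' where f: "(s a, a, f) \<in> S" "(s b, b, f') \<in> S" using s ab by blast
    have "(s a + s b) mod ?n = \<kappa> (a \<otimes> b)" by (rule k[OF linkD(4)[OF S f]])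
    moreover have "(s a + s b) mod ?n = (s a mod ?n + s b mod ?n) mod ?n" by (simp add: mod_simps)
    ultimately show "\<kappa> (a \<otimes> b) = (\<kappa> a + \<kappa> b) mod ?n" unfolding \<kappa>_def using ab by simp
  qed
  moreover have "compat G S \<kappa>" unfolding compat_def using k by blast
  ultimately show ?thesis by blast
qed

lemma compat_unique:
  assumes S: "link G F S" and k: "\<kappa> \<in> chr G n (carrier G)" "\<kappa>' \<in> chr G n (carrier G)" "compat G S \<kappa>" "compat G S \<kappa>'"
  shows "\<kappa> = \<kappa>'"
proof (rule chr_eqI[OF k(1,2)])
  fix g assume "g \<in> carrier G"
  then obtain k f where "(k, g, f) \<in> S" using linkD(5)[OF S] by blast
  then show "\<kappa> g = \<kappa>' g" using k(3,4) unfolding compat_def by metis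
qed

end

context rank1_target
begin

sublocale GF: two_groups G F by unfold_locales

text \<open>Records only the points with integral first coordinate. They meet every nonempty
  cylinder, which suffices for a map that is constant on cylinders of level
  \<open>k + m\<close>.\<close>

definition graph :: "('k \<Rightarrow> 'f) \<Rightarrow> (int \<times> nat \<times> 'f) set" where
  "graph \<phi> = {(j, g, f). \<exists>x\<in>carrier K. \<zeta> x = iota j \<and> \<gamma> x = g \<and> \<phi> x = f}"

lemma graphE:
  assumes "(j, g, f) \<in> graph \<phi>"
  obtains x where "x \<in> carrier K" "\<zeta> x = iota j" "\<gamma> x = g" "\<phi> x = f"
  using assms unfolding graph_def mem_Collect_eq case_prod_conv by (elim bexE conjE)

lemma int_point:
  assumes "g \<in> carrier G" "j mod P ^ m = \<kappa> g"
  obtains x where "x \<in> carrier K" "\<zeta> x = iota j" "\<gamma> x = g"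
  using coord_ex[of "iota j" g] assms by (auto simp: iota_at)

text \<open>Truncating the first coordinate at level \<open>k + m\<close> stays within a cylinder on
  which all members of \<open>epi_KF\<close> are constant.\<close>

lemma int_approx:
  assumes x: "x \<in> carrier K"
  obtains x' where "x' \<in> carrier K" "\<zeta> x' = iota (\<zeta> x (k + m))" "\<gamma> x' = \<gamma> x" "x' \<in> Cyl (k + m) (\<zeta> x (k + m)) (\<gamma> x)"
proof -
  have "\<zeta> x (k + m) mod P ^ m = \<kappa> (\<gamma> x)"
    using Zp_mod[OF zeta_closed[OF x], of m "k + m"] zeta_gamma[OF x] by simp
  then obtain x' where x': "x' \<in> carrier K" "\<zeta> x' = iota (\<zeta> x (k + m))" "\<gamma> x' = \<gamma> x"
    using int_point[OF gamma_closed[OF x]] by blast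
  moreover have "x' \<in> Cyl (k + m) (\<zeta> x (k + m)) (\<gamma> x)"
    using x' Zp_mod_self[OF zeta_closed[OF x]] by (simp add: Cyl_def iota_at)
  ultimately show thesis using that by blast
qed

lemma graph_link:
  assumes ps: "\<phi> \<in> epi_KF"
  shows "link G F (graph \<phi>)" "compat G (graph \<phi>) \<kappa>"
proof -
  note E = epiD[OF ps]
  have mem: "\<And>j g f. (j, g, f) \<in> graph \<phi> \<longleftrightarrow> (\<exists>x\<in>carrier K. \<zeta> x = iota j \<and> \<gamma> x = g \<and> \<phi> x = f)"
    by (simp add: graph_def)
  have I: "(j, \<gamma> x, \<phi> x) \<in> graph \<phi>" if "x \<in> carrier K" "\<zeta> x = iota j" for x j
    unfolding mem using that by blast
  have km: "j mod P ^ m = \<kappa> (\<gamma> x)" if "x \<in> carrier K" "\<zeta> x = iota j" for x j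
    using zeta_gamma[OF that(1)] that(2) by (simp add: iota_at)
  show "link G F (graph \<phi>)" unfolding link_def int_card_G
  proof (intro conjI allI impI ballI)
    fix j g f assume "(j, g, f) \<in> graph \<phi>"
    then obtain x where x: "x \<in> carrier K" "\<zeta> x = iota j" "\<gamma> x = g" "\<phi> x = f" unfolding mem by blast
    show "g \<in> carrier G" "f \<in> carrier F" using x(3,4) gamma_closed[OF x(1)] E(1)[OF x(1)] by auto
    have "(- j, \<gamma> (\<ominus>\<^bsub>K\<^esub> x), \<phi> (\<ominus>\<^bsub>K\<^esub> x)) \<in> graph \<phi>"
      by (rule I) (use x(1,2) in \<open>simp_all add: zeta_minus iota_minus\<close>)
    then show "(- j, inv g, inv\<^bsub>F\<^esub> f) \<in> graph \<phi>"
      unfolding gamma_minus[OF x(1)] E(5)[OF x(1)] x(3,4) .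
  next
    fix j g f j' g' f' assume "(j, g, f) \<in> graph \<phi>" "(j', g', f') \<in> graph \<phi>"
    then obtain x y where x: "x \<in> carrier K" "\<zeta> x = iota j" "\<gamma> x = g" "\<phi> x = f"
      and y: "y \<in> carrier K" "\<zeta> y = iota j'" "\<gamma> y = g'" "\<phi> y = f'" unfolding mem by blast
    have "(j + j', \<gamma> (x \<oplus>\<^bsub>K\<^esub> y), \<phi> (x \<oplus>\<^bsub>K\<^esub> y)) \<in> graph \<phi>"
      by (rule I) (use x(1,2) y(1,2) in \<open>simp_all add: zeta_add iota_add\<close>)
    then show "(j + j', g \<otimes> g', f \<otimes>\<^bsub>F\<^esub> f') \<in> graph \<phi>"
      unfolding gamma_add[OF x(1) y(1)] E(2)[OF x(1) y(1)] x(3,4) y(3,4) .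
  next
    fix g assume g: "g \<in> carrier G"
    then have "\<kappa> g mod P ^ m = \<kappa> g" by (rule chr_mod[OF ch])
    then obtain x where "x \<in> carrier K" "\<zeta> x = iota (\<kappa> g)" "\<gamma> x = g" using int_point[OF g] by blast
    then show "\<exists>j f. (j, g, f) \<in> graph \<phi>" using I by blast
  next
    fix f assume "f \<in> carrier F"
    then obtain x where x: "x \<in> carrier K" "\<phi> x = f" using E(3) by blast
    obtain x' where x': "x' \<in> carrier K" "\<zeta> x' = iota (\<zeta> x (k + m))" "x' \<in> Cyl (k + m) (\<zeta> x (k + m)) (\<gamma> x)"
      using int_approx[OF x(1)] by blast
    have "\<phi> x' = f" using epi_near[OF ps x(1) x'(3)] x(2) by simp
    then show "\<exists>j g. (j, g, f) \<in> graph \<phi>" using I[OF x'(1,2)] by blast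
  next
    have "P ^ m mod P ^ m = \<kappa> \<one>" using chars_one[OF ch] by simp
    then obtain x where "x \<in> carrier K" "\<zeta> x = iota (P ^ m)" "\<gamma> x = \<one>"
      using int_point[OF G.one_closed] by blast
    then show "\<exists>f. (P ^ m, \<one>, f) \<in> graph \<phi>" using I by metis
  next
    fix j f assume "(j, \<one>, f) \<in> graph \<phi>"
    then obtain x where x: "x \<in> carrier K" "\<zeta> x = iota j" "\<gamma> x = \<one>" "\<phi> x = f" unfolding mem by blast
    show "P ^ m dvd j" using km[OF x(1,2)] x(3) chars_one[OF ch] by auto
    assume "j = 0"
    then have "x = \<zero>\<^bsub>K\<^esub>" using x by (intro coord_eqI) (simp_all add: iota_0)
    then show "f = \<one>\<^bsub>F\<^esub>" using x(4) E(4) by simp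
  qed
  show "compat G (graph \<phi>) \<kappa>" unfolding compat_def int_card_G
  proof (intro allI impI)
    fix j g f assume "(j, g, f) \<in> graph \<phi>"
    then obtain x where "x \<in> carrier K" "\<zeta> x = iota j" "\<gamma> x = g" unfolding mem by blast
    then show "j mod P ^ m = \<kappa> g" using km by blast
  qed
qed

lemma inj_graph: "inj_on graph epi_KF"
proof (rule inj_onI)
  fix \<phi> \<phi>' assume h: "\<phi> \<in> epi_KF" "\<phi>' \<in> epi_KF" "graph \<phi> = graph \<phi>'"
  have "\<phi> x = \<phi>' x" if x: "x \<in> carrier K" for x
  proof -
    obtain x' where x': "x' \<in> carrier K" "\<zeta> x' = iota (\<zeta> x (k + m))" "\<gamma> x' = \<gamma> x" "x' \<in> Cyl (k + m) (\<zeta> x (k + m)) (\<gamma> x)"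
      using int_approx[OF x] by blast
    have "(\<zeta> x (k + m), \<gamma> x, \<phi> x') \<in> graph \<phi>"
      unfolding graph_def mem_Collect_eq case_prod_conv by (rule bexI[of _ x']) (use x' in simp_all)
    then have "(\<zeta> x (k + m), \<gamma> x, \<phi> x') \<in> graph \<phi>'" unfolding h(3) .
    then obtain x'' where x'': "x'' \<in> carrier K" "\<zeta> x'' = iota (\<zeta> x (k + m))" "\<gamma> x'' = \<gamma> x" "\<phi>' x'' = \<phi> x'"
      by (rule graphE)
    have "x'' = x'" using x' x'' by (intro coord_eqI) simp_all
    then have "\<phi>' x' = \<phi> x'" using x''(4) by simp
    then show ?thesis using epi_near[OF h(1) x x'(4)] epi_near[OF h(2) x x'(4)] by simp
  qed
  then show "\<phi> = \<phi>'" by (intro extensionalityI[OF episD(3)[OF h(1)] episD(3)[OF h(2)]]) simp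
qed

text \<open>\<open>S\<close> has a member \<open>(|G|, \<one>, t)\<close>, and \<open>|F|\<close>
  times it is the integer \<open>P ^ (k + m)\<close> with both group components trivial.\<close>

lemma link_shift:
  assumes S: "link G F S" and s: "(j, g, f) \<in> S" and d: "P ^ (k + m) dvd j' - j"
  shows "(j', g, f) \<in> S"
proof -
  obtain t where t: "(P ^ m, \<one>, t) \<in> S" using linkD(7)[OF S] unfolding int_card_G by blast
  obtain q where q: "j' - j = P ^ (k + m) * q" using d by blast
  have tc: "t \<in> carrier F" using linkD(2)[OF S t] .
  have "t [^]\<^bsub>F\<^esub> (P ^ k) = \<one>\<^bsub>F\<^esub>"
    using F.pow_order_eq_1[OF tc] card_F int_pow_int[of F t "p ^ k"] by (simp add: order_def)
  then have "t [^]\<^bsub>F\<^esub> (P ^ k * q) = \<one>\<^bsub>F\<^esub>" using tc by (simp add: F.int_pow_pow[symmetric] F.int_pow_one)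
  then have "(P ^ k * q * P ^ m, \<one>, \<one>\<^bsub>F\<^esub>) \<in> S"
    using GF.link_pow[OF S t, of "P ^ k * q"] by (simp add: G.int_pow_one)
  moreover have "P ^ k * q * P ^ m = j' - j" using q by (simp add: power_add)
  ultimately have "(j' - j, \<one>, \<one>\<^bsub>F\<^esub>) \<in> S" by simp
  from linkD(4)[OF S s this] show ?thesis using linkD(1,2)[OF S s] by simp
qed

text \<open>The value of the surjection at \<open>x\<close> is read off from the member of
  \<open>S\<close> over the truncated first coordinate. \<open>link_unique\<close> makes it well
  defined, and \<open>link_shift\<close> lets any other integer with the same residue modulo
  \<open>P ^ (k + m)\<close> be used.\<close>

lemma graph_surj:
  assumes S: "link G F S" and cp: "compat G S \<kappa>"
  shows "\<exists>\<phi>\<in>epi_KF. graph \<phi> = S"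
proof -
  have ex: "\<exists>f. (\<zeta> x (k + m), \<gamma> x, f) \<in> S" if x: "x \<in> carrier K" for x
  proof -
    obtain j f where j: "(j, \<gamma> x, f) \<in> S" using linkD(5)[OF S gamma_closed[OF x]] by blast
    obtain t where t: "(P ^ m, \<one>, t) \<in> S" using linkD(7)[OF S] unfolding int_card_G by blast
    have "j mod P ^ m = \<kappa> (\<gamma> x)" using cp j unfolding compat_def int_card_G by blast
    then have "j mod P ^ m = \<zeta> x (k + m) mod P ^ m"
      using zeta_gamma[OF x] Zp_mod[OF zeta_closed[OF x], of m "k + m"] by simp
    then have "P ^ m dvd \<zeta> x (k + m) - j" by (metis mod_eq_dvd)
    then obtain q where q: "\<zeta> x (k + m) - j = P ^ m * q" by blast
    have "(j + q * P ^ m, \<gamma> x \<otimes> \<one> [^] q, f \<otimes>\<^bsub>F\<^esub> t [^]\<^bsub>F\<^esub> q) \<in> S"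
      by (rule linkD(4)[OF S j GF.link_pow[OF S t]])
    moreover have "j + q * P ^ m = \<zeta> x (k + m)" using q by (simp add: mult.commute)
    ultimately show ?thesis by auto (use x in \<open>simp add: G.int_pow_one, blast\<close>)
  qed
  define \<phi> where "\<phi> = (\<lambda>x\<in>carrier K. THE f. (\<zeta> x (k + m), \<gamma> x, f) \<in> S)"
  have ph: "\<phi> x = f" if "x \<in> carrier K" "(\<zeta> x (k + m), \<gamma> x, f) \<in> S" for x f
    unfolding \<phi>_def using that GF.link_unique[OF S] by (simp add: the_equality)
  have ph': "(\<zeta> x (k + m), \<gamma> x, \<phi> x) \<in> S" if "x \<in> carrier K" for x
    using ex[OF that] ph[OF that] by blast
  have int: "\<phi> x = f \<longleftrightarrow> (j, \<gamma> x, f) \<in> S" if x: "x \<in> carrier K" "\<zeta> x = iota j" for x j f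
  proof -
    have e: "\<zeta> x (k + m) mod P ^ (k + m) = j mod P ^ (k + m)" using x(2) by (simp add: iota_at)
    have d: "P ^ (k + m) dvd \<zeta> x (k + m) - j" using e unfolding mod_eq_dvd .
    have d': "P ^ (k + m) dvd j - \<zeta> x (k + m)" using e[symmetric] unfolding mod_eq_dvd .
    show ?thesis
    proof
      assume "\<phi> x = f"
      then show "(j, \<gamma> x, f) \<in> S" using link_shift[OF S _ d'] ph'[OF x(1)] by blast
    next
      assume "(j, \<gamma> x, f) \<in> S"
      then show "\<phi> x = f" using ph[OF x(1)] link_shift[OF S _ d] by blast
    qed
  qed
  have "\<phi> \<in> epi_KF"
  proof (rule episI)
    fix x y assume xy: "x \<in> carrier (add_monoid K)" "y \<in> carrier (add_monoid K)"
    then have K: "x \<in> carrier K" "y \<in> carrier K" by simp_all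
    have s: "(\<zeta> x (k + m) + \<zeta> y (k + m), \<gamma> x \<otimes> \<gamma> y, \<phi> x \<otimes>\<^bsub>F\<^esub> \<phi> y) \<in> S"
      by (rule linkD(4)[OF S ph'[OF K(1)] ph'[OF K(2)]])
    have "\<zeta> (x \<oplus>\<^bsub>K\<^esub> y) (k + m) mod P ^ (k + m) = (\<zeta> x (k + m) + \<zeta> y (k + m)) mod P ^ (k + m)"
      using K by (simp add: zeta_add Zp_add_at)
    then have d: "P ^ (k + m) dvd \<zeta> (x \<oplus>\<^bsub>K\<^esub> y) (k + m) - (\<zeta> x (k + m) + \<zeta> y (k + m))" unfolding mod_eq_dvd .
    have "\<phi> (x \<oplus>\<^bsub>K\<^esub> y) = \<phi> x \<otimes>\<^bsub>F\<^esub> \<phi> y"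
      by (rule ph) (use K link_shift[OF S s d] in \<open>simp_all add: gamma_add\<close>)
    then show "\<phi> (x \<otimes>\<^bsub>add_monoid K\<^esub> y) = \<phi> x \<otimes>\<^bsub>F\<^esub> \<phi> y" by simp
  next
    fix f assume "f \<in> carrier F"
    then obtain j g where jg: "(j, g, f) \<in> S" using linkD(6)[OF S] by blast
    have "j mod P ^ m = \<kappa> g" using cp jg unfolding compat_def int_card_G by blast
    then obtain x where x: "x \<in> carrier K" "\<zeta> x = iota j" "\<gamma> x = g"
      using int_point linkD(1)[OF S jg] by blast
    then have "\<phi> x = f" using int[OF x(1,2)] jg by simp
    then show "\<exists>x\<in>carrier (add_monoid K). \<phi> x = f" using x(1) by auto
  next
    fix x assume "x \<in> carrier (add_monoid K)"
    then show "\<phi> x \<in> carrier F" using ph' linkD(2)[OF S] by simp blast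
  qed (simp add: \<phi>_def)
  moreover have "graph \<phi> = S"
  proof -
    have "(j, g, f) \<in> graph \<phi> \<longleftrightarrow> (j, g, f) \<in> S" for j g f
    proof
      assume "(j, g, f) \<in> graph \<phi>"
      then obtain x where "x \<in> carrier K" "\<zeta> x = iota j" "\<gamma> x = g" "\<phi> x = f" unfolding graph_def by blast
      then show "(j, g, f) \<in> S" using int by blast
    next
      assume s: "(j, g, f) \<in> S"
      have "j mod P ^ m = \<kappa> g" using cp s unfolding compat_def int_card_G by blast
      then obtain x where x: "x \<in> carrier K" "\<zeta> x = iota j" "\<gamma> x = g"
        using int_point linkD(1)[OF S s] by blast
      then have "\<phi> x = f" using int[OF x(1,2)] s by simp
      then show "(j, g, f) \<in> graph \<phi>" unfolding graph_def using x by blast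
    qed
    then show ?thesis by auto
  qed
  ultimately show ?thesis by blast
qed

lemma bij_graph: "bij_betw graph epi_KF {S. link G F S \<and> compat G S \<kappa>}"
  unfolding bij_betw_def
proof
  show "inj_on graph epi_KF" by (rule inj_graph)
  show "graph ` epi_KF = {S. link G F S \<and> compat G S \<kappa>}"
  proof
    show "graph ` epi_KF \<subseteq> {S. link G F S \<and> compat G S \<kappa>}" using graph_link by auto
    show "{S. link G F S \<and> compat G S \<kappa>} \<subseteq> graph ` epi_KF"
    proof
      fix S assume "S \<in> {S. link G F S \<and> compat G S \<kappa>}"
      then obtain \<phi> where "\<phi> \<in> epi_KF" "graph \<phi> = S" using graph_surj by blast
      then show "S \<in> graph ` epi_KF" by blast
    qed
  qed
qed

text \<open>For the flipped subgroup, the required member over the neutral element of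
  \<open>F\<close> with first entry \<open>|F|\<close> is an element of the kernel with coordinate
  \<open>P ^ k\<close>, as in \<open>special\<close>. The remaining condition, on divisibility and
  on first entry zero, holds because that element generates the kernel and is not torsion.\<close>

lemma special_iff_flip:
  assumes ps: "\<phi> \<in> epi_KF"
  shows "special \<phi> \<longleftrightarrow> link F G (flip (graph \<phi>))"
proof
  have cF: "int (card (carrier F)) = P ^ k" using card_F by simp
  note L = linkD[OF graph_link(1)[OF ps]]
  {
    assume "special \<phi>"
    then obtain x0 where x0: "x0 \<in> carrier K" "\<zeta> x0 = iota (P ^ k)" "\<phi> x0 = \<one>\<^bsub>F\<^esub>"
      unfolding special_def by blast
    have ker: "kernel (add_monoid K) F \<phi> = cyc x0" by (rule special_kernel[OF ps x0])
    show "link F G (flip (graph \<phi>))" unfolding link_def cF flip_mem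
    proof (intro conjI allI impI ballI)
      fix j f g assume "(j, g, f) \<in> graph \<phi>"
      then show "f \<in> carrier F" "g \<in> carrier G" "(- j, inv g, inv\<^bsub>F\<^esub> f) \<in> graph \<phi>" using L(1,2,3) by blast+
    next
      show "\<exists>g. (P ^ k, g, \<one>\<^bsub>F\<^esub>) \<in> graph \<phi>" unfolding graph_def using x0 by blast
    next
      fix j g assume "(j, g, \<one>\<^bsub>F\<^esub>) \<in> graph \<phi>"
      then obtain x where x: "x \<in> carrier K" "\<zeta> x = iota j" "\<gamma> x = g" "\<phi> x = \<one>\<^bsub>F\<^esub>" by (rule graphE)
      then have "x \<in> cyc x0" using ker by (auto simp: kernel_def)
      then obtain c where c: "c \<in> carrier Z" "x = c \<odot>\<^bsub>K\<^esub> x0" unfolding cyc_mem by metis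
      have z: "iota j = iota (P ^ k) \<otimes>\<^bsub>Z\<^esub> c"
        using x(2) c x0 by (simp add: zeta_smult ZR.m_comm)
      then have "iota j k = (iota (P ^ k) \<otimes>\<^bsub>Z\<^esub> c) k" by simp
      then have "j mod P ^ k = 0" by (simp add: iota_at iota_mult_at)
      then show "P ^ k dvd j" by auto
      assume "j = 0"
      then have "c = \<zero>\<^bsub>Z\<^esub>" using Zp_torsion_free[OF c(1), of k] z by (simp add: iota_0)
      then have "x = \<zero>\<^bsub>K\<^esub>" using c x0 by (simp add: K.smult_l_null)
      then show "g = \<one>" using x(3) by simp
    next
      fix j f g j' f' g' assume "(j, g, f) \<in> graph \<phi>" "(j', g', f') \<in> graph \<phi>"
      then show "(j + j', g \<otimes> g', f \<otimes>\<^bsub>F\<^esub> f') \<in> graph \<phi>" by (rule L(4))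
    next
      fix f assume "f \<in> carrier F"
      then show "\<exists>j g. (j, g, f) \<in> graph \<phi>" by (rule L(6))
    next
      fix g assume "g \<in> carrier G"
      then show "\<exists>j f. (j, g, f) \<in> graph \<phi>" by (rule L(5))
    qed
  }
  assume "link F G (flip (graph \<phi>))"
  from linkD(7)[OF this] obtain g where "(P ^ k, g, \<one>\<^bsub>F\<^esub>) \<in> graph \<phi>" unfolding cF flip_mem by blast
  then obtain x where "x \<in> carrier K" "\<zeta> x = iota (P ^ k)" "\<gamma> x = g" "\<phi> x = \<one>\<^bsub>F\<^esub>" by (rule graphE)
  then show "special \<phi>" unfolding special_def by blast
qed

lemma card_special: "card {\<phi> \<in> epi_KF. special \<phi>} = card {S. link G F S \<and> link F G (flip S) \<and> compat G S \<kappa>}"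
proof -
  have "bij_betw graph {\<phi> \<in> epi_KF. special \<phi>} {S. link G F S \<and> link F G (flip S) \<and> compat G S \<kappa>}"
    unfolding bij_betw_def
  proof
    show "inj_on graph {\<phi> \<in> epi_KF. special \<phi>}" using inj_graph by (rule inj_on_subset) blast
    have "graph ` {\<phi> \<in> epi_KF. special \<phi>} = {S \<in> graph ` epi_KF. link F G (flip S)}"
      using special_iff_flip by blast
    also have "graph ` epi_KF = {S. link G F S \<and> compat G S \<kappa>}" using bij_graph by (simp add: bij_betw_def)
    finally show "graph ` {\<phi> \<in> epi_KF. special \<phi>} = {S. link G F S \<and> link F G (flip S) \<and> compat G S \<kappa>}" by auto
  qed
  then show ?thesis by (rule bij_betw_same_card)
qed

lemma card_epi_link: "card epi_KF = card {S. link G F S \<and> compat G S \<kappa>}"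
  by (rule bij_betw_same_card[OF bij_graph])

lemma finite_link_compat: "finite {S. link G F S \<and> compat G S \<kappa>}"
  using bij_betw_finite[OF bij_graph] finite_epi_KF by simp

end

section \<open>Counting linking subgroups\<close>

lemma (in pgroup) rank1_HM:
  assumes "\<kappa> \<in> chars"
  shows "rank1 p G m \<kappa> (HM \<kappa>) fst snd"
proof (intro rank1.intro rank1_axioms.intro)
  show "pgroup p G m" by (rule pgroup_axioms)
  show "\<kappa> \<in> chars" by (rule assms)
  show "Module.module Z (HM \<kappa>)" by (rule HM_module[OF assms])
  show "bij_betw (\<lambda>x. (fst x, snd x)) (carrier (HM \<kappa>)) (carrier (HM \<kappa>))" by (simp add: bij_betw_def)
qed (auto simp: HM_def)

lemma (in pgroup) rank1_iso:
  assumes ch: "\<kappa> \<in> chars" and K: "Module.module Z K" and g: "g \<in> module_iso Z K (HM \<kappa>)"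
  shows "rank1 p G m \<kappa> K (fst \<circ> g) (snd \<circ> g)"
proof (intro rank1.intro rank1_axioms.intro)
  note h = module_homD[OF module_isoD(1)[OF g]]
  show "bij_betw (\<lambda>x. ((fst \<circ> g) x, (snd \<circ> g) x)) (carrier K) (carrier (HM \<kappa>))"
    using module_isoD(2)[OF g] by simp
  fix x y assume xy: "x \<in> carrier K" "y \<in> carrier K"
  have "g (x \<oplus>\<^bsub>K\<^esub> y) = (fst (g x) \<oplus>\<^bsub>Z\<^esub> fst (g y), snd (g x) \<otimes> snd (g y))"
    using h(2)[OF xy] HM_add[of \<kappa> "fst (g x)" "snd (g x)" "fst (g y)" "snd (g y)"] by simp
  then show "(fst \<circ> g) (x \<oplus>\<^bsub>K\<^esub> y) = (fst \<circ> g) x \<oplus>\<^bsub>Z\<^esub> (fst \<circ> g) y"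
    "(snd \<circ> g) (x \<oplus>\<^bsub>K\<^esub> y) = (snd \<circ> g) x \<otimes> (snd \<circ> g) y" by simp_all
next
  note h = module_homD[OF module_isoD(1)[OF g]]
  fix r x assume rx: "r \<in> carrier Z" "x \<in> carrier K"
  have "g (r \<odot>\<^bsub>K\<^esub> x) = (r \<otimes>\<^bsub>Z\<^esub> fst (g x), act r (snd (g x)))"
    using h(3)[OF rx] HM_smult[of \<kappa> r "fst (g x)" "snd (g x)"] by simp
  then show "(fst \<circ> g) (r \<odot>\<^bsub>K\<^esub> x) = r \<otimes>\<^bsub>Z\<^esub> (fst \<circ> g) x" "(snd \<circ> g) (r \<odot>\<^bsub>K\<^esub> x) = act r ((snd \<circ> g) x)"
    by simp_all
qed (use pgroup_axioms ch K in auto)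

locale pgroup_pair = pgroup p G m + F: comm_group F for p and G :: "nat monoid" (structure) and m
    and F :: "'f monoid" +
  fixes k :: nat
  assumes fin_F: "finite (carrier F)" and card_F: "card (carrier F) = p ^ k"
begin

sublocale GF: two_groups G F by unfold_locales

lemma target:
  assumes "rank1 p G m \<kappa> K \<zeta> \<gamma>"
  shows "rank1_target p G m \<kappa> K \<zeta> \<gamma> F k"
  by (intro rank1_target.intro rank1_target_axioms.intro assms) (use F.comm_group_axioms fin_F card_F in auto)

lemma card_G_pos: "card (carrier G) > 0"
  using fin_G G.one_closed by (auto simp: card_gt_0_iff)

lemma link_decomp: "{S. link G F S \<and> Q S} = (\<Union>\<kappa>\<in>chars. {S. link G F S \<and> Q S \<and> compat G S \<kappa>})"
  using GF.link_compat[OF _ card_G_pos] unfolding int_card_G by blast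

lemma finite_part: "\<kappa> \<in> chars \<Longrightarrow> finite {S. link G F S \<and> Q S \<and> compat G S \<kappa>}"
  by (rule finite_subset[OF _ rank1_target.finite_link_compat[OF target[OF rank1_HM]]]) auto

lemma finite_link: "finite {S. link G F S}"
proof -
  have "finite {S. link G F S \<and> True}"
    by (subst link_decomp) (rule finite_UN_I[OF finite_chars finite_part])
  then show ?thesis by simp
qed

text \<open>Every linking subgroup has exactly one compatible character. The predicate
  \<open>Q\<close> lets the same sum serve all linking subgroups and those whose flip is linking
  too.\<close>

lemma sum_chars_link:
  "(\<Sum>\<kappa>\<in>chars. card {S. link G F S \<and> Q S \<and> compat G S \<kappa>}) = card {S. link G F S \<and> Q S}"
proof -
  have "card (\<Union>\<kappa>\<in>chars. {S. link G F S \<and> Q S \<and> compat G S \<kappa>})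
      = (\<Sum>\<kappa>\<in>chars. card {S. link G F S \<and> Q S \<and> compat G S \<kappa>})"
    by (rule card_UN_disjoint[OF finite_chars]) (use finite_part GF.compat_unique in blast)+
  then show ?thesis by (simp only: link_decomp[symmetric])
qed

end

lemma card_link_flip: "card {S. link G F S \<and> link F G (flip S)} = card {S. link F G S \<and> link G F (flip S)}"
proof -
  have "bij_betw flip {S. link G F S \<and> link F G (flip S)} {S. link F G S \<and> link G F (flip S)}"
    by (rule bij_betw_byWitness[where f' = flip]) auto
  then show ?thesis by (rule bij_betw_same_card)
qed

definition cyclic :: "('f, 'd) monoid_scheme \<Rightarrow> 'f \<Rightarrow> 'f set" where
  "cyclic F y = range (\<lambda>j::int. y [^]\<^bsub>F\<^esub> j)"

context pgroup_pair
begin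

section \<open>Linking subgroups with a prescribed partner \<open>y\<close> of the integer
  \<open>|G|\<close>\<close>

context
  fixes y assumes y: "y \<in> carrier F"
begin

text \<open>The least positive integer that occurs in a member of \<open>lset\<close> together with
  trivial components in \<open>G\<close> and \<open>F\<close>.\<close>

abbreviation N :: int where "N \<equiv> int (card (carrier G)) * int (F.ord y)"
abbreviation C :: "'f set" where "C \<equiv> cyclic F y"
abbreviation FC :: "'f set monoid" where "FC \<equiv> F Mod C"

lemma ord_pos: "F.ord y > 0"
  using F.ord_ge_1[OF fin_F y] by simp

lemma CI: "y [^]\<^bsub>F\<^esub> (j::int) \<in> C" unfolding cyclic_def by blast
lemma CE: "c \<in> C \<Longrightarrow> \<exists>j::int. c = y [^]\<^bsub>F\<^esub> j" unfolding cyclic_def by blast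

lemma C_subgroup: "subgroup C F"
proof (rule F.subgroupI)
  show "C \<subseteq> carrier F" using y by (auto simp: cyclic_def)
  show "C \<noteq> {}" using CI by blast
  fix a assume "a \<in> C"
  then obtain i where i: "a = y [^]\<^bsub>F\<^esub> (i::int)" using CE by blast
  have "inv\<^bsub>F\<^esub> a = y [^]\<^bsub>F\<^esub> (- i)" unfolding i using y by (simp add: F.int_pow_neg)
  then show "inv\<^bsub>F\<^esub> a \<in> C" using CI by simp
  fix b assume "b \<in> C"
  then obtain j where j: "b = y [^]\<^bsub>F\<^esub> (j::int)" using CE by blast
  have "a \<otimes>\<^bsub>F\<^esub> b = y [^]\<^bsub>F\<^esub> (i + j)" unfolding i j using y by (simp add: F.int_pow_mult)
  then show "a \<otimes>\<^bsub>F\<^esub> b \<in> C" using CI by simp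
qed

lemma pow_eq_iff: "y [^]\<^bsub>F\<^esub> (i::int) = y [^]\<^bsub>F\<^esub> j \<longleftrightarrow> int (F.ord y) dvd i - j"
proof -
  have "y [^]\<^bsub>F\<^esub> i = y [^]\<^bsub>F\<^esub> j \<longleftrightarrow> y [^]\<^bsub>F\<^esub> (i - j) = \<one>\<^bsub>F\<^esub>"
  proof -
    have "y [^]\<^bsub>F\<^esub> (i - j) = y [^]\<^bsub>F\<^esub> i \<otimes>\<^bsub>F\<^esub> inv\<^bsub>F\<^esub> (y [^]\<^bsub>F\<^esub> j)" by (rule F.int_pow_diff[OF y])
    then show ?thesis using y by (metis F.int_pow_closed F.inv_closed F.inv_equality F.inv_inv F.r_inv)
  qed
  also have "\<dots> \<longleftrightarrow> int (F.ord y) dvd i - j" by (rule F.int_pow_eq_id[OF y])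
  finally show ?thesis .
qed

lemma card_C: "card C = F.ord y"
proof -
  have "bij_betw (\<lambda>j::int. y [^]\<^bsub>F\<^esub> j) {0..<int (F.ord y)} C" unfolding bij_betw_def
  proof
    show "inj_on (\<lambda>j::int. y [^]\<^bsub>F\<^esub> j) {0..<int (F.ord y)}"
    proof (rule inj_onI)
      fix i j assume ij: "i \<in> {0..<int (F.ord y)}" "j \<in> {0..<int (F.ord y)}" "y [^]\<^bsub>F\<^esub> i = y [^]\<^bsub>F\<^esub> j"
      then have "i mod int (F.ord y) = j mod int (F.ord y)" unfolding mod_eq_dvd using pow_eq_iff by blast
      then show "i = j" using ij by simp
    qed
    show "(\<lambda>j::int. y [^]\<^bsub>F\<^esub> j) ` {0..<int (F.ord y)} = C"
    proof
      show "(\<lambda>j::int. y [^]\<^bsub>F\<^esub> j) ` {0..<int (F.ord y)} \<subseteq> C" using CI by blast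
      show "C \<subseteq> (\<lambda>j::int. y [^]\<^bsub>F\<^esub> j) ` {0..<int (F.ord y)}"
      proof
        fix c assume "c \<in> C"
        then obtain j where j: "c = y [^]\<^bsub>F\<^esub> (j::int)" using CE by blast
        have "y [^]\<^bsub>F\<^esub> j = y [^]\<^bsub>F\<^esub> (j mod int (F.ord y))"
          unfolding pow_eq_iff by (simp add: minus_mod_eq_mult_div)
        moreover have "j mod int (F.ord y) \<in> {0..<int (F.ord y)}" using ord_pos by simp
        ultimately show "c \<in> (\<lambda>j::int. y [^]\<^bsub>F\<^esub> j) ` {0..<int (F.ord y)}" using j by blast
      qed
    qed
  qed
  from bij_betw_same_card[OF this] show ?thesis by simp
qed

lemma FC_comm_group: "comm_group FC" by (rule F.abelian_FactGroup[OF C_subgroup])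
lemma FC_group: "group FC" using FC_comm_group by (rule comm_group.axioms(2))

lemma FC_carrier: "X \<in> carrier FC \<longleftrightarrow> (\<exists>f\<in>carrier F. X = C #>\<^bsub>F\<^esub> f)"
  by (auto simp: carrier_FactGroup)

definition lset :: "(int \<times> nat \<times> 'f) set set" where
  "lset = {S. link G F S \<and> (int (card (carrier G)), \<one>, y) \<in> S}"

text \<open>Modulo the group generated by \<open>y\<close> the first entry ceases to matter, and
  \<open>S\<close> becomes the graph of a surjection from \<open>G\<close> onto the quotient of
  \<open>F\<close>.\<close>

definition shape :: "(int \<times> nat \<times> 'f) set \<Rightarrow> nat \<Rightarrow> 'f set" where
  "shape S = (\<lambda>g\<in>carrier G. {f. \<exists>j. (j, g, f) \<in> S})"

lemma lset_pow:
  assumes "S \<in> lset"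
  shows "(j * int (card (carrier G)), \<one>, y [^]\<^bsub>F\<^esub> j) \<in> S"
  using GF.link_pow[of S "int (card (carrier G))" \<one> y j] assms by (simp add: lset_def G.int_pow_one)

lemma lset_diff:
  assumes S: "S \<in> lset" and s: "(i, g, f) \<in> S" "(j, g, f') \<in> S"
  obtains q where "i - j = q * int (card (carrier G))" "f \<otimes>\<^bsub>F\<^esub> inv\<^bsub>F\<^esub> f' = y [^]\<^bsub>F\<^esub> q"
proof -
  have l: "link G F S" using S by (simp add: lset_def)
  have c: "g \<in> carrier G" "f \<in> carrier F" "f' \<in> carrier F" using linkD(1,2)[OF l] s by auto
  have d: "(i - j, \<one>, f \<otimes>\<^bsub>F\<^esub> inv\<^bsub>F\<^esub> f') \<in> S" using GF.link_diff[OF l s] c by simp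
  obtain q where q: "i - j = int (card (carrier G)) * q" using GF.link_cong[OF l s] by blast
  have "(i - j, \<one>, y [^]\<^bsub>F\<^esub> q) \<in> S" using lset_pow[OF S, of q] q by (simp add: mult.commute)
  then have "f \<otimes>\<^bsub>F\<^esub> inv\<^bsub>F\<^esub> f' = y [^]\<^bsub>F\<^esub> q" using GF.link_unique[OF l d] by blast
  then show thesis by (rule that[rotated]) (simp add: q mult.commute)
qed

lemma shape_coset:
  assumes S: "S \<in> lset" and s: "(i, g, f) \<in> S"
  shows "shape S g = C #>\<^bsub>F\<^esub> f"
proof -
  have l: "link G F S" using S by (simp add: lset_def)
  have c: "g \<in> carrier G" "f \<in> carrier F" using linkD(1,2)[OF l] s by auto
  have "(\<exists>j. (j, g, f') \<in> S) \<longleftrightarrow> f' \<in> C #>\<^bsub>F\<^esub> f" for f'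
  proof
    assume "\<exists>j. (j, g, f') \<in> S"
    then obtain j where j: "(j, g, f') \<in> S" by blast
    obtain q where q: "f' \<otimes>\<^bsub>F\<^esub> inv\<^bsub>F\<^esub> f = y [^]\<^bsub>F\<^esub> (q::int)" using lset_diff[OF S j s] by blast
    have "f' \<in> carrier F" using linkD(2)[OF l j] .
    then have "f' = y [^]\<^bsub>F\<^esub> q \<otimes>\<^bsub>F\<^esub> f" using q c by (metis F.inv_closed F.inv_solve_right' F.m_closed)
    then show "f' \<in> C #>\<^bsub>F\<^esub> f" unfolding r_coset_def using CI by blast
  next
    assume "f' \<in> C #>\<^bsub>F\<^esub> f"
    then obtain q where q: "f' = y [^]\<^bsub>F\<^esub> (q::int) \<otimes>\<^bsub>F\<^esub> f" unfolding r_coset_def cyclic_def by blast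
    have "(q * int (card (carrier G)) + i, \<one> \<otimes> g, y [^]\<^bsub>F\<^esub> q \<otimes>\<^bsub>F\<^esub> f) \<in> S" by (rule linkD(4)[OF l lset_pow[OF S] s])
    then show "\<exists>j. (j, g, f') \<in> S" using c q by auto
  qed
  then show ?thesis unfolding shape_def using c by auto
qed

lemma shape_epis:
  assumes S: "S \<in> lset"
  shows "shape S \<in> epis G FC"
proof (rule episI)
  have l: "link G F S" using S by (simp add: lset_def)
  show "shape S \<in> extensional (carrier G)" by (simp add: shape_def)
  show "shape S g \<in> carrier FC" if g: "g \<in> carrier G" for g
  proof -
    obtain i f where s: "(i, g, f) \<in> S" using linkD(5)[OF l g] by blast
    show ?thesis unfolding shape_coset[OF S s] FC_carrier using linkD(2)[OF l s] by blast
  qed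
  show "shape S (g \<otimes> h) = shape S g \<otimes>\<^bsub>FC\<^esub> shape S h" if gh: "g \<in> carrier G" "h \<in> carrier G" for g h
  proof -
    obtain i f where s: "(i, g, f) \<in> S" using linkD(5)[OF l gh(1)] by blast
    obtain j f' where t: "(j, h, f') \<in> S" using linkD(5)[OF l gh(2)] by blast
    interpret C: normal C F by (rule F.subgroup_imp_normal[OF C_subgroup])
    have "(C #>\<^bsub>F\<^esub> f) <#>\<^bsub>F\<^esub> (C #>\<^bsub>F\<^esub> f') = C #>\<^bsub>F\<^esub> (f \<otimes>\<^bsub>F\<^esub> f')"
      by (rule C.rcos_sum[OF linkD(2)[OF l s] linkD(2)[OF l t]])
    then show ?thesis
      using shape_coset[OF S s] shape_coset[OF S t] shape_coset[OF S linkD(4)[OF l s t]] by simp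
  qed
  show "\<exists>g\<in>carrier G. shape S g = X" if X: "X \<in> carrier FC" for X
  proof -
    obtain f where f: "f \<in> carrier F" "X = C #>\<^bsub>F\<^esub> f" using X FC_carrier by blast
    obtain i g where s: "(i, g, f) \<in> S" using linkD(6)[OF l f(1)] by blast
    then show ?thesis using shape_coset[OF S s] f(2) linkD(1)[OF l s] by blast
  qed
qed

context
  fixes \<sigma> assumes \<sigma>: "\<sigma> \<in> epis G FC"
begin

lemma sg_coset: "g \<in> carrier G \<Longrightarrow> \<exists>f\<in>carrier F. \<sigma> g = C #>\<^bsub>F\<^esub> f"
  using episD(4)[OF \<sigma>] FC_carrier by blast

lemma sg_sub: "g \<in> carrier G \<Longrightarrow> f \<in> \<sigma> g \<Longrightarrow> f \<in> carrier F"
  using sg_coset[of g] F.r_coset_subset_G[OF subgroup.subset[OF C_subgroup]] by blast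

lemma sg_ne: "g \<in> carrier G \<Longrightarrow> \<exists>f. f \<in> \<sigma> g"
proof -
  assume "g \<in> carrier G"
  then obtain f where "f \<in> carrier F" "\<sigma> g = C #>\<^bsub>F\<^esub> f" using sg_coset by blast
  then show ?thesis using F.rcos_self[OF _ C_subgroup] by blast
qed

lemma sg_mult: "g \<in> carrier G \<Longrightarrow> h \<in> carrier G \<Longrightarrow> f \<in> \<sigma> g \<Longrightarrow> f' \<in> \<sigma> h \<Longrightarrow> f \<otimes>\<^bsub>F\<^esub> f' \<in> \<sigma> (g \<otimes> h)"
  using episD(5)[OF \<sigma>, of g h] by (auto simp: set_mult_def)

lemma sg_one: "\<sigma> \<one> = C"
  using hom_one[OF episD(1)[OF \<sigma>] G.is_group FC_group] by simp

lemma sg_surj: "f \<in> carrier F \<Longrightarrow> \<exists>g\<in>carrier G. f \<in> \<sigma> g"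
proof -
  assume f: "f \<in> carrier F"
  have "C #>\<^bsub>F\<^esub> f \<in> carrier FC" unfolding FC_carrier using f by blast
  then obtain g where "g \<in> carrier G" "\<sigma> g = C #>\<^bsub>F\<^esub> f" using episD(2)[OF \<sigma>] by (metis imageE)
  then show ?thesis using F.rcos_self[OF f C_subgroup] by blast
qed

lemma sg_inv: "g \<in> carrier G \<Longrightarrow> f \<in> \<sigma> g \<Longrightarrow> inv\<^bsub>F\<^esub> f \<in> \<sigma> (inv g)"
proof -
  assume g: "g \<in> carrier G" and f: "f \<in> \<sigma> g"
  obtain f' where f': "f' \<in> \<sigma> (inv g)" using sg_ne[OF G.inv_closed[OF g]] by blast
  have c: "f \<in> carrier F" "f' \<in> carrier F" using sg_sub[OF g f] sg_sub[OF G.inv_closed[OF g] f'] .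
  have "f \<otimes>\<^bsub>F\<^esub> f' \<in> C" using sg_mult[OF g G.inv_closed[OF g] f f'] g sg_one by simp
  then have "inv\<^bsub>F\<^esub> (f \<otimes>\<^bsub>F\<^esub> f') \<in> \<sigma> \<one>" using subgroup.m_inv_closed[OF C_subgroup] sg_one by simp
  from sg_mult[OF G.inv_closed[OF g] G.one_closed f' this]
  have "f' \<otimes>\<^bsub>F\<^esub> inv\<^bsub>F\<^esub> (f \<otimes>\<^bsub>F\<^esub> f') \<in> \<sigma> (inv g)" using g by simp
  moreover have "f' \<otimes>\<^bsub>F\<^esub> inv\<^bsub>F\<^esub> (f \<otimes>\<^bsub>F\<^esub> f') = inv\<^bsub>F\<^esub> f"
    using c by (simp add: F.inv_mult_group F.m_assoc[symmetric])
  ultimately show ?thesis by simp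
qed

lemma card_sg: "g \<in> carrier G \<Longrightarrow> card (\<sigma> g) = F.ord y"
proof -
  assume "g \<in> carrier G"
  then obtain f where "f \<in> carrier F" "\<sigma> g = C #>\<^bsub>F\<^esub> f" using sg_coset by blast
  then show ?thesis
    using F.card_rcosets_equal[OF F.rcosetsI[of C f]] subgroup.subset[OF C_subgroup] card_C by simp
qed

abbreviation D :: "(nat \<times> 'f) monoid" where "D \<equiv> G \<times>\<times> F"
text \<open>The fibre product of \<open>G\<close> and \<open>F\<close> over the quotient
  \<open>FC\<close>: what remains of a linking subgroup of shape \<open>\<sigma>\<close> when first
  entries are forgotten. \<open>AA\<close> below is the part over the neutral element of
  \<open>G\<close>.\<close>

abbreviation EE :: "(nat \<times> 'f) set" where "EE \<equiv> Sigma (carrier G) \<sigma>"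
abbreviation AA :: "(nat \<times> 'f) set" where "AA \<equiv> {\<one>} \<times> C"

lemma D_comm_group: "comm_group D"
proof (rule group.group_comm_groupI)
  show "group D" by (rule DirProd_group[OF G.is_group F.is_group])
  show "a \<otimes>\<^bsub>D\<^esub> b = b \<otimes>\<^bsub>D\<^esub> a" if "a \<in> carrier D" "b \<in> carrier D" for a b
    using that by (cases a; cases b) (simp add: G.m_comm F.m_comm)
qed

lemma EE_subgroup: "subgroup EE D"
proof (rule group.subgroupI[OF comm_group.axioms(2)[OF D_comm_group]])
  show "EE \<subseteq> carrier D" using sg_sub by auto
  show "EE \<noteq> {}" using sg_ne[OF G.one_closed] by blast
  show "inv\<^bsub>D\<^esub> a \<in> EE" if "a \<in> EE" for a
    using that sg_inv sg_sub inv_DirProd[OF G.is_group F.is_group] by auto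
  show "a \<otimes>\<^bsub>D\<^esub> b \<in> EE" if "a \<in> EE" "b \<in> EE" for a b
    using that sg_mult by auto
qed

lemma AA_subgroup: "subgroup AA D" "AA \<subseteq> EE"
proof -
  show "AA \<subseteq> EE" using sg_one by auto
  show "subgroup AA D"
  proof (rule group.subgroupI[OF comm_group.axioms(2)[OF D_comm_group]])
    have Cs: "\<And>c. c \<in> C \<Longrightarrow> c \<in> carrier F" using subgroup.mem_carrier[OF C_subgroup] .
    show "AA \<subseteq> carrier D" using Cs by auto
    show "AA \<noteq> {}" using CI by blast
    show "inv\<^bsub>D\<^esub> a \<in> AA" if "a \<in> AA" for a
      using that Cs subgroup.m_inv_closed[OF C_subgroup] inv_DirProd[OF G.is_group F.is_group] by auto
    show "a \<otimes>\<^bsub>D\<^esub> b \<in> AA" if "a \<in> AA" "b \<in> AA" for a b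
      using that subgroup.m_closed[OF C_subgroup] by auto
  qed
qed

lemma card_EE: "finite EE" "int (card EE) = N" "card AA = F.ord y"
proof -
  have f: "finite (\<sigma> g)" if "g \<in> carrier G" for g
    using sg_sub[OF that] fin_F by (meson finite_subset subsetI)
  show "finite EE" using fin_G f by (rule finite_SigmaI)
  have "card EE = (\<Sum>g\<in>carrier G. card (\<sigma> g))" using fin_G f by (intro card_SigmaI) auto
  then show "int (card EE) = N" using card_sg by simp
  show "card AA = F.ord y" using card_C by (simp add: card_cartesian_product)
qed

lemma N_pos: "N > 0" using card_G_pos ord_pos by simp

text \<open>Dictated by membership of \<open>(|G|, \<one>, y)\<close> in \<open>S\<close>: over the
  neutral element of \<open>G\<close>, the \<open>j\<close>-th power of \<open>y\<close> must occur
  with first entry \<open>j * |G|\<close> modulo \<open>N\<close>.\<close>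

definition \<omega>0 :: "nat \<times> 'f \<Rightarrow> int" where
  "\<omega>0 = (\<lambda>a\<in>AA. (int (card (carrier G)) * (SOME j. snd a = y [^]\<^bsub>F\<^esub> (j::int))) mod N)"

lemma w0_val: "\<omega>0 (\<one>, y [^]\<^bsub>F\<^esub> (j::int)) = (int (card (carrier G)) * j) mod N"
proof -
  let ?i = "SOME i. y [^]\<^bsub>F\<^esub> j = y [^]\<^bsub>F\<^esub> (i::int)"
  have "y [^]\<^bsub>F\<^esub> j = y [^]\<^bsub>F\<^esub> ?i" by (rule someI[of _ j]) simp
  then have "j mod int (F.ord y) = ?i mod int (F.ord y)" unfolding mod_eq_dvd pow_eq_iff .
  then have "(int (card (carrier G)) * ?i) mod N = (int (card (carrier G)) * j) mod N"
    by (simp only: mod_mult_mult1)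
  then show ?thesis unfolding \<omega>0_def using CI by simp
qed

lemma w0_chr: "\<omega>0 \<in> chr D N AA" unfolding chr_def
proof (intro CollectI conjI ballI)
  show "\<omega>0 \<in> AA \<rightarrow>\<^sub>E {0..<N}"
  proof (rule PiE_I)
    fix a assume "a \<in> AA"
    then have "\<omega>0 a = (int (card (carrier G)) * (SOME j. snd a = y [^]\<^bsub>F\<^esub> (j::int))) mod N"
      unfolding \<omega>0_def by (rule restrict_apply')
    then show "\<omega>0 a \<in> {0..<N}" using pos_mod_sign[OF N_pos] pos_mod_bound[OF N_pos] by (metis atLeastLessThan_iff)
  qed (simp add: \<omega>0_def)
  fix a b assume "a \<in> AA" "b \<in> AA"
  then obtain i j where ij: "a = (\<one>, y [^]\<^bsub>F\<^esub> (i::int))" "b = (\<one>, y [^]\<^bsub>F\<^esub> (j::int))"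
    unfolding cyclic_def by blast
  have "a \<otimes>\<^bsub>D\<^esub> b = (\<one>, y [^]\<^bsub>F\<^esub> (i + j))" unfolding ij using y by (simp add: F.int_pow_mult)
  then show "\<omega>0 (a \<otimes>\<^bsub>D\<^esub> b) = (\<omega>0 a + \<omega>0 b) mod N"
    unfolding ij by (simp only: w0_val mod_simps distrib_left)
qed

lemma card_X: "card (chr_extns D N AA EE \<omega>0) = card (carrier G)"
proof -
  have "card (chr_extns D N AA EE \<omega>0) * card AA = card EE"
    by (rule comm_group.card_chr_extns[OF D_comm_group EE_subgroup card_EE(1) _ N_pos AA_subgroup w0_chr])
      (simp only: card_EE(2) dvd_refl)
  then have "card (chr_extns D N AA EE \<omega>0) * F.ord y = card EE" unfolding card_EE(3) .
  moreover have "card EE = card (carrier G) * F.ord y" using card_EE(2) by (simp flip: of_nat_mult)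
  ultimately show ?thesis using ord_pos by simp
qed

text \<open>A linking subgroup in \<open>lset\<close> contains the integer \<open>N\<close> with
  trivial components, so it is recovered from its first entries modulo \<open>N\<close>, and these
  form a character of the fibre product.\<close>

definition S_of :: "(nat \<times> 'f \<Rightarrow> int) \<Rightarrow> (int \<times> nat \<times> 'f) set" where
  "S_of \<omega> = {(j, g, f). (g, f) \<in> EE \<and> j mod N = \<omega> (g, f)}"

lemma S_of_lset:
  assumes w: "\<omega> \<in> chr_extns D N AA EE \<omega>0"
  shows "S_of \<omega> \<in> lset" "shape (S_of \<omega>) = \<sigma>"
proof -
  have wc: "\<omega> \<in> chr D N EE" and wA: "\<And>a. a \<in> AA \<Longrightarrow> \<omega> a = \<omega>0 a" using w by (auto simp: chr_extns_def)
  have mem: "\<And>j g f. (j, g, f) \<in> S_of \<omega> \<longleftrightarrow> g \<in> carrier G \<and> f \<in> \<sigma> g \<and> j mod N = \<omega> (g, f)"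
    by (simp add: S_of_def)
  have wm: "\<omega> (g \<otimes> h, f \<otimes>\<^bsub>F\<^esub> f') = (\<omega> (g, f) + \<omega> (h, f')) mod N"
    if "g \<in> carrier G" "f \<in> \<sigma> g" "h \<in> carrier G" "f' \<in> \<sigma> h" for g f h f'
    using chr_mult[OF wc, of "(g, f)" "(h, f')"] that by simp
  have wy: "\<omega> (\<one>, y [^]\<^bsub>F\<^esub> (j::int)) = (int (card (carrier G)) * j) mod N" for j
    using wA[of "(\<one>, y [^]\<^bsub>F\<^esub> j)"] w0_val CI by simp
  have w1: "\<omega> (\<one>, \<one>\<^bsub>F\<^esub>) = 0" using wy[of 0] by simp
  have ny: "(int (card (carrier G)), \<one>, y) \<in> S_of \<omega>"
    unfolding mem using wy[of 1] CI[of 1] sg_one y by simp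
  have l: "link G F (S_of \<omega>)" unfolding link_def
  proof (intro conjI allI impI ballI)
    fix j g f assume "(j, g, f) \<in> S_of \<omega>"
    then have h: "g \<in> carrier G" "f \<in> \<sigma> g" "j mod N = \<omega> (g, f)" unfolding mem by auto
    show "g \<in> carrier G" "f \<in> carrier F" using h sg_sub by auto
    have "(\<omega> (g, f) + \<omega> (inv g, inv\<^bsub>F\<^esub> f)) mod N = \<omega> (\<one>, \<one>\<^bsub>F\<^esub>)"
      using wm[OF h(1,2) G.inv_closed[OF h(1)] sg_inv[OF h(1,2)]] h(1) sg_sub[OF h(1,2)] by simp
    then have "(j + \<omega> (inv g, inv\<^bsub>F\<^esub> f)) mod N = 0" using w1 h(3) by (metis mod_add_left_eq)
    then have "N dvd \<omega> (inv g, inv\<^bsub>F\<^esub> f) - (- j)" by (simp add: add.commute dvd_eq_mod_eq_0)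
    then have "\<omega> (inv g, inv\<^bsub>F\<^esub> f) mod N = (- j) mod N" unfolding mod_eq_dvd .
    moreover have "\<omega> (inv g, inv\<^bsub>F\<^esub> f) mod N = \<omega> (inv g, inv\<^bsub>F\<^esub> f)"
      by (rule chr_mod[OF wc]) (use h sg_inv in auto)
    ultimately show "(- j, inv g, inv\<^bsub>F\<^esub> f) \<in> S_of \<omega>" unfolding mem using h sg_inv by simp
  next
    fix j g f j' g' f' assume "(j, g, f) \<in> S_of \<omega>" "(j', g', f') \<in> S_of \<omega>"
    then have h: "g \<in> carrier G" "f \<in> \<sigma> g" "j mod N = \<omega> (g, f)" "g' \<in> carrier G" "f' \<in> \<sigma> g'" "j' mod N = \<omega> (g', f')"
      unfolding mem by auto
    have "(j + j') mod N = \<omega> (g \<otimes> g', f \<otimes>\<^bsub>F\<^esub> f')"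
      unfolding wm[OF h(1,2,4,5)] h(3)[symmetric] h(6)[symmetric] by (simp only: mod_simps)
    then show "(j + j', g \<otimes> g', f \<otimes>\<^bsub>F\<^esub> f') \<in> S_of \<omega>" unfolding mem using h sg_mult by simp
  next
    fix g assume g: "g \<in> carrier G"
    then obtain f where f: "f \<in> \<sigma> g" using sg_ne by blast
    have "(\<omega> (g, f), g, f) \<in> S_of \<omega>" unfolding mem using g f chr_mod[OF wc, of "(g, f)"] by simp
    then show "\<exists>j f. (j, g, f) \<in> S_of \<omega>" by blast
  next
    fix f assume "f \<in> carrier F"
    then obtain g where g: "g \<in> carrier G" "f \<in> \<sigma> g" using sg_surj by blast
    have "(\<omega> (g, f), g, f) \<in> S_of \<omega>" unfolding mem using g chr_mod[OF wc, of "(g, f)"] by simp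
    then show "\<exists>j g. (j, g, f) \<in> S_of \<omega>" by blast
  next
    show "\<exists>f. (int (card (carrier G)), \<one>, f) \<in> S_of \<omega>" using ny by blast
  next
    fix j f assume "(j, \<one>, f) \<in> S_of \<omega>"
    then have h: "f \<in> C" "j mod N = \<omega> (\<one>, f)" unfolding mem sg_one by auto
    obtain i where i: "f = y [^]\<^bsub>F\<^esub> (i::int)" using CE[OF h(1)] by blast
    have e: "j mod N = (int (card (carrier G)) * i) mod N" using h(2) wy i by simp
    then have "N dvd j - int (card (carrier G)) * i" unfolding mod_eq_dvd .
    then have "int (card (carrier G)) dvd j - int (card (carrier G)) * i" by (rule dvd_mult_left)
    then have "int (card (carrier G)) dvd (j - int (card (carrier G)) * i) + int (card (carrier G)) * i"
      by (rule dvd_add) (rule dvd_triv_left)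
    then show "int (card (carrier G)) dvd j" by (simp only: diff_add_cancel)
    assume "j = 0"
    then have "N dvd int (card (carrier G)) * i" using e by auto
    then have "int (F.ord y) dvd i - 0" using card_G_pos by simp
    then have "y [^]\<^bsub>F\<^esub> i = y [^]\<^bsub>F\<^esub> (0::int)" unfolding pow_eq_iff .
    then show "f = \<one>\<^bsub>F\<^esub>" using i by simp
  qed
  show S: "S_of \<omega> \<in> lset" unfolding lset_def using l ny by blast
  show "shape (S_of \<omega>) = \<sigma>"
  proof (rule extensionalityI)
    show "shape (S_of \<omega>) \<in> extensional (carrier G)" by (simp add: shape_def)
    show "\<sigma> \<in> extensional (carrier G)" by (rule episD(3)[OF \<sigma>])
    fix g assume g: "g \<in> carrier G"
    have "(\<exists>j. (j, g, f) \<in> S_of \<omega>) \<longleftrightarrow> f \<in> \<sigma> g" for f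
      unfolding mem using g chr_mod[OF wc, of "(g, f)"] by auto
    then show "shape (S_of \<omega>) g = \<sigma> g" unfolding shape_def using g by auto
  qed
qed

lemma S_of_surj:
  assumes S: "S \<in> lset" and sh: "shape S = \<sigma>"
  shows "\<exists>\<omega>\<in>chr_extns D N AA EE \<omega>0. S_of \<omega> = S"
proof -
  have l: "link G F S" using S by (simp add: lset_def)
  have E: "(g, f) \<in> EE \<longleftrightarrow> (\<exists>j. (j, g, f) \<in> S)" for g f
    using sh[symmetric] linkD(1)[OF l] by (auto simp: shape_def)
  then have "\<forall>a\<in>EE. \<exists>j. (j, fst a, snd a) \<in> S" by (metis prod.collapse)
  from bchoice[OF this] obtain s where s: "\<And>a. a \<in> EE \<Longrightarrow> (s a, fst a, snd a) \<in> S" by blast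
  define \<omega> where "\<omega> = (\<lambda>a\<in>EE. s a mod N)"
  have dvd: "N dvd i - j" if ij: "(i, g, f) \<in> S" "(j, g, f) \<in> S" for i j g f
  proof -
    obtain q where q: "i - j = q * int (card (carrier G))" "f \<otimes>\<^bsub>F\<^esub> inv\<^bsub>F\<^esub> f = y [^]\<^bsub>F\<^esub> (q::int)"
      using lset_diff[OF S ij] by blast
    have "y [^]\<^bsub>F\<^esub> q = y [^]\<^bsub>F\<^esub> (0::int)" using q(2) linkD(2)[OF l ij(1)] by simp
    then have "int (F.ord y) dvd q - 0" unfolding pow_eq_iff .
    then show ?thesis unfolding q(1) by (simp add: mult.commute)
  qed
  have val: "j mod N = \<omega> (g, f)" if j: "(j, g, f) \<in> S" for j g f
  proof -
    have e: "(g, f) \<in> EE" using E j by blast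
    have "N dvd j - s (g, f)" using dvd[OF j] s[OF e] by simp
    then have "j mod N = s (g, f) mod N" unfolding mod_eq_dvd .
    then show ?thesis unfolding \<omega>_def using e by simp
  qed
  have "\<omega> \<in> chr D N EE" unfolding chr_def
  proof (intro CollectI conjI ballI)
    show "\<omega> \<in> EE \<rightarrow>\<^sub>E {0..<N}"
    proof (rule PiE_I)
      fix a assume "a \<in> EE"
      then show "\<omega> a \<in> {0..<N}" unfolding \<omega>_def using N_pos by simp
    qed (simp add: \<omega>_def)
    fix a b assume ab: "a \<in> EE" "b \<in> EE"
    have "(s a + s b) mod N = \<omega> (fst a \<otimes> fst b, snd a \<otimes>\<^bsub>F\<^esub> snd b)" by (rule val[OF linkD(4)[OF l s[OF ab(1)] s[OF ab(2)]]])
    moreover have "(s a + s b) mod N = (\<omega> a + \<omega> b) mod N" unfolding \<omega>_def using ab by (simp add: mod_simps)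
    ultimately show "\<omega> (a \<otimes>\<^bsub>D\<^esub> b) = (\<omega> a + \<omega> b) mod N" by (cases a; cases b) simp
  qed
  moreover have "\<omega> a = \<omega>0 a" if aA: "a \<in> AA" for a
  proof -
    obtain j where j: "a = (\<one>, y [^]\<^bsub>F\<^esub> (j::int))" using aA unfolding cyclic_def by blast
    show ?thesis unfolding j w0_val val[OF lset_pow[OF S], symmetric] by (simp add: mult.commute)
  qed
  ultimately have w: "\<omega> \<in> chr_extns D N AA EE \<omega>0" unfolding chr_extns_def by blast
  have "(j, g, f) \<in> S_of \<omega> \<longleftrightarrow> (j, g, f) \<in> S" for j g f
  proof
    assume "(j, g, f) \<in> S_of \<omega>"
    then have e: "(g, f) \<in> EE" and j: "j mod N = \<omega> (g, f)" by (auto simp: S_of_def)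
    have i: "(s (g, f), g, f) \<in> S" using s[OF e] by simp
    have "j mod N = s (g, f) mod N" using j val[OF i] by simp
    then have "N dvd j - s (g, f)" unfolding mod_eq_dvd .
    then obtain q where q: "j - s (g, f) = N * q" by blast
    have "(int (F.ord y) * q * int (card (carrier G)), \<one>, y [^]\<^bsub>F\<^esub> (int (F.ord y) * q)) \<in> S" by (rule lset_pow[OF S])
    moreover have "y [^]\<^bsub>F\<^esub> (int (F.ord y) * q) = y [^]\<^bsub>F\<^esub> (0::int)" unfolding pow_eq_iff by simp
    ultimately have "(j - s (g, f), \<one>, \<one>\<^bsub>F\<^esub>) \<in> S" using q by (simp add: mult_ac)
    from linkD(4)[OF l i this] show "(j, g, f) \<in> S" using linkD(1,2)[OF l i] by simp
  next
    assume "(j, g, f) \<in> S"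
    then show "(j, g, f) \<in> S_of \<omega>" using E val unfolding S_of_def by blast
  qed
  then have "S_of \<omega> = S" by auto
  then show ?thesis using w by blast
qed

lemma inj_S_of: "inj_on S_of (chr_extns D N AA EE \<omega>0)"
proof (rule inj_onI)
  fix \<omega> \<omega>' assume h: "\<omega> \<in> chr_extns D N AA EE \<omega>0" "\<omega>' \<in> chr_extns D N AA EE \<omega>0" "S_of \<omega> = S_of \<omega>'"
  have c: "\<omega> \<in> chr D N EE" "\<omega>' \<in> chr D N EE" using h by (auto simp: chr_extns_def)
  show "\<omega> = \<omega>'"
  proof (rule chr_eqI[OF c])
    fix a assume a: "a \<in> EE"
    obtain g f where gf: "a = (g, f)" by (metis surj_pair)
    have "(\<omega> a, g, f) \<in> S_of \<omega>" unfolding S_of_def using a gf chr_mod[OF c(1) a] by simp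
    then have "(\<omega> a, g, f) \<in> S_of \<omega>'" using h(3) by simp
    then have "\<omega> a mod N = \<omega>' a" unfolding S_of_def gf by simp
    then show "\<omega> a = \<omega>' a" using chr_mod[OF c(1) a] by simp
  qed
qed

lemma card_fixed_shape: "card {S \<in> lset. shape S = \<sigma>} = card (carrier G)"
proof -
  have "bij_betw S_of (chr_extns D N AA EE \<omega>0) {S \<in> lset. shape S = \<sigma>}" unfolding bij_betw_def
  proof
    show "S_of ` chr_extns D N AA EE \<omega>0 = {S \<in> lset. shape S = \<sigma>}"
    proof
      show "S_of ` chr_extns D N AA EE \<omega>0 \<subseteq> {S \<in> lset. shape S = \<sigma>}" using S_of_lset by blast
      show "{S \<in> lset. shape S = \<sigma>} \<subseteq> S_of ` chr_extns D N AA EE \<omega>0"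
      proof
        fix S assume "S \<in> {S \<in> lset. shape S = \<sigma>}"
        then have "\<exists>\<omega>\<in>chr_extns D N AA EE \<omega>0. S_of \<omega> = S" by (intro S_of_surj) auto
        then show "S \<in> S_of ` chr_extns D N AA EE \<omega>0" by blast
      qed
    qed
  qed (rule inj_S_of)
  from bij_betw_same_card[OF this] show ?thesis using card_X by simp
qed

end

lemma finite_FC: "finite (carrier FC)"
  using fin_F by (simp add: carrier_FactGroup)

text \<open>Each surjection onto the quotient by \<open>y\<close> is the shape of exactly
  \<open>|G|\<close> members of \<open>lset\<close>, one for each extension of the prescribed
  character from \<open>AA\<close> to \<open>EE\<close>.\<close>

lemma card_lset: "card lset = card (carrier G) * card (epis G FC)"
proof -
  have fin: "finite lset" unfolding lset_def by (rule finite_subset[OF _ finite_link]) auto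
  have e: "lset = (\<Union>\<sigma>\<in>epis G FC. {S \<in> lset. shape S = \<sigma>})" using shape_epis by blast
  have "card (\<Union>\<sigma>\<in>epis G FC. {S \<in> lset. shape S = \<sigma>}) = (\<Sum>\<sigma>\<in>epis G FC. card {S \<in> lset. shape S = \<sigma>})"
    by (rule card_UN_disjoint) (use fin finite_epis[OF fin_G finite_FC] in auto)
  also have "\<dots> = (\<Sum>\<sigma>\<in>epis G FC. card (carrier G))" using card_fixed_shape by (intro sum.cong) auto
  finally show ?thesis using e by (simp add: mult.commute)
qed

end

theorem card_link: "card {S. link G F S} = card (carrier G) * (\<Sum>y\<in>carrier F. card (epis G (F Mod cyclic F y)))"
proof -
  have e: "{S. link G F S} = (\<Union>y\<in>carrier F. lset y)"
  proof
    show "{S. link G F S} \<subseteq> (\<Union>y\<in>carrier F. lset y)"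
    proof
      fix S assume "S \<in> {S. link G F S}"
      then have l: "link G F S" by simp
      obtain y where y: "(int (card (carrier G)), \<one>, y) \<in> S" using linkD(7)[OF l] by blast
      have "S \<in> lset y" unfolding lset_def[OF linkD(2)[OF l y]] using l y by blast
      then show "S \<in> (\<Union>y\<in>carrier F. lset y)" using linkD(2)[OF l y] by blast
    qed
    show "(\<Union>y\<in>carrier F. lset y) \<subseteq> {S. link G F S}" by (auto simp: lset_def)
  qed
  have "card (\<Union>y\<in>carrier F. lset y) = (\<Sum>y\<in>carrier F. card (lset y))"
  proof (rule card_UN_disjoint[OF fin_F])
    show "\<forall>y\<in>carrier F. finite (lset y)"
    proof
      fix y assume "y \<in> carrier F"
      then show "finite (lset y)" using e finite_link by (metis finite_UN fin_F)
    qed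
    show "\<forall>y\<in>carrier F. \<forall>y'\<in>carrier F. y \<noteq> y' \<longrightarrow> lset y \<inter> lset y' = {}"
      using GF.link_unique by (auto simp: lset_def)
  qed
  also have "\<dots> = (\<Sum>y\<in>carrier F. card (carrier G) * card (epis G (F Mod cyclic F y)))"
    by (rule sum.cong[OF refl card_lset])
  finally show ?thesis unfolding e by (simp add: sum_distrib_left)
qed

end

section \<open>Homomorphisms to the group of order \<open>p\<close>\<close>

lemma chr_shift:
  assumes w: "\<omega> \<in> chr G n A" "\<omega>' \<in> chr G n A" and n: "n > 0" and A: "\<And>a b. a \<in> A \<Longrightarrow> b \<in> A \<Longrightarrow> a \<otimes>\<^bsub>G\<^esub> b \<in> A"
  shows "(\<lambda>y\<in>A. (\<omega> y + i * \<omega>' y) mod n) \<in> chr G n A"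
  unfolding chr_def
proof (intro CollectI conjI ballI)
  show "(\<lambda>y\<in>A. (\<omega> y + i * \<omega>' y) mod n) \<in> A \<rightarrow>\<^sub>E {0..<n}" using n by auto
  fix a b assume ab: "a \<in> A" "b \<in> A"
  have "(\<omega> (a \<otimes>\<^bsub>G\<^esub> b) + i * \<omega>' (a \<otimes>\<^bsub>G\<^esub> b)) mod n = ((\<omega> a + \<omega> b) + i * (\<omega>' a + \<omega>' b)) mod n"
    unfolding chr_mult[OF w(1) ab] chr_mult[OF w(2) ab] by (rule mod_add_cong[OF mod_mod_trivial mod_mult_right_eq])
  also have "(\<omega> a + \<omega> b) + i * (\<omega>' a + \<omega>' b) = (\<omega> a + i * \<omega>' a) + (\<omega> b + i * \<omega>' b)"
    by (simp add: algebra_simps)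
  finally show "(\<lambda>y\<in>A. (\<omega> y + i * \<omega>' y) mod n) (a \<otimes>\<^bsub>G\<^esub> b)
      = ((\<lambda>y\<in>A. (\<omega> y + i * \<omega>' y) mod n) a + (\<lambda>y\<in>A. (\<omega> y + i * \<omega>' y) mod n) b) mod n"
    using ab A by (simp add: mod_simps)
qed

context padics
begin

abbreviation Ip :: "int monoid" where "Ip \<equiv> integer_mod_group p"

text \<open>For a finite abelian p-group this is \<open>p\<close> to the minimal number of
  generators, the statistic along which the random walk is controlled.\<close>

definition nhom :: "('a, 'm) monoid_scheme \<Rightarrow> nat" where
  "nhom A = card (chr A P (carrier A))"

lemma carrier_Ip: "carrier Ip = {0..<P}" using p_gt_1 by (simp add: carrier_integer_mod_group)

lemma unit_mod_p:
  assumes "0 < w" "w < P"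
  obtains i where "(i * w) mod P = t mod P"
proof -
  have "\<not> P dvd w" using assms zdvd_not_zless by blast
  then have "coprime w P" using prime_p by (metis coprime_commute prime_imp_coprime prime_int_nat_transfer int_eq_iff nat_int of_nat_0_le_iff prime_nat_int_transfer)
  then obtain x where x: "[w * x = 1] (mod P)" using cong_solve_coprime_int by blast
  have "(t * x * w) mod P = (t * ((w * x) mod P)) mod P" by (simp add: mod_simps mult_ac)
  also have "(w * x) mod P = 1 mod P" using x by (simp add: cong_def)
  finally have "(t * x * w) mod P = t mod P" by (simp add: mod_simps)
  then show thesis by (rule that)
qed

text \<open>Since \<open>P\<close> is prime, a nonzero homomorphism to \<open>Z/p\<close> is onto.
  Hence \<open>nhom\<close> is one more than a number of surjections, and the results on surjections
  apply to it.\<close>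

lemma chr_epis:
  assumes A: "group A"
  shows "chr A P (carrier A) = insert (\<lambda>x\<in>carrier A. 0) (epis A Ip)" "(\<lambda>x\<in>carrier A. 0) \<notin> epis A Ip"
proof -
  interpret group A by (rule A)
  show "(\<lambda>x\<in>carrier A. 0) \<notin> epis A Ip"
  proof
    assume "(\<lambda>x\<in>carrier A. 0) \<in> epis A Ip"
    then have "(\<lambda>x\<in>carrier A. 0) ` carrier A = {0..<P}" using episD(2) carrier_Ip by blast
    moreover have "1 \<in> {0..<P}" using p_gt_1 by simp
    ultimately have "1 \<in> (\<lambda>x\<in>carrier A. 0::int) ` carrier A" by simp
    then show False by auto
  qed
  show "chr A P (carrier A) = insert (\<lambda>x\<in>carrier A. 0) (epis A Ip)"
  proof
    show "insert (\<lambda>x\<in>carrier A. 0) (epis A Ip) \<subseteq> chr A P (carrier A)"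
    proof
      fix \<omega> assume w: "\<omega> \<in> insert (\<lambda>x\<in>carrier A. 0) (epis A Ip)"
      show "\<omega> \<in> chr A P (carrier A)"
      proof (cases "\<omega> \<in> epis A Ip")
        case True
        note D = episD[OF True]
        show ?thesis unfolding chr_def
        proof (intro CollectI conjI ballI)
          show "\<omega> \<in> carrier A \<rightarrow>\<^sub>E {0..<P}" using D(3,4) carrier_Ip by (intro PiE_I) (auto simp: extensional_def)
          show "\<omega> (a \<otimes>\<^bsub>A\<^esub> b) = (\<omega> a + \<omega> b) mod P" if "a \<in> carrier A" "b \<in> carrier A" for a b
            using D(5)[OF that] by simp
        qed
      next
        case False
        then have "\<omega> = (\<lambda>x\<in>carrier A. 0)" using w by blast
        then show ?thesis unfolding chr_def using p_gt_1 by auto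
      qed
    qed
    show "chr A P (carrier A) \<subseteq> insert (\<lambda>x\<in>carrier A. 0) (epis A Ip)"
    proof
      fix \<omega> assume w: "\<omega> \<in> chr A P (carrier A)"
      show "\<omega> \<in> insert (\<lambda>x\<in>carrier A. 0) (epis A Ip)"
      proof (cases "\<exists>a\<in>carrier A. \<omega> a \<noteq> 0")
        case False
        then have "\<omega> = (\<lambda>x\<in>carrier A. 0)" by (intro extensionalityI[OF chr_ext[OF w]]) auto
        then show ?thesis by blast
      next
        case True
        then obtain a where a: "a \<in> carrier A" "\<omega> a \<noteq> 0" by blast
        have r: "0 < \<omega> a" "\<omega> a < P" using chr_range[OF w a(1)] a(2) by auto
        have "\<omega> \<in> epis A Ip"
        proof (rule episI)
          show "\<omega> \<in> extensional (carrier A)" by (rule chr_ext[OF w])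
          show "\<omega> x \<in> carrier Ip" if "x \<in> carrier A" for x using chr_range[OF w that] carrier_Ip by simp
          show "\<omega> (x \<otimes>\<^bsub>A\<^esub> y) = \<omega> x \<otimes>\<^bsub>Ip\<^esub> \<omega> y" if "x \<in> carrier A" "y \<in> carrier A" for x y
            using chr_mult[OF w that] by simp
          fix t assume t: "t \<in> carrier Ip"
          obtain i where i: "(i * \<omega> a) mod P = t mod P" using unit_mod_p[OF r] .
          have "\<omega> (a [^]\<^bsub>A\<^esub> i) = t"
            using chr_int_pow[OF subgroup_self w a(1), of i] i t carrier_Ip by simp
          then show "\<exists>x\<in>carrier A. \<omega> x = t" using int_pow_closed[OF a(1)] by blast
        qed
        then show ?thesis by blast
      qed
    qed
  qed
qed

lemma nhom_epis:
  assumes "group A" "finite (epis A Ip)"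
  shows "nhom A = Suc (card (epis A Ip))"
  unfolding nhom_def chr_epis(1)[OF assms(1)] using chr_epis(2)[OF assms(1)] assms(2) by simp

text \<open>Evaluation at \<open>x\<close> maps the homomorphisms either to \<open>0\<close> or onto \<open>\<int>/p\<close>, with fibres of equal size.\<close>

lemma nhom_dichotomy:
  assumes A: "group A" and fin: "finite (chr A P (carrier A))" and x: "x \<in> carrier A"
  shows "nhom A = card {\<omega> \<in> chr A P (carrier A). \<omega> x = 0} \<or> nhom A = p * card {\<omega> \<in> chr A P (carrier A). \<omega> x = 0}"
proof (cases "\<exists>\<omega>\<in>chr A P (carrier A). \<omega> x \<noteq> 0")
  case False
  then have "{\<omega> \<in> chr A P (carrier A). \<omega> x = 0} = chr A P (carrier A)" by blast
  from arg_cong[OF this, of card] show ?thesis unfolding nhom_def by (intro disjI1) (rule sym)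
next
  case True
  interpret group A by (rule A)
  let ?H = "chr A P (carrier A)"
  obtain \<omega>0 where w0: "\<omega>0 \<in> ?H" "\<omega>0 x \<noteq> 0" using True by blast
  have r: "0 < \<omega>0 x" "\<omega>0 x < P" using chr_range[OF w0(1) x] w0(2) by auto
  have Ppos: "P > 0" using p_gt_1 by simp
  have fib: "card {\<omega> \<in> ?H. \<omega> x = t} = card {\<omega> \<in> ?H. \<omega> x = 0}" if t: "t \<in> {0..<P}" for t
  proof -
    obtain i where i: "(i * \<omega>0 x) mod P = t mod P" using unit_mod_p[OF r] .
    define s where "s j \<omega> = (\<lambda>y\<in>carrier A. (\<omega> y + j * \<omega>0 y) mod P)" for j :: int and \<omega>
    have sH: "s j \<omega> \<in> ?H" if "\<omega> \<in> ?H" for j \<omega> unfolding s_def using chr_shift[OF that w0(1) Ppos] m_closed by blast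
    have inv: "s (- j) (s j \<omega>) = \<omega>" if w: "\<omega> \<in> ?H" for j \<omega>
    proof (rule chr_eqI[OF sH[OF sH[OF w]] w])
      fix y assume y: "y \<in> carrier A"
      have "s (- j) (s j \<omega>) y = ((\<omega> y + j * \<omega>0 y) mod P + - j * \<omega>0 y) mod P" unfolding s_def using y by simp
      also have "\<dots> = (\<omega> y + j * \<omega>0 y + - j * \<omega>0 y) mod P" by (rule mod_add_left_eq)
      also have "\<dots> = \<omega> y mod P" by simp
      also have "\<dots> = \<omega> y" by (rule chr_mod[OF w y])
      finally show "s (- j) (s j \<omega>) y = \<omega> y" .
    qed
    have at: "s j \<omega> x = (\<omega> x + j * \<omega>0 x) mod P" for j \<omega> unfolding s_def using x by simp
    have "bij_betw (s i) {\<omega> \<in> ?H. \<omega> x = 0} {\<omega> \<in> ?H. \<omega> x = t}"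
    proof (rule bij_betw_byWitness[where f' = "s (- i)"])
      show "\<forall>\<omega>\<in>{\<omega> \<in> ?H. \<omega> x = 0}. s (- i) (s i \<omega>) = \<omega>" using inv by blast
      show "\<forall>\<omega>\<in>{\<omega> \<in> ?H. \<omega> x = t}. s i (s (- i) \<omega>) = \<omega>" using inv[of _ "- i"] by simp
      show "s i ` {\<omega> \<in> ?H. \<omega> x = 0} \<subseteq> {\<omega> \<in> ?H. \<omega> x = t}" using sH at i t by auto
      have "(t + - i * \<omega>0 x) mod P = 0"
      proof -
        have "P dvd i * \<omega>0 x - t" using i unfolding mod_eq_dvd .
        then have "P dvd t + - i * \<omega>0 x" by (simp add: dvd_diff_commute)
        then show ?thesis by simp
      qed
      then show "s (- i) ` {\<omega> \<in> ?H. \<omega> x = t} \<subseteq> {\<omega> \<in> ?H. \<omega> x = 0}" using sH at by auto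
    qed
    then show ?thesis by (rule bij_betw_same_card[symmetric])
  qed
  have im: "(\<lambda>\<omega>. \<omega> x) ` ?H \<subseteq> {0..<P}"
  proof (rule image_subsetI)
    fix \<omega> assume "\<omega> \<in> ?H"
    from chr_range[OF this x] show "\<omega> x \<in> {0..<P}" by simp
  qed
  have "card ?H = (\<Sum>\<omega>\<in>?H. 1)" by simp
  also have "\<dots> = (\<Sum>t\<in>{0..<P}. \<Sum>\<omega>\<in>{\<omega> \<in> ?H. \<omega> x = t}. 1)"
    by (rule sum.group[symmetric, OF fin _ im]) simp
  also have "\<dots> = (\<Sum>t\<in>{0..<P}. card {\<omega> \<in> ?H. \<omega> x = t})" by simp
  also have "\<dots> = (\<Sum>t\<in>{0..<P}. card {\<omega> \<in> ?H. \<omega> x = 0})" by (rule sum.cong[OF refl fib])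
  also have "\<dots> = p * card {\<omega> \<in> ?H. \<omega> x = 0}" by simp
  finally show ?thesis unfolding nhom_def by blast
qed

end

lemma card_epis_trivial:
  assumes A: "group A" and T: "group T" "carrier T = {\<one>\<^bsub>T\<^esub>}"
  shows "card (epis A T) = 1"
proof -
  interpret A: group A by (rule A)
  interpret T: group T by (rule T)
  have "\<phi> = (\<lambda>x\<in>carrier A. \<one>\<^bsub>T\<^esub>)" if "\<phi> \<in> epis A T" for \<phi>
    by (rule extensionalityI[OF episD(3)[OF that]]) (use episD(4)[OF that] T(2) in auto)
  moreover have "(\<lambda>x\<in>carrier A. \<one>\<^bsub>T\<^esub>) \<in> epis A T"
    by (rule episI) (use T(2) A.one_closed in auto)
  ultimately have "epis A T = {\<lambda>x\<in>carrier A. \<one>\<^bsub>T\<^esub>}" by blast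
  then show ?thesis by simp
qed

lemma has_sum_diff:
  fixes f g :: "'a \<Rightarrow> real"
  assumes "(f has_sum a) A" "(g has_sum b) A"
  shows "((\<lambda>x. f x - g x) has_sum (a - b)) A"
  using has_sum_add[OF assms(1), of "\<lambda>x. - g x" "- b"] assms(2) by (simp add: has_sum_uminus)

context rank1
begin

lemma target_Ip: "rank1_target p G m \<kappa> K \<zeta> \<gamma> Ip 1"
proof (intro rank1_target.intro rank1_target_axioms.intro rank1_axioms)
  show "comm_group Ip" by simp
qed (simp_all add: carrier_Ip)

lemma finite_chr_K: "finite (chr (add_monoid K) P (carrier (add_monoid K)))"
  unfolding chr_epis(1)[OF AK_group] using rank1_target.finite_epi_KF[OF target_Ip] by simp

lemma nhom_K: "nhom (add_monoid K) = Suc (card (epis (add_monoid K) Ip))"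
  by (rule nhom_epis[OF AK_group rank1_target.finite_epi_KF[OF target_Ip]])

text \<open>Homomorphisms from the quotient are those that vanish at \<open>x\<close>, so this is
  the dichotomy for evaluation at \<open>x\<close>.\<close>

lemma nhom_quotient:
  assumes C: "group C" "finite (carrier C)" and x: "x \<in> Ev C"
  shows "nhom (add_monoid K) = nhom C \<or> nhom (add_monoid K) = p * nhom C"
proof -
  have xK: "x \<in> carrier K" using x by (simp add: Ev_def)
  let ?z = "\<lambda>x\<in>carrier (add_monoid K). 0::int"
  let ?E = "{\<psi> \<in> epis (add_monoid K) Ip. \<psi> x = \<one>\<^bsub>Ip\<^esub>}"
  have e: "{\<omega> \<in> chr (add_monoid K) P (carrier (add_monoid K)). \<omega> x = 0} = insert ?z ?E"
    unfolding chr_epis(1)[OF AK_group] using xK by auto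
  have "?z \<notin> ?E" using chr_epis(2)[OF AK_group] by blast
  moreover have "finite ?E" using rank1_target.finite_epi_KF[OF target_Ip] by simp
  ultimately have "card {\<omega> \<in> chr (add_monoid K) P (carrier (add_monoid K)). \<omega> x = 0} = Suc (card ?E)"
    unfolding e by simp
  also have "card ?E = card (epis C Ip)" by (rule rank1_target.card_epi_kill[OF target_Ip C(1) x])
  also have "Suc \<dots> = nhom C" by (rule nhom_epis[symmetric, OF C(1) finite_epis[OF C(2)]]) (simp add: carrier_Ip)
  finally show ?thesis using nhom_dichotomy[OF AK_group finite_chr_K, of x] xK by simp
qed

text \<open>\<open>G\<close> is itself a quotient of the module by one element, the point
  \<open>x0\<close> with first coordinate \<open>|G|\<close> over the neutral element, which
  corresponds to the image of \<open>1\<close>.\<close>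

lemma nhom_K_G: "nhom (add_monoid K) = nhom G \<or> nhom (add_monoid K) = p * nhom G"
proof -
  interpret T: rank1_target p G m \<kappa> K \<zeta> \<gamma> G m
    by (intro rank1_target.intro rank1_target_axioms.intro rank1_axioms) (use G.comm_group_axioms fin_G card_G in auto)
  define \<phi> where "\<phi> = restrict \<gamma> (carrier K)"
  have ph: "\<phi> \<in> epis (add_monoid K) G"
  proof (rule episI)
    fix g assume g: "g \<in> carrier G"
    have "iota (\<kappa> g) m = \<kappa> g" using chr_mod[OF ch g] by (simp add: iota_at)
    then obtain x where "x \<in> carrier K" "\<gamma> x = g" using coord_ex[of "iota (\<kappa> g)" g] g iota_closed[of "\<kappa> g"] by metis
    then show "\<exists>x\<in>carrier (add_monoid K). \<phi> x = g" unfolding \<phi>_def by auto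
  qed (auto simp: \<phi>_def gamma_add)
  have "iota (P ^ m) m = \<kappa> \<one>" using chars_one[OF ch] by (simp add: iota_at)
  then obtain x0 where x0: "x0 \<in> carrier K" "\<zeta> x0 = iota (P ^ m)" "\<gamma> x0 = \<one>"
    using coord_ex[of "iota (P ^ m)" \<one>] iota_closed[of "P ^ m"] by (metis G.one_closed)
  have "kernel (add_monoid K) G \<phi> = cyc x0" by (rule T.special_kernel[OF ph x0(1,2)]) (simp add: \<phi>_def x0)
  then have "x0 \<in> Ev G" unfolding Ev_iff[OF G.is_group] using ph x0(1) by blast
  from nhom_quotient[OF G.is_group fin_G this] show ?thesis .
qed

text \<open>The moment formula for the trivial target: the quotient is almost surely finite.\<close>

lemma has_sum_mass: "((\<lambda>C. \<mu> (Ev (class_rep C))) has_sum 1) (X0 p)"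
proof -
  let ?T = "integer_mod_group 1"
  have T: "group ?T" "carrier ?T = {\<one>\<^bsub>?T\<^esub>}" by (auto simp: carrier_integer_mod_group)
  interpret T: rank1_target p G m \<kappa> K \<zeta> \<gamma> ?T 0
    by (intro rank1_target.intro rank1_target_axioms.intro rank1_axioms) (simp_all add: carrier_integer_mod_group)
  have "((\<lambda>C. \<mu> (Ev (class_rep C)) * real (card (epis (class_rep C) ?T))) has_sum 1) (X0 p)"
    using T.has_sum_Ev card_epis_trivial[OF AK_group T] by simp
  moreover have "card (epis (class_rep C) ?T) = 1" if "C \<in> X0 p" for C
    by (rule card_epis_trivial[OF fin_ab_p_groupD(2)[OF X0_rep[OF that]] T])
  ultimately show ?thesis
    by (elim has_sum_cong[THEN iffD1, rotated]) (simp only: of_nat_1 mult_1_right)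
qed

lemma has_sum_nhom:
  "((\<lambda>C. \<mu> (Ev (class_rep C)) * real (nhom (class_rep C))) has_sum (1 + (real (nhom (add_monoid K)) - 1) / real p)) (X0 p)"
proof -
  have "((\<lambda>C. \<mu> (Ev (class_rep C)) + \<mu> (Ev (class_rep C)) * real (card (epis (class_rep C) Ip)))
      has_sum (1 + real (card (epis (add_monoid K) Ip)) / real p ^ 1)) (X0 p)"
    by (rule has_sum_add[OF has_sum_mass rank1_target.has_sum_Ev[OF target_Ip]])
  moreover have "\<mu> (Ev (class_rep C)) + \<mu> (Ev (class_rep C)) * real (card (epis (class_rep C) Ip))
      = \<mu> (Ev (class_rep C)) * real (nhom (class_rep C))" if C: "C \<in> X0 p" for C
  proof -
    note D = fin_ab_p_groupD[OF X0_rep[OF C]]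
    have "nhom (class_rep C) = Suc (card (epis (class_rep C) Ip))"
      by (rule nhom_epis[OF D(2) finite_epis[OF D(3)]]) (simp add: carrier_Ip)
    then show ?thesis by (simp add: algebra_simps)
  qed
  ultimately have "((\<lambda>C. \<mu> (Ev (class_rep C)) * real (nhom (class_rep C)))
      has_sum (1 + real (card (epis (add_monoid K) Ip)) / real p ^ 1)) (X0 p)"
    by (elim has_sum_cong[THEN iffD1, rotated])
  then show ?thesis unfolding nhom_K by simp
qed

lemma nhom_support:
  assumes "C \<in> X0 p" "\<mu> (Ev (class_rep C)) \<noteq> 0"
  shows "nhom (add_monoid K) = nhom (class_rep C) \<or> nhom (add_monoid K) = p * nhom (class_rep C)"
proof -
  note D = fin_ab_p_groupD[OF X0_rep[OF assms(1)]]
  have "Ev (class_rep C) \<noteq> {}" using assms(2) by (metis measure_empty)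
  then show ?thesis using nhom_quotient[OF D(2,3)] by blast
qed

text \<open>The mass and the mean of \<open>nhom\<close> determine its distribution, as it takes only two values:
  their indicators are affine functions of \<open>nhom\<close>.\<close>

lemma
  defines "b \<equiv> nhom (add_monoid K)"
  shows has_sum_down: "((\<lambda>C. if p * nhom (class_rep C) = b then \<mu> (Ev (class_rep C)) else 0) has_sum (1 - 1 / real b)) (X0 p)"
    and has_sum_stay: "((\<lambda>C. if nhom (class_rep C) = b then \<mu> (Ev (class_rep C)) else 0) has_sum (1 / real b)) (X0 p)"
proof -
  have b: "b > 0" unfolding b_def nhom_K by simp
  have p: "real p > 1" using p_gt_1 by simp
  \<comment> \<open>The gap between the two possible values \<open>b\<close> and
    \<open>b / p\<close>, so that \<open>(b - nhom) / d\<close> is the indicator of the smaller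
    one.\<close>
  define d where "d = real b - real b / real p"
  have d: "d = real b * (1 - 1 / real p)" unfolding d_def by (simp add: algebra_simps)
  then have dpos: "d > 0" using b p by simp
  let ?m = "\<lambda>C. \<mu> (Ev (class_rep C))" and ?h = "\<lambda>C. real (nhom (class_rep C))"
  have s: "?m C = 0 \<or> nhom (class_rep C) = b \<or> p * nhom (class_rep C) = b" if "C \<in> X0 p" for C
    using nhom_support[OF that] unfolding b_def by auto
  have ne: "p * b \<noteq> b" using b p_gt_1 by simp
  have h: "real b / real p = ?h C" if "p * nhom (class_rep C) = b" for C
    using p by (simp flip: that)
  have 1: "((\<lambda>C. (?m C * real b - ?m C * ?h C) / d) has_sum ((1 * real b - (1 + (real b - 1) / real p)) / d)) (X0 p)"
    unfolding divide_inverse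
    by (intro has_sum_cmult_left has_sum_diff has_sum_nhom[folded b_def, unfolded divide_inverse] has_sum_mass)
  have 2: "(1 * real b - (1 + (real b - 1) / real p)) / d = 1 - 1 / real b"
    unfolding d using b p by (simp add: field_simps)
  have 3: "(?m C * real b - ?m C * ?h C) / d = (if p * nhom (class_rep C) = b then ?m C else 0)" if C: "C \<in> X0 p" for C
    using s[OF C]
  proof (elim disjE)
    assume e: "p * nhom (class_rep C) = b"
    have "(?m C * real b - ?m C * ?h C) / d = ?m C * (d / d)" unfolding h[OF e, symmetric] d_def
      by (simp only: right_diff_distrib diff_divide_distrib times_divide_eq_right)
    then show ?thesis using e dpos by simp
  qed (use ne in auto)
  show D: "((\<lambda>C. if p * nhom (class_rep C) = b then ?m C else 0) has_sum (1 - 1 / real b)) (X0 p)"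
    by (rule has_sum_cong[THEN iffD1, OF 3 1[unfolded 2]])
  have 4: "((\<lambda>C. ?m C - (if p * nhom (class_rep C) = b then ?m C else 0)) has_sum (1 / real b)) (X0 p)"
    using has_sum_diff[OF has_sum_mass D] by simp
  have 5: "?m C - (if p * nhom (class_rep C) = b then ?m C else 0) = (if nhom (class_rep C) = b then ?m C else 0)"
    if C: "C \<in> X0 p" for C using s[OF C] ne by auto
  show "((\<lambda>C. if nhom (class_rep C) = b then ?m C else 0) has_sum (1 / real b)) (X0 p)"
    by (rule has_sum_cong[THEN iffD1, OF 5 4])
qed

end

section \<open>Transition probabilities\<close>

context pgroup
begin

text \<open>The law of the quotient once the extension with class \<open>\<kappa>\<close> has been
  drawn.\<close>

definition dp :: "(nat \<Rightarrow> int) \<Rightarrow> nat monoid set \<Rightarrow> real" where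
  "dp \<kappa> C = d_prob p (X1_class p (middle_term (ext_class \<kappa>))) C"

text \<open>One module serves all \<open>C\<close> simultaneously, so that the masses of different
  classes can be added.\<close>

lemma dp_eq:
  assumes ch: "\<kappa> \<in> chars"
  obtains K :: padic_mod and \<zeta> \<gamma> where "rank1 p G m \<kappa> K \<zeta> \<gamma>"
    "\<forall>C. dp \<kappa> C = measure (haar_prob p K) {x \<in> carrier K. K A_Mod cyclic_submodule p K x \<cong> class_rep C}"
proof -
  obtain K g where K: "K = class_rep (X1_class p (middle_term (ext_class \<kappa>)))" "Module.module Z K"
    "g \<in> module_iso Z K (HM \<kappa>)" using middle_class_rep[OF ch] .
  show thesis
  proof (rule that[OF rank1_iso[OF ch K(2,3)]])
    show "\<forall>C. dp \<kappa> C = measure (haar_prob p K) {x \<in> carrier K. K A_Mod cyclic_submodule p K x \<cong> class_rep C}"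
      unfolding dp_def d_prob_def Let_def K(1) by (intro allI refl)
  qed
qed

lemma dp_nonneg: "dp \<kappa> C \<ge> 0"
  unfolding dp_def d_prob_def Let_def by (rule measure_nonneg)

end

lemma (in pgroup) pair_rep:
  assumes "C \<in> X0 p" "card (carrier (class_rep C)) = p ^ k"
  shows "pgroup_pair p G m (class_rep C) k"
  by (intro pgroup_pair.intro pgroup_pair_axioms.intro pgroup_axioms)
    (use fin_ab_p_groupD[OF X0_rep[OF assms(1)]] assms(2) in auto)

lemma (in pgroup) dp_auto:
  assumes ch: "\<kappa> \<in> chars" and C': "C' \<in> X0 p" "card (carrier (class_rep C')) = p ^ k"
  defines "F \<equiv> class_rep C'"
  shows "dp \<kappa> C' * real (card (auto F))
    = (1 - 1 / real p) / real p ^ k * real (card {S. link G F S \<and> link F G (flip S) \<and> compat G S \<kappa>})"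
proof -
  obtain K :: padic_mod and \<zeta> \<gamma> where R: "rank1 p G m \<kappa> K \<zeta> \<gamma>"
    and dp': "\<forall>C. dp \<kappa> C = measure (haar_prob p K) {x \<in> carrier K. K A_Mod cyclic_submodule p K x \<cong> class_rep C}"
    using dp_eq[OF ch] .
  interpret R: rank1_target p G m \<kappa> K \<zeta> \<gamma> F k
    unfolding F_def by (rule pgroup_pair.target[OF pair_rep[OF C'] R])
  show ?thesis using R.mu_Ev unfolding R.card_special unfolding dp'[rule_format] R.haar_MK R.Ev_def F_def .
qed

lemma (in pgroup_pair) dp_moment:
  assumes ch: "\<kappa> \<in> chars"
  shows "((\<lambda>C. dp \<kappa> C * real (card (epis (class_rep C) F)))
    has_sum (real (card {S. link G F S \<and> compat G S \<kappa>}) / real p ^ k)) (X0 p)"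
proof -
  obtain K :: padic_mod and \<zeta> \<gamma> where R: "rank1 p G m \<kappa> K \<zeta> \<gamma>"
    and dp': "\<forall>C. dp \<kappa> C = measure (haar_prob p K) {x \<in> carrier K. K A_Mod cyclic_submodule p K x \<cong> class_rep C}"
    using dp_eq[OF ch] .
  interpret R: rank1_target p G m \<kappa> K \<zeta> \<gamma> F k by (rule target[OF R])
  show ?thesis using R.has_sum_Ev unfolding R.card_epi_link unfolding dp'[rule_format] R.haar_MK R.Ev_def .
qed

section \<open>How one step of the walk changes the number of homomorphisms to
  \<open>Z/p\<close>\<close>

context pgroup
begin

text \<open>The value of \<open>nhom\<close> at the middle term, expressed by linking subgroups so
  that it depends on \<open>\<kappa>\<close> alone and not on a chosen module.\<close>

definition bk :: "(nat \<Rightarrow> int) \<Rightarrow> nat" where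
  "bk \<kappa> = Suc (card {S. link G Ip S \<and> compat G S \<kappa>})"

lemma
  assumes ch: "\<kappa> \<in> chars"
  shows dp_mass: "(dp \<kappa> has_sum 1) (X0 p)"
    and bk_cases: "bk \<kappa> = nhom G \<or> bk \<kappa> = p * nhom G"
    and dp_support: "\<And>C. C \<in> X0 p \<Longrightarrow> dp \<kappa> C \<noteq> 0 \<Longrightarrow> bk \<kappa> = nhom (class_rep C) \<or> bk \<kappa> = p * nhom (class_rep C)"
    and dp_down: "((\<lambda>C. if p * nhom (class_rep C) = bk \<kappa> then dp \<kappa> C else 0) has_sum (1 - 1 / real (bk \<kappa>))) (X0 p)"
    and dp_stay: "((\<lambda>C. if nhom (class_rep C) = bk \<kappa> then dp \<kappa> C else 0) has_sum (1 / real (bk \<kappa>))) (X0 p)"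
proof -
  obtain K :: padic_mod and \<zeta> \<gamma> where R: "rank1 p G m \<kappa> K \<zeta> \<gamma>"
    and dp': "\<forall>C. dp \<kappa> C = measure (haar_prob p K) {x \<in> carrier K. K A_Mod cyclic_submodule p K x \<cong> class_rep C}"
    using dp_eq[OF ch] .
  interpret R: rank1 p G m \<kappa> K \<zeta> \<gamma> by (rule R)
  have dp: "R.\<mu> (R.Ev (class_rep C)) = dp \<kappa> C" for C unfolding dp'[rule_format] R.haar_MK R.Ev_def by (rule refl)
  have b: "nhom (add_monoid K) = bk \<kappa>"
    unfolding R.nhom_K bk_def rank1_target.card_epi_link[OF R.target_Ip] by (rule refl)
  show "(dp \<kappa> has_sum 1) (X0 p)" using R.has_sum_mass unfolding dp .
  show "bk \<kappa> = nhom G \<or> bk \<kappa> = p * nhom G" using R.nhom_K_G unfolding b .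
  show "bk \<kappa> = nhom (class_rep C) \<or> bk \<kappa> = p * nhom (class_rep C)" if "C \<in> X0 p" "dp \<kappa> C \<noteq> 0" for C
    using R.nhom_support[of C] that unfolding b dp by blast
  show "((\<lambda>C. if p * nhom (class_rep C) = bk \<kappa> then dp \<kappa> C else 0) has_sum (1 - 1 / real (bk \<kappa>))) (X0 p)"
    using R.has_sum_down unfolding b dp .
  show "((\<lambda>C. if nhom (class_rep C) = bk \<kappa> then dp \<kappa> C else 0) has_sum (1 / real (bk \<kappa>))) (X0 p)"
    using R.has_sum_stay unfolding b dp .
qed

end

lemma has_sum_finite_sum:
  fixes f :: "'i \<Rightarrow> 'a \<Rightarrow> real"
  assumes "finite I" "\<And>i. i \<in> I \<Longrightarrow> (f i has_sum s i) A"
  shows "((\<lambda>x. \<Sum>i\<in>I. f i x) has_sum (\<Sum>i\<in>I. s i)) A"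
  using assms
proof (induction I rule: finite_induct)
  case (insert i I)
  then have "((\<lambda>x. f i x + (\<Sum>i\<in>I. f i x)) has_sum (s i + (\<Sum>i\<in>I. s i))) A" by (intro has_sum_add) auto
  then show ?case using insert by simp
qed simp

lemma card_auto_pos:
  assumes "group G" "finite (carrier G)"
  shows "card (auto G) > 0"
proof -
  interpret group G by (rule assms)
  have "(\<lambda>x\<in>carrier G. x) \<in> epis G G" by (rule episI) auto
  then show ?thesis using epis_self[OF assms(2)] finite_epis[OF assms(2) assms(2)] card_gt_0_iff[of "auto G"] by auto
qed

lemma (in padics) X0_pgroup: "C \<in> X0 p \<Longrightarrow> \<exists>m. pgroup p (class_rep C) m"
proof -
  assume C: "C \<in> X0 p"
  note D = fin_ab_p_groupD[OF X0_rep[OF C]]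
  obtain m where "card (carrier (class_rep C)) = p ^ m" using D(4) by blast
  then show ?thesis
    using D by (intro exI[of _ m] pgroup.intro pgroup_axioms.intro padics_axioms) auto
qed

lemma cyclic_one: "group F \<Longrightarrow> cyclic F \<one>\<^bsub>F\<^esub> = {\<one>\<^bsub>F\<^esub>}"
  unfolding cyclic_def by (auto simp: group.int_pow_one)

lemma Mod_one_iso: "group F \<Longrightarrow> F Mod {\<one>\<^bsub>F\<^esub>} \<cong> F"
  unfolding is_iso_def using group.trivial_factor_iso by blast

context pgroup
begin

abbreviation gN :: real where "gN \<equiv> real (card (carrier G))"

lemma gN_pos: "gN > 0" using card_G p_gt_1 by simp

text \<open>Multiplying by \<open>|G|\<close> clears the average over characters, and by
  \<open>|F|\<close> the mass of the generators. The count that remains is symmetric in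
  \<open>G\<close> and \<open>F\<close> up to \<open>flip\<close>.\<close>

lemma card_auto_swap:
  assumes C: "G = class_rep C" and C': "C' \<in> X0 p"
  defines "F \<equiv> class_rep C'"
  shows "Delta0_prob p C C' * real (card (auto F)) * (gN * real (card (carrier F)))
     = (1 - 1 / real p) * real (card {S. link G F S \<and> link F G (flip S)})"
proof -
  obtain k where k: "card (carrier F) = p ^ k" using fin_ab_p_groupD(4)[OF X0_rep[OF C']] unfolding F_def by blast
  interpret pgroup_pair p G m F k unfolding F_def by (rule pair_rep[OF C' k[unfolded F_def]])
  let ?N = "\<lambda>\<kappa>. real (card {S. link G F S \<and> link F G (flip S) \<and> compat G S \<kappa>})"
  have "Delta0_prob p C C' * real (card (auto F)) * gN = (\<Sum>\<kappa>\<in>chars. dp \<kappa> C' * real (card (auto F)))"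
  proof -
    have "x / gN * a * gN = x * a" for x a using gN_pos by simp
    then show ?thesis unfolding Delta0_prob_eq[OF C] dp_def[symmetric] by (simp only: sum_distrib_right)
  qed
  also have "\<dots> = (\<Sum>\<kappa>\<in>chars. (1 - 1 / real p) / real p ^ k * ?N \<kappa>)"
    unfolding F_def by (rule sum.cong[OF refl dp_auto[OF _ C' k[unfolded F_def]]])
  also have "\<dots> = (1 - 1 / real p) / real p ^ k * real (\<Sum>\<kappa>\<in>chars. card {S. link G F S \<and> link F G (flip S) \<and> compat G S \<kappa>})"
    by (simp only: sum_distrib_left of_nat_sum)
  also have "(\<Sum>\<kappa>\<in>chars. card {S. link G F S \<and> link F G (flip S) \<and> compat G S \<kappa>})
      = card {S. link G F S \<and> link F G (flip S)}" by (rule sum_chars_link)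
  finally have e: "Delta0_prob p C C' * real (card (auto F)) * gN
      = (1 - 1 / real p) / real p ^ k * real (card {S. link G F S \<and> link F G (flip S)})" .
  have "Delta0_prob p C C' * real (card (auto F)) * (gN * real (card (carrier F)))
      = (Delta0_prob p C C' * real (card (auto F)) * gN) * real p ^ k" unfolding k by simp
  also have "\<dots> = (1 - 1 / real p) * real (card {S. link G F S \<and> link F G (flip S)})"
    unfolding e using p_gt_1 by simp
  finally show ?thesis .
qed

lemma T_nonneg: "G = class_rep C \<Longrightarrow> Delta0_prob p C C' \<ge> 0"
  unfolding Delta0_prob_eq dp_def[symmetric] by (intro divide_nonneg_nonneg sum_nonneg dp_nonneg) simp

end

lemma (in pgroup_pair) sum_card_compat: "(\<Sum>\<kappa>\<in>chars. card {S. link G F S \<and> compat G S \<kappa>})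
   = card (carrier G) * (\<Sum>y\<in>carrier F. card (epis G (F Mod cyclic F y)))"
  using sum_chars_link[of "\<lambda>_. True"] card_link by simp

text \<open>Averages the moment formula over the characters; the linking subgroups compatible with
  the single characters add up to all of them, and \<open>card_link\<close> counts these.\<close>

lemma (in pgroup_pair) T_moment:
  assumes B: "G = class_rep B"
  shows "((\<lambda>C'. Delta0_prob p B C' * real (card (epis (class_rep C') F)))
    has_sum (real (\<Sum>y\<in>carrier F. card (epis G (F Mod cyclic F y))) / real (card (carrier F)))) (X0 p)"
proof -
  let ?s = "\<lambda>\<kappa>. real (card {S. link G F S \<and> compat G S \<kappa>}) / real p ^ k"
  have "((\<lambda>C'. (\<Sum>\<kappa>\<in>chars. dp \<kappa> C' * real (card (epis (class_rep C') F))) / gN) has_sum ((\<Sum>\<kappa>\<in>chars. ?s \<kappa>) / gN)) (X0 p)"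
    unfolding divide_inverse
    by (intro has_sum_cmult_left has_sum_finite_sum finite_chars dp_moment[unfolded divide_inverse])
  moreover have "(\<Sum>\<kappa>\<in>chars. ?s \<kappa>) / gN
      = real (\<Sum>y\<in>carrier F. card (epis G (F Mod cyclic F y))) / real (card (carrier F))"
  proof -
    have "(\<Sum>\<kappa>\<in>chars. ?s \<kappa>) = real (\<Sum>\<kappa>\<in>chars. card {S. link G F S \<and> compat G S \<kappa>}) / real p ^ k"
      by (simp only: sum_divide_distrib of_nat_sum)
    also have "\<dots> = gN * real (\<Sum>y\<in>carrier F. card (epis G (F Mod cyclic F y))) / real p ^ k"
      unfolding sum_card_compat by (simp only: of_nat_mult)
    finally show ?thesis using gN_pos card_F by simp
  qed
  moreover have "(\<lambda>C'. (\<Sum>\<kappa>\<in>chars. dp \<kappa> C' * real (card (epis (class_rep C') F))) / gN)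
      = (\<lambda>C'. Delta0_prob p B C' * real (card (epis (class_rep C') F)))"
    by (rule ext) (simp add: Delta0_prob_eq[OF B] dp_def sum_distrib_right)
  ultimately show ?thesis by (simp only:)
qed

context pgroup
begin

lemma nhom_G: "nhom G = Suc (card (epis G Ip))"
  by (rule nhom_epis[OF G.is_group finite_epis[OF fin_G]]) (simp add: carrier_Ip)

lemma cyclic_Ip: "y \<in> carrier Ip \<Longrightarrow> y \<noteq> 0 \<Longrightarrow> cyclic Ip y = carrier Ip"
proof
  assume y: "y \<in> carrier Ip" "y \<noteq> 0"
  show "cyclic Ip y \<subseteq> carrier Ip"
    unfolding cyclic_def carrier_Ip using p_gt_1 by (auto simp: int_pow_integer_mod_group)
  show "carrier Ip \<subseteq> cyclic Ip y"
  proof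
    fix t assume t: "t \<in> carrier Ip"
    obtain i where "(i * y) mod P = t mod P" using unit_mod_p[of y t] y carrier_Ip by auto
    then have "t = y [^]\<^bsub>Ip\<^esub> i" using t carrier_Ip by (simp add: int_pow_integer_mod_group)
    then show "t \<in> cyclic Ip y" unfolding cyclic_def by blast
  qed
qed

text \<open>The count of linking subgroups for the target \<open>Z/p\<close>: the element
  \<open>0\<close> contributes all surjections from \<open>G\<close>, while each of the other
  \<open>p - 1\<close> elements generates the target and contributes the one map to the trivial
  group.\<close>

lemma sum_bk: "(\<Sum>\<kappa>\<in>chars. bk \<kappa>) = card (carrier G) * (nhom G + (p - 1))"
proof -
  interpret pgroup_pair p G m Ip 1
    by (intro pgroup_pair.intro pgroup_pair_axioms.intro pgroup_axioms) (simp_all add: carrier_Ip)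
  have 0: "card (epis G (Ip Mod cyclic Ip 0)) = card (epis G Ip)"
  proof (rule card_epis_iso_right[OF G.is_group])
    have c: "cyclic Ip 0 = {\<one>\<^bsub>Ip\<^esub>}" using cyclic_one[of Ip] by simp
    show "group (Ip Mod cyclic Ip 0)" by (rule FC_group) simp
    show "Ip Mod cyclic Ip 0 \<cong> Ip" unfolding c by (rule Mod_one_iso) simp
  qed
  have 1: "card (epis G (Ip Mod cyclic Ip y)) = 1" if y: "y \<in> carrier Ip - {0}" for y
  proof (rule card_epis_trivial[OF G.is_group])
    have c: "cyclic Ip y = carrier Ip" using cyclic_Ip y by blast
    show "group (Ip Mod cyclic Ip y)"
      unfolding c by (rule normal.factorgroup_is_group[OF F.subgroup_imp_normal[OF F.subgroup_self]])
    show "carrier (Ip Mod cyclic Ip y) = {\<one>\<^bsub>Ip Mod cyclic Ip y\<^esub>}"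
      unfolding c carrier_FactGroup one_FactGroup
      using F.coset_join2[OF _ F.subgroup_self] F.one_closed by (auto intro!: image_eqI[of _ _ 0])
  qed
  have "(\<Sum>y\<in>carrier Ip. card (epis G (Ip Mod cyclic Ip y)))
      = card (epis G (Ip Mod cyclic Ip 0)) + (\<Sum>y\<in>carrier Ip - {0}. card (epis G (Ip Mod cyclic Ip y)))"
    by (rule sum.remove[OF fin_F]) simp
  also have "(\<Sum>y\<in>carrier Ip - {0}. card (epis G (Ip Mod cyclic Ip y))) = (\<Sum>y\<in>carrier Ip - {0}. 1)"
    by (rule sum.cong[OF refl 1])
  also have "\<dots> = p - 1" using card_F by simp
  finally have s: "(\<Sum>y\<in>carrier Ip. card (epis G (Ip Mod cyclic Ip y))) = card (epis G Ip) + (p - 1)" unfolding 0 .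
  have "(\<Sum>\<kappa>\<in>chars. bk \<kappa>) = card chars + (\<Sum>\<kappa>\<in>chars. card {S. link G Ip S \<and> compat G S \<kappa>})"
    unfolding bk_def by (simp only: sum_Suc add.commute)
  also have "\<dots> = card (carrier G) + card (carrier G) * (card (epis G Ip) + (p - 1))"
    unfolding sum_card_compat s card_chars by (rule refl)
  finally show ?thesis unfolding nhom_G by (simp add: algebra_simps)
qed

text \<open>As \<open>bk\<close> takes only two values, the two cardinalities solve two linear
  equations: their sum is the number \<open>|G|\<close> of characters, and the sum of
  \<open>bk\<close> is known.\<close>

lemma
  shows card_up: "real (card {\<kappa> \<in> chars. bk \<kappa> = p * nhom G}) = gN / real (nhom G)"
    and card_flat: "real (card {\<kappa> \<in> chars. bk \<kappa> = nhom G}) = gN * (1 - 1 / real (nhom G))"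
proof -
  let ?U = "{\<kappa> \<in> chars. bk \<kappa> = p * nhom G}" and ?L = "{\<kappa> \<in> chars. bk \<kappa> = nhom G}"
  have a: "nhom G > 0" unfolding nhom_G by simp
  have p: "real p > 1" using p_gt_1 by simp
  have d: "?U \<inter> ?L = {}" using a p_gt_1 by auto
  have u: "chars = ?U \<union> ?L" using bk_cases by blast
  have f: "finite ?U" "finite ?L" using finite_chars by simp_all
  have 1: "card (carrier G) = card ?U + card ?L" using card_Un_disjoint[OF f d] u card_chars by simp
  have "(\<Sum>\<kappa>\<in>chars. bk \<kappa>) = (\<Sum>\<kappa>\<in>?U. bk \<kappa>) + (\<Sum>\<kappa>\<in>?L. bk \<kappa>)"
    using sum.union_disjoint[OF f d, of bk] u by simp
  also have "\<dots> = card ?U * (p * nhom G) + card ?L * nhom G" by simp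
  finally have 2: "real (card (carrier G) * (nhom G + (p - 1))) = real (card ?U * (p * nhom G) + card ?L * nhom G)"
    unfolding sum_bk by simp
  have 3: "gN = real (card ?U) + real (card ?L)" using 1 by simp
  have pr: "real (p - 1) = real p - 1" using p_gt_1 by simp
  have "gN * (real (nhom G) + (real p - 1)) = real (card ?U) * (real p * real (nhom G)) + real (card ?L) * real (nhom G)"
    using 2 by (simp only: of_nat_mult of_nat_add pr)
  then have "(gN - real (card ?U) * real (nhom G)) * (real p - 1) = 0"
    using 3 by (simp add: algebra_simps)
  then have 4: "gN = real (card ?U) * real (nhom G)" using p by simp
  then show "real (card ?U) = gN / real (nhom G)" using a by (simp add: field_simps)
  then show "real (card ?L) = gN * (1 - 1 / real (nhom G))" using 3 a by (simp add: field_simps)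
qed

lemma sum_indicator_chars:
  "(\<Sum>\<kappa>\<in>chars. if bk \<kappa> = b then c else (0::real)) = real (card {\<kappa> \<in> chars. bk \<kappa> = b}) * c"
  using finite_chars by (simp flip: sum.inter_filter)

lemma nhom_pos: "C \<in> X0 p \<Longrightarrow> nhom (class_rep C) > 0"
proof -
  assume C: "C \<in> X0 p"
  note D = fin_ab_p_groupD[OF X0_rep[OF C]]
  show ?thesis by (subst nhom_epis[OF D(2) finite_epis[OF D(3)]]) (simp_all add: carrier_Ip)
qed

text \<open>Passing to the extension never lowers \<open>nhom\<close> and taking the quotient never
  raises it. A net decrease means that the extension keeps it and the quotient lowers it; with
  \<open>a = nhom G\<close> each happens with probability \<open>1 - 1/a\<close>.\<close>

lemma T_down:
  assumes C: "G = class_rep C"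
  shows "((\<lambda>C'. if p * nhom (class_rep C') = nhom G then Delta0_prob p C C' else 0) has_sum (1 - 1 / real (nhom G))\<^sup>2) (X0 p)"
proof -
  let ?a = "nhom G"
  have a: "?a > 0" unfolding nhom_G by simp
  have pa: "p * ?a \<noteq> ?a" "p * (p * ?a) \<noteq> ?a" using a p_gt_1 by (simp_all add: nat_mult_eq_1_iff)
  have "((\<lambda>C'. if p * nhom (class_rep C') = ?a then dp \<kappa> C' else 0) has_sum (if bk \<kappa> = ?a then 1 - 1 / real ?a else 0)) (X0 p)"
    if k: "\<kappa> \<in> chars" for \<kappa>
  proof (cases "bk \<kappa> = ?a")
    case True
    then show ?thesis using dp_down[OF k] by simp
  next
    case False
    then have b: "bk \<kappa> = p * ?a" using bk_cases[OF k] by blast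
    have "(if p * nhom (class_rep C') = ?a then dp \<kappa> C' else 0) = 0" if C': "C' \<in> X0 p" for C'
    proof (rule ccontr)
      assume "\<not> ?thesis"
      then have h: "p * nhom (class_rep C') = ?a" "dp \<kappa> C' \<noteq> 0" by (auto split: if_splits)
      have "p * ?a = nhom (class_rep C') \<or> p * ?a = p * nhom (class_rep C')" using dp_support[OF k C' h(2)] b by simp
      then show False using h(1) pa p_gt_1 by auto
    qed
    from has_sum_0[OF this] show ?thesis using False by simp
  qed
  then have "((\<lambda>C'. (\<Sum>\<kappa>\<in>chars. if p * nhom (class_rep C') = ?a then dp \<kappa> C' else 0) * inverse gN)
      has_sum ((\<Sum>\<kappa>\<in>chars. if bk \<kappa> = ?a then 1 - 1 / real ?a else 0) * inverse gN)) (X0 p)"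
    by (intro has_sum_cmult_left has_sum_finite_sum finite_chars)
  moreover have "(\<lambda>C'. (\<Sum>\<kappa>\<in>chars. if p * nhom (class_rep C') = ?a then dp \<kappa> C' else 0) * inverse gN)
      = (\<lambda>C'. if p * nhom (class_rep C') = ?a then Delta0_prob p C C' else 0)"
    by (rule ext) (simp add: Delta0_prob_eq[OF C] dp_def divide_inverse)
  moreover have "(\<Sum>\<kappa>\<in>chars. if bk \<kappa> = ?a then 1 - 1 / real ?a else 0) * inverse gN = (1 - 1 / real ?a)\<^sup>2"
    unfolding sum_indicator_chars card_flat using gN_pos by (simp add: power2_eq_square field_simps)
  ultimately show ?thesis by (simp only:)
qed

text \<open>A net increase means that the extension raises \<open>nhom\<close> to
  \<open>p * a\<close>, with probability \<open>1/a\<close>, and the quotient keeps that value, with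
  probability \<open>1 / (p * a)\<close>, where \<open>a = nhom G\<close>.\<close>

lemma T_up:
  assumes C: "G = class_rep C"
  shows "((\<lambda>C'. if nhom (class_rep C') = p * nhom G then Delta0_prob p C C' else 0) has_sum (1 / (real p * (real (nhom G))\<^sup>2))) (X0 p)"
proof -
  let ?a = "nhom G"
  have a: "?a > 0" unfolding nhom_G by simp
  have pa: "p * ?a \<noteq> ?a" "p * (p * ?a) \<noteq> ?a" using a p_gt_1 by (simp_all add: nat_mult_eq_1_iff)
  have "((\<lambda>C'. if nhom (class_rep C') = p * ?a then dp \<kappa> C' else 0) has_sum (if bk \<kappa> = p * ?a then 1 / real (p * ?a) else 0)) (X0 p)"
    if k: "\<kappa> \<in> chars" for \<kappa>
  proof (cases "bk \<kappa> = p * ?a")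
    case True
    then show ?thesis using dp_stay[OF k] by simp
  next
    case False
    then have b: "bk \<kappa> = ?a" using bk_cases[OF k] by blast
    have "(if nhom (class_rep C') = p * ?a then dp \<kappa> C' else 0) = 0" if C': "C' \<in> X0 p" for C'
    proof (rule ccontr)
      assume "\<not> ?thesis"
      then have h: "nhom (class_rep C') = p * ?a" "dp \<kappa> C' \<noteq> 0" by (auto split: if_splits)
      then show False using dp_support[OF k C' h(2)] b pa by simp
    qed
    from has_sum_0[OF this] show ?thesis using False by simp
  qed
  then have "((\<lambda>C'. (\<Sum>\<kappa>\<in>chars. if nhom (class_rep C') = p * ?a then dp \<kappa> C' else 0) * inverse gN)
      has_sum ((\<Sum>\<kappa>\<in>chars. if bk \<kappa> = p * ?a then 1 / real (p * ?a) else 0) * inverse gN)) (X0 p)"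
    by (intro has_sum_cmult_left has_sum_finite_sum finite_chars)
  moreover have "(\<lambda>C'. (\<Sum>\<kappa>\<in>chars. if nhom (class_rep C') = p * ?a then dp \<kappa> C' else 0) * inverse gN)
      = (\<lambda>C'. if nhom (class_rep C') = p * ?a then Delta0_prob p C C' else 0)"
    by (rule ext) (simp add: Delta0_prob_eq[OF C] dp_def divide_inverse)
  moreover have "(\<Sum>\<kappa>\<in>chars. if bk \<kappa> = p * ?a then 1 / real (p * ?a) else 0) * inverse gN = 1 / (real p * (real ?a)\<^sup>2)"
    unfolding sum_indicator_chars card_up using gN_pos by (simp add: power2_eq_square field_simps)
  ultimately show ?thesis by (simp only:)
qed

end

section \<open>Counting homomorphisms\<close>

definition homs :: "('a, 'm) monoid_scheme \<Rightarrow> ('b, 'n) monoid_scheme \<Rightarrow> ('a \<Rightarrow> 'b) set" where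
  "homs A F = hom A F \<inter> extensional (carrier A)"

lemma finite_homs: "finite (carrier A) \<Longrightarrow> finite (carrier F) \<Longrightarrow> finite (homs A F)"
  by (rule finite_subset[OF _ finite_PiE[of "carrier A" "\<lambda>_. carrier F"]])
    (auto simp: homs_def hom_def PiE_def)

context padics
begin

text \<open>There are \<open>p\<close> characters, hence a nonzero one, and its kernel is a proper
  subgroup of a group of prime order.\<close>

lemma prime_order_chr:
  assumes Q: "comm_group Q" and c: "card (carrier Q) = p"
  shows "\<exists>\<omega>\<in>chr Q P (carrier Q). \<forall>x\<in>carrier Q. \<omega> x = 0 \<longrightarrow> x = \<one>\<^bsub>Q\<^esub>"
proof -
  interpret comm_group Q by (rule Q)
  have fin: "finite (carrier Q)" using c p_gt_1 by (metis card.infinite not_less0)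
  have "card (chr Q P (carrier Q)) = p"
    using card_chr[OF subgroup_self fin, of P] c p_gt_1 by simp
  then have "\<not> chr Q P (carrier Q) \<subseteq> {\<lambda>x\<in>carrier Q. 0}"
    using p_gt_1 card_mono[of "{\<lambda>x\<in>carrier Q. 0::int}" "chr Q P (carrier Q)"] by auto
  then obtain \<omega> where w: "\<omega> \<in> chr Q P (carrier Q)" "\<omega> \<noteq> (\<lambda>x\<in>carrier Q. 0)" by blast
  let ?K = "{x \<in> carrier Q. \<omega> x = 0}"
  have sub: "subgroup ?K Q"
  proof (rule subgroupI)
    show "?K \<noteq> {}" using chr_one[OF subgroup_self w(1)] by blast
    fix x y assume x: "x \<in> ?K"
    have "\<omega> (inv\<^bsub>Q\<^esub> x) = \<omega> (x [^]\<^bsub>Q\<^esub> (-1::int))" using x int_pow_neg[of x 1] by simp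
    also have "\<dots> = 0" using chr_int_pow[OF subgroup_self w(1), of x "-1"] x by simp
    finally show "inv\<^bsub>Q\<^esub> x \<in> ?K" using x by simp
    assume "y \<in> ?K"
    then show "x \<otimes>\<^bsub>Q\<^esub> y \<in> ?K" using chr_mult[OF w(1), of x y] x by simp
  qed auto
  have "card (rcosets\<^bsub>Q\<^esub> ?K) * card ?K = p" using lagrange[OF sub] c by (simp add: order_def)
  then have "card ?K dvd p" by (metis dvd_triv_right)
  then have "card ?K = 1 \<or> card ?K = p" using prime_p by (simp add: prime_nat_iff)
  moreover have "card ?K \<noteq> p"
  proof
    assume "card ?K = p"
    then have "?K = carrier Q" using card_subset_eq[OF fin, of ?K] c by auto
    then have "\<omega> = (\<lambda>x\<in>carrier Q. 0)" by (intro extensionalityI[OF chr_ext[OF w(1)]]) auto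
    then show False using w(2) by blast
  qed
  ultimately have "card ?K = 1" by blast
  then obtain z where z: "?K = {z}" by (rule card_1_singletonE)
  then have "z = \<one>\<^bsub>Q\<^esub>" using subgroup.one_closed[OF sub] by simp
  then show ?thesis using w(1) z by blast
qed

text \<open>Sylow's theorem provides the subgroup of order \<open>p ^ k\<close>; the quotient by it
  has order \<open>p\<close>, and a faithful character of that quotient is pulled back.\<close>

lemma index_p_chr:
  assumes F: "comm_group F" and c: "card (carrier F) = p ^ Suc k"
  obtains H \<theta> where "subgroup H F" "card H = p ^ k" "\<theta> \<in> chr F P (carrier F)"
    "\<forall>f\<in>carrier F. \<theta> f = 0 \<longrightarrow> f \<in> H"
proof -
  interpret comm_group F by (rule F)
  have fin: "finite (carrier F)" using c p_gt_1 by (metis card.infinite less_not_refl not_gr_zero power_not_zero zero_less_one_class.zero_less_one less_trans)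
  have "order F = p ^ k * p" using c by (simp add: order_def mult.commute)
  then obtain H where H: "subgroup H F" "card H = p ^ k" using sylow_thm[OF prime_p is_group _ fin] by blast
  interpret N: normal H F by (rule subgroup_imp_normal[OF H(1)])
  have Q: "comm_group (F Mod H)" by (rule abelian_FactGroup[OF H(1)])
  have "card (rcosets\<^bsub>F\<^esub> H) * p ^ k = p ^ Suc k" using lagrange[OF H(1)] c H(2) by (simp add: order_def)
  then have "card (carrier (F Mod H)) = p" using p_gt_1 by (simp add: FactGroup_def)
  then obtain \<omega> where w: "\<omega> \<in> chr (F Mod H) P (carrier (F Mod H))"
    "\<And>X. X \<in> carrier (F Mod H) \<Longrightarrow> \<omega> X = 0 \<Longrightarrow> X = \<one>\<^bsub>F Mod H\<^esub>" using prime_order_chr[OF Q] by blast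
  have q: "H #>\<^bsub>F\<^esub> f \<in> carrier (F Mod H)" if "f \<in> carrier F" for f using that by (auto simp: carrier_FactGroup)
  show thesis
  proof (rule that[OF H])
    show "(\<lambda>f\<in>carrier F. \<omega> (H #>\<^bsub>F\<^esub> f)) \<in> chr F P (carrier F)" unfolding chr_def
    proof (intro CollectI conjI ballI)
      show "(\<lambda>f\<in>carrier F. \<omega> (H #>\<^bsub>F\<^esub> f)) \<in> carrier F \<rightarrow>\<^sub>E {0..<P}" using chr_range[OF w(1) q] by auto
      fix a b assume ab: "a \<in> carrier F" "b \<in> carrier F"
      show "(\<lambda>f\<in>carrier F. \<omega> (H #>\<^bsub>F\<^esub> f)) (a \<otimes>\<^bsub>F\<^esub> b)
          = ((\<lambda>f\<in>carrier F. \<omega> (H #>\<^bsub>F\<^esub> f)) a + (\<lambda>f\<in>carrier F. \<omega> (H #>\<^bsub>F\<^esub> f)) b) mod P"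
        using chr_mult[OF w(1) q[OF ab(1)] q[OF ab(2)]] N.rcos_sum[OF ab] ab by simp
    qed
    show "\<forall>f\<in>carrier F. (\<lambda>f\<in>carrier F. \<omega> (H #>\<^bsub>F\<^esub> f)) f = 0 \<longrightarrow> f \<in> H"
    proof (intro ballI impI)
      fix f assume f: "f \<in> carrier F" "(\<lambda>f\<in>carrier F. \<omega> (H #>\<^bsub>F\<^esub> f)) f = 0"
      then have "H #>\<^bsub>F\<^esub> f = H" using w(2)[OF q[OF f(1)]] by simp
      then show "f \<in> H" using rcos_self[OF f(1) H(1)] by simp
    qed
  qed
qed

text \<open>A subgroup of index \<open>p\<close> bounds the number of homomorphisms to \<open>F\<close> by that of homomorphisms
  to it times that of homomorphisms to \<open>\<int>/p\<close>.\<close>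

lemma card_homs_le:
  fixes F :: "'f monoid"
  assumes A: "group A" "finite (carrier A)"
  shows "comm_group F \<Longrightarrow> card (carrier F) = p ^ k \<Longrightarrow> card (homs A F) \<le> nhom A ^ k"
proof (induction k arbitrary: F)
  case 0
  interpret comm_group F by (rule 0(1))
  have "carrier F = {\<one>\<^bsub>F\<^esub>}" using 0(2) one_closed by (metis card_1_singletonE power_0 singletonD)
  then have "\<phi> = (\<lambda>x\<in>carrier A. \<one>\<^bsub>F\<^esub>)" if "\<phi> \<in> homs A F" for \<phi>
    using that by (intro extensionalityI[of _ "carrier A"]) (auto simp: homs_def hom_def)
  then have "homs A F \<subseteq> {\<lambda>x\<in>carrier A. \<one>\<^bsub>F\<^esub>}" by blast
  from card_mono[OF _ this] show ?case by simp
next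
  case (Suc k)
  interpret A: group A by (rule A(1))
  interpret F: comm_group F by (rule Suc.prems(1))
  have finF: "finite (carrier F)" using Suc.prems(2) p_gt_1 by (metis card.infinite power_eq_0_iff not_less0)
  obtain H \<theta> where H: "subgroup H F" "card H = p ^ k" and chi: "\<theta> \<in> chr F P (carrier F)"
    "\<forall>f\<in>carrier F. \<theta> f = 0 \<longrightarrow> f \<in> H" using index_p_chr[OF Suc.prems] .
  let ?FH = "F\<lparr>carrier := H\<rparr>"
  have FH: "comm_group ?FH"
  proof (rule group.group_comm_groupI[OF subgroup.subgroup_is_group[OF H(1) F.is_group]])
    fix x y assume "x \<in> carrier ?FH" "y \<in> carrier ?FH"
    then show "x \<otimes>\<^bsub>?FH\<^esub> y = y \<otimes>\<^bsub>?FH\<^esub> x" using subgroup.mem_carrier[OF H(1)] by (simp add: F.m_comm)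
  qed
  have le: "card (homs A ?FH) \<le> nhom A ^ k" by (rule Suc.IH[OF FH]) (simp add: H(2))
  have finH: "finite (homs A ?FH)" by (rule finite_homs[OF A(2)]) (use finite_subset[OF subgroup.subset[OF H(1)] finF] in simp)
  have h: "\<And>\<psi> x. \<psi> \<in> homs A F \<Longrightarrow> x \<in> carrier A \<Longrightarrow> \<psi> x \<in> carrier F"
    "\<And>\<psi> x y. \<psi> \<in> homs A F \<Longrightarrow> x \<in> carrier A \<Longrightarrow> y \<in> carrier A \<Longrightarrow> \<psi> (x \<otimes>\<^bsub>A\<^esub> y) = \<psi> x \<otimes>\<^bsub>F\<^esub> \<psi> y"
    "\<And>\<psi>. \<psi> \<in> homs A F \<Longrightarrow> \<psi> \<in> extensional (carrier A)"
    by (auto simp: homs_def hom_def)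
  define \<Phi> where "\<Phi> \<psi> = (\<lambda>x\<in>carrier A. \<theta> (\<psi> x))" for \<psi>
  have im: "\<Phi> ` homs A F \<subseteq> chr A P (carrier A)"
  proof (rule image_subsetI)
    fix \<psi> assume ps: "\<psi> \<in> homs A F"
    show "\<Phi> \<psi> \<in> chr A P (carrier A)" unfolding chr_def
    proof (intro CollectI conjI ballI)
      show "\<Phi> \<psi> \<in> carrier A \<rightarrow>\<^sub>E {0..<P}" unfolding \<Phi>_def using chr_range[OF chi(1) h(1)[OF ps]] by auto
      show "\<Phi> \<psi> (x \<otimes>\<^bsub>A\<^esub> y) = (\<Phi> \<psi> x + \<Phi> \<psi> y) mod P" if "x \<in> carrier A" "y \<in> carrier A" for x y
        unfolding \<Phi>_def using that h(2)[OF ps that] chr_mult[OF chi(1) h(1)[OF ps that(1)] h(1)[OF ps that(2)]] by simp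
    qed
  qed
  have fibre: "card {\<psi> \<in> homs A F. \<Phi> \<psi> = t} \<le> nhom A ^ k" for t
  proof (cases "{\<psi> \<in> homs A F. \<Phi> \<psi> = t} = {}")
    case False
    then obtain \<psi>0 where p0: "\<psi>0 \<in> homs A F" "\<Phi> \<psi>0 = t" by blast
    \<comment> \<open>Dividing by a fixed member of the fibre moves all values into
      \<open>H\<close>, the place where \<open>\<theta>\<close> vanishes.\<close>
    define D where "D \<psi> = (\<lambda>x\<in>carrier A. \<psi> x \<otimes>\<^bsub>F\<^esub> inv\<^bsub>F\<^esub> \<psi>0 x)" for \<psi>
    have "inj_on D {\<psi> \<in> homs A F. \<Phi> \<psi> = t}"
    proof (rule inj_onI)
      fix \<psi> \<psi>' assume ps: "\<psi> \<in> {\<psi> \<in> homs A F. \<Phi> \<psi> = t}" "\<psi>' \<in> {\<psi> \<in> homs A F. \<Phi> \<psi> = t}" and e: "D \<psi> = D \<psi>'"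
      have "\<psi> x = \<psi>' x" if x: "x \<in> carrier A" for x
      proof -
        have "\<psi> x \<otimes>\<^bsub>F\<^esub> inv\<^bsub>F\<^esub> \<psi>0 x = \<psi>' x \<otimes>\<^bsub>F\<^esub> inv\<^bsub>F\<^esub> \<psi>0 x" using fun_cong[OF e, of x] x unfolding D_def by simp
        then show ?thesis using ps p0(1) h(1) x by (simp add: F.right_cancel)
      qed
      then show "\<psi> = \<psi>'" using ps h(3) by (intro extensionalityI[of _ "carrier A"]) auto
    qed
    moreover have "D ` {\<psi> \<in> homs A F. \<Phi> \<psi> = t} \<subseteq> homs A ?FH"
    proof (rule image_subsetI)
      fix \<psi> assume "\<psi> \<in> {\<psi> \<in> homs A F. \<Phi> \<psi> = t}"
      then have ps: "\<psi> \<in> homs A F" and e: "\<Phi> \<psi> = \<Phi> \<psi>0" using p0(2) by auto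
      have mem: "\<psi> x \<otimes>\<^bsub>F\<^esub> inv\<^bsub>F\<^esub> \<psi>0 x \<in> H" if x: "x \<in> carrier A" for x
      proof (rule chi(2)[rule_format])
        let ?u = "\<psi> x" and ?v = "\<psi>0 x"
        have c: "?u \<in> carrier F" "?v \<in> carrier F" using h(1) ps p0(1) x by auto
        then show "?u \<otimes>\<^bsub>F\<^esub> inv\<^bsub>F\<^esub> ?v \<in> carrier F" by simp
        have uv: "\<theta> ?u = \<theta> ?v" using fun_cong[OF e, of x] x unfolding \<Phi>_def by simp
        have "\<theta> (?u \<otimes>\<^bsub>F\<^esub> inv\<^bsub>F\<^esub> ?v) = (\<theta> ?v + \<theta> (inv\<^bsub>F\<^esub> ?v)) mod P"
          using chr_mult[OF chi(1) c(1) F.inv_closed[OF c(2)]] uv by simp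
        also have "\<dots> = \<theta> (?v \<otimes>\<^bsub>F\<^esub> inv\<^bsub>F\<^esub> ?v)" by (rule chr_mult[OF chi(1) c(2) F.inv_closed[OF c(2)], symmetric])
        also have "\<dots> = 0" using F.r_inv[OF c(2)] F.chr_one[OF F.subgroup_self chi(1)] by simp
        finally show "\<theta> (?u \<otimes>\<^bsub>F\<^esub> inv\<^bsub>F\<^esub> ?v) = 0" .
      qed
      have "D \<psi> (x \<otimes>\<^bsub>A\<^esub> y) = D \<psi> x \<otimes>\<^bsub>F\<^esub> D \<psi> y" if "x \<in> carrier A" "y \<in> carrier A" for x y
      proof -
        have c: "\<psi> x \<in> carrier F" "\<psi> y \<in> carrier F" "\<psi>0 x \<in> carrier F" "\<psi>0 y \<in> carrier F" using h(1) ps p0(1) that by auto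
        show ?thesis unfolding D_def using that c h(2)[OF ps that] h(2)[OF p0(1) that]
          by (simp add: F.inv_mult F.m_ac)
      qed
      then show "D \<psi> \<in> homs A ?FH" using mem by (auto simp: homs_def hom_def D_def)
    qed
    ultimately have "card {\<psi> \<in> homs A F. \<Phi> \<psi> = t} \<le> card (homs A ?FH)" by (rule card_inj_on_le[OF _ _ finH])
    then show ?thesis using le by (rule le_trans)
  qed (simp only: card.empty le0)
  have "card (homs A F) = (\<Sum>\<psi>\<in>homs A F. 1)" by simp
  also have "\<dots> = (\<Sum>t\<in>chr A P (carrier A). \<Sum>\<psi>\<in>{\<psi> \<in> homs A F. \<Phi> \<psi> = t}. 1)"
    by (rule sum.group[symmetric, OF finite_homs[OF A(2) finF] finite_chr[OF A(2)] im])
  also have "\<dots> = (\<Sum>t\<in>chr A P (carrier A). card {\<psi> \<in> homs A F. \<Phi> \<psi> = t})" by simp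
  also have "\<dots> \<le> (\<Sum>t\<in>chr A P (carrier A). nhom A ^ k)" by (rule sum_mono[OF fibre])
  also have "\<dots> = nhom A ^ Suc k" unfolding nhom_def by simp
  finally show ?case .
qed

end

section \<open>Summability of the moment measures\<close>

context padics
begin

abbreviation nc :: "nat monoid set \<Rightarrow> nat" where "nc C \<equiv> nhom (class_rep C)"
abbreviation T :: "nat monoid set \<Rightarrow> nat monoid set \<Rightarrow> real" where "T \<equiv> Delta0_prob p"

definition w :: "nat monoid set \<Rightarrow> real" where "w C = 1 / real (card (auto (class_rep C)))"

definition sur :: "nat monoid set \<Rightarrow> nat monoid set \<Rightarrow> real" where
  "sur F C = real (card (epis (class_rep C) (class_rep F)))"

lemmas X0_D = fin_ab_p_groupD[OF X0_rep]

lemma carrier_pos: "C \<in> X0 p \<Longrightarrow> card (carrier (class_rep C)) > 0"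
  using X0_D(2,3) group.is_monoid monoid.one_closed card_gt_0_iff by (metis empty_iff)

lemma auto_pos: "C \<in> X0 p \<Longrightarrow> card (auto (class_rep C)) > 0"
  using card_auto_pos X0_D(2,3) by blast

lemma w_nonneg: "w C \<ge> 0" by (simp add: w_def)

lemma T_balance:
  assumes C: "C \<in> X0 p" and C': "C' \<in> X0 p"
  shows "w C * T C C' = w C' * T C' C"
proof -
  let ?G = "class_rep C" and ?F = "class_rep C'"
  obtain m where m: "pgroup p ?G m" using X0_pgroup[OF C] by blast
  obtain k where k: "pgroup p ?F k" using X0_pgroup[OF C'] by blast
  let ?n = "real (card (carrier ?G)) * real (card (carrier ?F))"
  have "T C C' * real (card (auto ?F)) * ?n = (1 - 1 / real p) * real (card {S. link ?G ?F S \<and> link ?F ?G (flip S)})"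
    by (rule pgroup.card_auto_swap[OF m refl C'])
  also have "\<dots> = (1 - 1 / real p) * real (card {S. link ?F ?G S \<and> link ?G ?F (flip S)})"
    by (subst card_link_flip) (rule refl)
  also have "\<dots> = T C' C * real (card (auto ?G)) * (real (card (carrier ?F)) * real (card (carrier ?G)))"
    by (rule pgroup.card_auto_swap[OF k refl C, symmetric])
  also have "\<dots> = T C' C * real (card (auto ?G)) * ?n"
    by (subst mult.commute[of "real (card (carrier ?F))"]) (rule refl)
  finally have "T C C' * real (card (auto ?F)) = T C' C * real (card (auto ?G))"
    using carrier_pos[OF C] carrier_pos[OF C'] by simp
  then show ?thesis unfolding w_def using auto_pos[OF C] auto_pos[OF C'] by (simp add: field_simps)
qed

lemma T_ge_0: "C \<in> X0 p \<Longrightarrow> T C C' \<ge> 0"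
  using X0_pgroup pgroup.T_nonneg by blast

lemma has_sum_T_down:
  "C \<in> X0 p \<Longrightarrow> ((\<lambda>C'. if p * nc C' = nc C then T C C' else 0) has_sum (1 - 1 / real (nc C))\<^sup>2) (X0 p)"
  using X0_pgroup pgroup.T_down by blast

lemma has_sum_T_up:
  "C \<in> X0 p \<Longrightarrow> ((\<lambda>C'. if nc C' = p * nc C then T C C' else 0) has_sum (1 / (real p * (real (nc C))\<^sup>2))) (X0 p)"
  using X0_pgroup pgroup.T_up by blast

lemma nc_pos: "C \<in> X0 p \<Longrightarrow> nc C > 0"
  using X0_pgroup pgroup.nhom_pos by blast

text \<open>Taken from the walk itself: if \<open>nc C > 1\<close>, a downward step has positive
  probability, so some class has \<open>nc\<close> smaller by exactly the factor
  \<open>p\<close>.\<close>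

lemma nc_power: "C \<in> X0 p \<Longrightarrow> \<exists>r. nc C = p ^ r"
proof (induction "nc C" arbitrary: C rule: less_induct)
  case less
  show ?case
  proof (cases "nc C = 1")
    case True
    then show ?thesis by (intro exI[of _ 0]) simp
  next
    case False
    then have n: "nc C > 1" using nc_pos[OF less.prems] by simp
    have "\<exists>C'\<in>X0 p. p * nc C' = nc C"
    proof (rule ccontr)
      assume "\<not> ?thesis"
      then have "(if p * nc C' = nc C then T C C' else 0) = 0" if "C' \<in> X0 p" for C' using that by auto
      from has_sum_0[OF this] have "(1 - 1 / real (nc C))\<^sup>2 = 0"
        by (rule has_sum_unique[OF has_sum_T_down[OF less.prems]])
      then show False using n by simp
    qed
    then obtain C' where C': "C' \<in> X0 p" "p * nc C' = nc C" by blast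
    have "1 * nc C' < p * nc C'" by (rule mult_strict_right_mono[OF p_gt_1 nc_pos[OF C'(1)]])
    then have "nc C' < nc C" unfolding C'(2) by simp
    then obtain r where "nc C' = p ^ r" using less.hyps C'(1) by blast
    then show ?thesis using C'(2) by (intro exI[of _ "Suc r"]) simp
  qed
qed

text \<open>The bound on homomorphisms leaves room for one endomorphism, so the identity is the
  trivial map. This makes the lowest level finite.\<close>

lemma nc_one:
  assumes C: "C \<in> X0 p" and n: "nc C = 1"
  shows "card (carrier (class_rep C)) = 1"
proof -
  let ?G = "class_rep C"
  interpret comm_group ?G by (rule X0_D(1)[OF C])
  obtain k where k: "card (carrier ?G) = p ^ k" using X0_D(4)[OF C] by blast
  have "card (homs ?G ?G) \<le> nhom ?G ^ k" by (rule card_homs_le[OF X0_D(2)[OF C] X0_D(3)[OF C] X0_D(1)[OF C] k])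
  then have c: "card (homs ?G ?G) \<le> Suc 0" using n by simp
  have "(\<lambda>x\<in>carrier ?G. x) \<in> homs ?G ?G" "(\<lambda>x\<in>carrier ?G. \<one>\<^bsub>?G\<^esub>) \<in> homs ?G ?G"
    by (auto simp: homs_def hom_def)
  then have e: "(\<lambda>x\<in>carrier ?G. x) = (\<lambda>x\<in>carrier ?G. \<one>\<^bsub>?G\<^esub>)"
    using c card_le_Suc0_iff_eq[OF finite_homs[OF X0_D(3)[OF C] X0_D(3)[OF C]]] by blast
  have "x = \<one>\<^bsub>?G\<^esub>" if "x \<in> carrier ?G" for x using fun_cong[OF e, of x] that by simp
  then have "carrier ?G = {\<one>\<^bsub>?G\<^esub>}" by blast
  then show ?thesis by simp
qed

text \<open>By detailed balance, the mass flowing down from one level of \<open>nc\<close> to the next equals the mass flowing up.\<close>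

lemma level_step:
  assumes s: "\<And>D. finite D \<Longrightarrow> D \<subseteq> {C \<in> X0 p. nc C = q} \<Longrightarrow> sum w D \<le> s"
    and B: "finite B" "B \<subseteq> {C \<in> X0 p. nc C = p * q}" and q: "q > 0"
  shows "(1 - 1 / real (p * q))\<^sup>2 * sum w B \<le> s / (real p * (real q)\<^sup>2)"
proof -
  let ?d = "\<lambda>C C'. if p * nc C' = nc C then T C C' else 0"
  let ?\<beta> = "1 / (real p * (real q)\<^sup>2)"
  \<comment> \<open>The total mass of a level is not yet known to be finite. Hence the argument uses
    finite sets \<open>B\<close> on the upper level and a common bound \<open>s\<close> for finite
    partial sums on the lower one.\<close>
  have "((\<lambda>C'. \<Sum>C\<in>B. w C * ?d C C') has_sum (\<Sum>C\<in>B. w C * (1 - 1 / real (p * q))\<^sup>2)) (X0 p)"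
  proof (rule has_sum_finite_sum[OF B(1)])
    fix C assume "C \<in> B"
    then have C: "C \<in> X0 p" "nc C = p * q" using B(2) by auto
    show "((\<lambda>C'. w C * ?d C C') has_sum (w C * (1 - 1 / real (p * q))\<^sup>2)) (X0 p)"
      using has_sum_cmult_right[OF has_sum_T_down[OF C(1)], of "w C"] by (simp only: C(2))
  qed
  then have "(\<Sum>C\<in>B. w C * (1 - 1 / real (p * q))\<^sup>2) \<le> s * ?\<beta>"
  proof (rule has_sum_le_finite_sums)
    fix D assume D: "finite D" "D \<subseteq> X0 p"
    let ?D = "{C' \<in> D. nc C' = q}"
    have "(\<Sum>C\<in>B. w C * ?d C C') \<le> (if nc C' = q then w C' * ?\<beta> else 0)" if C': "C' \<in> D" for C'
    proof (cases "nc C' = q")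
      case True
      \<comment> \<open>Detailed balance reverses the downward steps from \<open>B\<close> to
        \<open>C'\<close> into upward steps from \<open>C'\<close>, whose total probability is
        \<open>?\<beta>\<close>.\<close>
      have "(\<Sum>C\<in>B. w C * ?d C C') = (\<Sum>C\<in>B. w C' * (if nc C = p * nc C' then T C' C else 0))"
      proof (rule sum.cong[OF refl])
        fix C assume "C \<in> B"
        then have "w C * T C C' = w C' * T C' C" using T_balance B(2) C' D(2) by blast
        then show "w C * ?d C C' = w C' * (if nc C = p * nc C' then T C' C else 0)" by auto
      qed
      also have "\<dots> = w C' * (\<Sum>C\<in>B. if nc C = p * nc C' then T C' C else 0)" by (rule sum_distrib_left[symmetric])
      also have "\<dots> \<le> w C' * (1 / (real p * (real (nc C'))\<^sup>2))"
      proof (rule mult_left_mono[OF finite_sum_le_has_sum[OF has_sum_T_up B(1)] w_nonneg])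
        show "C' \<in> X0 p" "B \<subseteq> X0 p" using C' D(2) B(2) by auto
        then show "0 \<le> (if nc C = p * nc C' then T C' C else 0)" for C using T_ge_0 by simp
      qed
      finally show ?thesis using True by simp
    next
      case False
      then have "p * nc C' \<noteq> nc C" if "C \<in> B" for C using B(2) that p_gt_1 by auto
      then have "(\<Sum>C\<in>B. w C * ?d C C') = 0" by (intro sum.neutral) auto
      then show ?thesis using False by simp
    qed
    then have "(\<Sum>C'\<in>D. \<Sum>C\<in>B. w C * ?d C C') \<le> (\<Sum>C'\<in>D. if nc C' = q then w C' * ?\<beta> else 0)" by (rule sum_mono)
    also have "\<dots> = (\<Sum>C'\<in>?D. w C' * ?\<beta>)" using D(1) by (simp only: sum.inter_filter)
    also have "\<dots> = sum w ?D * ?\<beta>" by (rule sum_distrib_right[symmetric])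
    also have "\<dots> \<le> s * ?\<beta>" by (rule mult_right_mono[OF s]) (use D in auto)
    finally show "(\<Sum>C'\<in>D. \<Sum>C\<in>B. w C * ?d C C') \<le> s * ?\<beta>" .
  qed
  then show ?thesis by (simp add: sum_distrib_right[symmetric] mult.commute)
qed

text \<open>The recursion multiplies by the upward probability \<open>1 / p ^ (2 * r + 1)\<close>
  and divides by the downward probability, the square of \<open>1 - 1 / p ^ (r + 1)\<close>; the
  latter is at least \<open>1/4\<close>, which accounts for the constant \<open>4\<close>.\<close>

fun level_bound :: "nat \<Rightarrow> real" where
  "level_bound 0 = sum w {C \<in> X0 p. nc C = 1}"
| "level_bound (Suc r) = 4 / (real p * (real p ^ r)\<^sup>2) * level_bound r"

lemma level_bound_nonneg: "level_bound r \<ge> 0"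
  by (induction r) (auto intro!: sum_nonneg w_nonneg mult_nonneg_nonneg)

lemma level_le: "finite D \<Longrightarrow> D \<subseteq> {C \<in> X0 p. nc C = p ^ r} \<Longrightarrow> sum w D \<le> level_bound r"
proof (induction r arbitrary: D)
  case 0
  have "finite {C \<in> X0 p. nc C = 1}"
    by (rule finite_subset[OF _ finite_X0_order[of p 1]]) (use nc_one in auto)
  then have "sum w D \<le> sum w {C \<in> X0 p. nc C = 1}" by (rule sum_mono2) (use 0 w_nonneg in auto)
  then show ?case by simp
next
  case (Suc r)
  have pp: "real p \<ge> 2" using p_gt_1 by simp
  have q: "p ^ r > 0" using p_gt_1 by simp
  let ?\<alpha> = "(1 - 1 / real (p * p ^ r))\<^sup>2" and ?\<beta> = "real p * (real p ^ r)\<^sup>2"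
  have "real p * real p ^ r \<ge> 2 * 1" by (rule mult_mono) (use pp in auto)
  then have "1 / 2 \<le> 1 - 1 / real (p * p ^ r)" by (simp add: field_simps)
  then have a: "1 / 4 \<le> ?\<alpha>" using power_mono[of "1/2" "1 - 1 / real (p * p ^ r)" 2] by (simp add: power2_eq_square)
  have "?\<alpha> * sum w D \<le> level_bound r / (real p * (real (p ^ r))\<^sup>2)"
    by (rule level_step[OF Suc.IH Suc.prems(1) _ q]) (use Suc.prems(2) in auto)
  moreover have "1 / 4 * sum w D \<le> ?\<alpha> * sum w D" by (rule mult_right_mono[OF a]) (auto intro: sum_nonneg w_nonneg)
  ultimately have "1 / 4 * sum w D \<le> level_bound r / (real p * (real (p ^ r))\<^sup>2)" by (rule order_trans[rotated])
  then have "1 / 4 * sum w D \<le> level_bound r / ?\<beta>" by (simp only: of_nat_power)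
  then show ?case by (simp add: mult.commute)
qed

text \<open>Consecutive terms have ratio \<open>4 * p ^ k / p ^ (2 * r + 1)\<close>, which is at
  most \<open>1/2\<close> once \<open>r > k\<close>.\<close>

lemma summable_level: "summable (\<lambda>r. (real p ^ r) ^ k * level_bound r)"
proof (rule summable_ratio_test[of "1/2" "k + 1"])
  show "1 / 2 < (1::real)" by simp
  fix r assume r: "k + 1 \<le> r"
  have pp: "real p \<ge> 2" using p_gt_1 by simp
  have "(2::real) ^ 3 \<le> real p ^ 3" by (rule power_mono[OF pp]) simp
  also have "\<dots> \<le> real p ^ (2 * r + 1 - k)" by (rule power_increasing) (use r pp in auto)
  finally have "8 * real p ^ k \<le> real p ^ (2 * r + 1 - k) * real p ^ k" by (intro mult_right_mono) auto
  also have "\<dots> = real p * (real p ^ r)\<^sup>2" using r by (simp flip: power_add power_mult power_Suc add: mult.commute)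
  finally have b: "4 * real p ^ k / (real p * (real p ^ r)\<^sup>2) \<le> 1 / 2" using pp by (simp add: field_simps)
  have "(real p ^ Suc r) ^ k * level_bound (Suc r)
      = 4 * real p ^ k / (real p * (real p ^ r)\<^sup>2) * ((real p ^ r) ^ k * level_bound r)"
    by (simp add: power_mult_distrib)
  also have "\<dots> \<le> 1 / 2 * ((real p ^ r) ^ k * level_bound r)"
    by (rule mult_right_mono[OF b]) (use level_bound_nonneg in auto)
  finally show "norm ((real p ^ Suc r) ^ k * level_bound (Suc r)) \<le> 1 / 2 * norm ((real p ^ r) ^ k * level_bound r)"
    using level_bound_nonneg[of r] level_bound_nonneg[of "Suc r"] by (simp add: abs_mult)
qed

text \<open>Finite sums are sorted by the exponent \<open>r\<close> of \<open>nc C = p ^ r\<close>,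
  on which the summand is \<open>(p ^ r) ^ k\<close> times the weight, and compared with the series
  of level bounds.\<close>

lemma summable_nc: "(\<lambda>C. w C * real (nc C) ^ k) summable_on X0 p"
proof (rule nonneg_bdd_above_summable_on)
  show "0 \<le> w C * real (nc C) ^ k" for C using w_nonneg by simp
  let ?t = "\<lambda>r. (real p ^ r) ^ k * level_bound r"
  have "\<forall>C\<in>X0 p. \<exists>r. nc C = p ^ r" using nc_power by blast
  from bchoice[OF this] obtain \<rho> where rho: "\<And>C. C \<in> X0 p \<Longrightarrow> nc C = p ^ \<rho> C" by blast
  have "sum (\<lambda>C. w C * real (nc C) ^ k) D \<le> suminf ?t" if D: "D \<subseteq> X0 p" "finite D" for D
  proof -
    obtain R where R: "\<rho> ` D \<subseteq> {..<R}" using finite_nat_iff_bounded[of "\<rho> ` D"] D(2) by blast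
    have "sum (\<lambda>C. w C * real (nc C) ^ k) D = (\<Sum>r<R. \<Sum>C\<in>{C \<in> D. \<rho> C = r}. w C * real (nc C) ^ k)"
      by (rule sum.group[symmetric, OF D(2) _ R]) simp
    also have "\<dots> \<le> (\<Sum>r<R. ?t r)"
    proof (rule sum_mono)
      fix r
      let ?D = "{C \<in> D. \<rho> C = r}"
      have "(\<Sum>C\<in>?D. w C * real (nc C) ^ k) = (\<Sum>C\<in>?D. (real p ^ r) ^ k * w C)"
        using rho D(1) by (intro sum.cong refl) auto
      also have "\<dots> = (real p ^ r) ^ k * sum w ?D" by (rule sum_distrib_left[symmetric])
      also have "\<dots> \<le> ?t r"
        by (rule mult_left_mono[OF level_le]) (use rho D in auto)
      finally show "(\<Sum>C\<in>?D. w C * real (nc C) ^ k) \<le> ?t r" .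
    qed
    also have "\<dots> \<le> suminf ?t" by (rule sum_le_suminf[OF summable_level]) (use level_bound_nonneg in auto)
    finally show ?thesis .
  qed
  then show "bdd_above (sum (\<lambda>C. w C * real (nc C) ^ k) ` {D. D \<subseteq> X0 p \<and> finite D})"
    by (intro bdd_aboveI2[of _ _ "suminf ?t"]) auto
qed

text \<open>Surjections onto a group of order \<open>p ^ k\<close> are at most as many as
  homomorphisms, hence at most the \<open>k\<close>-th power of \<open>nc\<close>.\<close>

lemma summable_sur:
  assumes F: "F \<in> X0 p"
  shows "(\<lambda>C. w C * sur F C) summable_on X0 p"
proof -
  obtain k where k: "card (carrier (class_rep F)) = p ^ k" using X0_D(4)[OF F] by blast
  show ?thesis
  proof (rule summable_on_comparison_test[OF summable_nc[of k]])
    fix C assume C: "C \<in> X0 p"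
    have "card (epis (class_rep C) (class_rep F)) \<le> card (homs (class_rep C) (class_rep F))"
      by (rule card_mono[OF finite_homs[OF X0_D(3)[OF C] X0_D(3)[OF F]]]) (auto simp: epis_def homs_def epi_def)
    also have "\<dots> \<le> nc C ^ k" by (rule card_homs_le[OF X0_D(2)[OF C] X0_D(3)[OF C] X0_D(1)[OF F] k])
    finally have "sur F C \<le> real (nc C) ^ k" unfolding sur_def by (simp flip: of_nat_power)
    then show "w C * sur F C \<le> w C * real (nc C) ^ k" using w_nonneg by (rule mult_left_mono)
    show "0 \<le> w C * sur F C" using w_nonneg by (simp add: sur_def)
  qed
qed

section \<open>The operator on moment measures\<close>

definition c0 :: real where "c0 = (\<Prod>i. 1 - 1 / real p ^ Suc i)"

text \<open>An absolutely convergent infinite product without zero factors. It guarantees that the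
  moment measures do not vanish.\<close>

lemma c0_nonzero: "c0 \<noteq> 0"
  unfolding c0_def
proof (rule prodinf_nonzero)
  have p: "real p > 1" using p_gt_1 by simp
  have "summable (\<lambda>i. (1 / real p) ^ Suc i)"
    unfolding summable_Suc_iff by (rule summable_geometric) (use p in simp)
  then have "summable (\<lambda>i. norm ((1 - 1 / real p ^ Suc i) - 1))" by (simp add: power_divide)
  then have "abs_convergent_prod (\<lambda>i. 1 - 1 / real p ^ Suc i)" unfolding abs_convergent_prod_conv_summable .
  then show "convergent_prod (\<lambda>i. 1 - 1 / real p ^ Suc i)" by (rule abs_convergent_prod_imp_convergent_prod)
  fix i
  have "real p ^ Suc i > 1" by (rule one_less_power[OF p]) simp
  then show "1 - 1 / real p ^ Suc i \<noteq> 0" by simp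
qed

lemma Moment_eq: "Moment p F C = c0 * (w C * sur F C)"
  by (simp add: Moment_def mu0_def c0_def w_def sur_def Sur_epis)

lemma summable_Moment: "F \<in> X0 p \<Longrightarrow> Moment p F summable_on X0 p"
  unfolding Moment_eq[abs_def] by (rule summable_on_cmult_right[OF summable_sur])

definition quot :: "nat monoid set \<Rightarrow> nat \<Rightarrow> nat monoid set" where
  "quot F y = (SOME C. C \<in> X0 p \<and> class_rep F Mod cyclic (class_rep F) y \<cong> class_rep C)"

context
  fixes F :: "nat monoid set" and y :: nat
  assumes F: "F \<in> X0 p" and y: "y \<in> carrier (class_rep F)"
begin

lemma cyclic_subgroup: "subgroup (cyclic (class_rep F) y) (class_rep F)"
proof -
  obtain k where k: "card (carrier (class_rep F)) = p ^ k" using X0_D(4)[OF F] by blast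
  obtain m where m: "pgroup p (class_rep F) m" using X0_pgroup[OF F] by blast
  show ?thesis by (rule pgroup_pair.C_subgroup[OF pgroup.pair_rep[OF m F k] y])
qed

lemma quotient_comm_group: "comm_group (class_rep F Mod cyclic (class_rep F) y)"
  by (rule comm_group.abelian_FactGroup[OF X0_D(1)[OF F] cyclic_subgroup])

lemma quotient_card:
  "card (carrier (class_rep F Mod cyclic (class_rep F) y)) * card (cyclic (class_rep F) y) = card (carrier (class_rep F))"
  using group.lagrange[OF X0_D(2)[OF F] cyclic_subgroup] by (simp add: FactGroup_def order_def)

lemma quot_props: "quot F y \<in> X0 p" "class_rep F Mod cyclic (class_rep F) y \<cong> class_rep (quot F y)"
proof -
  let ?Q = "class_rep F Mod cyclic (class_rep F) y"
  obtain k where k: "card (carrier (class_rep F)) = p ^ k" using X0_D(4)[OF F] by blast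
  have "card (carrier ?Q) dvd p ^ k" using quotient_card unfolding k by (metis dvd_triv_left)
  then obtain i where "card (carrier ?Q) = p ^ i" using divides_primepow_nat[OF prime_p] by blast
  moreover have "finite (carrier ?Q)" using X0_D(3)[OF F] by (simp add: carrier_FactGroup)
  ultimately have "\<exists>C. C \<in> X0 p \<and> ?Q \<cong> class_rep C" using X0_ex'[OF quotient_comm_group] by blast
  from someI_ex[OF this] show "quot F y \<in> X0 p" "?Q \<cong> class_rep (quot F y)" unfolding quot_def by blast+
qed

lemma card_epis_quot:
  assumes "group A"
  shows "card (epis A (class_rep F Mod cyclic (class_rep F) y)) = card (epis A (class_rep (quot F y)))"
  by (rule card_epis_iso_right[OF assms comm_group.axioms(2)[OF quotient_comm_group] quot_props(2)])

lemma quot_le: "class_le (quot F y) F"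
proof -
  let ?F = "class_rep F" and ?C = "cyclic (class_rep F) y"
  interpret F: comm_group ?F by (rule X0_D(1)[OF F])
  interpret N: normal ?C ?F by (rule F.subgroup_imp_normal[OF cyclic_subgroup])
  have "(\<lambda>f\<in>carrier ?F. ?C #>\<^bsub>?F\<^esub> f) \<in> epis ?F (?F Mod ?C)"
    by (rule episI) (auto simp: carrier_FactGroup N.rcos_sum)
  moreover have "finite (epis ?F (?F Mod ?C))"
    by (rule finite_epis) (use X0_D(3)[OF F] in \<open>auto simp: carrier_FactGroup\<close>)
  ultimately have "card (epis ?F (class_rep (quot F y))) \<noteq> 0" using card_epis_quot[OF F.is_group]
    by (metis card_eq_0_iff emptyE)
  then show ?thesis unfolding class_le_def Sur_epis by (metis card.empty)
qed

lemma quot_one: "y = \<one>\<^bsub>class_rep F\<^esub> \<Longrightarrow> quot F y = F"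
proof -
  assume "y = \<one>\<^bsub>class_rep F\<^esub>"
  then have "class_rep F Mod cyclic (class_rep F) y \<cong> class_rep F"
    using Mod_one_iso[OF X0_D(2)[OF F]] cyclic_one[OF X0_D(2)[OF F]] by simp
  then have "class_rep F \<cong> class_rep (quot F y)"
    using quot_props(2) group.iso_sym[OF comm_group.axioms(2)[OF quotient_comm_group]] iso_trans by blast
  then show ?thesis using X0_eq[OF F quot_props(1)] by simp
qed

lemma quot_less:
  assumes "y \<noteq> \<one>\<^bsub>class_rep F\<^esub>"
  shows "card (carrier (class_rep (quot F y))) < card (carrier (class_rep F))"
proof -
  let ?C = "cyclic (class_rep F) y"
  have "finite ?C" using finite_subset[OF subgroup.subset[OF cyclic_subgroup] X0_D(3)[OF F]] .
  moreover have "y [^]\<^bsub>class_rep F\<^esub> (1::int) \<in> ?C" unfolding cyclic_def by blast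
  then have "{\<one>\<^bsub>class_rep F\<^esub>, y} \<subseteq> ?C"
    using subgroup.one_closed[OF cyclic_subgroup] group.int_pow_1[OF X0_D(2)[OF F] y] by simp
  ultimately have "card {\<one>\<^bsub>class_rep F\<^esub>, y} \<le> card ?C" by (rule card_mono)
  then have "card ?C > 1" using assms by simp
  moreover have "card (carrier (class_rep (quot F y))) = card (carrier (class_rep F Mod ?C))"
    using iso_same_card[OF quot_props(2)] by simp
  ultimately show ?thesis using quotient_card carrier_pos[OF quot_props(1)]
    by (metis less_numeral_extra(4) mult.right_neutral mult_less_cancel1)
qed

end

text \<open>Detailed balance moves the weight from \<open>C\<close> to \<open>C'\<close> and
  reverses the step. The sum over \<open>C\<close> then is the mean number of surjections onto
  \<open>F\<close> after one step from \<open>C'\<close>.\<close>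

lemma Delta0_Moment_has_sum:
  assumes F: "F \<in> X0 p" and C': "C' \<in> X0 p"
  shows "((\<lambda>C. Moment p F C * T C C') has_sum
     ((\<Sum>y\<in>carrier (class_rep F). Moment p (quot F y) C') / real (card (carrier (class_rep F))))) (X0 p)"
proof -
  let ?F = "class_rep F" and ?G = "class_rep C'"
  obtain k where k: "card (carrier ?F) = p ^ k" using X0_D(4)[OF F] by blast
  obtain m where m: "pgroup p ?G m" using X0_pgroup[OF C'] by blast
  have "((\<lambda>C. T C' C * sur F C)
    has_sum (real (\<Sum>y\<in>carrier ?F. card (epis ?G (?F Mod cyclic ?F y))) / real (card (carrier ?F)))) (X0 p)"
    unfolding sur_def by (rule pgroup_pair.T_moment[OF pgroup.pair_rep[OF m F k] refl])
  moreover have "real (\<Sum>y\<in>carrier ?F. card (epis ?G (?F Mod cyclic ?F y))) = (\<Sum>y\<in>carrier ?F. sur (quot F y) C')"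
    unfolding sur_def using card_epis_quot[OF F _ X0_D(2)[OF C']] by simp
  ultimately have "((\<lambda>C. T C' C * sur F C) has_sum ((\<Sum>y\<in>carrier ?F. sur (quot F y) C') / real (card (carrier ?F)))) (X0 p)"
    by (simp only:)
  from has_sum_cmult_right[OF this, of "c0 * w C'"]
  have "((\<lambda>C. c0 * w C' * (T C' C * sur F C)) has_sum
     (c0 * w C' * ((\<Sum>y\<in>carrier ?F. sur (quot F y) C') / real (card (carrier ?F))))) (X0 p)" .
  moreover have "c0 * w C' * ((\<Sum>y\<in>carrier ?F. sur (quot F y) C') / real (card (carrier ?F)))
      = (\<Sum>y\<in>carrier ?F. Moment p (quot F y) C') / real (card (carrier ?F))"
    unfolding Moment_eq by (simp add: sum_distrib_left mult.assoc)
  moreover have "c0 * w C' * (T C' C * sur F C) = Moment p F C * T C C'" if C: "C \<in> X0 p" for C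
    unfolding Moment_eq using T_balance[OF C C'] by (simp add: mult_ac)
  ultimately show ?thesis by (metis (no_types, lifting) has_sum_cong)
qed

lemma class_le_card:
  assumes "F \<in> X0 p" "F' \<in> X0 p" "class_le F' F"
  shows "card (carrier (class_rep F')) \<le> card (carrier (class_rep F))"
    "card (carrier (class_rep F')) = card (carrier (class_rep F)) \<Longrightarrow> F' = F"
proof -
  obtain \<phi> where ph: "\<phi> \<in> epis (class_rep F) (class_rep F')" using assms(3) unfolding class_le_def Sur_epis by blast
  note D = episD[OF ph]
  show "card (carrier (class_rep F')) \<le> card (carrier (class_rep F))"
    using card_image_le[OF X0_D(3)[OF assms(1)], of \<phi>] unfolding D(2) .
  assume e: "card (carrier (class_rep F')) = card (carrier (class_rep F))"
  have "inj_on \<phi> (carrier (class_rep F))" by (rule eq_card_imp_inj_on[OF X0_D(3)[OF assms(1)]]) (simp only: D(2) e)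
  then have "\<phi> \<in> iso (class_rep F) (class_rep F')" using D(1,2) by (simp add: iso_def bij_betw_def)
  then have "class_rep F \<cong> class_rep F'" by (rule is_isoI)
  then show "F' = F" using X0_eq[OF assms(1,2)] by simp
qed

lemma class_le_refl: "F \<in> X0 p \<Longrightarrow> class_le F F"
  using auto_pos epis_self[OF X0_D(3)] unfolding class_le_def Sur_epis by (metis card.empty less_irrefl)

lemma class_le_trans:
  assumes "class_le F'' F'" "class_le F' F" and F: "F \<in> X0 p"
  shows "class_le F'' F"
proof -
  obtain \<phi> \<psi> where e: "\<phi> \<in> epis (class_rep F) (class_rep F')" "\<psi> \<in> epis (class_rep F') (class_rep F'')"
    using assms unfolding class_le_def Sur_epis by blast
  note D = episD[OF e(1)] and E = episD[OF e(2)]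
  have "restrict (\<psi> \<circ> \<phi>) (carrier (class_rep F)) \<in> epis (class_rep F) (class_rep F'')"
  proof (rule episI)
    fix z assume "z \<in> carrier (class_rep F'')"
    then obtain y where y: "y \<in> carrier (class_rep F')" "\<psi> y = z" using E(2) by (metis imageE)
    then obtain x where x: "x \<in> carrier (class_rep F)" "\<phi> x = y" using D(2) by (metis imageE)
    then show "\<exists>x\<in>carrier (class_rep F). restrict (\<psi> \<circ> \<phi>) (carrier (class_rep F)) x = z" using y by auto
  next
    fix a b assume ab: "a \<in> carrier (class_rep F)" "b \<in> carrier (class_rep F)"
    show "restrict (\<psi> \<circ> \<phi>) (carrier (class_rep F)) (a \<otimes>\<^bsub>class_rep F\<^esub> b)
      = restrict (\<psi> \<circ> \<phi>) (carrier (class_rep F)) a \<otimes>\<^bsub>class_rep F''\<^esub> restrict (\<psi> \<circ> \<phi>) (carrier (class_rep F)) b"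
      using ab D(5)[OF ab] E(5)[OF D(4)[OF ab(1)] D(4)[OF ab(2)]] monoid.m_closed[OF group.is_monoid[OF X0_D(2)[OF F]] ab]
      by simp
  qed (use D(4) E(4) in auto)
  then show ?thesis unfolding class_le_def Sur_epis by blast
qed

text \<open>The Moment measures are triangular with respect to the order of the group.\<close>

lemma Moment_nonzero:
  assumes "F \<in> X0 p" "F' \<in> X0 p"
  shows "Moment p F' F \<noteq> 0 \<longleftrightarrow> class_le F' F"
proof -
  have "w F \<noteq> 0" unfolding w_def using auto_pos[OF assms(1)] by simp
  then have "Moment p F' F \<noteq> 0 \<longleftrightarrow> card (epis (class_rep F) (class_rep F')) \<noteq> 0"
    unfolding Moment_eq sur_def using c0_nonzero by simp
  then show ?thesis
    unfolding class_le_def Sur_epis using finite_epis[OF X0_D(3)[OF assms(1)] X0_D(3)[OF assms(2)]] by simp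
qed

text \<open>Evaluate at a class of minimal order among those with nonzero coefficient: a moment
  measure is nonzero there only if its index is a quotient of that class, hence of smaller order or
  equal to it.\<close>

lemma Moment_indep:
  assumes S: "finite S" "S \<subseteq> X0 p" and z: "\<And>C. C \<in> X0 p \<Longrightarrow> (\<Sum>F\<in>S. a F * Moment p F C) = 0" and F: "F \<in> S"
  shows "a F = 0"
proof (rule ccontr)
  assume "a F \<noteq> 0"
  let ?n = "\<lambda>F. card (carrier (class_rep F))"
  have ex: "\<exists>F. F \<in> S \<and> a F \<noteq> 0" using F \<open>a F \<noteq> 0\<close> by blast
  define F1 where "F1 = arg_min ?n (\<lambda>F. F \<in> S \<and> a F \<noteq> 0)"
  have F1: "F1 \<in> S" "a F1 \<noteq> 0" and min: "\<And>F. F \<in> S \<Longrightarrow> a F \<noteq> 0 \<Longrightarrow> ?n F1 \<le> ?n F"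
    using arg_min_nat_lemma[of "\<lambda>F. F \<in> S \<and> a F \<noteq> 0" _ ?n] ex unfolding F1_def by blast+
  have X: "F1 \<in> X0 p" using F1 S by blast
  have "a F' * Moment p F' F1 = 0" if F': "F' \<in> S - {F1}" for F'
  proof (rule ccontr)
    assume n: "a F' * Moment p F' F1 \<noteq> 0"
    have F'X: "F' \<in> X0 p" using F' S by blast
    have "class_le F' F1" using n Moment_nonzero[OF X F'X] by simp
    then have "F' = F1" using class_le_card[OF X F'X] min[of F'] F' n by fastforce
    then show False using F' by blast
  qed
  then have "(\<Sum>F\<in>S - {F1}. a F * Moment p F F1) = 0" by (intro sum.neutral ballI)
  then have "(\<Sum>F\<in>S. a F * Moment p F F1) = a F1 * Moment p F1 F1"
    using sum.remove[OF S(1) F1(1), of "\<lambda>F. a F * Moment p F F1"] by simp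
  then have "a F1 * Moment p F1 F1 = 0" using z[OF X] by simp
  then show False using F1(2) Moment_nonzero[OF X X] class_le_refl[OF X] by simp
qed

section \<open>The triangular matrix of the operator on moment measures\<close>

definition below :: "nat monoid set \<Rightarrow> nat monoid set set" where
  "below F = {F' \<in> X0 p. class_le F' F}"

lemma finite_below: "F \<in> X0 p \<Longrightarrow> finite (below F)"
proof (rule finite_subset)
  assume F: "F \<in> X0 p"
  show "below F \<subseteq> (\<Union>n\<le>card (carrier (class_rep F)). {C \<in> X0 p. card (carrier (class_rep C)) = n})"
    using class_le_card(1)[OF F] unfolding below_def by auto
qed (use finite_X0_order in blast)

definition coef :: "nat monoid set \<Rightarrow> nat monoid set \<Rightarrow> real" where
  "coef F F' = real (card {y \<in> carrier (class_rep F). quot F y = F'}) / real (card (carrier (class_rep F)))"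

text \<open>Quotients of members of \<open>below F\<close> stay in \<open>below F\<close>, so the
  operator preserves the finite-dimensional span of these moment measures and acts on it by the
  matrix \<open>coef\<close>.\<close>

lemma sum_coef:
  assumes F: "F \<in> X0 p" and x: "x \<in> below F"
  shows "(\<Sum>y\<in>carrier (class_rep x). Moment p (quot x y) C) / real (card (carrier (class_rep x)))
    = (\<Sum>y\<in>below F. coef x y * Moment p y C)"
proof -
  have X: "x \<in> X0 p" "class_le x F" using x by (auto simp: below_def)
  have im: "quot x ` carrier (class_rep x) \<subseteq> below F"
    using quot_props(1)[OF X(1)] class_le_trans[OF quot_le[OF X(1)] X(2) F] unfolding below_def by blast
  have "(\<Sum>y\<in>carrier (class_rep x). Moment p (quot x y) C)
      = (\<Sum>y\<in>below F. \<Sum>z\<in>{z \<in> carrier (class_rep x). quot x z = y}. Moment p (quot x z) C)"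
    by (rule sum.group[symmetric, OF X0_D(3)[OF X(1)] finite_below[OF F] im])
  also have "\<dots> = (\<Sum>y\<in>below F. \<Sum>z\<in>{z \<in> carrier (class_rep x). quot x z = y}. Moment p y C)"
    by (intro sum.cong refl) simp
  finally show ?thesis by (simp add: coef_def sum_divide_distrib)
qed

text \<open>Only the neutral \<open>y\<close> gives a quotient of full order. This is the source of
  the eigenvalue.\<close>

lemma coef_self:
  assumes F: "F \<in> X0 p"
  shows "coef F F = 1 / real (card (carrier (class_rep F)))"
proof -
  have one: "\<one>\<^bsub>class_rep F\<^esub> \<in> carrier (class_rep F)"
    using X0_D(2)[OF F] by (simp add: group.is_monoid)
  have "{y \<in> carrier (class_rep F). quot F y = F} = {\<one>\<^bsub>class_rep F\<^esub>}"
    using quot_one[OF F one] quot_less[OF F] one by force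
  then show ?thesis by (simp add: coef_def)
qed

lemma coef_less:
  assumes F: "F \<in> X0 p" and c: "coef F F' \<noteq> 0" and ne: "F' \<noteq> F"
  shows "card (carrier (class_rep F')) < card (carrier (class_rep F))"
proof -
  have "{y \<in> carrier (class_rep F). quot F y = F'} \<noteq> {}" using c unfolding coef_def by (metis card.empty div_0 of_nat_0)
  then obtain y where y: "y \<in> carrier (class_rep F)" "quot F y = F'" by blast
  then show ?thesis using quot_less[OF F y(1)] quot_one[OF F y(1)] ne by auto
qed

end

section \<open>Eigenfunctions\<close>

text \<open>Back substitution from the top index \<open>F\<close>, normalised there to
  \<open>1\<close>: the equation at \<open>y\<close> expresses \<open>a y\<close> through the values
  at indices with larger \<open>s\<close>, after division by a difference of diagonal
  entries.\<close>

lemma triangular_eigenvector: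
  fixes B :: "'c \<Rightarrow> 'c \<Rightarrow> real" and s :: "'c \<Rightarrow> nat"
  assumes D: "finite D" "F \<in> D" and top: "\<And>x. x \<in> D \<Longrightarrow> x \<noteq> F \<Longrightarrow> s x < s F"
    and tri: "\<And>x y. x \<in> D \<Longrightarrow> y \<in> D \<Longrightarrow> x \<noteq> y \<Longrightarrow> B x y \<noteq> 0 \<Longrightarrow> s y < s x"
    and diag: "\<And>x. x \<in> D \<Longrightarrow> x \<noteq> F \<Longrightarrow> B x x \<noteq> B F F"
  shows "\<exists>a. a F = 1 \<and> (\<forall>y\<in>D. (\<Sum>x\<in>D. a x * B x y) = B F F * a y)"
proof -
  let ?up = "\<lambda>y. {x \<in> D. s y < s x}"
  define H where "H = (\<lambda>a y. if y = F then 1 else (\<Sum>x\<in>?up y. a x * B x y) / (B F F - B y y))"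
  \<comment> \<open>The recursion descends from \<open>F\<close>, so the distance of
    \<open>s y\<close> from its maximum \<open>s F\<close> is the measure that decreases.\<close>
  define R where "R = Wellfounded.measure (\<lambda>y. s F - s y)"
  define a where "a = wfrec R H"
  have le: "s x \<le> s F" if "x \<in> D" for x using top[OF that] by (cases "x = F") auto
  have a: "a y = H a y" for y
  proof -
    have "a y = H (cut a R y) y" unfolding a_def by (rule wfrec) (simp add: R_def)
    also have "\<dots> = H a y"
    proof -
      have c: "cut a R y x = a x" if "x \<in> ?up y" for x
        by (rule cut_apply) (use that le[of x] in \<open>auto simp: R_def\<close>)
      have "(\<Sum>x\<in>?up y. cut a R y x * B x y) = (\<Sum>x\<in>?up y. a x * B x y)"
        by (rule sum.cong[OF refl]) (simp only: c)
      then show ?thesis unfolding H_def by (simp only:)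
    qed
    finally show ?thesis .
  qed
  have aF: "a F = 1" by (subst a) (simp add: H_def)
  moreover have "(\<Sum>x\<in>D. a x * B x y) = B F F * a y" if y: "y \<in> D" for y
  proof -
    have "(\<Sum>x\<in>D - {y}. a x * B x y) = (\<Sum>x\<in>?up y. a x * B x y)"
      by (rule sum.mono_neutral_right) (use D(1) tri y in auto)
    then have e: "(\<Sum>x\<in>D. a x * B x y) = a y * B y y + (\<Sum>x\<in>?up y. a x * B x y)"
      using sum.remove[OF D(1) y, of "\<lambda>x. a x * B x y"] by simp
    show ?thesis
    proof (cases "y = F")
      case True
      have "?up y = {}" using le True by fastforce
      then have "(\<Sum>x\<in>?up y. a x * B x y) = 0" by (simp only: sum.empty)
      then have "(\<Sum>x\<in>D. a x * B x y) = a y * B y y" using e by linarith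
      then show ?thesis by (simp only: True aF mult_1_left mult_1_right)
    next
      case False
      have "a y = (\<Sum>x\<in>?up y. a x * B x y) / (B F F - B y y)" using a[of y] False by (simp add: H_def)
      then have "(\<Sum>x\<in>?up y. a x * B x y) = a y * (B F F - B y y)" using diag[OF y False] by simp
      then show ?thesis unfolding e by (simp add: algebra_simps)
    qed
  qed
  ultimately show ?thesis by blast
qed

context padics
begin

text \<open>Every other class below \<open>F\<close> has smaller order, so its diagonal entry, the
  reciprocal of that order, differs from the one at \<open>F\<close>.\<close>

lemma coef_eigenvector:
  assumes F: "F \<in> X0 p"
  shows "\<exists>a. a F = 1 \<and> (\<forall>y\<in>below F. (\<Sum>x\<in>below F. a x * coef x y) = 1 / real (card (carrier (class_rep F))) * a y)"
proof -
  let ?n = "\<lambda>F. card (carrier (class_rep F))"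
  have X: "\<And>x. x \<in> below F \<Longrightarrow> x \<in> X0 p" by (simp add: below_def)
  have less: "?n x < ?n F" if "x \<in> below F" "x \<noteq> F" for x
    using class_le_card[OF F X[OF that(1)]] that by (fastforce simp: below_def)
  have "\<exists>a. a F = 1 \<and> (\<forall>y\<in>below F. (\<Sum>x\<in>below F. a x * coef x y) = coef F F * a y)"
  proof (rule triangular_eigenvector[OF finite_below[OF F], of F ?n])
    show "F \<in> below F" using F class_le_refl by (simp add: below_def)
    show "?n x < ?n F" if "x \<in> below F" "x \<noteq> F" for x by (rule less[OF that])
    show "?n y < ?n x" if "x \<in> below F" "y \<in> below F" "x \<noteq> y" "coef x y \<noteq> 0" for x y
      using coef_less[OF X[OF that(1)] that(4)] that(3) by simp
    show "coef x x \<noteq> coef F F" if "x \<in> below F" "x \<noteq> F" for x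
      using less[OF that] carrier_pos[OF X[OF that(1)]] carrier_pos[OF F]
      unfolding coef_self[OF X[OF that(1)]] coef_self[OF F] by simp
  qed
  then show ?thesis unfolding coef_self[OF F] .
qed

lemma eigenfunction_comb:
  assumes F: "F \<in> X0 p" and aF: "a F = 1"
    and a: "\<forall>y\<in>below F. (\<Sum>x\<in>below F. a x * coef x y) = l * a y"
  shows "eigenfunction p l (\<lambda>C. \<Sum>x\<in>below F. a x * Moment p x C)"
  unfolding eigenfunction_def signed_measure_def
proof (intro conjI ballI)
  let ?E = "\<lambda>C. \<Sum>x\<in>below F. a x * Moment p x C"
  have X: "\<And>x. x \<in> below F \<Longrightarrow> x \<in> X0 p" by (simp add: below_def)
  have "(?E has_sum (\<Sum>x\<in>below F. a x * infsum (Moment p x) (X0 p))) (X0 p)"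
    by (rule has_sum_finite_sum[OF finite_below[OF F] has_sum_cmult_right[OF has_sum_infsum[OF summable_Moment[OF X]]]])
  then have "?E summable_on X0 p" by (rule has_sum_imp_summable)
  then have "(\<lambda>C. norm (?E C)) summable_on X0 p" by (rule summable_on_iff_abs_summable_on_real[THEN iffD1])
  then show "(\<lambda>C. \<bar>?E C\<bar>) summable_on X0 p" by (simp only: real_norm_def)
  show "\<exists>C\<in>X0 p. ?E C \<noteq> 0"
  proof (rule ccontr)
    assume n: "\<not> ?thesis"
    \<comment> \<open>Vanishing of the combination would contradict independence of the moment
      measures, as the leading coefficient is \<open>1\<close>.\<close>
    have "a F = 0"
    proof (rule Moment_indep[OF finite_below[OF F]])
      show "below F \<subseteq> X0 p" using X by blast
      show "?E C = 0" if "C \<in> X0 p" for C using n that by blast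
      show "F \<in> below F" using F class_le_refl[OF F] by (simp add: below_def)
    qed
    then show False using aF by simp
  qed
  fix C' assume C': "C' \<in> X0 p"
  have "((\<lambda>C. \<Sum>x\<in>below F. a x * (Moment p x C * T C C'))
      has_sum (\<Sum>x\<in>below F. a x * (\<Sum>y\<in>below F. coef x y * Moment p y C'))) (X0 p)"
  proof (intro has_sum_finite_sum has_sum_cmult_right finite_below F)
    fix x assume x: "x \<in> below F"
    show "((\<lambda>C. Moment p x C * T C C') has_sum (\<Sum>y\<in>below F. coef x y * Moment p y C')) (X0 p)"
      using Delta0_Moment_has_sum[OF X[OF x] C'] unfolding sum_coef[OF F x] .
  qed
  moreover have "(\<lambda>C. \<Sum>x\<in>below F. a x * (Moment p x C * T C C')) = (\<lambda>C. ?E C * T C C')"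
    by (rule ext) (simp add: sum_distrib_right mult.assoc)
  moreover have "(\<Sum>x\<in>below F. a x * (\<Sum>y\<in>below F. coef x y * Moment p y C'))
      = (\<Sum>y\<in>below F. (\<Sum>x\<in>below F. a x * coef x y) * Moment p y C')"
    unfolding sum_distrib_left sum_distrib_right mult.assoc by (rule sum.swap)
  moreover have "\<dots> = (\<Sum>y\<in>below F. l * (a y * Moment p y C'))"
    by (rule sum.cong[OF refl]) (use a in simp)
  ultimately have "((\<lambda>C. ?E C * T C C') has_sum (\<Sum>y\<in>below F. l * (a y * Moment p y C'))) (X0 p)" by (simp only:)
  then show "Delta0 p ?E C' = l * ?E C'"
    unfolding Delta0_def sum_distrib_left[symmetric] by (rule infsumI)
qed

text \<open>Take \<open>F0\<close> of maximal order among the classes with nonzero coefficient in a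
  relation. It lies below no other of these classes, so the total coefficient of its moment measure
  is its own coefficient, and independence of the moment measures applies.\<close>

lemma lin_indep_leading:
  assumes one: "\<And>F. F \<in> X0 p \<Longrightarrow> a F F = 1"
  shows "lin_indep_family p (X0 p) (\<lambda>F C. \<Sum>x\<in>below F. a F x * Moment p x C)"
  unfolding lin_indep_family_def
proof (intro allI impI ballI, elim conjE, rule ccontr)
  fix S b F
  assume S: "finite S" "S \<subseteq> X0 p" and z: "\<forall>C\<in>X0 p. (\<Sum>F\<in>S. b F * (\<Sum>x\<in>below F. a F x * Moment p x C)) = 0"
    and F: "F \<in> S" "b F \<noteq> 0"
  let ?n = "\<lambda>F. card (carrier (class_rep F))"
  let ?S = "{F \<in> S. b F \<noteq> 0}"
  have fS: "finite ?S" "?S \<noteq> {}" using S F by auto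
  obtain F0 where F0: "F0 \<in> S" "b F0 \<noteq> 0" and max: "\<And>F. F \<in> S \<Longrightarrow> b F \<noteq> 0 \<Longrightarrow> ?n F \<le> ?n F0"
  proof -
    have "Max (?n ` ?S) \<in> ?n ` ?S" using fS by (intro Max_in) auto
    then obtain F0 where f: "Max (?n ` ?S) = ?n F0" "F0 \<in> ?S" by (rule imageE)
    have m: "?n F \<le> ?n F0" if "F \<in> S" "b F \<noteq> 0" for F unfolding f(1)[symmetric] using fS that by (intro Max_ge) auto
    show thesis by (rule that[OF _ _ m]) (use f(2) in auto)
  qed
  have X: "F0 \<in> X0 p" using F0 S by blast
  \<comment> \<open>All the combinations are rewritten over one common finite set \<open>U\<close>
    of moment measures, with zero coefficients outside \<open>below F\<close>, so that the order of
    summation can be exchanged.\<close>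
  define U where "U = (\<Union>F\<in>S. below F)"
  define e where "e F x = (if x \<in> below F then a F x else 0)" for F x
  have U: "finite U" "U \<subseteq> X0 p" unfolding U_def using S finite_below by (auto simp: below_def)
  have E: "(\<Sum>x\<in>below F. a F x * Moment p x C) = (\<Sum>x\<in>U. e F x * Moment p x C)" if "F \<in> S" for F C
  proof -
    have "(\<Sum>x\<in>U. e F x * Moment p x C) = (\<Sum>x\<in>below F. e F x * Moment p x C)"
      by (rule sum.mono_neutral_right[OF U(1)]) (use that in \<open>auto simp: U_def e_def\<close>)
    then show ?thesis by (simp add: e_def)
  qed
  have "(\<Sum>F\<in>S. b F * e F F0) = 0"
  proof (rule Moment_indep[OF U])
    fix C assume C: "C \<in> X0 p"
    have "(\<Sum>x\<in>U. (\<Sum>F\<in>S. b F * e F x) * Moment p x C) = (\<Sum>F\<in>S. b F * (\<Sum>x\<in>U. e F x * Moment p x C))"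
      unfolding sum_distrib_left sum_distrib_right mult.assoc by (rule sum.swap)
    also have "\<dots> = (\<Sum>F\<in>S. b F * (\<Sum>x\<in>below F. a F x * Moment p x C))"
      by (rule sum.cong[OF refl]) (simp only: E)
    also have "\<dots> = 0" using z C by blast
    finally show "(\<Sum>x\<in>U. (\<Sum>F\<in>S. b F * e F x) * Moment p x C) = 0" .
  next
    show "F0 \<in> U" unfolding U_def below_def using F0(1) X class_le_refl by blast
  qed
  moreover have "b F' * e F' F0 = 0" if F': "F' \<in> S - {F0}" for F'
  proof (rule ccontr)
    assume n: "b F' * e F' F0 \<noteq> 0"
    then have "class_le F0 F'" "b F' \<noteq> 0" by (auto simp: e_def below_def split: if_splits)
    then have "F0 = F'" using class_le_card[of F' F0] max[of F'] F' X S(2) by fastforce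
    then show False using F' by blast
  qed
  then have "(\<Sum>F\<in>S - {F0}. b F * e F F0) = 0" by (intro sum.neutral ballI)
  ultimately have "b F0 * e F0 F0 = 0"
    using sum.remove[OF S(1) F0(1), of "\<lambda>F. b F * e F F0"] by simp
  moreover have "e F0 F0 = 1" unfolding e_def below_def using one[OF X] X class_le_refl[OF X] by simp
  ultimately show False using F0(2) by simp
qed

end

theorem mainTheorem6:
  fixes p :: nat
  assumes "prime p"
  shows "\<exists>E :: nat monoid set \<Rightarrow> nat monoid set \<Rightarrow> real.
    (\<forall>F\<in>X0 p.
       eigenfunction p (1 / real (card (carrier (class_rep F)))) (E F) \<and>
       moment_comb_with_leading_term p (E F) 1 F) \<and>
    lin_indep_family p (X0 p) E"
proof -
  interpret padics p by (rule padics.intro[OF assms])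
  have "\<forall>F\<in>X0 p. \<exists>a. a F = 1 \<and>
      (\<forall>y\<in>below F. (\<Sum>x\<in>below F. a x * coef x y) = 1 / real (card (carrier (class_rep F))) * a y)"
    using coef_eigenvector by blast
  from bchoice[OF this] obtain a where a: "\<And>F. F \<in> X0 p \<Longrightarrow> a F F = 1"
    "\<And>F. F \<in> X0 p \<Longrightarrow> \<forall>y\<in>below F. (\<Sum>x\<in>below F. a F x * coef x y) = 1 / real (card (carrier (class_rep F))) * a F y"
    by blast
  let ?E = "\<lambda>F C. \<Sum>x\<in>below F. a F x * Moment p x C"
  show ?thesis
  proof (intro exI[of _ ?E] conjI ballI)
    show "lin_indep_family p (X0 p) ?E" by (rule lin_indep_leading[OF a(1)])
    fix F assume F: "F \<in> X0 p"
    show "eigenfunction p (1 / real (card (carrier (class_rep F)))) (?E F)"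
      by (rule eigenfunction_comb[OF F a(1)[OF F] a(2)[OF F]])
    show "moment_comb_with_leading_term p (?E F) 1 F"
      unfolding moment_comb_with_leading_term_def
      by (intro exI[of _ "below F"] exI[of _ "a F"])
        (use F finite_below[OF F] a(1)[OF F] class_le_refl[OF F] in \<open>auto simp: below_def\<close>)
  qed
qed

end
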